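(* Let $\{Y_n; n\ge 1\}$ be a sequence of independent and identically distributed random variables in a sub-linear expectation space $(\Omega,\mathscr{H},\widehat{\mathbb E})$, and let $\mathbb V$ be a capacity associated with $\widehat{\mathbb E}$ (as defined in the context). Let $\mathscr{H}_b=\{f\in\mathscr{H}: f \text{ is bounded}\}$ and suppose that $\widehat{\mathbb E}$ on $\mathscr{H}_b$ satisfies $$\widehat{\mathbb E}[X]=\sup_{P\in\mathscr{P}}P[X],\quad X\in\mathscr{H}_b,\qquad P[X]:=\int X\,dP,$$ where $\mathscr{P}$ is a countable-dimensionally weakly compact family of probability measures on $(\Omega,\sigma(\mathscr{H}))$, i.e. for any $X_1,X_2,\ldots\in\mathscr{H}_b$ and any sequence $\{P_n\}\subset\mathscr{P}$ there are a subsequence $\{n_k\}$ and a probability measure $P\in\mathscr{P}$ for which $$\lim_{k\to\infty}P_{n_k}[\varphi(X_1,\ldots,X_d)]=P[\varphi(X_1,\ldots,X_d)],\quad \varphi\in C_{b,Lip}(\mathbb R^d),\ d\ge 1.$$ Assume that $$C_{\mathbb V}\left[\frac{Y_1^2}{\log\log|Y_1|}\right]<\infty,$$ that the limits $\breve{\mathbb E}[Y_1]$ and $\breve{\mathbb E}[-Y_1]$ exist with $\breve{\mathbb E}[Y_1]=\breve{\mathbb E}[-Y_1]=0$, and that $$\underline{\sigma}^2>0\quad\text{and}\quad\overline{\sigma}^2<\infty,$$ where $\overline{\sigma}^2=\lim_{c\to\infty}\widehat{\mathbb E}[Y_1^2\wedge c]$ and $\underline{\sigma}^2=\lim_{c\to\infty}\widehat{\mathcal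 E}[Y_1^2\wedge c]$ (and $\underline\sigma,\overline\sigma$ are the nonnegative square roots). Then for each of $V=\mathbb V^{\mathscr{P}}$, $V=\mathbb C^{\ast}$ and $V=\widehat{\mathbb V}^{\ast}$, $$V\left(C\left\{\frac{\sum_{i=1}^nY_i}{\sqrt{2n\log\log n}}\right\}=[-\sigma,\sigma]\right)=\begin{cases}1,&\text{when }\sigma\in[\underline{\sigma},\overline{\sigma}],\\ 0,&\text{when }\sigma\notin[\underline{\sigma},\overline{\sigma}],\end{cases}$$ where $C\{x_n\}$ denotes the cluster set of a sequence $\{x_n\}$ in $\mathbb R$.
   Context: Sub-linear expectation space. $(\Omega,\mathcal F)$ is a measurable space and $\mathscr{H}$ is a linear space of real measurable functions on $(\Omega,\mathcal F)$ (called random variables) such that $X_1,\ldots,X_n\in\mathscr{H}$ implies $\varphi(X_1,\ldots,X_n)\in\mathscr{H}$ for each $\varphi\in C_{l,Lip}(\mathbb R^n)$, where $C_{l,Lip}(\mathbb R^n)$ is the linear space of functions $\varphi$ with $|\varphi(\boldsymbol x)-\varphi(\boldsymbol y)|\le C(1+|\boldsymbol x|^m+|\boldsymbol y|^m)|\boldsymbol x-\boldsymbol y|$ for all $\boldsymbol x,\boldsymbol y\in\mathbb R^n$, for some $C>0$, $m\in\mathbb N$ depending on $\varphi$. $C_{b,Lip}(\mathbb R^n)$ is the space of bounded Lipschitz functions. A sub-linear expectation is a function $\widehat{\mathbb E}:\mathscr{H}\to[-\infty,\infty]$ such that for all $X,Y\in\mathscr{H}$: (a) $X\ge Y$ implies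 $\widehat{\mathbb E}[X]\ge\widehat{\mathbb E}[Y]$; (b) $\widehat{\mathbb E}[c]=c$ for constants $c$; (c) $\widehat{\mathbb E}[X+Y]\le\widehat{\mathbb E}[X]+\widehat{\mathbb E}[Y]$ whenever the right side is not of the form $+\infty-\infty$ or $-\infty+\infty$; (d) $\widehat{\mathbb E}[\lambda X]=\lambda\widehat{\mathbb E}[X]$ for $\lambda\ge0$ (with $0\cdot\infty=0$). The conjugate expectation is $\widehat{\mathcal E}[X]:=-\widehat{\mathbb E}[-X]$. Independence and identical distribution. $\boldsymbol X_1\overset{d}{=}\boldsymbol X_2$ ($n$-dimensional random vectors in possibly different sub-linear expectation spaces) means $\widehat{\mathbb E}_1[\varphi(\boldsymbol X_1)]=\widehat{\mathbb E}_2[\varphi(\boldsymbol X_2)]$ for all $\varphi\in C_{b,Lip}(\mathbb R^n)$; $\{X_n\}$ is identically distributed if $X_i\overset{d}{=}X_1$ for each $i$. A random vector $\boldsymbol Y\in\mathscr{H}^n$ is independent to $\boldsymbol X\in\mathscr{H}^m$ if $\widehat{\mathbb E}[\varphi(\boldsymbol X,\boldsymbol Y)]=\widehat{\mathbb E}\big[\widehat{\mathbb E}[\varphi(\boldsymbol x,\boldsymbol Y)]\big|_{\boldsymbol x=\boldsymbol X}\big]$ for all $\varphi\in C_{b,Lip}(\mathbb R^m\times\mathbb R^n)$. A sequence $\{X_n;n\ge1\}$ is independent if $X_{i+1}$ is independent to $(X_1,\ldots,X_i)$ for each $i\ge1$. Capacities. $\mathbb V:\mathcal F\to[0,1]$ denotes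 a capacity associated with $\widehat{\mathbb E}$, meaning: $\widehat{\mathbb E}[f]\le\mathbb V(A)\le\widehat{\mathbb E}[g]$ whenever $f\le I_A\le g$, $f,g\in\mathscr{H}$, $A\in\mathcal F$, and $\mathbb V(A\cup B)\le\mathbb V(A)+\mathbb V(B)$ for all $A,B\in\mathcal F$. The Choquet integral is $C_{\mathbb V}[X]=\int_0^\infty\mathbb V(X\ge t)\,dt+\int_{-\infty}^0[\mathbb V(X\ge t)-1]\,dt$ (for $X\in\mathscr{H}$ it does not depend on the choice of such $\mathbb V$). Further: - $\widehat{\mathbb V}(A)=\inf\{\widehat{\mathbb E}[\xi]: I_A\le\xi,\ \xi\in\mathscr{H}\}$, $A\in\mathcal F$; - $\widehat{\mathbb V}^{\ast}(A)=\inf\{\sum_{n=1}^\infty\widehat{\mathbb V}(A_n): A\subset\bigcup_{n=1}^\infty A_n\}$ with $A_n\in\mathcal F$; - $\mathbb C^{\ast}(A)=\inf\{\lim_{n\to\infty}\widehat{\mathbb E}[\sum_{i=1}^ng_i]: I_A\le\sum_{n=1}^\infty g_n,\ 0\le g_n\in\mathscr{H}\}$; - $\mathbb V^{\mathscr{P}}(A)=\sup_{P\in\mathscr{P}}P(A)$. Notation. $x\wedge y=\min(x,y)$, $x\vee y=\max(x,y)$, $\log x=\ln\max(e,x)$ (so $\log\log x=\ln\max(e,\ln\max(e,x))$). $X^{(c)}=(-c)\vee X\wedge c$ for $c>0$, and $\breve{\mathbb E}[X]=\lim_{c\to\infty}\widehat{\mathbb E}[X^{(c)}]$ if the limit exists.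 *)

theory Defs
  imports "HOL-Probability.Probability"
begin

text \<open>
  A vector of dimension \<open>n\<close> is a sequence \<^typ>\<open>nat \<Rightarrow> real\<close> of which only the coordinates
  \<open>0, ..., n - 1\<close> matter.  The Lipschitz-type conditions below range over all sequences but measure
  distances by the Euclidean norm of the first \<open>n\<close> coordinates, so a function satisfying them
  cannot depend on the other coordinates: the sets \<open>C_lLip n\<close> and \<open>C_bLip n\<close> are in bijection with
  the corresponding spaces of functions on \<open>n\<close>-dimensional Euclidean space.
\<close>

definition C_lLip :: "nat \<Rightarrow> ((nat \<Rightarrow> real) \<Rightarrow> real) set" where
  "C_lLip n = {\<phi>. \<exists>C>0. \<exists>m::nat. \<forall>x y.
     \<bar>\<phi> x - \<phi> y\<bar> \<le> C * (1 + L2_set x {..<n} ^ m + L2_set y {..<n} ^ m)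
                    * L2_set (\<lambda>i. x i - y i) {..<n}}"

definition C_bLip :: "nat \<Rightarrow> ((nat \<Rightarrow> real) \<Rightarrow> real) set" where
  "C_bLip n = {\<phi>. bounded (range \<phi>) \<and>
     (\<exists>C. \<forall>x y. \<bar>\<phi> x - \<phi> y\<bar> \<le> C * L2_set (\<lambda>i. x i - y i) {..<n})}"

text \<open>
  The measure \<open>M\<close> only carries the measurable space \<open>(space M, sets M)\<close>; its measure function is
  never used.  All pointwise conditions are relativised to \<^term>\<open>space M\<close>, and \<open>E\<close> is
  constrained on \<open>H\<close> only.  In \<^typ>\<open>ereal\<close> one has \<open>0 * \<infinity> = 0\<close>.
\<close>

locale sublinear_expectation_space =
  fixes M :: "'a measure"
    and H :: "('a \<Rightarrow> real) set"
    and E :: "('a \<Rightarrow> real) \<Rightarrow> ereal"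
  assumes H_measurable: "H \<subseteq> borel_measurable M"
    and H_zero: "(\<lambda>\<omega>. 0) \<in> H"
    and H_add: "\<And>X Y. X \<in> H \<Longrightarrow> Y \<in> H \<Longrightarrow> (\<lambda>\<omega>. X \<omega> + Y \<omega>) \<in> H"
    and H_scale: "\<And>a X. X \<in> H \<Longrightarrow> (\<lambda>\<omega>. a * X \<omega>) \<in> H"
    and H_comp: "\<And>n \<phi> X. \<phi> \<in> C_lLip n \<Longrightarrow> (\<And>i. i < n \<Longrightarrow> X i \<in> H) \<Longrightarrow>
                   (\<lambda>\<omega>. \<phi> (\<lambda>i. X i \<omega>)) \<in> H"
    and E_mono: "\<And>X Y. X \<in> H \<Longrightarrow> Y \<in> H \<Longrightarrow> (\<And>\<omega>. \<omega> \<in> space M \<Longrightarrow> Y \<omega> \<le> X \<omega>) \<Longrightarrow> E Y \<le> E X"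
    and E_const: "\<And>c. E (\<lambda>\<omega>. c) = ereal c"
    and E_subadd: "\<And>X Y. X \<in> H \<Longrightarrow> Y \<in> H \<Longrightarrow>
                     \<not> (E X = \<infinity> \<and> E Y = -\<infinity>) \<Longrightarrow> \<not> (E X = -\<infinity> \<and> E Y = \<infinity>) \<Longrightarrow>
                     E (\<lambda>\<omega>. X \<omega> + Y \<omega>) \<le> E X + E Y"
    and E_pos_hom: "\<And>a X. X \<in> H \<Longrightarrow> a \<ge> 0 \<Longrightarrow> E (\<lambda>\<omega>. a * X \<omega>) = ereal a * E X"

definition conj_expectation :: "(('a \<Rightarrow> real) \<Rightarrow> ereal) \<Rightarrow> ('a \<Rightarrow> real) \<Rightarrow> ereal" where
  "conj_expectation E X = - E (\<lambda>\<omega>. - X \<omega>)"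

definition same_distribution ::
  "nat \<Rightarrow> (('a \<Rightarrow> real) \<Rightarrow> ereal) \<Rightarrow> (nat \<Rightarrow> 'a \<Rightarrow> real) \<Rightarrow>
   (('b \<Rightarrow> real) \<Rightarrow> ereal) \<Rightarrow> (nat \<Rightarrow> 'b \<Rightarrow> real) \<Rightarrow> bool" where
  "same_distribution n E1 X1 E2 X2 \<longleftrightarrow>
     (\<forall>\<phi>\<in>C_bLip n. E1 (\<lambda>\<omega>. \<phi> (\<lambda>i. X1 i \<omega>)) = E2 (\<lambda>\<omega>. \<phi> (\<lambda>i. X2 i \<omega>)))"

definition vec_append :: "nat \<Rightarrow> (nat \<Rightarrow> real) \<Rightarrow> (nat \<Rightarrow> real) \<Rightarrow> nat \<Rightarrow> real" where
  "vec_append m x y = (\<lambda>i. if i < m then x i else y (i - m))"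

text \<open>
  The \<open>n\<close>-dimensional \<open>Y\<close> is independent to the \<open>m\<close>-dimensional \<open>X\<close>.  The inner expectation is
  that of a bounded random variable, hence finite, so \<^const>\<open>real_of_ereal\<close> loses nothing.
\<close>

definition independent_to ::
  "(('a \<Rightarrow> real) \<Rightarrow> ereal) \<Rightarrow> nat \<Rightarrow> (nat \<Rightarrow> 'a \<Rightarrow> real) \<Rightarrow> nat \<Rightarrow> (nat \<Rightarrow> 'a \<Rightarrow> real) \<Rightarrow> bool" where
  "independent_to E n Y m X \<longleftrightarrow>
     (\<forall>\<phi>\<in>C_bLip (m + n).
        E (\<lambda>\<omega>. \<phi> (vec_append m (\<lambda>i. X i \<omega>) (\<lambda>j. Y j \<omega>))) =
        E (\<lambda>\<omega>. real_of_ereal (E (\<lambda>\<omega>'. \<phi> (vec_append m (\<lambda>i. X i \<omega>) (\<lambda>j. Y j \<omega>'))))))"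

text \<open>Sequences of random variables are indexed from 1; the entry at index 0 is never used.\<close>

definition independent_seq :: "(('a \<Rightarrow> real) \<Rightarrow> ereal) \<Rightarrow> (nat \<Rightarrow> 'a \<Rightarrow> real) \<Rightarrow> bool" where
  "independent_seq E X \<longleftrightarrow>
     (\<forall>i\<ge>1. independent_to E 1 (\<lambda>_. X (i + 1)) i (\<lambda>j. X (j + 1)))"

definition identically_distributed_seq ::
  "(('a \<Rightarrow> real) \<Rightarrow> ereal) \<Rightarrow> (nat \<Rightarrow> 'a \<Rightarrow> real) \<Rightarrow> bool" where
  "identically_distributed_seq E X \<longleftrightarrow>
     (\<forall>i\<ge>1. same_distribution 1 E (\<lambda>_. X i) E (\<lambda>_. X 1))"

definition associated_capacity ::
  "'a measure \<Rightarrow> ('a \<Rightarrow> real) set \<Rightarrow> (('a \<Rightarrow> real) \<Rightarrow> ereal) \<Rightarrow> ('a set \<Rightarrow> real) \<Rightarrow> bool" where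
  "associated_capacity M H E V \<longleftrightarrow>
     (\<forall>A\<in>sets M. 0 \<le> V A \<and> V A \<le> 1) \<and>
     (\<forall>A\<in>sets M. \<forall>f\<in>H. (\<forall>\<omega>\<in>space M. f \<omega> \<le> indicator A \<omega>) \<longrightarrow> E f \<le> ereal (V A)) \<and>
     (\<forall>A\<in>sets M. \<forall>g\<in>H. (\<forall>\<omega>\<in>space M. indicator A \<omega> \<le> g \<omega>) \<longrightarrow> ereal (V A) \<le> E g) \<and>
     (\<forall>A\<in>sets M. \<forall>B\<in>sets M. V (A \<union> B) \<le> V A + V B)"

text \<open>
  The second integrand of the Choquet integral is nonpositive, so its integral is written as minus
  the integral of \<open>1 - V (X \<ge> t)\<close>.
\<close>

definition choquet :: "'a measure \<Rightarrow> ('a set \<Rightarrow> real) \<Rightarrow> ('a \<Rightarrow> real) \<Rightarrow> ereal" where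
  "choquet M V X =
     enn2ereal (\<integral>\<^sup>+t\<in>{0..}. ennreal (V {\<omega>\<in>space M. X \<omega> \<ge> t}) \<partial>lborel)
     - enn2ereal (\<integral>\<^sup>+t\<in>{..0}. ennreal (1 - V {\<omega>\<in>space M. X \<omega> \<ge> t}) \<partial>lborel)"

definition V_hat ::
  "'a measure \<Rightarrow> ('a \<Rightarrow> real) set \<Rightarrow> (('a \<Rightarrow> real) \<Rightarrow> ereal) \<Rightarrow> 'a set \<Rightarrow> ereal" where
  "V_hat M H E A = Inf {E \<xi> | \<xi>. \<xi> \<in> H \<and> (\<forall>\<omega>\<in>space M. indicator A \<omega> \<le> \<xi> \<omega>)}"

definition V_hat_star ::
  "'a measure \<Rightarrow> ('a \<Rightarrow> real) set \<Rightarrow> (('a \<Rightarrow> real) \<Rightarrow> ereal) \<Rightarrow> 'a set \<Rightarrow> ereal" where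
  "V_hat_star M H E A =
     Inf {(\<Sum>n. V_hat M H E (B n)) | B. (\<forall>n::nat. B n \<in> sets M) \<and> A \<subseteq> (\<Union>n. B n)}"

text \<open>The pointwise series \<open>\<Sum>n. g n \<omega>\<close> may diverge, hence is taken in \<^typ>\<open>ereal\<close>.\<close>

definition C_star ::
  "'a measure \<Rightarrow> ('a \<Rightarrow> real) set \<Rightarrow> (('a \<Rightarrow> real) \<Rightarrow> ereal) \<Rightarrow> 'a set \<Rightarrow> ereal" where
  "C_star M H E A =
     Inf {L. \<exists>g :: nat \<Rightarrow> 'a \<Rightarrow> real.
            (\<forall>n. g n \<in> H \<and> (\<forall>\<omega>\<in>space M. 0 \<le> g n \<omega>)) \<and>
            (\<forall>\<omega>\<in>space M. indicator A \<omega> \<le> (\<Sum>n. ereal (g n \<omega>))) \<and>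
            (\<lambda>n. E (\<lambda>\<omega>. \<Sum>i<n. g i \<omega>)) \<longlonglongrightarrow> L}"

definition V_sup :: "'a measure set \<Rightarrow> 'a set \<Rightarrow> ereal" where
  "V_sup \<P> A = (SUP P\<in>\<P>. ereal (measure P A))"

definition bounded_part :: "'a measure \<Rightarrow> ('a \<Rightarrow> real) set \<Rightarrow> ('a \<Rightarrow> real) set" where
  "bounded_part M H = {f \<in> H. bounded (f ` space M)}"

definition sigma_gen_by :: "'a measure \<Rightarrow> ('a \<Rightarrow> real) set \<Rightarrow> 'a measure" where
  "sigma_gen_by M H = sigma (space M) {X -` B \<inter> space M | X B. X \<in> H \<and> B \<in> sets borel}"

definition countably_dim_weakly_compact ::
  "'a measure \<Rightarrow> ('a \<Rightarrow> real) set \<Rightarrow> 'a measure set \<Rightarrow> bool" where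
  "countably_dim_weakly_compact M H \<P> \<longleftrightarrow>
     (\<forall>X :: nat \<Rightarrow> 'a \<Rightarrow> real. \<forall>Q :: nat \<Rightarrow> 'a measure.
        (\<forall>i. X i \<in> bounded_part M H) \<and> (\<forall>n. Q n \<in> \<P>) \<longrightarrow>
        (\<exists>r P. strict_mono r \<and> P \<in> \<P> \<and>
           (\<forall>d\<ge>1. \<forall>\<phi>\<in>C_bLip d.
              (\<lambda>k. \<integral>\<omega>. \<phi> (\<lambda>i. X i \<omega>) \<partial>(Q (r k))) \<longlonglongrightarrow> (\<integral>\<omega>. \<phi> (\<lambda>i. X i \<omega>) \<partial>P))))"

definition lg :: "real \<Rightarrow> real" where
  "lg x = ln (max (exp 1) x)"

definition trunc :: "real \<Rightarrow> real \<Rightarrow> real" where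
  "trunc c x = max (- c) (min x c)"

text \<open>Both limits are monotone in \<open>c\<close>, so they exist in \<^typ>\<open>ereal\<close>.\<close>

definition upper_variance :: "(('a \<Rightarrow> real) \<Rightarrow> ereal) \<Rightarrow> ('a \<Rightarrow> real) \<Rightarrow> ereal" where
  "upper_variance E X = Lim at_top (\<lambda>c::real. E (\<lambda>\<omega>. min ((X \<omega>)\<^sup>2) c))"

definition lower_variance :: "(('a \<Rightarrow> real) \<Rightarrow> ereal) \<Rightarrow> ('a \<Rightarrow> real) \<Rightarrow> ereal" where
  "lower_variance E X = Lim at_top (\<lambda>c::real. conj_expectation E (\<lambda>\<omega>. min ((X \<omega>)\<^sup>2) c))"

definition cluster_set :: "(nat \<Rightarrow> real) \<Rightarrow> real set" where
  "cluster_set x = {l. \<exists>r. strict_mono r \<and> (x \<circ> r) \<longlonglongrightarrow> l}"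

end

theory Submission
  imports Defs "HOL-Real_Asymp.Real_Asymp"
begin

text \<open>
  Write \<open>Z i = Y (i + 1)\<close>, \<open>S n = Z 0 + ... + Z (n - 1)\<close> and \<open>a n = sqrt (2 n log log n)\<close>.
  The proof reduces the statement to a classical law of the iterated logarithm for martingale
  differences, made uniform over all the probability measures involved.

  \<^emph>\<open>Under each \<open>P \<in> \<P>\<close> the sequence is a martingale difference sequence.\<close>
  Independence says that \<open>E[g(Z 0, ..., Z (n-1)) (\<phi>(Z n) - law \<phi>)] = 0\<close> for bounded Lipschitz
  \<open>g \<ge> 0\<close> and \<open>\<phi>\<close>, where \<open>law \<phi> = E[\<phi>(Y 1)]\<close>. As \<open>E\<close> dominates the integral of every \<open>P\<close>,
  the conditional mean of \<open>\<phi>(Z n)\<close> under \<open>P\<close> is at most \<open>law \<phi>\<close>. Taking for \<open>\<phi>\<close> the truncations of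
  \<open>y\<close>, \<open>- y\<close>, \<open>y\<^sup>2\<close> and \<open>- y\<^sup>2\<close>, the conditional mean is \<open>0\<close> and the conditional variance lies between
  \<open>\<sigma>\<^sub>l\<^sup>2\<close> and \<open>\<sigma>\<^sub>u\<^sup>2\<close>. Conditional tails are controlled by one function \<open>tailw\<close> of the level, and
  the Choquet condition makes it summable along geometric blocks (\<open>tail_summable_tailw\<close>). All
  of this holds with the same constants for every \<open>P\<close>.

  \<^emph>\<open>Two block estimates.\<close>
  A maximal inequality of Fuk--Nagaev type bounds the probability that \<open>S\<close> exceeds
  \<open>(1 + \<epsilon>) \<sigma>\<^sub>u a n\<close> in a geometric block by a summable sequence (\<open>upper_block_bound\<close>). In the other
  direction, the positive part of a difference of two exponential submartingales, stopped on a
  sloped line, shows that in a block from \<open>Q^k\<close> to \<open>Q^(k+1)\<close> that line is reached with conditional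
  probability at least a constant times \<open>k powr (- (1 - 2 \<eta>))\<close> (\<open>line_hitting\<close>,
  \<open>lower_block_bound\<close>), which is not summable. The line is the tangent to
  \<open>m \<mapsto> sqrt (v m 2 log log n)\<close> at the end of the block, so by the inequality between the
  arithmetic and geometric means every point on it is large compared with \<open>a\<close>
  (\<open>line_crossing_large\<close>): the target may be reached at any time of the block, so it does no harm
  if the conditional variances fluctuate above their lower bound and speed up the process.

  \<^emph>\<open>Outside \<open>[\<sigma>\<^sub>l, \<sigma>\<^sub>u]\<close> the capacities vanish.\<close>
  As the capacities satisfy \<open>V_sup \<P> \<le> C_star \<le> V_hat_star \<le> 1\<close>, it suffices that \<open>V_hat_star\<close>
  vanishes. The block estimates hold for all \<open>P\<close> at once, hence for \<open>V_hat\<close> of superlevel sets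
  of Lipschitz functions of finitely many \<open>Z i\<close> (\<open>V_hat_le\<close>); countable covers by such sets replace
  the two Borel--Cantelli lemmas (\<open>upper_small\<close>, \<open>lower_small\<close>).

  \<^emph>\<open>Inside \<open>[\<sigma>\<^sub>l, \<sigma>\<^sub>u]\<close> the value is one.\<close>
  It suffices to bound \<open>V_sup \<P>\<close> below. By weak compactness one \<open>P \<in> \<P>\<close> gives \<open>Y 1\<close> a variance at
  most \<open>\<sigma>\<^sub>l\<^sup>2\<close>, and others bring it as close to \<open>\<sigma>\<^sub>u\<^sup>2\<close> as desired; mixtures of their laws have
  variance near \<open>\<sigma>\<^sup>2\<close>. Let \<open>Q\<close> be the product of a slowly varying sequence of such laws. The law of
  the iterated logarithm holds \<open>Q\<close>-almost surely with constant \<open>\<sigma>\<close> (\<open>AE_Q_cluster\<close>), and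
  independence gives \<open>\<integral>f dQ \<le> E[f(Z)]\<close> for bounded Lipschitz cylinder functions
  (\<open>integral_Q_le_Er\<close>). A compact set \<open>K\<close> of sequences inside the event carries almost all of \<open>Q\<close>;
  approximating its indicator from above by cylinder functions, weak compactness yields
  \<open>P \<in> \<P>\<close> with \<open>P(Z \<in> K)\<close> close to \<open>1\<close> (\<open>V_sup_cluster_ge_1\<close>).
\<close>


section \<open>Pointwise inequalities for the exponential function\<close>

lemma exp_quadratic_upper:
  fixes u \<delta> :: real
  assumes "u \<le> \<delta>" "0 < \<delta>" "\<delta> \<le> 1"
  shows "exp u \<le> 1 + u + (1 + \<delta>) / 2 * u\<^sup>2"
proof -
  obtain t where t: "\<bar>t\<bar> \<le> \<bar>u\<bar>" and e: "exp u = (\<Sum>m<3. u ^ m / fact m) + exp t / fact 3 * u ^ 3"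
    using Maclaurin_exp_le[of u 3] by blast
  have e': "exp u = 1 + u + u\<^sup>2 / 2 + exp t / 6 * u ^ 3"
    using e by (simp add: eval_nat_numeral)
  show ?thesis
  proof (cases "u \<le> 0")
    case True
    hence "exp t / 6 * u ^ 3 \<le> 0" by (simp add: mult_nonneg_nonpos power3_eq_cube mult_nonneg_nonneg mult_nonpos_nonpos)
    moreover have "0 \<le> \<delta> * u\<^sup>2" using assms by simp
    ultimately show ?thesis using e' by (simp add: field_simps)
  next
    case False
    have "exp t \<le> exp 1" using t assms False by simp
    also have "\<dots> \<le> 3" by (rule exp_le)
    finally have "exp t / 6 * u ^ 3 \<le> 1/2 * u ^ 3"
      using False by (intro mult_right_mono) auto
    also have "\<dots> = 1/2 * u\<^sup>2 * u" by (simp add: power2_eq_square power3_eq_cube)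
    also have "\<dots> \<le> 1/2 * u\<^sup>2 * \<delta>" using assms False by (intro mult_left_mono) auto
    finally show ?thesis using e' by (simp add: field_simps)
  qed
qed

lemma quartic_exp_bound:
  fixes d r :: real
  assumes "0 < d" "d \<le> 1" "0 \<le> r"
  shows "(1 + r / d) ^ 4 \<le> 256 / d ^ 4 * exp r"
proof -
  have "1 + r / d \<le> 4 / d * (1 + r / 4)" using assms by (simp add: field_simps)
  hence "(1 + r / d) ^ 4 \<le> (4 / d * (1 + r / 4)) ^ 4"
    using assms by (intro power_mono) auto
  also have "\<dots> = 256 / d ^ 4 * (1 + r / 4) ^ 4" by (simp only: power_mult_distrib power_divide) simp
  also have "\<dots> \<le> 256 / d ^ 4 * exp (r / 4) ^ 4"
    using assms by (intro mult_left_mono power_mono exp_ge_add_one_self) auto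
  also have "exp (r / 4) ^ 4 = exp r" by (simp flip: exp_of_nat_mult)
  finally show ?thesis using assms by simp
qed

text \<open>
  If \<open>l * min z y\<close> is at most \<open>\<delta>\<close>, the quadratic bound applies. Otherwise \<open>z > 0\<close>, and the last
  summand alone suffices: the exponential loses \<open>exp (l * (y - z))\<close> against \<open>exp (l * y)\<close>, which
  outweighs the fourth power of \<open>y / z\<close> up to the constant \<open>256 / \<delta> ^ 4\<close>. The fourth power makes the weight of a value \<open>z\<close> far
  below \<open>y\<close> so small that the resulting tail terms can be summed over geometric blocks.
\<close>

lemma exp_step_upper:
  fixes z y l \<delta> :: real
  assumes "0 < \<delta>" "\<delta> \<le> 1" "0 < l" "0 < y"
  shows "exp (l * min z y) \<le> 1 + l * z + (1 + \<delta>) / 2 * l\<^sup>2 * z\<^sup>2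
           + 256 / \<delta> ^ 4 * exp (l * y) * (min (\<bar>z\<bar> / y) 1) ^ 4"
proof -
  define u where "u = l * min z y"
  have P: "0 \<le> 256 / \<delta> ^ 4 * exp (l * y) * (min (\<bar>z\<bar> / y) 1) ^ 4" using assms by simp
  have le: "u \<le> l * z" using assms by (simp add: u_def)
  show ?thesis
  proof (cases "u \<le> \<delta>")
    case True
    have "\<bar>min z y\<bar> \<le> \<bar>z\<bar>" using assms by (auto simp: min_def abs_if)
    hence "(min z y)\<^sup>2 \<le> z\<^sup>2" by (simp add: abs_le_square_iff)
    hence "u\<^sup>2 \<le> l\<^sup>2 * z\<^sup>2" unfolding u_def power_mult_distrib by (intro mult_left_mono) auto
    hence "(1 + \<delta>) / 2 * u\<^sup>2 \<le> (1 + \<delta>) / 2 * (l\<^sup>2 * z\<^sup>2)" using assms by (intro mult_left_mono) auto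
    thus ?thesis using exp_quadratic_upper[OF True assms(1,2)] le P
      unfolding u_def[symmetric] mult.assoc[of "(1 + \<delta>) / 2" "l\<^sup>2"] by linarith
  next
    case False
    define v where "v = l * y"
    have uv: "u \<le> v" using assms by (simp add: u_def v_def)
    have zp: "z > 0"
    proof (rule ccontr)
      assume "\<not> z > 0"
      hence "l * z \<le> 0" using assms by (simp add: mult_nonneg_nonpos)
      thus False using le False assms by linarith
    qed
    have m: "min (\<bar>z\<bar> / y) 1 = u / v"
      using zp assms unfolding u_def v_def by (auto simp: min_def field_simps)
    \<comment> \<open>\<open>u > \<delta>\<close> bounds the ratio \<open>v / u\<close> by a function of the gap \<open>v - u\<close>.\<close>
    have "v / u = 1 + (v - u) / u" using False assms by (simp add: field_simps)
    also have "\<dots> \<le> 1 + (v - u) / \<delta>" using False assms uv by (intro add_left_mono divide_left_mono) auto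
    finally have "(v / u) ^ 4 \<le> (1 + (v - u) / \<delta>) ^ 4" using False assms uv by (intro power_mono) auto
    also have "\<dots> \<le> 256 / \<delta> ^ 4 * exp (v - u)" using quartic_exp_bound uv assms by simp
    finally have "(v / u) ^ 4 * (exp u * (u / v) ^ 4) \<le> 256 / \<delta> ^ 4 * exp (v - u) * (exp u * (u / v) ^ 4)"
      by (intro mult_right_mono) auto
    hence "exp u \<le> 256 / \<delta> ^ 4 * exp v * (u / v) ^ 4"
      using False assms uv by (simp add: exp_diff power_divide field_simps)
    moreover have "0 \<le> l * z" "0 \<le> (1 + \<delta>) / 2 * l\<^sup>2 * z\<^sup>2" using assms zp by auto
    ultimately show ?thesis unfolding m u_def[symmetric] v_def[symmetric] by linarith
  qed
qed

lemma exp_le_quadratic_bounded: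
  fixes u A :: real
  assumes "u \<le> A" "0 \<le> A"
  shows "exp u \<le> 1 + u + u\<^sup>2 * exp A"
proof (cases "u \<le> 1/2")
  case True
  have "u\<^sup>2 \<le> u\<^sup>2 * exp A" using assms by (simp add: mult_le_cancel_left1)
  thus ?thesis using exp_quadratic_upper[of u 1] True by simp
next
  case False
  obtain t where t: "\<bar>t\<bar> \<le> \<bar>u\<bar>" and e: "exp u = (\<Sum>m<2. u ^ m / fact m) + exp t / fact 2 * u ^ 2"
    using Maclaurin_exp_le[of u 2] by blast
  have e': "exp u = 1 + u + exp t / 2 * u ^ 2"
    using e by (simp add: eval_nat_numeral)
  have "t \<le> A" using t assms False by linarith
  hence "exp t \<le> exp A" by simp
  hence "exp t / 2 \<le> exp A" using exp_gt_zero[of A] by linarith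
  hence "exp t / 2 * u^2 \<le> exp A * u^2" by (intro mult_right_mono) auto
  thus ?thesis using e' by (simp add: mult.commute)
qed

lemma one_minus_exp_lower:
  fixes a z z0 \<delta> :: real
  assumes "0 \<le> a" "0 \<le> z" "0 \<le> z0" "a * z0 \<le> \<delta>" "\<delta> \<le> 1"
  shows "(1 - \<delta>) * a * min (z\<^sup>2) (z0\<^sup>2) \<le> z * (1 - exp (- (a * z)))"
proof -
  define s where "s = min z z0"
  have s: "0 \<le> s" "s \<le> z" "s \<le> z0" using assms by (auto simp: s_def)
  have as: "a * s \<le> \<delta>" using mult_left_mono[OF s(3) assms(1)] assms by linarith
  have "exp (- (a * s)) \<le> 1 + - (a * s) + (1 + 1) / 2 * (- (a * s))\<^sup>2"
    by (rule exp_quadratic_upper) (use assms s in \<open>auto intro: order_trans[of _ 0]\<close>)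
  hence "a * s * (1 - a * s) \<le> 1 - exp (- (a * s))" by (simp add: power2_eq_square algebra_simps)
  moreover have "a * s * (1 - \<delta>) \<le> a * s * (1 - a * s)" using as s assms by (intro mult_left_mono) auto
  moreover have "exp (- (a * z)) \<le> exp (- (a * s))" using s assms by (simp add: mult_left_mono)
  ultimately have 1: "a * s * (1 - \<delta>) \<le> 1 - exp (- (a * z))" by linarith
  have "min (z\<^sup>2) (z0\<^sup>2) = s * s" unfolding s_def using assms
    by (auto simp: min_def power2_eq_square mult_mono) (smt (verit) mult_strict_mono)+
  hence "(1 - \<delta>) * a * min (z\<^sup>2) (z0\<^sup>2) = s * (a * s * (1 - \<delta>))" by simp
  also have "\<dots> \<le> z * (1 - exp (- (a * z)))"
    using 1 s assms by (intro mult_mono) auto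
  finally show ?thesis .
qed

text \<open>
  The difference of the two sides is a function of the exponent that vanishes at \<open>l = r\<close>; its
  derivative in \<open>l\<close> is nonnegative, for \<open>x \<ge> 0\<close> by convexity and for \<open>x < 0\<close> by
  \<open>one_minus_exp_lower\<close>. The bound involves only a truncated square, which is what lower bounds on
  conditional variances control.
\<close>

lemma exp_diff_lower:
  fixes x l r z0 \<delta> :: real
  assumes "0 \<le> r" "r \<le> l" "0 \<le> z0" "l * z0 \<le> \<delta>" "0 \<le> \<delta>" "\<delta> \<le> 1"
  shows "(l - r) * x + (1 - \<delta>) / 2 * (l\<^sup>2 - r\<^sup>2) * min (x\<^sup>2) (z0\<^sup>2) \<le> exp (l * x) - exp (r * x)"
proof -
  define q where "q = min (x\<^sup>2) (z0\<^sup>2)"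
  define k where "k = (\<lambda>a. exp (a * x) - a * x - (1 - \<delta>) / 2 * a\<^sup>2 * q)"
  have q0: "0 \<le> q" "q \<le> x\<^sup>2" by (auto simp: q_def)
  have "k r \<le> k l"
  proof (rule DERIV_nonneg_imp_nondecreasing[OF assms(2)])
    fix a assume a: "r \<le> a" "a \<le> l"
    have "DERIV k a :> x * exp (a * x) - x - (1 - \<delta>) * a * q"
      unfolding k_def by (auto intro!: derivative_eq_intros simp: field_simps)
    moreover have "0 \<le> x * exp (a * x) - x - (1 - \<delta>) * a * q"
    proof (cases "0 \<le> x")
      case True
      have "x * (a * x) \<le> x * (exp (a * x) - 1)"
        by (rule mult_left_mono[OF _ True]) (use exp_ge_add_one_self[of "a * x"] in linarith)
      moreover have "(1 - \<delta>) * (a * q) \<le> 1 * (a * q)" using assms a q0 by (intro mult_right_mono) auto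
      moreover have "a * q \<le> a * x\<^sup>2" using a assms q0 by (intro mult_left_mono) auto
      ultimately show ?thesis by (simp add: algebra_simps power2_eq_square)
    next
      case False
      have "a * z0 \<le> \<delta>" using mult_right_mono[OF a(2) assms(3)] assms by linarith
      hence "(1 - \<delta>) * a * min ((-x)\<^sup>2) (z0\<^sup>2) \<le> (-x) * (1 - exp (- (a * (-x))))"
        using False assms a by (intro one_minus_exp_lower) auto
      thus ?thesis by (simp add: q_def algebra_simps)
    qed
    ultimately show "\<exists>y. DERIV k a :> y \<and> 0 \<le> y" by blast
  qed
  thus ?thesis unfolding k_def q_def by (simp add: algebra_simps)
qed


section \<open>Martingale differences and a maximal inequality\<close>

text \<open>
  Conditional expectations enter through integrals against bounded nonnegative weights that are
  measurable at time \<open>n\<close>: the conditional mean of \<open>X n\<close> is \<open>0\<close>, its conditional variance at most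
  \<open>u n\<close>, and \<open>w y\<close> bounds the conditional fourth moment of \<open>\<bar>X n\<bar> / y\<close> cut off at \<open>1\<close>. The last
  quantity dominates the conditional probability of \<open>\<bar>X n\<bar> > y\<close> and is the remainder produced by
  \<open>exp_step_upper\<close>.
\<close>

locale mds = prob_space P for P :: "'a measure" +
  fixes F :: "nat \<Rightarrow> 'a measure" and X :: "nat \<Rightarrow> 'a \<Rightarrow> real"
    and u :: "nat \<Rightarrow> real" and w :: "real \<Rightarrow> real"
  assumes subalg: "subalgebra P (F n)"
    and F_mono: "m \<le> n \<Longrightarrow> sets (F m) \<subseteq> sets (F n)"
    and adapted: "X n \<in> borel_measurable (F (Suc n))"
    and square_integrable: "integrable P (\<lambda>\<omega>. (X n \<omega>)\<^sup>2)"
    and cond_mean: "g \<in> borel_measurable (F n) \<Longrightarrow> (\<And>\<omega>. 0 \<le> g \<omega> \<and> g \<omega> \<le> B) \<Longrightarrow>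
      (\<integral>\<omega>. g \<omega> * X n \<omega> \<partial>P) = 0"
    and cond_var: "g \<in> borel_measurable (F n) \<Longrightarrow> (\<And>\<omega>. 0 \<le> g \<omega> \<and> g \<omega> \<le> B) \<Longrightarrow>
      (\<integral>\<omega>. g \<omega> * (X n \<omega>)\<^sup>2 \<partial>P) \<le> u n * (\<integral>\<omega>. g \<omega> \<partial>P)"
    and cond_tail: "g \<in> borel_measurable (F n) \<Longrightarrow> (\<And>\<omega>. 0 \<le> g \<omega> \<and> g \<omega> \<le> B) \<Longrightarrow> 0 < y \<Longrightarrow>
      (\<integral>\<omega>. g \<omega> * min (\<bar>X n \<omega>\<bar> / y) 1 ^ 4 \<partial>P) \<le> w y * (\<integral>\<omega>. g \<omega> \<partial>P)"
begin

lemma space_F [simp]: "space (F n) = space P"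
  using subalg[of n] by (simp add: subalgebra_def)

lemma sets_F: "sets (F n) \<subseteq> sets P"
  using subalg[of n] by (simp add: subalgebra_def)

lemma measurable_F_P: "f \<in> borel_measurable (F n) \<Longrightarrow> f \<in> borel_measurable P"
  by (rule measurable_from_subalg[OF subalg])

lemma measurable_F_mono: "f \<in> borel_measurable (F m) \<Longrightarrow> m \<le> n \<Longrightarrow> f \<in> borel_measurable (F n)"
  by (rule measurable_from_subalg[of "F n" "F m"]) (auto simp: subalgebra_def F_mono)

lemma X_F [measurable_dest]: "i < n \<Longrightarrow> X i \<in> borel_measurable (F n)"
  using measurable_F_mono[OF adapted, of i n] by simp

lemma X_P [measurable]: "X i \<in> borel_measurable P"
  using measurable_F_P[OF adapted] .

lemma integrable_times:
  assumes "integrable P f" "g \<in> borel_measurable P" "\<And>\<omega>. \<bar>g \<omega>\<bar> \<le> (B::real)"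
  shows "integrable P (\<lambda>\<omega>. g \<omega> * (f \<omega> :: real))"
proof (rule Bochner_Integration.integrable_bound)
  show "integrable P (\<lambda>\<omega>. B * f \<omega>)" using assms by simp
  show "(\<lambda>\<omega>. g \<omega> * f \<omega>) \<in> borel_measurable P" using assms by measurable
  show "AE \<omega> in P. norm (g \<omega> * f \<omega>) \<le> norm (B * f \<omega>)"
    using assms(3) by (intro AE_I2) (auto simp: abs_mult intro!: mult_right_mono order_trans[OF assms(3)])
qed

lemma integrable_bdd: "f \<in> borel_measurable P \<Longrightarrow> (\<And>\<omega>. \<bar>f \<omega>\<bar> \<le> (B::real)) \<Longrightarrow> integrable P f"
  by (rule integrable_const_bound[of _ B]) auto

lemma integrable_X: "integrable P (X n)"
  by (rule square_integrable_imp_integrable[OF X_P square_integrable])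

lemma integral_F_nonneg: "(\<And>\<omega>. 0 \<le> g \<omega>) \<Longrightarrow> 0 \<le> (\<integral>\<omega>. (g \<omega> :: real) \<partial>P)"
  by (simp add: integral_nonneg_AE)

lemma exp_step_upper_integral:
  assumes g: "g \<in> borel_measurable (F n)" "\<And>\<omega>. 0 \<le> g \<omega> \<and> g \<omega> \<le> B"
    and d: "0 < \<delta>" "\<delta> \<le> 1" "0 < l" "0 < y"
  shows "(\<integral>\<omega>. g \<omega> * exp (l * min (X n \<omega>) y) \<partial>P)
    \<le> (1 + (1 + \<delta>) / 2 * l\<^sup>2 * u n + 256 / \<delta> ^ 4 * exp (l * y) * w y) * (\<integral>\<omega>. g \<omega> \<partial>P)"
proof -
  have gP[measurable]: "g \<in> borel_measurable P" by (rule measurable_F_P[OF g(1)])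
  have gB: "\<bar>g \<omega>\<bar> \<le> B" for \<omega> using g(2)[of \<omega>] by auto
  define a b where "a = (1 + \<delta>) / 2 * l\<^sup>2" and "b = 256 / \<delta> ^ 4 * exp (l * y)"
  have ab: "0 \<le> a" "0 \<le> b" using d by (auto simp: a_def b_def)
  have ig: "integrable P g" by (rule integrable_bdd[OF gP gB])
  have i1: "integrable P (\<lambda>\<omega>. g \<omega> * X n \<omega>)" by (rule integrable_times[OF integrable_X gP gB])
  have i2: "integrable P (\<lambda>\<omega>. g \<omega> * (X n \<omega>)\<^sup>2)" by (rule integrable_times[OF square_integrable gP gB])
  have i3: "integrable P (\<lambda>\<omega>. g \<omega> * min (\<bar>X n \<omega>\<bar> / y) 1 ^ 4)"
    by (rule integrable_times[OF _ gP gB], rule integrable_bdd[of _ 1])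
       (use d in \<open>auto intro!: power_le_one\<close>)
  have i4: "integrable P (\<lambda>\<omega>. g \<omega> * exp (l * min (X n \<omega>) y))"
    by (rule integrable_times[OF _ gP gB], rule integrable_bdd[of _ "exp (l * y)"])
       (use d in auto)
  have "(\<integral>\<omega>. g \<omega> * exp (l * min (X n \<omega>) y) \<partial>P)
      \<le> (\<integral>\<omega>. g \<omega> + l * (g \<omega> * X n \<omega>) + a * (g \<omega> * (X n \<omega>)\<^sup>2)
            + b * (g \<omega> * min (\<bar>X n \<omega>\<bar> / y) 1 ^ 4) \<partial>P)"
  proof (rule integral_mono)
    show "integrable P (\<lambda>\<omega>. g \<omega> + l * (g \<omega> * X n \<omega>) + a * (g \<omega> * (X n \<omega>)\<^sup>2)
            + b * (g \<omega> * min (\<bar>X n \<omega>\<bar> / y) 1 ^ 4))"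
      using ig i1 i2 i3 by (intro Bochner_Integration.integrable_add integrable_mult_right)
    fix \<omega>
    have "g \<omega> * exp (l * min (X n \<omega>) y) \<le> g \<omega> * (1 + l * X n \<omega> + a * (X n \<omega>)\<^sup>2 + b * min (\<bar>X n \<omega>\<bar> / y) 1 ^ 4)"
      using exp_step_upper[OF d, of "X n \<omega>"] g(2)[of \<omega>] unfolding a_def b_def by (intro mult_left_mono) auto
    thus "g \<omega> * exp (l * min (X n \<omega>) y) \<le> g \<omega> + l * (g \<omega> * X n \<omega>) + a * (g \<omega> * (X n \<omega>)\<^sup>2)
            + b * (g \<omega> * min (\<bar>X n \<omega>\<bar> / y) 1 ^ 4)" by (simp add: algebra_simps)
  qed (rule i4)
  also have "\<dots> = (\<integral>\<omega>. g \<omega> \<partial>P) + l * (\<integral>\<omega>. g \<omega> * X n \<omega> \<partial>P) + a * (\<integral>\<omega>. g \<omega> * (X n \<omega>)\<^sup>2 \<partial>P)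
            + b * (\<integral>\<omega>. g \<omega> * min (\<bar>X n \<omega>\<bar> / y) 1 ^ 4 \<partial>P)"
    using ig i1 i2 i3 by simp
  also have "\<dots> \<le> (\<integral>\<omega>. g \<omega> \<partial>P) + l * 0 + a * (u n * (\<integral>\<omega>. g \<omega> \<partial>P)) + b * (w y * (\<integral>\<omega>. g \<omega> \<partial>P))"
    using ab cond_mean[OF g] cond_var[OF g] cond_tail[OF g d(4)] d(3)
    by (intro add_mono mult_left_mono) auto
  finally show ?thesis by (simp add: a_def b_def algebra_simps)
qed

lemma u_nonneg: "0 \<le> u n"
proof -
  have "0 \<le> (\<integral>\<omega>. 1 * (X n \<omega>)\<^sup>2 \<partial>P)" by (rule integral_F_nonneg) auto
  also have "\<dots> \<le> u n * (\<integral>\<omega>. 1 \<partial>P)" by (rule cond_var[of "\<lambda>_. 1" n 1]) auto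
  finally show ?thesis using prob_space by simp
qed

lemma w_nonneg: "0 < y \<Longrightarrow> 0 \<le> w y"
proof -
  assume y: "0 < y"
  have "0 \<le> (\<integral>\<omega>. 1 * min (\<bar>X 0 \<omega>\<bar> / y) 1 ^ 4 \<partial>P)" by (rule integral_F_nonneg) (use y in auto)
  also have "\<dots> \<le> w y * (\<integral>\<omega>. 1 \<partial>P)" by (rule cond_tail[of "\<lambda>_. 1" 0 1]) (use y in auto)
  finally show ?thesis using prob_space by simp
qed

lemma tail_prob:
  assumes y: "0 < y"
  shows "prob {\<omega> \<in> space P. y < \<bar>X i \<omega>\<bar>} \<le> w y"
proof -
  have "prob {\<omega> \<in> space P. y < \<bar>X i \<omega>\<bar>} = (\<integral>\<omega>. indicator {\<omega> \<in> space P. y < \<bar>X i \<omega>\<bar>} \<omega> \<partial>P)"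
    by simp
  also have "\<dots> \<le> (\<integral>\<omega>. 1 * min (\<bar>X i \<omega>\<bar> / y) 1 ^ 4 \<partial>P)"
  proof (rule integral_mono)
    show "integrable P (\<lambda>\<omega>. 1 * min (\<bar>X i \<omega>\<bar> / y) 1 ^ 4)"
      by (rule integrable_bdd[of _ 1]) (use y in \<open>auto intro!: power_le_one\<close>)
    show "integrable P (indicator {\<omega> \<in> space P. y < \<bar>X i \<omega>\<bar>} :: _ \<Rightarrow> real)"
      by (rule integrable_bdd[of _ 1]) (auto simp: indicator_def)
  qed (use y in \<open>auto simp: indicator_def min_def field_simps\<close>)
  also have "\<dots> \<le> w y * (\<integral>\<omega>. 1 \<partial>P)" by (rule cond_tail[of "\<lambda>_. 1" i 1]) (use y in auto)
  finally show ?thesis using prob_space by simp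
qed

lemma tail_prob_union:
  assumes y: "0 < y"
  shows "prob {\<omega> \<in> space P. \<exists>i<n. y < \<bar>X i \<omega>\<bar>} \<le> real n * w y"
proof -
  have "{\<omega> \<in> space P. \<exists>i<n. y < \<bar>X i \<omega>\<bar>} = (\<Union>i<n. {\<omega> \<in> space P. y < \<bar>X i \<omega>\<bar>})" by auto
  also have "prob \<dots> \<le> (\<Sum>i<n. prob {\<omega> \<in> space P. y < \<bar>X i \<omega>\<bar>})"
    by (rule finite_measure_subadditive_finite) auto
  also have "\<dots> \<le> (\<Sum>i<n. w y)" by (intro sum_mono tail_prob y)
  finally show ?thesis by simp
qed

text \<open>
  The exponential of the truncated sum, frozen when the level \<open>x\<close> is reached, grows in the mean by
  at most the factor of \<open>exp_step_upper_integral\<close> in each step.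
\<close>

lemma max_truncated_sum_bound:
  assumes d: "0 < \<delta>" "\<delta> \<le> 1" "0 < l" "0 < y" "0 < x"
  shows "exp (l * x) * prob {\<omega> \<in> space P. \<exists>m\<le>n. x \<le> (\<Sum>i<m. min (X i \<omega>) y)}
    \<le> (\<Prod>i<n. 1 + (1 + \<delta>) / 2 * l\<^sup>2 * u i + 256 / \<delta> ^ 4 * exp (l * y) * w y)"
proof -
  define S where "S = (\<lambda>m \<omega>. \<Sum>i<m. min (X i \<omega>) y)"
  define \<beta> where "\<beta> = (\<lambda>i. 1 + (1 + \<delta>) / 2 * l\<^sup>2 * u i + 256 / \<delta> ^ 4 * exp (l * y) * w y)"
  define Hit where "Hit = (\<lambda>m \<omega>. \<exists>j\<le>m. x \<le> S j \<omega>)"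
  define D where "D = (\<lambda>m \<omega>. if Hit m \<omega> then exp (l * x) else exp (l * S m \<omega>))"
  \<comment> \<open>the part of \<open>D m\<close> that is already frozen, and the part that still moves\<close>
  define h1 where "h1 = (\<lambda>m \<omega>. if Hit m \<omega> then exp (l * x) else 0)"
  define h2 where "h2 = (\<lambda>m \<omega>. if Hit m \<omega> then 0 else exp (l * S m \<omega>))"
  have \<beta>1: "1 \<le> \<beta> i" for i unfolding \<beta>_def using u_nonneg[of i] w_nonneg[OF d(4)] d by simp
  have SF: "S j \<in> borel_measurable (F m)" if "j \<le> m" for j m
    unfolding S_def using that by (intro borel_measurable_sum borel_measurable_min X_F) auto
  have hit[measurable]: "Measurable.pred (F m) (Hit m)" for m
  proof -
    have "Measurable.pred (F m) (\<lambda>\<omega>. \<exists>j\<in>{..m}. x \<le> S j \<omega>)"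
    proof (rule pred_intros_finite(4))
      fix j assume "j \<in> {..m}"
      hence [measurable]: "S j \<in> borel_measurable (F m)" using SF by simp
      show "Measurable.pred (F m) (\<lambda>\<omega>. x \<le> S j \<omega>)" by measurable
    qed simp
    moreover have "(\<lambda>\<omega>. \<exists>j\<in>{..m}. x \<le> S j \<omega>) = Hit m" by (auto simp: Hit_def)
    ultimately show ?thesis by argo
  qed
  have h1m: "h1 m \<in> borel_measurable (F m)" and h2m: "h2 m \<in> borel_measurable (F m)"
    and Dm: "D m \<in> borel_measurable (F m)" for m
  proof -
    have [measurable]: "S m \<in> borel_measurable (F m)" by (rule SF) simp
    show "h1 m \<in> borel_measurable (F m)" "h2 m \<in> borel_measurable (F m)" "D m \<in> borel_measurable (F m)"
      unfolding h1_def h2_def D_def by measurable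
  qed
  have h1b: "\<bar>h1 m \<omega>\<bar> \<le> exp (l * x)" and h2b: "0 \<le> h2 m \<omega> \<and> h2 m \<omega> \<le> exp (l * x)"
    and Db: "\<bar>D m \<omega>\<bar> \<le> exp (l * x)" for m \<omega>
    unfolding h1_def h2_def D_def using d by (auto simp: not_le Hit_def)
  have intD: "integrable P (D m)" for m by (rule integrable_bdd[OF measurable_F_P[OF Dm] Db])
  have main: "(\<integral>\<omega>. D m \<omega> \<partial>P) \<le> (\<Prod>i<m. \<beta> i)" for m
  proof (induction m)
    case 0
    have "D 0 \<omega> = 1" for \<omega> using d by (simp add: D_def Hit_def S_def)
    thus ?case using prob_space by simp
  next
    case (Suc m)
    have h2i: "integrable P (\<lambda>\<omega>. h2 m \<omega> * exp (l * min (X m \<omega>) y))"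
    proof (rule integrable_times[where B = "exp (l * x)"])
      show "integrable P (\<lambda>\<omega>. exp (l * min (X m \<omega>) y))"
        by (rule integrable_bdd[of _ "exp (l * y)"]) (use d in auto)
      show "h2 m \<in> borel_measurable P" by (rule measurable_F_P[OF h2m])
    qed (use h2b in \<open>auto simp: abs_of_nonneg\<close>)
    have h1i: "integrable P (h1 m)" by (rule integrable_bdd[OF measurable_F_P[OF h1m] h1b])
    have h2i': "integrable P (h2 m)"
      by (rule integrable_bdd[OF measurable_F_P[OF h2m], where B = "exp (l * x)"]) (use h2b in \<open>auto simp: abs_of_nonneg\<close>)
    have "(\<integral>\<omega>. D (Suc m) \<omega> \<partial>P) \<le> (\<integral>\<omega>. h1 m \<omega> + h2 m \<omega> * exp (l * min (X m \<omega>) y) \<partial>P)"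
    proof (rule integral_mono[OF intD])
      show "integrable P (\<lambda>\<omega>. h1 m \<omega> + h2 m \<omega> * exp (l * min (X m \<omega>) y))" using h1i h2i by simp
      fix \<omega>
      have S': "S (Suc m) \<omega> = S m \<omega> + min (X m \<omega>) y" by (simp add: S_def)
      show "D (Suc m) \<omega> \<le> h1 m \<omega> + h2 m \<omega> * exp (l * min (X m \<omega>) y)"
      proof (cases "Hit m \<omega>")
        case True
        hence "Hit (Suc m) \<omega>" using le_SucI unfolding Hit_def by blast
        thus ?thesis using True by (simp add: D_def h1_def h2_def)
      next
        case False
        have "h2 m \<omega> * exp (l * min (X m \<omega>) y) = exp (l * S (Suc m) \<omega>)"
          using False by (auto simp: h2_def S' exp_add[symmetric] distrib_left)
        moreover have "D (Suc m) \<omega> \<le> exp (l * S (Suc m) \<omega>)"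
          using False d by (auto simp: D_def Hit_def le_Suc_eq)
        ultimately show ?thesis using False by (auto simp: h1_def)
      qed
    qed
    also have "\<dots> = (\<integral>\<omega>. h1 m \<omega> \<partial>P) + (\<integral>\<omega>. h2 m \<omega> * exp (l * min (X m \<omega>) y) \<partial>P)"
      using h1i h2i by simp
    also have "\<dots> \<le> 1 * (\<integral>\<omega>. h1 m \<omega> \<partial>P) + \<beta> m * (\<integral>\<omega>. h2 m \<omega> \<partial>P)"
      using exp_step_upper_integral[OF h2m h2b d(1-4)] unfolding \<beta>_def by simp
    also have "\<dots> \<le> \<beta> m * (\<integral>\<omega>. h1 m \<omega> \<partial>P) + \<beta> m * (\<integral>\<omega>. h2 m \<omega> \<partial>P)"
      using \<beta>1[of m] by (intro add_mono mult_right_mono integral_F_nonneg order_refl) (auto simp: h1_def)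
    also have "\<dots> = \<beta> m * (\<integral>\<omega>. h1 m \<omega> + h2 m \<omega> \<partial>P)" using h1i h2i' by (simp add: distrib_left)
    also have "(\<lambda>\<omega>. h1 m \<omega> + h2 m \<omega>) = D m" by (auto simp: h1_def h2_def D_def)
    also have "\<beta> m * (\<integral>\<omega>. D m \<omega> \<partial>P) \<le> \<beta> m * (\<Prod>i<m. \<beta> i)"
      using Suc \<beta>1[of m] by (intro mult_left_mono) auto
    finally show ?case by (simp add: mult.commute)
  qed
  define A where "A = {\<omega> \<in> space P. Hit n \<omega>}"
  have "A = {\<omega> \<in> space (F n). Hit n \<omega>}" by (simp add: A_def)
  also have "\<dots> \<in> sets (F n)" by measurable
  finally have A[measurable]: "A \<in> sets P" using sets_F by auto
  have "exp (l * x) * prob A = (\<integral>\<omega>. exp (l * x) * indicator A \<omega> \<partial>P)"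
    by simp
  also have "\<dots> \<le> (\<integral>\<omega>. D n \<omega> \<partial>P)"
  proof (rule integral_mono[OF _ intD])
    show "integrable P (\<lambda>\<omega>. exp (l * x) * indicator A \<omega>)"
      by (rule integrable_bdd[of _ "exp (l * x)"]) (auto simp: indicator_def)
  qed (auto simp: D_def A_def indicator_def)
  finally show ?thesis using main[of n] unfolding A_def Hit_def S_def \<beta>_def by simp
qed

text \<open>
  Markov's inequality for the truncated sums with the Gaussian exponent \<open>x / ((1 + \<delta>) b)\<close>, unless
  that is so large that the tail term \<open>exp (l * y) * n * w y\<close> becomes dominant; then the exponent
  \<open>ln (1 / W) / y\<close> balances it.
\<close>

lemma maximal_inequality:
  assumes d: "0 < \<delta>" "\<delta> \<le> 1" and x: "0 < x"
    and W: "0 < W" "real n * w (x / 2) \<le> W" and b: "0 < b" "(\<Sum>i<n. u i) \<le> b"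
  shows "prob {\<omega> \<in> space P. \<exists>m\<le>n. x \<le> (\<Sum>i<m. X i \<omega>)}
    \<le> (1 + exp (256 / \<delta> ^ 4)) * W + exp (256 / \<delta> ^ 4) * exp (- x\<^sup>2 / (2 * (1 + \<delta>) * b))"
proof (cases "W < 1")
  case False
  have "prob {\<omega> \<in> space P. \<exists>m\<le>n. x \<le> (\<Sum>i<m. X i \<omega>)} \<le> 1" by simp
  also have "\<dots> \<le> 1 * W + (exp (256 / \<delta> ^ 4) * W + exp (256 / \<delta> ^ 4) * exp (- x\<^sup>2 / (2 * (1 + \<delta>) * b)))"
    using False W(1) by (simp add: add_increasing2)
  finally show ?thesis by (simp add: algebra_simps)
next
  case True
  define C where "C = 256 / \<delta> ^ 4"
  \<comment> \<open>With this level the exponent \<open>l2\<close> gives \<open>exp (- l2 * x / 2) = W\<close>.\<close>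
  define y where "y = x / 2"
  define l1 where "l1 = x / ((1 + \<delta>) * b)"
  define l2 where "l2 = ln (1 / W) / y"
  define l where "l = min l1 l2"
  have y: "0 < y" using x by (simp add: y_def)
  have l1: "0 < l1" using x b d by (simp add: l1_def)
  have l2: "0 < l2" using W True y by (simp add: l2_def)
  have l: "0 < l" using l1 l2 by (simp add: l_def)
  have C: "0 \<le> C" using d by (simp add: C_def)
  let ?E = "{\<omega> \<in> space P. \<exists>m\<le>n. x \<le> (\<Sum>i<m. min (X i \<omega>) y)}"
  have "exp (l * x) * prob ?E \<le> (\<Prod>i<n. 1 + (1 + \<delta>) / 2 * l\<^sup>2 * u i + C * exp (l * y) * w y)"
    unfolding C_def by (rule max_truncated_sum_bound[OF d l y x])
  also have "\<dots> \<le> (\<Prod>i<n. exp ((1 + \<delta>) / 2 * l\<^sup>2 * u i + C * exp (l * y) * w y))"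
  proof (rule prod_mono, safe)
    fix i
    have "0 \<le> (1 + \<delta>) / 2 * l\<^sup>2 * u i" "0 \<le> C * exp (l * y) * w y"
      using d C u_nonneg[of i] w_nonneg[OF y] by auto
    thus "0 \<le> 1 + (1 + \<delta>) / 2 * l\<^sup>2 * u i + C * exp (l * y) * w y" by linarith
    show "1 + (1 + \<delta>) / 2 * l\<^sup>2 * u i + C * exp (l * y) * w y
        \<le> exp ((1 + \<delta>) / 2 * l\<^sup>2 * u i + C * exp (l * y) * w y)"
      using exp_ge_add_one_self by (simp add: add.assoc)
  qed
  also have "\<dots> = exp ((1 + \<delta>) / 2 * l\<^sup>2 * (\<Sum>i<n. u i) + C * exp (l * y) * (real n * w y))"
    by (simp add: exp_sum[symmetric] sum.distrib sum_distrib_left)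
  also have "\<dots> \<le> exp ((1 + \<delta>) / 2 * l\<^sup>2 * b + C * exp (l * y) * W)"
    unfolding exp_le_cancel_iff using b W d C y_def by (intro add_mono mult_left_mono) auto
  finally have "prob ?E \<le> exp ((1 + \<delta>) / 2 * l\<^sup>2 * b + C * exp (l * y) * W) / exp (l * x)"
    by (simp add: field_simps)
  hence pE: "prob ?E \<le> exp ((1 + \<delta>) / 2 * l\<^sup>2 * b + C * exp (l * y) * W - l * x)"
    by (simp add: exp_diff)
  have "l * y \<le> l2 * y" using y by (simp add: l_def)
  also have "l2 * y = ln (1 / W)" using y by (simp add: l2_def)
  finally have "exp (l * y) \<le> 1 / W" using W by (metis exp_le_cancel_iff exp_ln zero_less_divide_1_iff)
  hence "exp (l * y) * W \<le> 1" using W by (simp add: field_simps)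
  hence "C * (exp (l * y) * W) \<le> C * 1" using C by (rule mult_left_mono)
  moreover have "(1 + \<delta>) / 2 * l\<^sup>2 * b \<le> l * x / 2"
  proof -
    have "l * ((1 + \<delta>) * b) \<le> l1 * ((1 + \<delta>) * b)" using d b by (intro mult_right_mono) (auto simp: l_def)
    also have "\<dots> = x" using d b by (simp add: l1_def)
    finally have "l / 2 * (l * ((1 + \<delta>) * b)) \<le> l / 2 * x" using l by (intro mult_left_mono) auto
    thus ?thesis by (simp add: power2_eq_square algebra_simps)
  qed
  ultimately have "(1 + \<delta>) / 2 * l\<^sup>2 * b + C * exp (l * y) * W - l * x \<le> C + - (l * x) / 2"
    by (simp add: mult.assoc)
  hence "prob ?E \<le> exp (C + - (l * x) / 2)" using pE by (meson exp_le_cancel_iff order_trans)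
  hence pE': "prob ?E \<le> exp C * exp (- (l * x) / 2)" by (simp only: exp_add)
  have "exp (- (l * x) / 2) \<le> exp (- x\<^sup>2 / (2 * (1 + \<delta>) * b)) + W"
  proof (cases "l1 \<le> l2")
    case True
    hence "- (l * x) / 2 = - x\<^sup>2 / (2 * (1 + \<delta>) * b)"
      by (simp add: l_def l1_def power2_eq_square field_simps)
    thus ?thesis using W by simp
  next
    case False
    hence "- (l * x) / 2 = - ln (1 / W)" using x by (simp add: l_def l2_def y_def field_simps)
    also have "\<dots> = ln W" using W by (simp add: ln_div)
    finally show ?thesis using W by simp
  qed
  hence "exp C * exp (- (l * x) / 2) \<le> exp C * (exp (- x\<^sup>2 / (2 * (1 + \<delta>) * b)) + W)"
    by (intro mult_left_mono) auto
  with pE' have pE'': "prob ?E \<le> exp C * (exp (- x\<^sup>2 / (2 * (1 + \<delta>) * b)) + W)" by linarith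
  let ?T = "{\<omega> \<in> space P. \<exists>i<n. y < \<bar>X i \<omega>\<bar>}"
  have m1: "?E \<in> sets P" and m2: "?T \<in> sets P" by measurable
  have "{\<omega> \<in> space P. \<exists>m\<le>n. x \<le> (\<Sum>i<m. X i \<omega>)} \<subseteq> ?E \<union> ?T"
  proof safe
    fix \<omega> m assume a: "\<omega> \<in> space P" "m \<le> n" "x \<le> (\<Sum>i<m. X i \<omega>)" "\<not> (\<exists>i<n. y < \<bar>X i \<omega>\<bar>)"
    have "(\<Sum>i<m. min (X i \<omega>) y) = (\<Sum>i<m. X i \<omega>)"
    proof (rule sum.cong)
      fix i assume "i \<in> {..<m}"
      hence "\<not> y < \<bar>X i \<omega>\<bar>" using a by auto
      thus "min (X i \<omega>) y = X i \<omega>" by auto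
    qed simp
    thus "\<exists>m\<le>n. x \<le> (\<Sum>i<m. min (X i \<omega>) y)" using a by auto
  qed
  hence "prob {\<omega> \<in> space P. \<exists>m\<le>n. x \<le> (\<Sum>i<m. X i \<omega>)} \<le> prob (?E \<union> ?T)"
    using m1 m2 by (intro finite_measure_mono) auto
  also have "\<dots> \<le> prob ?E + prob ?T" by (rule measure_Un_le[OF m1 m2])
  also have "prob ?T \<le> W" using tail_prob_union[OF y, of n] W unfolding y_def by linarith
  finally show ?thesis using pE'' unfolding C_def[symmetric] by (simp add: algebra_simps)
qed

end


section \<open>Reaching a sloped line\<close>

context mds begin

text \<open>
  A lower bound \<open>s\<close> for the conditional expectation, given the first \<open>i\<close> variables, of
  \<open>(X i)\<^sup>2\<close> cut off at \<open>c\<close>.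
\<close>

definition lowvar :: "nat \<Rightarrow> real \<Rightarrow> real \<Rightarrow> bool" where
  "lowvar i c s \<longleftrightarrow> (\<forall>g B. g \<in> borel_measurable (F i) \<longrightarrow> (\<forall>\<omega>. 0 \<le> g \<omega> \<and> g \<omega> \<le> B) \<longrightarrow>
     s * (\<integral>\<omega>. g \<omega> \<partial>P) \<le> (\<integral>\<omega>. g \<omega> * min ((X i \<omega>)\<^sup>2) c \<partial>P))"

text \<open>
  Integrating \<open>exp_diff_lower\<close>: the conditional moment generating function of the variable truncated
  at \<open>A / l\<close> grows between \<open>r\<close> and \<open>l\<close> by at least \<open>exp (v * (l\<^sup>2 - r\<^sup>2) / 2)\<close>, as for a Gaussian
  variable of variance \<open>v\<close>. The truncation costs a negative drift of at most \<open>t * l / A\<close>, and the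
  last assumption says that \<open>v\<close> falls short of the variance bound \<open>s\<close> by enough to pay for it.
\<close>

lemma exp_step_lower_integral:
  assumes g: "g \<in> borel_measurable (F n)" "\<And>\<omega>. 0 \<le> g \<omega> \<and> g \<omega> \<le> B"
    and low: "lowvar n (z\<^sup>2) s" and up: "u n \<le> t"
    and r: "0 \<le> r" "r \<le> l" "0 < l" and z: "0 \<le> z" "z \<le> A / l" "l * z \<le> \<delta>" and d: "0 \<le> \<delta>" "\<delta> \<le> 1"
    and A: "0 < A" and v: "0 \<le> v" "v * l\<^sup>2 \<le> 1"
       "v * (1 + v * l\<^sup>2) * (1 + l\<^sup>2 * t * exp A) \<le> (1 - \<delta>) * s - 2 * t / A"
  shows "exp (v * (l\<^sup>2 - r\<^sup>2) / 2) * (\<integral>\<omega>. g \<omega> * exp (r * min (X n \<omega>) (A / l)) \<partial>P)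
     \<le> (\<integral>\<omega>. g \<omega> * exp (l * min (X n \<omega>) (A / l)) \<partial>P)"
proof -
  have gP[measurable]: "g \<in> borel_measurable P" by (rule measurable_F_P[OF g(1)])
  have gB: "\<bar>g \<omega>\<bar> \<le> B" for \<omega> using g(2)[of \<omega>] by auto
  define M where "M = A / l"
  have M: "0 < M" using A r by (simp add: M_def)
  define G where "G = (\<integral>\<omega>. g \<omega> \<partial>P)"
  have G: "0 \<le> G" unfolding G_def by (rule integral_F_nonneg) (use g in auto)
  define I where "I = (\<lambda>a. \<integral>\<omega>. g \<omega> * exp (a * min (X n \<omega>) M) \<partial>P)"
  have ig: "integrable P g" by (rule integrable_bdd[OF gP gB])
  have iX: "integrable P (\<lambda>\<omega>. g \<omega> * X n \<omega>)" by (rule integrable_times[OF integrable_X gP gB])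
  have i1: "integrable P (\<lambda>\<omega>. g \<omega> * min (X n \<omega>) M)"
    by (rule integrable_times[OF _ gP gB]) (auto intro!: integrable_min integrable_X)
  have i2: "integrable P (\<lambda>\<omega>. g \<omega> * (X n \<omega>)\<^sup>2)" by (rule integrable_times[OF square_integrable gP gB])
  have i3: "integrable P (\<lambda>\<omega>. g \<omega> * min ((X n \<omega>)\<^sup>2) (z\<^sup>2))"
    by (rule integrable_times[OF _ gP gB], rule integrable_bdd[of _ "z\<^sup>2"]) auto
  have i4: "integrable P (\<lambda>\<omega>. g \<omega> * exp (a * min (X n \<omega>) M))" if "0 \<le> a" for a
    by (rule integrable_times[OF _ gP gB], rule integrable_bdd[of _ "exp (a * M)"])
       (use that in \<open>auto intro!: mult_left_mono\<close>)
  have l0: "0 \<le> l" using r by simp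
  have t0: "0 \<le> t" using u_nonneg[of n] up by simp
  have gX: "(\<integral>\<omega>. g \<omega> * X n \<omega> \<partial>P) = 0" by (rule cond_mean[OF g])
  have gX2: "(\<integral>\<omega>. g \<omega> * (X n \<omega>)\<^sup>2 \<partial>P) \<le> t * G"
    using cond_var[OF g] mult_right_mono[OF up G] unfolding G_def by linarith
  \<comment> \<open>truncating from above costs at most the variance over \<open>M\<close>\<close>
  have low1: "- (t / M * G) \<le> (\<integral>\<omega>. g \<omega> * min (X n \<omega>) M \<partial>P)"
  proof -
    have "(\<integral>\<omega>. g \<omega> * X n \<omega> - 1 / M * (g \<omega> * (X n \<omega>)\<^sup>2) \<partial>P) \<le> (\<integral>\<omega>. g \<omega> * min (X n \<omega>) M \<partial>P)"
    proof (rule integral_mono)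
      show "integrable P (\<lambda>\<omega>. g \<omega> * X n \<omega> - 1 / M * (g \<omega> * (X n \<omega>)\<^sup>2))"
        using iX i2 by (intro Bochner_Integration.integrable_diff integrable_mult_right)
      fix \<omega>
      have "X n \<omega> - (X n \<omega>)\<^sup>2 / M \<le> min (X n \<omega>) M"
      proof (cases "X n \<omega> \<le> M")
        case True thus ?thesis using M by simp
      next
        case False
        hence "M * X n \<omega> \<le> X n \<omega> * X n \<omega>" using M by (intro mult_right_mono) auto
        hence "X n \<omega> \<le> (X n \<omega>)\<^sup>2 / M" using M by (simp add: field_simps power2_eq_square)
        thus ?thesis using False M by simp
      qed
      from mult_left_mono[OF this, of "g \<omega>"] g(2)[of \<omega>]
      show "g \<omega> * X n \<omega> - 1 / M * (g \<omega> * (X n \<omega>)\<^sup>2) \<le> g \<omega> * min (X n \<omega>) M"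
        by (simp add: algebra_simps)
    qed (rule i1)
    moreover have "(\<integral>\<omega>. g \<omega> * X n \<omega> - 1 / M * (g \<omega> * (X n \<omega>)\<^sup>2) \<partial>P)
        = (\<integral>\<omega>. g \<omega> * X n \<omega> \<partial>P) - 1 / M * (\<integral>\<omega>. g \<omega> * (X n \<omega>)\<^sup>2 \<partial>P)"
      using iX i2 by simp
    moreover have "1 / M * (\<integral>\<omega>. g \<omega> * (X n \<omega>)\<^sup>2 \<partial>P) \<le> 1 / M * (t * G)"
      using gX2 M by (intro mult_left_mono) auto
    ultimately show ?thesis using gX by simp
  qed
  have diff: "(l - r) * (\<integral>\<omega>. g \<omega> * min (X n \<omega>) M \<partial>P)
      + (1 - \<delta>) / 2 * (l\<^sup>2 - r\<^sup>2) * (\<integral>\<omega>. g \<omega> * min ((X n \<omega>)\<^sup>2) (z\<^sup>2) \<partial>P) \<le> I l - I r"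
  proof -
    have "(l - r) * (\<integral>\<omega>. g \<omega> * min (X n \<omega>) M \<partial>P)
        + (1 - \<delta>) / 2 * (l\<^sup>2 - r\<^sup>2) * (\<integral>\<omega>. g \<omega> * min ((X n \<omega>)\<^sup>2) (z\<^sup>2) \<partial>P)
      = (\<integral>\<omega>. (l - r) * (g \<omega> * min (X n \<omega>) M)
        + (1 - \<delta>) / 2 * (l\<^sup>2 - r\<^sup>2) * (g \<omega> * min ((X n \<omega>)\<^sup>2) (z\<^sup>2)) \<partial>P)"
      using i1 i3 by simp
    also have "\<dots> \<le> (\<integral>\<omega>. g \<omega> * exp (l * min (X n \<omega>) M) - g \<omega> * exp (r * min (X n \<omega>) M) \<partial>P)"
    proof (rule integral_mono)
      show "integrable P (\<lambda>\<omega>. (l - r) * (g \<omega> * min (X n \<omega>) M)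
        + (1 - \<delta>) / 2 * (l\<^sup>2 - r\<^sup>2) * (g \<omega> * min ((X n \<omega>)\<^sup>2) (z\<^sup>2)))"
        using i1 i3 by (intro Bochner_Integration.integrable_add integrable_mult_right)
      show "integrable P (\<lambda>\<omega>. g \<omega> * exp (l * min (X n \<omega>) M) - g \<omega> * exp (r * min (X n \<omega>) M))"
        by (intro Bochner_Integration.integrable_diff i4 l0 r)
      fix \<omega>
      have sq: "min ((min (X n \<omega>) M)\<^sup>2) (z\<^sup>2) = min ((X n \<omega>)\<^sup>2) (z\<^sup>2)"
      proof (cases "X n \<omega> \<le> M")
        case False
        hence "z\<^sup>2 \<le> M\<^sup>2" "M\<^sup>2 \<le> (X n \<omega>)\<^sup>2" using z M unfolding M_def by (auto intro: power_mono)
        thus ?thesis using False by simp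
      qed simp
      have "(l - r) * min (X n \<omega>) M + (1 - \<delta>) / 2 * (l\<^sup>2 - r\<^sup>2) * min ((min (X n \<omega>) M)\<^sup>2) (z\<^sup>2)
          \<le> exp (l * min (X n \<omega>) M) - exp (r * min (X n \<omega>) M)"
        by (rule exp_diff_lower) (use r z d in auto)
      hence "g \<omega> * ((l - r) * min (X n \<omega>) M + (1 - \<delta>) / 2 * (l\<^sup>2 - r\<^sup>2) * min ((X n \<omega>)\<^sup>2) (z\<^sup>2))
          \<le> g \<omega> * (exp (l * min (X n \<omega>) M) - exp (r * min (X n \<omega>) M))"
        unfolding sq using g(2)[of \<omega>] by (intro mult_left_mono) auto
      thus "(l - r) * (g \<omega> * min (X n \<omega>) M)
        + (1 - \<delta>) / 2 * (l\<^sup>2 - r\<^sup>2) * (g \<omega> * min ((X n \<omega>)\<^sup>2) (z\<^sup>2))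
        \<le> g \<omega> * exp (l * min (X n \<omega>) M) - g \<omega> * exp (r * min (X n \<omega>) M)"
        by (simp add: algebra_simps)
    qed
    also have "\<dots> = I l - I r" unfolding I_def using i4[OF l0] i4[OF r(1)] by simp
    finally show ?thesis .
  qed
  have r2: "r\<^sup>2 \<le> l\<^sup>2" using r by (intro power_mono) auto
  have lows: "s * G \<le> (\<integral>\<omega>. g \<omega> * min ((X n \<omega>)\<^sup>2) (z\<^sup>2) \<partial>P)"
    using low g unfolding lowvar_def G_def by blast
  define v' where "v' = (1 - \<delta>) * s - 2 * t / A"
  have D: "(l\<^sup>2 - r\<^sup>2) / 2 * v' * G \<le> I l - I r"
  proof -
    have "(l - r) * (- (t / M * G)) \<le> (l - r) * (\<integral>\<omega>. g \<omega> * min (X n \<omega>) M \<partial>P)"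
      using low1 r by (intro mult_left_mono) auto
    moreover have "(1 - \<delta>) / 2 * (l\<^sup>2 - r\<^sup>2) * (s * G)
        \<le> (1 - \<delta>) / 2 * (l\<^sup>2 - r\<^sup>2) * (\<integral>\<omega>. g \<omega> * min ((X n \<omega>)\<^sup>2) (z\<^sup>2) \<partial>P)"
      using lows d r2 by (intro mult_left_mono) auto
    moreover have "(l - r) * (t / M * G) \<le> (l\<^sup>2 - r\<^sup>2) * (t / A * G)"
    proof -
      have "(l - r) * (t / M * G) = (l - r) * l * (t / A * G)" using A r by (simp add: M_def)
      also have "\<dots> \<le> (l - r) * (l + r) * (t / A * G)"
        using r A t0 G by (intro mult_right_mono mult_left_mono) auto
      finally show ?thesis by (simp add: power2_eq_square algebra_simps)
    qed
    ultimately have "(1 - \<delta>) / 2 * (l\<^sup>2 - r\<^sup>2) * (s * G) - (l\<^sup>2 - r\<^sup>2) * (t / A * G) \<le> I l - I r"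
      using diff by linarith
    moreover have "(1 - \<delta>) / 2 * (l\<^sup>2 - r\<^sup>2) * (s * G) - (l\<^sup>2 - r\<^sup>2) * (t / A * G) = (l\<^sup>2 - r\<^sup>2) / 2 * v' * G"
      unfolding v'_def using A by (simp add: field_simps)
    ultimately show ?thesis by metis
  qed
  have Ir: "I r \<le> (1 + l\<^sup>2 * t * exp A) * G"
  proof -
    have "I r \<le> (\<integral>\<omega>. g \<omega> + r * (g \<omega> * X n \<omega>) + (l\<^sup>2 * exp A) * (g \<omega> * (X n \<omega>)\<^sup>2) \<partial>P)"
      unfolding I_def
    proof (rule integral_mono)
      show "integrable P (\<lambda>\<omega>. g \<omega> + r * (g \<omega> * X n \<omega>) + (l\<^sup>2 * exp A) * (g \<omega> * (X n \<omega>)\<^sup>2))"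
        using ig iX i2 by (intro Bochner_Integration.integrable_add integrable_mult_right)
      show "integrable P (\<lambda>\<omega>. g \<omega> * exp (r * min (X n \<omega>) M))" by (rule i4[OF r(1)])
      fix \<omega>
      have "r * min (X n \<omega>) M \<le> r * M" using r by (intro mult_left_mono) auto
      also have "\<dots> \<le> l * M" using r M by (intro mult_right_mono) auto
      also have "\<dots> = A" using r by (simp add: M_def)
      finally have "exp (r * min (X n \<omega>) M) \<le> 1 + r * min (X n \<omega>) M + (r * min (X n \<omega>) M)\<^sup>2 * exp A"
        using A by (intro exp_le_quadratic_bounded) auto
      moreover have "r * min (X n \<omega>) M \<le> r * X n \<omega>" using r by (intro mult_left_mono) auto
      moreover have "(r * min (X n \<omega>) M)\<^sup>2 \<le> l\<^sup>2 * (X n \<omega>)\<^sup>2"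
      proof -
        have "\<bar>min (X n \<omega>) M\<bar> \<le> \<bar>X n \<omega>\<bar>" using M by (auto simp: min_def)
        hence "(min (X n \<omega>) M)\<^sup>2 \<le> (X n \<omega>)\<^sup>2" by (simp add: abs_le_square_iff)
        thus ?thesis unfolding power_mult_distrib using r2 by (intro mult_mono) auto
      qed
      hence "(r * min (X n \<omega>) M)\<^sup>2 * exp A \<le> l\<^sup>2 * (X n \<omega>)\<^sup>2 * exp A" by (intro mult_right_mono) auto
      ultimately have "exp (r * min (X n \<omega>) M) \<le> 1 + r * X n \<omega> + l\<^sup>2 * (X n \<omega>)\<^sup>2 * exp A" by linarith
      from mult_left_mono[OF this, of "g \<omega>"] g(2)[of \<omega>]
      show "g \<omega> * exp (r * min (X n \<omega>) M) \<le> g \<omega> + r * (g \<omega> * X n \<omega>) + (l\<^sup>2 * exp A) * (g \<omega> * (X n \<omega>)\<^sup>2)"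
        by (simp add: algebra_simps)
    qed
    also have "\<dots> = G + r * (\<integral>\<omega>. g \<omega> * X n \<omega> \<partial>P) + (l\<^sup>2 * exp A) * (\<integral>\<omega>. g \<omega> * (X n \<omega>)\<^sup>2 \<partial>P)"
      unfolding G_def using ig iX i2 by simp
    also have "\<dots> \<le> G + r * 0 + (l\<^sup>2 * exp A) * (t * G)"
      using gX gX2 r by (intro add_mono mult_left_mono) auto
    finally show ?thesis by (simp add: algebra_simps)
  qed
  define h where "h = v * (l\<^sup>2 - r\<^sup>2) / 2"
  have h: "0 \<le> h" "h \<le> v * l\<^sup>2 / 2" using v r2 by (auto simp: h_def intro!: mult_left_mono)
  have "exp h \<le> 1 + h + (1 + 1) / 2 * h\<^sup>2" by (rule exp_quadratic_upper) (use h v in auto)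
  also have "h\<^sup>2 \<le> h * (v * l\<^sup>2)"
    unfolding power2_eq_square[of h] using h v by (intro mult_left_mono) auto
  finally have eh: "exp h - 1 \<le> h * (1 + v * l\<^sup>2)" by (simp add: algebra_simps)
  have Ir0: "0 \<le> I r" unfolding I_def by (rule integral_F_nonneg) (use g in auto)
  have "(exp h - 1) * I r \<le> h * (1 + v * l\<^sup>2) * ((1 + l\<^sup>2 * t * exp A) * G)"
    using eh Ir Ir0 h v by (intro mult_mono) auto
  also have "\<dots> = (l\<^sup>2 - r\<^sup>2) / 2 * (v * (1 + v * l\<^sup>2) * (1 + l\<^sup>2 * t * exp A)) * G"
    by (simp add: h_def)
  also have "\<dots> \<le> (l\<^sup>2 - r\<^sup>2) / 2 * v' * G"
    using v(3) r2 G unfolding v'_def by (intro mult_right_mono mult_left_mono) auto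
  finally have "(exp h - 1) * I r \<le> I l - I r" using D by linarith
  thus ?thesis unfolding h_def I_def M_def by (simp add: algebra_simps)
qed

text \<open>
  Let \<open>e1 m = exp (l S - v l\<^sup>2 m / 2)\<close> and \<open>e2 m = K exp (r S - v r\<^sup>2 m / 2)\<close>, where \<open>S\<close> are the
  truncated partial sums after time \<open>N\<close>. By \<open>exp_step_lower_integral\<close> both \<open>e1\<close> and the positive
  part of \<open>e1 - e2\<close> are submartingales. The factor \<open>K\<close> is chosen such that \<open>e1 n \<le> e2 n\<close> if
  \<open>S n < b\<close>; so at time \<open>n\<close> the positive part is nonzero only on paths that have met the line.
  Along the line \<open>e1\<close> is constant, and the truncation bounds the overshoot by \<open>A / l\<close>. So the
  stopped process is at most \<open>R = exp (l b - v l\<^sup>2 n / 2 + A)\<close>, and its initial value \<open>1 - K\<close> is at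
  most \<open>R\<close> times the hitting probability.
\<close>

lemma line_hitting:
  fixes N n :: nat
  assumes g: "g \<in> borel_measurable (F N)" "\<And>\<omega>. 0 \<le> g \<omega> \<and> g \<omega> \<le> B"
    and low: "\<And>i. N \<le> i \<Longrightarrow> i < N + n \<Longrightarrow> lowvar i (z\<^sup>2) s"
    and up: "\<And>i. N \<le> i \<Longrightarrow> i < N + n \<Longrightarrow> u i \<le> t"
    and r: "0 \<le> r" "r < l" and z: "0 \<le> z" "z \<le> A / l" "l * z \<le> \<delta>" and d: "0 \<le> \<delta>" "\<delta> \<le> 1"
    and A: "0 < A" and v: "0 \<le> v" "v * l\<^sup>2 \<le> 1"
       "v * (1 + v * l\<^sup>2) * (1 + l\<^sup>2 * t * exp A) \<le> (1 - \<delta>) * s - 2 * t / A"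
    and b: "0 < b - v * l / 2 * real n"
  shows "(1 - exp ((l - r) * b - v * (l\<^sup>2 - r\<^sup>2) / 2 * real n)) * (\<integral>\<omega>. g \<omega> \<partial>P)
    \<le> exp (l * b - v * l\<^sup>2 / 2 * real n + A) *
      (\<integral>\<omega>. g \<omega> * indicator {\<omega>. \<exists>m\<le>n. b - v * l / 2 * (real n - real m) \<le> (\<Sum>i=N..<N+m. X i \<omega>)} \<omega> \<partial>P)"
proof -
  have l: "0 < l" using r by simp
  define M where "M = A / l"
  define c where "c = v * l\<^sup>2 / 2"
  define e where "e = v * r\<^sup>2 / 2"
  define K where "K = exp ((l - r) * b - v * (l\<^sup>2 - r\<^sup>2) / 2 * real n)"
  define R where "R = exp (l * b - c * real n + A)"
  define bd where "bd = (\<lambda>m::nat. b - v * l / 2 * (real n - real m))"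
  define S where "S = (\<lambda>m \<omega>. \<Sum>i=N..<N+m. min (X i \<omega>) M)"
  define Hit where "Hit = (\<lambda>m \<omega>. \<exists>j\<le>m. bd j \<le> S j \<omega>)"
  define e1 where "e1 = (\<lambda>m \<omega>. exp (l * S m \<omega> - c * real m))"
  define e2 where "e2 = (\<lambda>m \<omega>. K * exp (r * S m \<omega> - e * real m))"
  define D where "D = (\<lambda>m \<omega>. if Hit m \<omega> then R else max 0 (e1 m \<omega> - e2 m \<omega>))"
  have K0: "0 < K" by (simp add: K_def)
  have SF: "S j \<in> borel_measurable (F (N + m))" if "j \<le> m" for j m
    unfolding S_def using that by (intro borel_measurable_sum borel_measurable_min X_F) auto
  have SM: "S m \<omega> \<le> real m * M" for m \<omega>
  proof -
    have "S m \<omega> \<le> (\<Sum>i=N..<N+m. M)" unfolding S_def by (intro sum_mono) auto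
    thus ?thesis by simp
  qed
  have hit[measurable]: "Measurable.pred (F (N + m)) (Hit m)" for m
  proof -
    have "Measurable.pred (F (N + m)) (\<lambda>\<omega>. \<exists>j\<in>{..m}. bd j \<le> S j \<omega>)"
    proof (rule pred_intros_finite(4))
      fix j assume "j \<in> {..m}"
      hence [measurable]: "S j \<in> borel_measurable (F (N + m))" using SF by simp
      show "Measurable.pred (F (N + m)) (\<lambda>\<omega>. bd j \<le> S j \<omega>)" by measurable
    qed simp
    moreover have "(\<lambda>\<omega>. \<exists>j\<in>{..m}. bd j \<le> S j \<omega>) = Hit m" by (auto simp: Hit_def)
    ultimately show ?thesis by argo
  qed
  have gm[measurable]: "g \<in> borel_measurable (F (N + m))" for m by (rule measurable_F_mono[OF g(1)]) simp
  have Sm[measurable]: "S m \<in> borel_measurable (F (N + m))" for m by (rule SF) simp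
  have e1m[measurable]: "e1 m \<in> borel_measurable (F (N + m))" for m unfolding e1_def by measurable
  have e2m[measurable]: "e2 m \<in> borel_measurable (F (N + m))" for m unfolding e2_def by measurable
  have Dm[measurable]: "D m \<in> borel_measurable (F (N + m))" for m unfolding D_def by measurable
  have e1b: "0 \<le> e1 m \<omega> \<and> e1 m \<omega> \<le> exp (l * (real m * M) - c * real m)" for m \<omega>
    unfolding e1_def using SM[of m \<omega>] l by (auto intro!: mult_left_mono)
  have e2b: "0 \<le> e2 m \<omega> \<and> e2 m \<omega> \<le> K * exp (r * (real m * M) - e * real m)" for m \<omega>
    unfolding e2_def using SM[of m \<omega>] r K0 by (auto intro!: mult_left_mono)
  have DB: "0 \<le> D m \<omega> \<and> D m \<omega> \<le> R + exp (l * (real m * M) - c * real m)" for m \<omega>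
    unfolding D_def using e1b[of m \<omega>] e2b[of m \<omega>] by (auto simp: R_def add_increasing add_increasing2)
  have B: "0 \<le> B" using g(2)[of undefined] by linarith
  have gDB: "0 \<le> g \<omega> * D m \<omega> \<and> g \<omega> * D m \<omega> \<le> B * (R + exp (l * (real m * M) - c * real m))" for m \<omega>
    using g(2)[of \<omega>] DB[of m \<omega>] B by (auto intro!: mult_mono)
  have intgD: "integrable P (\<lambda>\<omega>. g \<omega> * D m \<omega>)" for m
    by (rule integrable_bdd[where B = "B * (R + exp (l * (real m * M) - c * real m))"],
        rule measurable_F_P[of _ "N + m"], measurable) (use gDB in \<open>auto simp: abs_of_nonneg\<close>)
  have main: "m \<le> n \<Longrightarrow> (1 - K) * (\<integral>\<omega>. g \<omega> \<partial>P) \<le> (\<integral>\<omega>. g \<omega> * D m \<omega> \<partial>P)" for m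
  proof (induction m)
    case 0
    have "1 - K \<le> D 0 \<omega>" for \<omega> using b by (auto simp: D_def Hit_def S_def bd_def e1_def e2_def)
    hence "(\<integral>\<omega>. (1 - K) * g \<omega> \<partial>P) \<le> (\<integral>\<omega>. g \<omega> * D 0 \<omega> \<partial>P)"
      using g(2) by (intro integral_mono intgD integrable_mult_right)
         (auto intro!: integrable_bdd[of _ B] measurable_F_P[OF g(1)] simp: abs_of_nonneg mult.commute[of "1 - K"] intro: mult_left_mono)
    thus ?case by simp
  next
    case (Suc m)
    define G where "G = (\<lambda>\<omega>. if Hit m \<omega> \<or> e1 m \<omega> \<le> e2 m \<omega> then 0 else g \<omega>)"
    define h where "h = (\<lambda>\<omega>. if Hit m \<omega> then R * g \<omega> else 0)"
    define E where "E = (\<lambda>a x. exp (a * min x M))"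
    have Gm[measurable]: "G \<in> borel_measurable (F (N + m))" unfolding G_def by measurable
    have hm[measurable]: "h \<in> borel_measurable (F (N + m))" unfolding h_def by measurable
    have Gb: "0 \<le> G \<omega> \<and> G \<omega> \<le> B" for \<omega> unfolding G_def using g(2)[of \<omega>] B by auto
    have hb: "\<bar>h \<omega>\<bar> \<le> R * B" for \<omega> unfolding h_def using g(2)[of \<omega>] B
      by (auto simp: R_def abs_mult intro!: mult_left_mono)
    have Eb: "\<bar>E a x\<bar> \<le> exp (a * M)" if "0 \<le> a" for a x
      unfolding E_def using that by (auto intro!: mult_left_mono)
    have Em[measurable]: "(\<lambda>\<omega>. E a (X i \<omega>)) \<in> borel_measurable P" for a i unfolding E_def by measurable
    \<comment> \<open>Before the line is met and where \<open>e1 > e2\<close>, the difference \<open>e1 - e2\<close> after one step equals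
      \<open>exp (- c) * g1 * E l + (exp (- c) * g2 * E l - exp (- e) * g2 * E r)\<close>: the first part grows by the
      inequality from \<open>0\<close> to \<open>l\<close>, and the bracket has nonnegative mean by the one from \<open>r\<close> to \<open>l\<close>.\<close>
    define g1 where "g1 = (\<lambda>\<omega>. G \<omega> * (e1 m \<omega> - e2 m \<omega>))"
    define g2 where "g2 = (\<lambda>\<omega>. G \<omega> * e2 m \<omega>)"
    have g1m: "g1 \<in> borel_measurable (F (N + m))" unfolding g1_def by measurable
    have g2m: "g2 \<in> borel_measurable (F (N + m))" unfolding g2_def by measurable
    have g1b: "0 \<le> g1 \<omega> \<and> g1 \<omega> \<le> B * exp (l * (real m * M) - c * real m)" for \<omega>
    proof (cases "G \<omega> = 0")
      case True thus ?thesis using B by (simp add: g1_def)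
    next
      case False
      hence "e2 m \<omega> \<le> e1 m \<omega>" by (auto simp: G_def split: if_splits)
      thus ?thesis unfolding g1_def using Gb[of \<omega>] e1b[of m \<omega>] e2b[of m \<omega>] B
        by (intro conjI mult_mono mult_nonneg_nonneg) auto
    qed
    have g2b: "0 \<le> g2 \<omega> \<and> g2 \<omega> \<le> B * (K * exp (r * (real m * M) - e * real m))" for \<omega>
      unfolding g2_def using Gb[of \<omega>] e2b[of m \<omega>] B by (intro conjI mult_mono mult_nonneg_nonneg) auto
    have lo: "lowvar (N + m) (z\<^sup>2) s" "u (N + m) \<le> t" using low up Suc.prems by auto
    have I1: "exp c * (\<integral>\<omega>. g1 \<omega> \<partial>P) \<le> (\<integral>\<omega>. g1 \<omega> * E l (X (N + m) \<omega>) \<partial>P)"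
      using exp_step_lower_integral[OF g1m g1b lo order_refl _ l z d A v] l
      unfolding E_def M_def c_def by simp
    have I2: "exp (c - e) * (\<integral>\<omega>. g2 \<omega> * E r (X (N + m) \<omega>) \<partial>P) \<le> (\<integral>\<omega>. g2 \<omega> * E l (X (N + m) \<omega>) \<partial>P)"
      using exp_step_lower_integral[OF g2m g2b lo r(1) _ l z d A v] r
      unfolding E_def M_def c_def e_def by (simp add: field_simps)
    have iE: "integrable P (\<lambda>\<omega>. k \<omega> * E a (X (N + m) \<omega>))"
      if "k \<in> borel_measurable (F (N + m))" "\<And>\<omega>. 0 \<le> k \<omega> \<and> k \<omega> \<le> C" "0 \<le> a" for k a C
    proof (rule integrable_times[where B = C])
      show "integrable P (\<lambda>\<omega>. E a (X (N + m) \<omega>))"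
        by (rule integrable_bdd[where B = "exp (a * M)"]) (use Eb[OF that(3)] in auto)
      show "k \<in> borel_measurable P" by (rule measurable_F_P[OF that(1)])
    qed (use that in \<open>auto simp: abs_of_nonneg\<close>)
    have ih: "integrable P h" by (rule integrable_bdd[OF measurable_F_P[OF hm] hb])
    have ig1: "integrable P g1"
      by (rule integrable_bdd[OF measurable_F_P[OF g1m], where B = "B * exp (l * (real m * M) - c * real m)"])
         (use g1b in \<open>auto simp: abs_of_nonneg\<close>)
    have "(1 - K) * (\<integral>\<omega>. g \<omega> \<partial>P) \<le> (\<integral>\<omega>. g \<omega> * D m \<omega> \<partial>P)" using Suc by simp
    also have "(\<lambda>\<omega>. g \<omega> * D m \<omega>) = (\<lambda>\<omega>. h \<omega> + g1 \<omega>)"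
      by (auto simp: fun_eq_iff h_def g1_def G_def D_def max_def)
    also have "(\<integral>\<omega>. h \<omega> + g1 \<omega> \<partial>P) = (\<integral>\<omega>. h \<omega> \<partial>P) + (\<integral>\<omega>. g1 \<omega> \<partial>P)" using ih ig1 by simp
    also have "(\<integral>\<omega>. g1 \<omega> \<partial>P) \<le> exp (- c) * (\<integral>\<omega>. g1 \<omega> * E l (X (N + m) \<omega>) \<partial>P)"
      using mult_left_mono[OF I1, of "exp (- c)"] by (simp add: mult.assoc[symmetric] exp_add[symmetric])
    also have "\<dots> \<le> exp (- c) * (\<integral>\<omega>. g1 \<omega> * E l (X (N + m) \<omega>) \<partial>P)
        + (exp (- c) * (\<integral>\<omega>. g2 \<omega> * E l (X (N + m) \<omega>) \<partial>P) - exp (- e) * (\<integral>\<omega>. g2 \<omega> * E r (X (N + m) \<omega>) \<partial>P))"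
      using mult_left_mono[OF I2, of "exp (- c)"] by (simp add: mult.assoc[symmetric] exp_add[symmetric])
    also have "\<dots> = (\<integral>\<omega>. exp (- c) * (g1 \<omega> * E l (X (N + m) \<omega>)) + (exp (- c) * (g2 \<omega> * E l (X (N + m) \<omega>))
        - exp (- e) * (g2 \<omega> * E r (X (N + m) \<omega>))) \<partial>P)"
      using iE[OF g1m g1b, of l] iE[OF g2m g2b, of l] iE[OF g2m g2b, of r] l r by simp
    also have "(\<integral>\<omega>. h \<omega> \<partial>P) + \<dots> = (\<integral>\<omega>. h \<omega> + (exp (- c) * (g1 \<omega> * E l (X (N + m) \<omega>))
        + (exp (- c) * (g2 \<omega> * E l (X (N + m) \<omega>)) - exp (- e) * (g2 \<omega> * E r (X (N + m) \<omega>)))) \<partial>P)"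
      using iE[OF g1m g1b, of l] iE[OF g2m g2b, of l] iE[OF g2m g2b, of r] l r ih by simp
    also have "\<dots> \<le> (\<integral>\<omega>. g \<omega> * D (Suc m) \<omega> \<partial>P)"
    proof (rule integral_mono)
      show "integrable P (\<lambda>\<omega>. h \<omega> + (exp (- c) * (g1 \<omega> * E l (X (N + m) \<omega>))
        + (exp (- c) * (g2 \<omega> * E l (X (N + m) \<omega>)) - exp (- e) * (g2 \<omega> * E r (X (N + m) \<omega>)))))"
        using iE[OF g1m g1b, of l] iE[OF g2m g2b, of l] iE[OF g2m g2b, of r] l r ih by simp
      show "integrable P (\<lambda>\<omega>. g \<omega> * D (Suc m) \<omega>)" by (rule intgD)
      fix \<omega>
      have S': "S (Suc m) \<omega> = S m \<omega> + min (X (N + m) \<omega>) M" by (simp add: S_def)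
      have E1: "e1 (Suc m) \<omega> = exp (- c) * (e1 m \<omega> * E l (X (N + m) \<omega>))"
        unfolding e1_def E_def S' by (simp add: exp_add[symmetric] algebra_simps)
      have E2: "e2 (Suc m) \<omega> = exp (- e) * (e2 m \<omega> * E r (X (N + m) \<omega>))"
        unfolding e2_def E_def S' by (simp add: exp_add[symmetric] algebra_simps)
      have "exp (- c) * (g1 \<omega> * E l (X (N + m) \<omega>))
        + (exp (- c) * (g2 \<omega> * E l (X (N + m) \<omega>)) - exp (- e) * (g2 \<omega> * E r (X (N + m) \<omega>)))
        = G \<omega> * (e1 (Suc m) \<omega> - e2 (Suc m) \<omega>)"
        unfolding E1 E2 g1_def g2_def by (simp add: algebra_simps)
      also have "h \<omega> + \<dots> \<le> g \<omega> * D (Suc m) \<omega>"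
      proof (cases "Hit m \<omega>")
        case True
        hence "Hit (Suc m) \<omega>" using le_SucI unfolding Hit_def by blast
        thus ?thesis using True by (simp add: h_def G_def D_def)
      next
        case False
        have "e1 (Suc m) \<omega> - e2 (Suc m) \<omega> \<le> D (Suc m) \<omega>"
        proof (cases "Hit (Suc m) \<omega>")
          case True
          \<comment> \<open>The line was not met at time \<open>m\<close>, so the overshoot is at most the truncation level.\<close>
          have "S m \<omega> \<le> bd m" using False unfolding Hit_def by force
          moreover have "bd m \<le> bd (Suc m)"
            unfolding bd_def using v l by (intro diff_left_mono mult_left_mono) auto
          ultimately have "S (Suc m) \<omega> \<le> bd (Suc m) + M" unfolding S' by linarith
          hence "l * S (Suc m) \<omega> \<le> l * (bd (Suc m) + M)" using l by (intro mult_left_mono) auto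
          also have "\<dots> - c * real (Suc m) = l * b - c * real n + A"
            unfolding bd_def M_def c_def using l by (simp add: field_simps power2_eq_square)
          finally have "e1 (Suc m) \<omega> \<le> R" unfolding e1_def R_def by simp
          thus ?thesis using True e2b[of "Suc m" \<omega>] by (simp add: D_def)
        next
          case False thus ?thesis by (simp add: D_def)
        qed
        moreover have "0 \<le> D (Suc m) \<omega>" using DB[of "Suc m" \<omega>] by simp
        ultimately show ?thesis using False g(2)[of \<omega>] by (auto simp: h_def G_def intro!: mult_left_mono)
      qed
      finally show "h \<omega> + (exp (- c) * (g1 \<omega> * E l (X (N + m) \<omega>))
        + (exp (- c) * (g2 \<omega> * E l (X (N + m) \<omega>)) - exp (- e) * (g2 \<omega> * E r (X (N + m) \<omega>))))
        \<le> g \<omega> * D (Suc m) \<omega>" .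
    qed
    finally show ?case by simp
  qed
  let ?H = "{\<omega>. \<exists>m\<le>n. bd m \<le> (\<Sum>i=N..<N+m. X i \<omega>)}"
  have "(\<integral>\<omega>. g \<omega> * D n \<omega> \<partial>P) \<le> (\<integral>\<omega>. R * (g \<omega> * indicator ?H \<omega>) \<partial>P)"
  proof (rule integral_mono[OF intgD])
    have meas: "Measurable.pred P (\<lambda>\<omega>. \<exists>m\<in>{..n}. bd m \<le> (\<Sum>i=N..<N+m. X i \<omega>))" by measurable
    have "indicator ?H = (\<lambda>\<omega>. if \<exists>m\<in>{..n}. bd m \<le> (\<Sum>i=N..<N+m. X i \<omega>) then 1 else 0 :: real)"
      by (auto simp: indicator_def fun_eq_iff)
    also have "\<dots> \<in> borel_measurable P" using meas by measurable
    finally have im: "(indicator ?H :: _ \<Rightarrow> real) \<in> borel_measurable P" .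
    have "integrable P (\<lambda>\<omega>. g \<omega> * indicator ?H \<omega>)"
      by (rule integrable_times[OF integrable_bdd[of _ 1]])
         (use im g(2) measurable_F_P[OF g(1)] in \<open>auto simp: abs_of_nonneg indicator_def\<close>)
    thus "integrable P (\<lambda>\<omega>. R * (g \<omega> * indicator ?H \<omega>))" by simp
    fix \<omega>
    have R0: "0 < R" by (simp add: R_def)
    show "g \<omega> * D n \<omega> \<le> R * (g \<omega> * indicator ?H \<omega>)"
    proof (cases "Hit n \<omega>")
      case True
      then obtain j where j: "j \<le> n" "bd j \<le> S j \<omega>" unfolding Hit_def by auto
      have "S j \<omega> \<le> (\<Sum>i=N..<N+j. X i \<omega>)" unfolding S_def by (intro sum_mono) auto
      hence "\<omega> \<in> ?H" using j by force
      thus ?thesis using True by (simp add: D_def)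
    next
      case False
      hence "S n \<omega> < b" unfolding Hit_def bd_def by force
      hence "(l - r) * S n \<omega> \<le> (l - r) * b" using r by (intro mult_left_mono) auto
      hence "l * S n \<omega> - c * real n \<le> (l - r) * b - v * (l\<^sup>2 - r\<^sup>2) / 2 * real n + (r * S n \<omega> - e * real n)"
        unfolding c_def e_def by (simp add: field_simps)
      hence "e1 n \<omega> \<le> e2 n \<omega>" unfolding e1_def e2_def K_def by (simp add: exp_add[symmetric])
      thus ?thesis using False R0 g(2)[of \<omega>] by (auto simp: D_def indicator_def)
    qed
  qed
  also have "\<dots> = R * (\<integral>\<omega>. g \<omega> * indicator ?H \<omega> \<partial>P)" by simp
  finally show ?thesis using main[of n] unfolding R_def K_def bd_def c_def by simp
qed

end


section \<open>Normalization and geometric blocks\<close>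

abbreviation LL :: "real \<Rightarrow> real" where "LL x \<equiv> lg (lg x)"

definition nrm :: "nat \<Rightarrow> real" where
  "nrm n = sqrt (2 * real n * LL (real n))"

lemma lg_ge_1: "1 \<le> lg x"
  unfolding lg_def by (subst ln_ge_iff) (auto simp: less_max_iff_disj)

lemma lg_mono: "x \<le> y \<Longrightarrow> lg x \<le> lg y"
  unfolding lg_def by (subst ln_le_cancel_iff) (auto simp: less_max_iff_disj)

lemma LL_mono: "x \<le> y \<Longrightarrow> LL x \<le> LL y"
  by (intro lg_mono)

lemma ln_ln_le_LL:
  assumes "1 < x" shows "ln (ln x) \<le> LL x"
proof -
  have "ln x \<le> lg x" unfolding lg_def using assms by simp
  hence "ln (ln x) \<le> ln (lg x)" using assms lg_ge_1[of x] by (subst ln_le_cancel_iff) auto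
  also have "\<dots> \<le> LL x" unfolding lg_def[of "lg x"] using lg_ge_1[of x] by simp
  finally show ?thesis .
qed

lemma LL_eq: "exp (exp 1) \<le> x \<Longrightarrow> LL x = ln (ln x)"
proof -
  assume a: "exp (exp 1) \<le> x"
  have "(1::real) \<le> exp 1" by simp
  hence "exp 1 \<le> x" using a by (meson exp_le_cancel_iff order_trans)
  hence "lg x = ln x" by (simp add: lg_def max_absorb2)
  moreover have "exp 1 \<le> ln x" using a by (subst ln_ge_iff) (auto intro: less_le_trans[OF exp_gt_zero])
  ultimately show ?thesis by (simp add: lg_def max_absorb2)
qed

lemma eventually_LL_eq: "eventually (\<lambda>x. LL x = ln (ln x)) at_top"
  using eventually_ge_at_top[of "exp (exp 1)"] by eventually_elim (rule LL_eq)

lemma LL_at_top: "filterlim LL at_top at_top"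
proof -
  have "filterlim (\<lambda>x::real. ln (ln x)) at_top at_top" by real_asymp
  thus ?thesis by (rule filterlim_mono_eventually) (use eventually_LL_eq in \<open>auto elim: eventually_mono\<close>)
qed

lemma LL_over_sqrt: "((\<lambda>x. LL x / sqrt x) \<longlongrightarrow> 0) at_top"
proof -
  have "((\<lambda>x::real. ln (ln x) / sqrt x) \<longlongrightarrow> 0) at_top" by real_asymp
  thus ?thesis by (rule Lim_transform_eventually) (use eventually_LL_eq in \<open>auto elim: eventually_mono\<close>)
qed

lemma nrm_nonneg [simp]: "0 \<le> nrm n"
  unfolding nrm_def using lg_ge_1[of "lg (real n)"] by simp

lemma nrm_pos: "0 < n \<Longrightarrow> 0 < nrm n"
  unfolding nrm_def using lg_ge_1[of "lg (real n)"] by simp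

lemma nrm_sq: "(nrm n)\<^sup>2 = 2 * real n * LL (real n)"
  unfolding nrm_def using lg_ge_1[of "lg (real n)"] by simp

lemma nrm_mono: "m \<le> n \<Longrightarrow> nrm m \<le> nrm n"
  unfolding nrm_def using LL_mono[of "real m" "real n"] lg_ge_1[of "lg (real m)"]
  by (intro real_sqrt_le_mono mult_mono) auto

lemma power_at_top: "1 < (\<theta>::real) \<Longrightarrow> filterlim (\<lambda>k. \<theta> ^ k) at_top sequentially"
  by real_asymp

definition blk :: "real \<Rightarrow> nat \<Rightarrow> nat" where
  "blk \<theta> k = nat \<lceil>\<theta> ^ k\<rceil>"

lemma blk_bounds:
  assumes "1 < \<theta>"
  shows "\<theta> ^ k \<le> real (blk \<theta> k)" "real (blk \<theta> k) \<le> \<theta> ^ k + 1" "1 \<le> blk \<theta> k"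
proof -
  have "0 < \<theta> ^ k" using assms by simp
  hence c: "0 < \<lceil>\<theta> ^ k\<rceil>" by simp
  hence e: "real (blk \<theta> k) = of_int \<lceil>\<theta> ^ k\<rceil>" by (simp add: blk_def)
  show "\<theta> ^ k \<le> real (blk \<theta> k)" "real (blk \<theta> k) \<le> \<theta> ^ k + 1" unfolding e by linarith+
  show "1 \<le> blk \<theta> k" using c unfolding blk_def by linarith
qed

lemma blk_mono: "1 < \<theta> \<Longrightarrow> k \<le> j \<Longrightarrow> blk \<theta> k \<le> blk \<theta> j"
  unfolding blk_def by (intro nat_mono ceiling_mono power_increasing) auto

lemma blk_at_top: "1 < \<theta> \<Longrightarrow> filterlim (blk \<theta>) at_top sequentially"
proof -
  assume t: "1 < \<theta>"
  have "filterlim (\<lambda>k. \<theta> ^ k) at_top sequentially" by (rule power_at_top[OF t])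
  hence "filterlim (\<lambda>k. real (blk \<theta> k)) at_top sequentially"
    by (rule filterlim_at_top_mono) (use blk_bounds(1)[OF t] in auto)
  thus ?thesis by (rule filterlim_sequentially_iff_filterlim_real[THEN iffD2])
qed

lemma blk_cover:
  assumes "1 < \<theta>" "blk \<theta> K \<le> n"
  obtains k where "K \<le> k" "blk \<theta> k \<le> n" "n < blk \<theta> (Suc k)"
proof -
  have "eventually (\<lambda>k. Suc n \<le> blk \<theta> k) sequentially"
    using blk_at_top[OF assms(1)] unfolding filterlim_at_top by blast
  then obtain j where j: "n < blk \<theta> j" by (auto simp: eventually_sequentially Suc_le_eq)
  define k where "k = (GREATEST k. blk \<theta> k \<le> n)"
  have bd: "\<And>k. blk \<theta> k \<le> n \<Longrightarrow> k \<le> j" using j blk_mono[OF assms(1)] by (meson le_less_trans leD linear)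
  have "blk \<theta> k \<le> n" unfolding k_def by (rule GreatestI_nat[of _ K j]) (use assms bd in auto)
  moreover have "K \<le> k" unfolding k_def by (rule Greatest_le_nat[of _ K j]) (use assms bd in auto)
  moreover have "n < blk \<theta> (Suc k)"
  proof (rule ccontr)
    assume "\<not> n < blk \<theta> (Suc k)"
    hence "Suc k \<le> k" unfolding k_def by (intro Greatest_le_nat[of _ _ j]) (use bd in auto)
    thus False by simp
  qed
  ultimately show ?thesis using that by blast
qed

text \<open>
  The tails are summable against the block lengths at levels comparable to the normalization. This
  is the only form in which the moment condition enters.
\<close>

definition tail_summable :: "(real \<Rightarrow> real) \<Rightarrow> bool" where
  "tail_summable w \<longleftrightarrow> (\<forall>\<theta> c. 1 < \<theta> \<longrightarrow> 0 < c \<longrightarrow>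
      summable (\<lambda>k. real (blk \<theta> (Suc k)) * w (c * nrm (blk \<theta> k))))"

text \<open>
  By \<open>maximal_inequality\<close>; the exponent is at least \<open>(1 + \<epsilon>) log log\<close> of the block length, so the
  Gaussian part decays like \<open>k powr (- (1 + \<epsilon>))\<close>. The bound \<open>bd\<close> is chosen before the measure and
  the process, which makes it applicable to all measures of \<open>\<P>\<close> simultaneously.
\<close>

lemma upper_block_bound:
  assumes w: "tail_summable w" "\<And>y. 0 < y \<Longrightarrow> 0 \<le> w y" and t: "0 < t" and \<epsilon>: "0 < \<epsilon>"
  shows "\<exists>\<theta> \<delta> bd. 1 < \<theta> \<and> 0 < \<delta> \<and> summable bd \<and>
    (\<forall>k (P :: 'a measure) F X u. mds P F X u w \<longrightarrow>
       (\<Sum>i<blk \<theta> (Suc k). u i) \<le> real (blk \<theta> (Suc k)) * (t\<^sup>2 * (1 + \<delta>)) \<longrightarrow>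
       measure P {\<omega> \<in> space P. \<exists>m\<le>blk \<theta> (Suc k). (1 + \<epsilon>) * t * nrm (blk \<theta> k) \<le> (\<Sum>i<m. X i \<omega>)} \<le> bd k)"
proof -
  \<comment> \<open>Four factors \<open>1 + \<delta>\<close> are lost: one in the maximal inequality, one in the variance bound, two
    in the ratio of consecutive block lengths. The number 15 makes \<open>(1 + \<delta>) ^ 4 \<le> 1 + \<epsilon>\<close>.\<close>
  define \<delta> where "\<delta> = min 1 \<epsilon> / 15"
  define \<theta> where "\<theta> = 1 + \<delta>"
  have \<delta>: "0 < \<delta>" "\<delta> \<le> 1" using \<epsilon> by (auto simp: \<delta>_def)
  have \<theta>: "1 < \<theta>" using \<delta> by (simp add: \<theta>_def)
  have d4: "(1 + \<delta>) ^ 4 \<le> 1 + \<epsilon>"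
  proof -
    have "\<delta>^2 \<le> \<delta>" "\<delta>^3 \<le> \<delta>" "\<delta>^4 \<le> \<delta>"
      using \<delta> power_decreasing[of 1 _ \<delta>] by auto
    moreover have "(1 + \<delta>) ^ 4 = 1 + 4 * \<delta> + 6 * \<delta>^2 + 4 * \<delta>^3 + \<delta>^4" by algebra
    ultimately have "(1 + \<delta>) ^ 4 \<le> 1 + 15 * \<delta>" by linarith
    thus ?thesis by (simp add: \<delta>_def)
  qed
  define x where "x = (\<lambda>k. (1 + \<epsilon>) * t * nrm (blk \<theta> k))"
  define B where "B = (\<lambda>k. real (blk \<theta> (Suc k)) * (t\<^sup>2 * (1 + \<delta>)))"
  \<comment> \<open>The geometric term keeps \<open>W k\<close> positive.\<close>
  define W where "W = (\<lambda>k. real (blk \<theta> (Suc k)) * w (x k / 2) + (1/2) ^ k)"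
  define ex where "ex = (\<lambda>k. exp (- (x k)\<^sup>2 / (2 * (1 + \<delta>) * B k)))"
  define bd where "bd = (\<lambda>k. (1 + exp (256 / \<delta> ^ 4)) * W k + exp (256 / \<delta> ^ 4) * ex k)"
  have blk0: "0 < blk \<theta> k" for k using blk_bounds(3)[OF \<theta>, of k] by simp
  have x0: "0 < x k" for k unfolding x_def using t \<epsilon> nrm_pos[OF blk0] by simp
  have B0: "0 < B k" for k unfolding B_def using t \<delta> blk0 by simp
  have W0: "0 < W k" for k unfolding W_def using w(2)[of "x k / 2"] x0[of k] by (simp add: add_nonneg_pos)
  have "summable (\<lambda>k. real (blk \<theta> (Suc k)) * w ((1 + \<epsilon>) * t / 2 * nrm (blk \<theta> k)))"
    using w(1)[unfolded tail_summable_def, rule_format, OF \<theta>, of "(1 + \<epsilon>) * t / 2"] t \<epsilon> by simp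
  hence sW: "summable W" unfolding W_def x_def by (intro summable_add) (auto simp: summable_geometric)
  have sex: "summable ex"
  proof (rule summable_comparison_test_ev)
    show "summable (\<lambda>k. (ln \<theta>) powr (- (1 + \<epsilon>)) * real k powr (- (1 + \<epsilon>)))"
      using \<epsilon> by (intro summable_mult) (simp add: summable_real_powr_iff)
    have "filterlim (\<lambda>k. \<theta> ^ k) at_top sequentially" by (rule power_at_top[OF \<theta>])
    hence "eventually (\<lambda>k. 1 / \<delta> \<le> \<theta> ^ k) sequentially" by (simp add: filterlim_at_top)
    thus "\<forall>\<^sub>F k in sequentially. norm (ex k) \<le> (ln \<theta>) powr (- (1 + \<epsilon>)) * real k powr (- (1 + \<epsilon>))"
      using eventually_gt_at_top[of 0]
    proof eventually_elim
      case (elim k)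
      have th: "1 < \<theta> ^ k" using \<theta> elim(2) by (simp add: one_less_power)
      have "real (blk \<theta> (Suc k)) \<le> \<theta> ^ Suc k + 1" by (rule blk_bounds(2)[OF \<theta>])
      also have "1 \<le> \<delta> * \<theta> ^ k" using elim \<delta> by (simp add: field_simps)
      also have "\<dots> \<le> \<delta> * \<theta> ^ Suc k" using \<theta> \<delta> by simp
      finally have "real (blk \<theta> (Suc k)) \<le> (1 + \<delta>) * (1 + \<delta>) * \<theta> ^ k" by (simp add: \<theta>_def algebra_simps)
      also have "\<dots> \<le> (1 + \<delta>) * (1 + \<delta>) * real (blk \<theta> k)"
        using \<delta> blk_bounds(1)[OF \<theta>] by (intro mult_left_mono) auto
      finally have b: "real (blk \<theta> (Suc k)) \<le> (1 + \<delta>)\<^sup>2 * real (blk \<theta> k)" by (simp add: power2_eq_square)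
      define L where "L = LL (real (blk \<theta> k))"
      have L: "1 \<le> L" unfolding L_def by (rule lg_ge_1)
      have "(1 + \<epsilon>) * L * (2 * (1 + \<delta>) * B k) = 2 * (1 + \<epsilon>) * L * t\<^sup>2 * ((1 + \<delta>)\<^sup>2 * real (blk \<theta> (Suc k)))"
        unfolding B_def by (simp add: power2_eq_square algebra_simps)
      also have "\<dots> \<le> 2 * (1 + \<epsilon>) * L * t\<^sup>2 * ((1 + \<delta>)\<^sup>2 * ((1 + \<delta>)\<^sup>2 * real (blk \<theta> k)))"
        using b L \<epsilon> \<delta> by (intro mult_left_mono) auto
      also have "\<dots> = 2 * (1 + \<epsilon>) * L * t\<^sup>2 * real (blk \<theta> k) * (1 + \<delta>) ^ 4" by algebra
      also have "\<dots> \<le> 2 * (1 + \<epsilon>) * L * t\<^sup>2 * real (blk \<theta> k) * (1 + \<epsilon>)"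
        using d4 L \<epsilon> by (intro mult_left_mono) auto
      also have "\<dots> = (x k)\<^sup>2"
        unfolding x_def power_mult_distrib nrm_sq L_def[symmetric] by (simp add: power2_eq_square)
      finally have "(1 + \<epsilon>) * L \<le> (x k)\<^sup>2 / (2 * (1 + \<delta>) * B k)"
        using B0[of k] \<delta> by (subst pos_le_divide_eq) auto
      hence "ex k \<le> exp (- ((1 + \<epsilon>) * L))" unfolding ex_def by simp
      also have "\<dots> \<le> exp (- ((1 + \<epsilon>) * ln (real k * ln \<theta>)))"
      proof -
        have "ln (real k * ln \<theta>) = ln (ln (\<theta> ^ k))" using \<theta> by (simp add: ln_realpow)
        also have "\<dots> \<le> LL (\<theta> ^ k)" by (rule ln_ln_le_LL[OF th])
        also have "\<dots> \<le> L" unfolding L_def by (rule LL_mono[OF blk_bounds(1)[OF \<theta>]])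
        finally show ?thesis using \<epsilon> by simp
      qed
      also have "\<dots> = (real k * ln \<theta>) powr (- (1 + \<epsilon>))"
        using elim(2) \<theta> by (simp add: powr_def algebra_simps)
      also have "\<dots> = (ln \<theta>) powr (- (1 + \<epsilon>)) * real k powr (- (1 + \<epsilon>))"
        using \<theta> by (simp add: powr_mult)
      finally show ?case by (simp add: ex_def)
    qed
  qed
  have "summable bd" unfolding bd_def by (intro summable_add summable_mult sW sex)
  moreover have "measure P {\<omega> \<in> space P. \<exists>m\<le>blk \<theta> (Suc k). (1 + \<epsilon>) * t * nrm (blk \<theta> k) \<le> (\<Sum>i<m. X i \<omega>)} \<le> bd k"
    if "mds P F X u w" "(\<Sum>i<blk \<theta> (Suc k). u i) \<le> real (blk \<theta> (Suc k)) * (t\<^sup>2 * (1 + \<delta>))"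
    for k and P :: "'a measure" and F X u
  proof -
    interpret mds P F X u w by fact
    have "prob {\<omega> \<in> space P. \<exists>m\<le>blk \<theta> (Suc k). x k \<le> (\<Sum>i<m. X i \<omega>)} \<le> bd k"
      unfolding bd_def ex_def
      by (rule maximal_inequality[OF \<delta> x0 W0 _ B0]) (use that in \<open>auto simp: W_def B_def\<close>)
    thus ?thesis by (simp only: x_def)
  qed
  ultimately show ?thesis using \<theta> \<delta> by blast
qed

text \<open>
  The line of \<open>line_hitting\<close> for the block from \<open>Q ^ k\<close> to \<open>Q ^ Suc k\<close>, lowered by a fraction \<open>\<eta>\<close>: with
  \<open>l = sqrt (2 log log / (n v))\<close> it is the tangent at \<open>m = n\<close> to \<open>sqrt (2 v m log log)\<close>, the
  trajectory of iterated-logarithm size.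
\<close>

definition line :: "nat \<Rightarrow> real \<Rightarrow> real \<Rightarrow> nat \<Rightarrow> nat \<Rightarrow> real" where
  "line Q v \<eta> k m = (let n = real (Q ^ Suc k - Q ^ k); l = sqrt (2 * LL (real (Q ^ Suc k)) / (n * v))
     in v * l * ((n + real m) / 2 - \<eta> * n))"

lemma block_length_real: "2 \<le> Q \<Longrightarrow> real (Q ^ Suc k - Q ^ k) = real (Q ^ Suc k) * (1 - 1 / real Q)"
  by (subst of_nat_diff) (auto simp: field_simps)

lemma block_slope_limits:
  assumes Q: "2 \<le> Q" and v: "0 < v"
  defines "l \<equiv> \<lambda>k. sqrt (2 * LL (real (Q ^ Suc k)) / (real (Q ^ Suc k - Q ^ k) * v))"
  shows "l \<longlonglongrightarrow> 0" "(\<lambda>k. l k * sqrt (sqrt (real (Q ^ Suc k)))) \<longlonglongrightarrow> 0"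
proof -
  define N where "N = (\<lambda>k. real (Q ^ Suc k))"
  define c where "c = 2 / ((1 - 1 / real Q) * v)"
  have q: "0 < 1 - 1 / real Q" using Q by simp
  have N0: "1 \<le> N k" for k unfolding N_def using Q by (simp add: Suc_le_eq del: power_Suc)
  have "filterlim (\<lambda>k. real Q ^ k) at_top sequentially"
    using Q by (intro power_at_top) auto
  hence "filterlim (\<lambda>k. real Q ^ Suc k) at_top sequentially" by (rule filterlim_compose[OF _ filterlim_Suc])
  hence Nt: "filterlim N at_top sequentially" unfolding N_def by simp
  have "(\<lambda>k. LL (N k) / sqrt (N k)) \<longlonglongrightarrow> 0" by (rule filterlim_compose[OF LL_over_sqrt Nt])
  hence "(\<lambda>k. sqrt (c * (LL (N k) / sqrt (N k)))) \<longlonglongrightarrow> sqrt (c * 0)" by (intro tendsto_intros)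
  moreover have "l k * sqrt (sqrt (real (Q ^ Suc k))) = sqrt (c * (LL (N k) / sqrt (N k)))" for k
  proof -
    have "l k * sqrt (sqrt (N k)) = sqrt (2 * LL (N k) / (N k * (1 - 1 / real Q) * v) * sqrt (N k))"
      unfolding l_def block_length_real[OF Q] by (simp only: N_def real_sqrt_mult)
    also have "2 * LL (N k) / (N k * (1 - 1 / real Q) * v) * sqrt (N k) = c * (LL (N k) / sqrt (N k))"
    proof -
      define qq where "qq = 1 - 1 / real Q"
      have qq: "0 < qq" using q by (simp add: qq_def)
      show ?thesis unfolding c_def qq_def[symmetric] using qq v N0[of k] by (simp add: field_simps)
    qed
    finally show ?thesis by (simp add: N_def)
  qed
  ultimately show 2: "(\<lambda>k. l k * sqrt (sqrt (real (Q ^ Suc k)))) \<longlonglongrightarrow> 0" by simp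
  show "l \<longlonglongrightarrow> 0"
  proof (rule tendsto_sandwich[OF _ _ tendsto_const 2])
    have l0: "0 \<le> l k" for k unfolding l_def using v lg_ge_1[of "lg (real (Q ^ Suc k))"] by simp
    thus "\<forall>\<^sub>F k in sequentially. 0 \<le> l k" by simp
    show "\<forall>\<^sub>F k in sequentially. l k \<le> l k * sqrt (sqrt (real (Q ^ Suc k)))"
    proof (rule always_eventually, rule allI)
      fix k
      have "1 \<le> sqrt (sqrt (real (Q ^ Suc k)))" using N0[of k] unfolding N_def by simp
      thus "l k \<le> l k * sqrt (sqrt (real (Q ^ Suc k)))" using l0[of k] by (simp add: mult_le_cancel_left1)
    qed
  qed
qed

text \<open>
  \<open>line_hitting\<close> with \<open>l = sqrt (2 log log / (n v))\<close> and \<open>r = (1 - \<eta>) l\<close>. Then \<open>l\<close> tends to \<open>0\<close>,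
  so the error terms vanish in the limit, \<open>K = exp (- \<eta>\<^sup>2 log log)\<close> falls below \<open>1 / 2\<close>, and
  \<open>ln R\<close> is \<open>(1 - 2 \<eta>) log log\<close> up to a constant. Again \<open>\<kappa>\<close> and \<open>k0\<close> do not depend on the measure.
\<close>

lemma lower_block_bound:
  assumes v: "0 < v" "v < s" and t: "0 < t" and \<eta>: "0 < \<eta>" "\<eta> < 1/2" and Q: "2 \<le> Q"
  shows "\<exists>\<kappa>>0. \<exists>k0. \<forall>k\<ge>k0. \<forall>(P :: 'a measure) F X u w (g :: 'a \<Rightarrow> real) B. mds P F X u w \<longrightarrow>
     (\<forall>i. Q ^ k \<le> i \<longrightarrow> i < Q ^ Suc k \<longrightarrow> mds.lowvar P F X i (sqrt (real (Q ^ Suc k))) s \<and> u i \<le> t) \<longrightarrow>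
     g \<in> borel_measurable (F (Q ^ k)) \<longrightarrow> (\<forall>\<omega>. 0 \<le> g \<omega> \<and> g \<omega> \<le> B) \<longrightarrow>
     \<kappa> * exp (- ((1 - 2 * \<eta>) * LL (real (Q ^ Suc k)))) * (\<integral>\<omega>. g \<omega> \<partial>P) \<le>
     (\<integral>\<omega>. g \<omega> * indicator {\<omega>. \<exists>m\<le>Q ^ Suc k - Q ^ k. line Q v \<eta> k m \<le> (\<Sum>i=Q^k..<Q^k+m. X i \<omega>)} \<omega> \<partial>P)"
proof -
  \<comment> \<open>The gap \<open>s - v\<close> is split: a quarter pays for \<open>\<delta>\<close>, a quarter for the truncation at \<open>A / l\<close>, and
    half remains for the terms that tend to \<open>0\<close>.\<close>
  define \<delta> where "\<delta> = (s - v) / (4 * s)"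
  define A where "A = 8 * t / (s - v)"
  define n where "n = (\<lambda>k. Q ^ Suc k - Q ^ k)"
  define N where "N = (\<lambda>k. real (Q ^ Suc k))"
  define l where "l = (\<lambda>k. sqrt (2 * LL (N k) / (real (n k) * v)))"
  \<comment> \<open>Squares are cut off at \<open>z\<^sup>2 = sqrt N\<close>: this tends to infinity, yet \<open>l * z\<close> tends to \<open>0\<close>.\<close>
  define z where "z = (\<lambda>k. sqrt (sqrt (N k)))"
  have s: "0 < s" using v by simp
  have \<delta>: "0 < \<delta>" "\<delta> \<le> 1" using v s by (auto simp: \<delta>_def field_simps)
  have A: "0 < A" using v t by (simp add: A_def)
  have gap: "(1 - \<delta>) * s - 2 * t / A = (s + v) / 2"
    using v t s by (simp add: \<delta>_def A_def field_simps)
  note lim = block_slope_limits[OF Q v(1)]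
  have l_lim: "l \<longlonglongrightarrow> 0" and lz_lim: "(\<lambda>k. l k * z k) \<longlonglongrightarrow> 0"
    using lim unfolding l_def z_def N_def n_def by auto
  have n0: "0 < n k" for k unfolding n_def using Q by (simp add: power_strict_increasing)
  have LL0: "0 < LL (N k)" for k using lg_ge_1[of "lg (N k)"] by linarith
  have l0: "0 < l k" for k unfolding l_def using LL0[of k] n0[of k] v by simp
  have "(\<lambda>k. v * (l k)\<^sup>2) \<longlonglongrightarrow> v * 0\<^sup>2" by (intro tendsto_intros l_lim)
  hence c1: "eventually (\<lambda>k. v * (l k)\<^sup>2 < 1) sequentially" by (intro order_tendstoD(2)) auto
  have "(\<lambda>k. v * (1 + v * (l k)\<^sup>2) * (1 + (l k)\<^sup>2 * t * exp A)) \<longlonglongrightarrow> v * (1 + v * 0\<^sup>2) * (1 + 0\<^sup>2 * t * exp A)"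
    by (intro tendsto_intros l_lim)
  hence c2: "eventually (\<lambda>k. v * (1 + v * (l k)\<^sup>2) * (1 + (l k)\<^sup>2 * t * exp A) < (s + v) / 2) sequentially"
    by (rule order_tendstoD(2)) (use v in auto)
  have c3: "eventually (\<lambda>k. l k * z k < min A \<delta>) sequentially"
    by (rule order_tendstoD(2)[OF lz_lim]) (use A \<delta> in auto)
  have "filterlim (\<lambda>k. real Q ^ k) at_top sequentially"
    using Q by (intro power_at_top) auto
  hence "filterlim (\<lambda>k. real Q ^ Suc k) at_top sequentially" by (rule filterlim_compose[OF _ filterlim_Suc])
  hence Nt: "filterlim N at_top sequentially" unfolding N_def by simp
  have "filterlim (\<lambda>k. LL (N k)) at_top sequentially" by (rule filterlim_compose[OF LL_at_top Nt])
  hence c4: "eventually (\<lambda>k. ln 2 / \<eta>\<^sup>2 \<le> LL (N k)) sequentially" by (simp add: filterlim_at_top)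
  from c1 c2 c3 c4 have "eventually (\<lambda>k. v * (l k)\<^sup>2 \<le> 1 \<and> l k * z k \<le> A \<and> l k * z k \<le> \<delta> \<and> ln 2 / \<eta>\<^sup>2 \<le> LL (N k) \<and>
     v * (1 + v * (l k)\<^sup>2) * (1 + (l k)\<^sup>2 * t * exp A) \<le> (1 - \<delta>) * s - 2 * t / A) sequentially"
    by eventually_elim (auto simp: gap)
  then obtain k0 where k0: "\<And>k. k0 \<le> k \<Longrightarrow> v * (l k)\<^sup>2 \<le> 1 \<and> l k * z k \<le> A \<and> l k * z k \<le> \<delta> \<and> ln 2 / \<eta>\<^sup>2 \<le> LL (N k) \<and>
     v * (1 + v * (l k)\<^sup>2) * (1 + (l k)\<^sup>2 * t * exp A) \<le> (1 - \<delta>) * s - 2 * t / A"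
    unfolding eventually_sequentially by blast
  show ?thesis
  proof (rule exI[of _ "exp (- A) / 2"], rule conjI, simp, rule exI[of _ k0], intro allI impI)
    fix k and P :: "'a measure" and F X u w and g :: "'a \<Rightarrow> real" and B
    assume k: "k0 \<le> k" and mds: "mds P F X u w"
      and i: "\<forall>i. Q ^ k \<le> i \<longrightarrow> i < Q ^ Suc k \<longrightarrow> mds.lowvar P F X i (sqrt (real (Q ^ Suc k))) s \<and> u i \<le> t"
      and g: "g \<in> borel_measurable (F (Q ^ k))" "\<forall>\<omega>. 0 \<le> g \<omega> \<and> g \<omega> \<le> B"
    interpret mds P F X u w by fact
    note k0 = k0[OF k]
    define r where "r = (1 - \<eta>) * l k"
    define b where "b = real (n k) * v * l k * (1 - \<eta>)"
    define L where "L = LL (N k)"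
    have nvl: "real (n k) * v * (l k)\<^sup>2 = 2 * L"
      unfolding l_def L_def using n0[of k] v LL0[of k] by (simp add: field_simps)
    have z2: "(z k)\<^sup>2 = sqrt (real (Q ^ Suc k))" unfolding z_def N_def by simp
    have QN: "Q ^ k + n k = Q ^ Suc k" unfolding n_def using Q by simp
    have bb: "b - v * l k / 2 * real (n k) = real (n k) * v * l k * (1/2 - \<eta>)"
      by (simp add: b_def algebra_simps)
    have e1: "(l k - r) * b - v * ((l k)\<^sup>2 - r\<^sup>2) / 2 * real (n k) = - (\<eta>\<^sup>2 * L)"
    proof -
      have "(l k - r) * b - v * ((l k)\<^sup>2 - r\<^sup>2) / 2 * real (n k) = - (\<eta>\<^sup>2 / 2 * (real (n k) * v * (l k)\<^sup>2))"
        unfolding r_def b_def by (simp add: power2_eq_square field_simps)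
      thus ?thesis unfolding nvl by simp
    qed
    have e2: "l k * b - v * (l k)\<^sup>2 / 2 * real (n k) + A = (1 - 2 * \<eta>) * L + A"
    proof -
      have "l k * b - v * (l k)\<^sup>2 / 2 * real (n k) = (1/2 - \<eta>) * (real (n k) * v * (l k)\<^sup>2)"
        unfolding b_def by (simp add: power2_eq_square field_simps)
      thus ?thesis unfolding nvl by (simp add: algebra_simps)
    qed
    have e3: "b - v * l k / 2 * (real (n k) - real m) = line Q v \<eta> k m" for m
      unfolding line_def Let_def b_def l_def[symmetric] n_def[symmetric] N_def[symmetric]
      by (simp add: l_def n_def N_def field_simps)
    have main: "(1 - exp (- (\<eta>\<^sup>2 * L))) * (\<integral>\<omega>. g \<omega> \<partial>P) \<le> exp ((1 - 2 * \<eta>) * L + A) *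
      (\<integral>\<omega>. g \<omega> * indicator {\<omega>. \<exists>m\<le>n k. line Q v \<eta> k m \<le> (\<Sum>i=Q^k..<Q^k+m. X i \<omega>)} \<omega> \<partial>P)"
      unfolding e1[symmetric] e2[symmetric] e3[symmetric]
    proof (rule line_hitting[where z = "z k" and s = s and t = t and \<delta> = \<delta> and B = B])
      show "g \<in> borel_measurable (F (Q ^ k))" by (rule g)
      show "0 \<le> g \<omega> \<and> g \<omega> \<le> B" for \<omega> using g by auto
      show "lowvar i ((z k)\<^sup>2) s" if "Q ^ k \<le> i" "i < Q ^ k + n k" for i
        using that i unfolding z2 QN by auto
      show "u i \<le> t" if "Q ^ k \<le> i" "i < Q ^ k + n k" for i
        using that i unfolding QN by auto
      show "0 \<le> r" "r < l k" using l0[of k] \<eta> by (auto simp: r_def mult_less_cancel_right1)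
      show "z k \<le> A / l k" using k0 l0[of k] by (simp add: field_simps)
      show "0 < b - v * l k / 2 * real (n k)" unfolding bb using n0[of k] v l0[of k] \<eta> by simp
      show "0 \<le> z k" unfolding z_def N_def by simp
    qed (use k0 \<delta> A v in auto)
    have "ln 2 \<le> \<eta>\<^sup>2 * L" using k0 \<eta> unfolding L_def by (simp add: field_simps)
    hence "exp (- (\<eta>\<^sup>2 * L)) \<le> exp (- ln 2)" by simp
    also have "\<dots> = 1/2" by (simp add: exp_minus)
    finally have half: "1/2 \<le> 1 - exp (- (\<eta>\<^sup>2 * L))" by simp
    define I where "I = (\<integral>\<omega>. g \<omega> * indicator {\<omega>. \<exists>m\<le>n k. line Q v \<eta> k m \<le> (\<Sum>i=Q^k..<Q^k+m. X i \<omega>)} \<omega> \<partial>P)"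
    have G0: "0 \<le> (\<integral>\<omega>. g \<omega> \<partial>P)" by (rule integral_F_nonneg) (use g in auto)
    have "1/2 * (\<integral>\<omega>. g \<omega> \<partial>P) \<le> exp ((1 - 2 * \<eta>) * L + A) * I"
      using mult_right_mono[OF half G0] main unfolding I_def by linarith
    hence "exp (- ((1 - 2 * \<eta>) * L + A)) * (1/2 * (\<integral>\<omega>. g \<omega> \<partial>P)) \<le> exp (- ((1 - 2 * \<eta>) * L + A)) * (exp ((1 - 2 * \<eta>) * L + A) * I)"
      by (intro mult_left_mono) auto
    also have "\<dots> = I" by (simp add: mult.assoc[symmetric] exp_add[symmetric])
    also have "exp (- ((1 - 2 * \<eta>) * L + A)) * (1/2 * (\<integral>\<omega>. g \<omega> \<partial>P))
       = exp (- A) / 2 * exp (- ((1 - 2 * \<eta>) * L)) * (\<integral>\<omega>. g \<omega> \<partial>P)"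
      by (simp add: exp_add[symmetric] algebra_simps)
    finally show "exp (- A) / 2 * exp (- ((1 - 2 * \<eta>) * LL (real (Q ^ Suc k)))) * (\<integral>\<omega>. g \<omega> \<partial>P) \<le>
     (\<integral>\<omega>. g \<omega> * indicator {\<omega>. \<exists>m\<le>Q ^ Suc k - Q ^ k. line Q v \<eta> k m \<le> (\<Sum>i=Q^k..<Q^k+m. X i \<omega>)} \<omega> \<partial>P)"
      unfolding I_def L_def N_def n_def .
  qed
qed

lemma block_probabilities_diverge:
  assumes \<eta>: "0 < \<eta>" "\<eta> < 1/2" and Q: "2 \<le> Q"
  shows "\<not> summable (\<lambda>k. exp (- ((1 - 2 * \<eta>) * LL (real (Q ^ Suc k)))))"
proof
  assume a: "summable (\<lambda>k. exp (- ((1 - 2 * \<eta>) * LL (real (Q ^ Suc k)))))"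
  define p where "p = - (1 - 2 * \<eta>)"
  have "filterlim (\<lambda>k. real Q ^ k) at_top sequentially"
    using Q by (intro power_at_top) auto
  hence "filterlim (\<lambda>k. real Q ^ Suc k) at_top sequentially" by (rule filterlim_compose[OF _ filterlim_Suc])
  hence "eventually (\<lambda>k. exp (exp 1) \<le> real (Q ^ Suc k)) sequentially" by (simp add: filterlim_at_top)
  hence ev: "eventually (\<lambda>k. exp (- ((1 - 2 * \<eta>) * LL (real (Q ^ Suc k)))) = (ln (real Q)) powr p * real (Suc k) powr p) sequentially"
  proof eventually_elim
    case (elim k)
    have "LL (real (Q ^ Suc k)) = ln (real (Suc k) * ln (real Q))"
      unfolding LL_eq[OF elim] using Q by (simp add: ln_realpow del: power_Suc)
    moreover have "real (Suc k) * ln (real Q) \<noteq> 0" using Q by simp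
    ultimately have "exp (- ((1 - 2 * \<eta>) * LL (real (Q ^ Suc k)))) = (real (Suc k) * ln (real Q)) powr p"
      by (simp only: powr_def p_def if_False minus_mult_left)
    thus ?case using Q by (simp add: powr_mult mult.commute)
  qed
  have "summable (\<lambda>k. (ln (real Q)) powr p * real (Suc k) powr p)"
    using summable_cong[OF ev] a by simp
  hence "summable (\<lambda>k. real (Suc k) powr p)"
    using Q by (subst (asm) summable_cmult_iff) auto
  hence "summable (\<lambda>k. real k powr p)" by (subst (asm) summable_Suc_iff)
  thus False using \<eta> by (simp add: summable_real_powr_iff p_def)
qed

text \<open>
  A point on the line is \<open>v * l * ((n + m) / 2)\<close> up to errors of order \<open>\<eta>\<close>, and
  \<open>(n + m) / 2 \<ge> sqrt (n * m)\<close> turns it into \<open>sqrt (2 v m log log)\<close>. A large ratio \<open>Q\<close> makes the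
  start of the block, both its length and the sum \<open>S0\<close> accumulated there, negligible. The line is
  lowered by \<open>1\<close> to leave room for smoothing indicators into Lipschitz functions.
\<close>

lemma line_crossing_large:
  assumes v: "0 < v" and \<eta>: "0 < \<eta>" "8 * \<eta> \<le> 1" and Q: "2 \<le> Q"
    and Q1: "1 \<le> 2 * \<eta> * (real Q - 1)" and Q2: "T\<^sup>2 \<le> \<eta>\<^sup>2 * v * (real Q - 1)" and T: "0 \<le> T"
    and big: "1 \<le> \<eta> * sqrt v * sqrt (real (Q ^ k))"
    and m: "m \<le> Q ^ Suc k - Q ^ k" and hit: "line Q v \<eta> k m - 1 \<le> SN"
    and SN: "- (T * nrm (Q ^ k)) \<le> S0"
  shows "(1 - 8 * \<eta>) * sqrt v * nrm (Q ^ k + m) \<le> S0 + SN"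
proof -
  define N where "N = real (Q ^ k)"
  define n where "n = real (Q ^ Suc k - Q ^ k)"
  define L where "L = LL (real (Q ^ Suc k))"
  define j where "j = N + real m"
  define vl where "vl = v * sqrt (2 * L / (n * v))"
  have N1: "1 \<le> N" unfolding N_def using Q by (simp add: Suc_le_eq)
  have nN: "n = (real Q - 1) * N" unfolding n_def N_def using Q
    by (subst of_nat_diff) (auto simp: algebra_simps)
  have n1: "N \<le> n" unfolding nN using Q N1 by (simp add: mult_le_cancel_right1)
  have L: "1 \<le> L" unfolding L_def by (rule lg_ge_1)
  have vl: "vl = sqrt v * sqrt (2 * L) / sqrt n"
    unfolding vl_def using v n1 N1 by (simp add: real_sqrt_divide real_sqrt_mult field_simps)
  have vl0: "0 < vl" unfolding vl using v L n1 N1 by simp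
  have "N * 1 \<le> N * (2 * \<eta> * (real Q - 1))" using Q1 N1 by (intro mult_left_mono) auto
  hence i: "N \<le> 2 * \<eta> * n" by (simp add: nN algebra_simps)
  have vn: "vl * n = sqrt v * sqrt (2 * L) * sqrt n"
    unfolding vl using n1 N1 by (simp add: field_simps)
  have ii: "T * nrm (Q ^ k) \<le> vl * (\<eta> * n)"
  proof -
    have "T * sqrt N \<le> \<eta> * sqrt v * sqrt n"
    proof (rule power2_le_imp_le)
      have "T\<^sup>2 * N \<le> \<eta>\<^sup>2 * v * (real Q - 1) * N" using Q2 N1 by (intro mult_right_mono) auto
      thus "(T * sqrt N)\<^sup>2 \<le> (\<eta> * sqrt v * sqrt n)\<^sup>2"
        using N1 v n1 by (simp add: power_mult_distrib nN)
    qed (use \<eta> v n1 N1 in auto)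
    hence "T * sqrt N * sqrt (2 * L) \<le> \<eta> * sqrt v * sqrt n * sqrt (2 * L)" using L by (intro mult_right_mono) auto
    moreover have "nrm (Q ^ k) \<le> sqrt N * sqrt (2 * L)"
    proof -
      have "LL (real (Q ^ k)) \<le> L" unfolding L_def using Q by (intro LL_mono) simp
      hence "2 * real (Q ^ k) * LL (real (Q ^ k)) \<le> N * (2 * L)" unfolding N_def by (simp add: mult_left_mono)
      thus ?thesis unfolding nrm_def real_sqrt_mult[symmetric] by (rule real_sqrt_le_mono)
    qed
    hence "T * nrm (Q ^ k) \<le> T * (sqrt N * sqrt (2 * L))" using T by (intro mult_left_mono) auto
    ultimately show ?thesis using vn by (simp add: algebra_simps)
  qed
  have iii: "1 \<le> vl * (\<eta> * n)"
  proof -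
    have "1 \<le> \<eta> * sqrt v * sqrt N" using big by (simp add: N_def)
    also have "\<dots> \<le> \<eta> * sqrt v * (sqrt n * sqrt (2 * L))"
    proof (rule mult_left_mono)
      have "sqrt N * 1 \<le> sqrt n * sqrt (2 * L)" using n1 N1 L by (intro mult_mono) auto
      thus "sqrt N \<le> sqrt n * sqrt (2 * L)" by simp
    qed (use \<eta> v in auto)
    finally show ?thesis using vn by (simp add: algebra_simps)
  qed
  have "vl * ((1 - 8 * \<eta>) * ((n + j) / 2)) \<le> vl * ((n + real m) / 2 - \<eta> * n - 2 * (\<eta> * n))"
  proof (rule mult_left_mono)
    have "0 \<le> \<eta> * j" unfolding j_def using \<eta> N1 by simp
    hence "(1 - 8 * \<eta>) * ((n + j) / 2) \<le> (n + j) / 2 - 4 * (\<eta> * n)" by (simp add: field_simps)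
    also have "\<dots> \<le> (n + real m) / 2 - \<eta> * n - 2 * (\<eta> * n)" using i by (simp add: j_def field_simps)
    finally show "(1 - 8 * \<eta>) * ((n + j) / 2) \<le> (n + real m) / 2 - \<eta> * n - 2 * (\<eta> * n)" .
  qed (use vl0 in simp)
  also have "\<dots> = line Q v \<eta> k m - vl * (\<eta> * n) - vl * (\<eta> * n)"
    unfolding line_def Let_def vl_def n_def L_def by (simp add: algebra_simps)
  also have "\<dots> \<le> S0 + SN" using hit SN ii iii by linarith
  finally have 1: "vl * ((1 - 8 * \<eta>) * ((n + j) / 2)) \<le> S0 + SN" .
  have "sqrt n * sqrt j \<le> (n + j) / 2"
    using arith_geo_mean_sqrt[of n j] n1 N1 by (simp add: j_def real_sqrt_mult)
  hence "vl * ((1 - 8 * \<eta>) * (sqrt n * sqrt j)) \<le> vl * ((1 - 8 * \<eta>) * ((n + j) / 2))"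
    using vl0 \<eta> by (intro mult_left_mono) auto
  also have "vl * ((1 - 8 * \<eta>) * (sqrt n * sqrt j)) = (1 - 8 * \<eta>) * sqrt v * (sqrt (2 * L) * sqrt j)"
    unfolding vl using n1 N1 by (simp add: field_simps)
  finally have 2: "(1 - 8 * \<eta>) * sqrt v * (sqrt (2 * L) * sqrt j) \<le> S0 + SN" using 1 by linarith
  have "nrm (Q ^ k + m) \<le> sqrt (2 * L) * sqrt j"
  proof -
    have "Q ^ k \<le> Q ^ Suc k" using Q by simp
    hence "Q ^ k + m \<le> Q ^ Suc k" using m by linarith
    hence "real (Q ^ k + m) \<le> real (Q ^ Suc k)" using of_nat_le_iff by blast
    hence "LL (real (Q ^ k + m)) \<le> L" unfolding L_def by (rule LL_mono)
    hence "j * LL (real (Q ^ k + m)) \<le> j * L" using N1 by (intro mult_left_mono) (auto simp: j_def)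
    hence "2 * real (Q ^ k + m) * LL (real (Q ^ k + m)) \<le> 2 * L * j" by (simp add: j_def N_def algebra_simps)
    thus ?thesis unfolding nrm_def real_sqrt_mult[symmetric] by (rule real_sqrt_le_mono)
  qed
  hence "(1 - 8 * \<eta>) * sqrt v * nrm (Q ^ k + m) \<le> (1 - 8 * \<eta>) * sqrt v * (sqrt (2 * L) * sqrt j)"
    using \<eta> v by (intro mult_left_mono) auto
  thus ?thesis using 2 by linarith
qed


section \<open>From block events to cluster sets\<close>

lemma cluster_set_iff: "l \<in> cluster_set x \<longleftrightarrow> (\<forall>e>0. \<forall>N. \<exists>n\<ge>N. \<bar>x n - l\<bar> < e)"
proof
  assume "l \<in> cluster_set x"
  then obtain r where r: "strict_mono r" "(x \<circ> r) \<longlonglongrightarrow> l" by (auto simp: cluster_set_def)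
  show "\<forall>e>0. \<forall>N. \<exists>n\<ge>N. \<bar>x n - l\<bar> < e"
  proof (intro allI impI)
    fix e :: real and N assume "0 < e"
    then obtain k0 where k0: "\<And>k. k0 \<le> k \<Longrightarrow> \<bar>x (r k) - l\<bar> < e"
      using LIMSEQ_D[OF r(2)] by auto
    show "\<exists>n\<ge>N. \<bar>x n - l\<bar> < e"
      using k0[of "max k0 N"] seq_suble[OF r(1), of "max k0 N"] by (intro exI[of _ "r (max k0 N)"]) auto
  qed
next
  assume a: "\<forall>e>0. \<forall>N. \<exists>n\<ge>N. \<bar>x n - l\<bar> < e"
  define r where "r = rec_nat (SOME n. \<bar>x n - l\<bar> < 1) (\<lambda>k n. SOME n'. Suc n \<le> n' \<and> \<bar>x n' - l\<bar> < 1 / real (Suc (Suc k)))"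
  have "\<exists>n'. Suc n \<le> n' \<and> \<bar>x n' - l\<bar> < 1 / real (Suc (Suc k))" for n k
    using a[rule_format, of "1 / real (Suc (Suc k))" "Suc n"] by auto
  from someI_ex[OF this] have S: "Suc (r k) \<le> r (Suc k)" "\<bar>x (r (Suc k)) - l\<bar> < 1 / real (Suc (Suc k))" for k
    by (auto simp: r_def)
  have "\<exists>n. \<bar>x n - l\<bar> < 1" using a[rule_format, of 1 0] by auto
  from someI_ex[OF this] have 0: "\<bar>x (r 0) - l\<bar> < 1" by (simp add: r_def)
  have "strict_mono r" using S(1) by (intro strict_mono_Suc_iff[THEN iffD2]) (auto simp: Suc_le_eq)
  moreover have "(\<lambda>k. x (r k) - l) \<longlonglongrightarrow> 0"
  proof (rule Lim_null_comparison)
    show "(\<lambda>k. inverse (real (Suc k))) \<longlonglongrightarrow> 0" by (rule LIMSEQ_inverse_real_of_nat)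
    have "norm (x (r k) - l) \<le> inverse (real (Suc k))" for k
      using 0 S(2)[of "k - 1"] by (cases k) (auto simp: inverse_eq_divide)
    thus "\<forall>\<^sub>F k in sequentially. norm (x (r k) - l) \<le> inverse (real (Suc k))" by simp
  qed
  hence "(x \<circ> r) \<longlonglongrightarrow> l" by (subst LIM_zero_iff[symmetric]) (simp add: o_def)
  ultimately show "l \<in> cluster_set x" by (auto simp: cluster_set_def)
qed

lemma cluster_point_in_interval:
  assumes "\<And>N. \<exists>n\<ge>N. x n \<in> {a..b::real}"
  obtains l where "l \<in> cluster_set x" "l \<in> {a..b}"
proof -
  have "\<exists>r :: nat \<Rightarrow> nat. strict_mono r \<and> (\<forall>k. x (r k) \<in> {a..b})"
  proof -
    have "infinite {n. x n \<in> {a..b}}" unfolding infinite_nat_iff_unbounded_le using assms by auto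
    from infinite_enumerate[OF this] obtain r :: "nat \<Rightarrow> nat" where "strict_mono r \<and> (\<forall>k. r k \<in> {n. x n \<in> {a..b}})" ..
    thus ?thesis by (intro exI[of _ r]) simp
  qed
  then obtain r :: "nat \<Rightarrow> nat" where r: "strict_mono r" "\<And>k. (x \<circ> r) k \<in> {a..b}" by auto
  have "compact {a..b}" by simp
  then obtain l q where "l \<in> {a..b}" "strict_mono q" "((x \<circ> r) \<circ> q) \<longlonglongrightarrow> l"
    unfolding compact_def using r(2) by metis
  thus ?thesis using r(1) that[of l] by (auto simp: cluster_set_def o_assoc[symmetric] intro!: exI[of _ "r \<circ> q"] strict_mono_o)
qed

text \<open>
  A sequence whose increments vanish cannot pass from near \<open>- s\<close> to near \<open>s\<close> without coming
  arbitrarily close to every value in between.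
\<close>

lemma cluster_set_eq_interval:
  assumes s: "0 < s" and up: "\<And>e. 0 < e \<Longrightarrow> eventually (\<lambda>n. \<bar>x n\<bar> \<le> s + e) sequentially"
    and hi: "\<And>e N. 0 < e \<Longrightarrow> \<exists>n\<ge>N. s - e \<le> x n" and lo: "\<And>e N. 0 < e \<Longrightarrow> \<exists>n\<ge>N. x n \<le> - s + e"
    and inc: "(\<lambda>n. x (Suc n) - x n) \<longlonglongrightarrow> 0"
  shows "cluster_set x = {-s..s}"
proof (intro set_eqI iffI)
  fix l assume l: "l \<in> cluster_set x"
  show "l \<in> {-s..s}"
  proof (rule ccontr)
    assume "l \<notin> {-s..s}"
    define e where "e = (\<bar>l\<bar> - s) / 2"
    have e: "0 < e" using \<open>l \<notin> {-s..s}\<close> by (auto simp: e_def)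
    obtain N where N: "\<And>n. N \<le> n \<Longrightarrow> \<bar>x n\<bar> \<le> s + e" using up[OF e] by (auto simp: eventually_sequentially)
    obtain n where "N \<le> n" "\<bar>x n - l\<bar> < e" using l e unfolding cluster_set_iff by blast
    moreover have "\<bar>l\<bar> = s + 2 * e" by (simp add: e_def field_simps)
    ultimately show False using N[of n] by linarith
  qed
next
  fix l assume l: "l \<in> {-s..s}"
  show "l \<in> cluster_set x" unfolding cluster_set_iff
  proof (intro allI impI)
    fix e :: real and N assume e: "0 < e"
    obtain N1 where N1: "\<And>n. N1 \<le> n \<Longrightarrow> \<bar>x (Suc n) - x n\<bar> < e"
      using LIMSEQ_D[OF inc e] by auto
    \<comment> \<open>an upcrossing of the level \<open>l\<close> passes within one increment of it\<close>
    obtain p where p: "max N N1 \<le> p" "x p \<le> - s + e / 2" using lo[of "e/2" "max N N1"] e by auto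
    obtain q where q: "p \<le> q" "s - e / 2 \<le> x q" using hi[of "e/2" p] e by auto
    show "\<exists>n\<ge>N. \<bar>x n - l\<bar> < e"
    proof (cases "x q < l")
      case True
      thus ?thesis using l q p e by (intro exI[of _ q]) auto
    next
      case False
      define j where "j = (LEAST j. p \<le> j \<and> l \<le> x j)"
      have j: "p \<le> j" "l \<le> x j" using LeastI[of "\<lambda>j. p \<le> j \<and> l \<le> x j" q] False q unfolding j_def by auto
      show ?thesis
      proof (cases "j = p")
        case True
        thus ?thesis using l p j e by (intro exI[of _ p]) auto
      next
        case False
        then obtain i where i: "j = Suc i" "p \<le> i" using j by (cases j) auto
        have "\<not> (p \<le> i \<and> l \<le> x i)" using not_less_Least[of i "\<lambda>j. p \<le> j \<and> l \<le> x j"] i unfolding j_def by auto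
        hence "x i < l" using i by auto
        thus ?thesis using N1[of i] i p j by (intro exI[of _ j]) auto
      qed
    qed
  qed
qed

lemma nrm_ratio: "(\<lambda>n. nrm n / nrm (Suc n)) \<longlonglongrightarrow> 1"
proof -
  have "((\<lambda>x::real. sqrt (2 * x * ln (ln x)) / sqrt (2 * (x + 1) * ln (ln (x + 1)))) \<longlongrightarrow> 1) at_top"
    by real_asymp
  from filterlim_compose[OF this filterlim_real_sequentially]
  have "(\<lambda>n. sqrt (2 * real n * ln (ln (real n))) / sqrt (2 * (real n + 1) * ln (ln (real n + 1)))) \<longlonglongrightarrow> 1" .
  thus ?thesis
  proof (rule Lim_transform_eventually)
    have "eventually (\<lambda>n. exp (exp 1) \<le> real n) sequentially"
      using filterlim_real_sequentially unfolding filterlim_at_top by blast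
    thus "eventually (\<lambda>n. sqrt (2 * real n * ln (ln (real n))) / sqrt (2 * (real n + 1) * ln (ln (real n + 1))) = nrm n / nrm (Suc n)) sequentially"
    proof eventually_elim
      case (elim n)
      thus ?case using LL_eq[of "real n"] LL_eq[of "real n + 1"] by (simp add: nrm_def add.commute)
    qed
  qed
qed

lemma normalized_increments:
  fixes X :: "nat \<Rightarrow> real"
  assumes X: "(\<lambda>n. X n / nrm n) \<longlonglongrightarrow> 0" and T: "eventually (\<lambda>n. \<bar>\<Sum>i<n. X i\<bar> \<le> T * nrm n) sequentially"
  shows "(\<lambda>n. (\<Sum>i<Suc n. X i) / nrm (Suc n) - (\<Sum>i<n. X i) / nrm n) \<longlonglongrightarrow> 0"
proof -
  have r1: "(\<lambda>n. nrm n / nrm (Suc n) - 1) \<longlonglongrightarrow> 1 - 1" by (intro tendsto_intros nrm_ratio)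
  have ev: "eventually (\<lambda>n. \<bar>(\<Sum>i<n. X i) / nrm n\<bar> \<le> T) sequentially"
    using T eventually_gt_at_top[of 0]
    by eventually_elim (auto simp: abs_divide divide_le_eq nrm_pos)
  have "(\<lambda>n. (nrm n / nrm (Suc n) - 1) * ((\<Sum>i<n. X i) / nrm n)) \<longlonglongrightarrow> 0"
  proof (rule Lim_null_comparison)
    show "eventually (\<lambda>n. norm ((nrm n / nrm (Suc n) - 1) * ((\<Sum>i<n. X i) / nrm n)) \<le> \<bar>nrm n / nrm (Suc n) - 1\<bar> * T) sequentially"
      using ev by eventually_elim (unfold real_norm_def abs_mult, rule mult_left_mono, auto)
    show "(\<lambda>n. \<bar>nrm n / nrm (Suc n) - 1\<bar> * T) \<longlonglongrightarrow> 0"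
      using tendsto_mult_right[OF tendsto_rabs[OF r1], of T] by simp
  qed
  moreover have "(\<lambda>n. X n / nrm n * (nrm n / nrm (Suc n))) \<longlonglongrightarrow> 0 * 1" by (intro tendsto_mult X nrm_ratio)
  ultimately have "(\<lambda>n. (nrm n / nrm (Suc n) - 1) * ((\<Sum>i<n. X i) / nrm n) + X n / nrm n * (nrm n / nrm (Suc n))) \<longlonglongrightarrow> 0 + 0 * 1"
    by (rule tendsto_add)
  hence "(\<lambda>n. (nrm n / nrm (Suc n) - 1) * ((\<Sum>i<n. X i) / nrm n) + X n / nrm n * (nrm n / nrm (Suc n))) \<longlonglongrightarrow> 0" by simp
  thus ?thesis
  proof (rule Lim_transform_eventually)
    show "eventually (\<lambda>n. (nrm n / nrm (Suc n) - 1) * ((\<Sum>i<n. X i) / nrm n) + X n / nrm n * (nrm n / nrm (Suc n))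
       = (\<Sum>i<Suc n. X i) / nrm (Suc n) - (\<Sum>i<n. X i) / nrm n) sequentially"
      using eventually_gt_at_top[of 0]
    proof eventually_elim
      case (elim n)
      have "0 < nrm n" "0 < nrm (Suc n)" using elim by (auto intro: nrm_pos)
      thus ?case by (simp add: field_simps)
    qed
  qed
qed

lemma upper_paths:
  fixes S :: "nat \<Rightarrow> real"
  assumes \<theta>: "1 < \<theta>" and c: "0 \<le> c"
    and ev: "eventually (\<lambda>k. \<not> (\<exists>m\<le>blk \<theta> (Suc k). c * nrm (blk \<theta> k) \<le> S m)) sequentially"
  shows "eventually (\<lambda>n. S n \<le> c * nrm n) sequentially"
proof -
  obtain K where K: "\<And>k. K \<le> k \<Longrightarrow> \<not> (\<exists>m\<le>blk \<theta> (Suc k). c * nrm (blk \<theta> k) \<le> S m)"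
    using ev by (auto simp: eventually_sequentially)
  show ?thesis unfolding eventually_sequentially
  proof (intro exI allI impI)
    fix n assume "blk \<theta> K \<le> n"
    then obtain k where k: "K \<le> k" "blk \<theta> k \<le> n" "n < blk \<theta> (Suc k)" by (rule blk_cover[OF \<theta>])
    have "S n < c * nrm (blk \<theta> k)" using K[OF k(1)] k(3) by (meson less_imp_le not_le)
    also have "\<dots> \<le> c * nrm n" using c nrm_mono[OF k(2)] by (intro mult_left_mono)
    finally show "S n \<le> c * nrm n" by simp
  qed
qed

text \<open>
  The gap between \<open>c\<close> and \<open>t\<close> pays for a variance below \<open>t\<^sup>2\<close> and for the losses in crossing the line:
  \<open>sqrt v\<close> is the midpoint of \<open>c\<close> and \<open>t\<close>, and \<open>\<eta>\<close> satisfies \<open>(1 - 8 \<eta>) sqrt v = c\<close>.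
\<close>

lemma lower_constants:
  assumes "0 < c" "c < (t::real)" "0 \<le> T"
  obtains v \<eta> Q where "0 < v" "v < t\<^sup>2" "0 < \<eta>" "8 * \<eta> \<le> 1" "\<eta> < 1/2" "c \<le> (1 - 8 * \<eta>) * sqrt v" "2 \<le> Q"
    "1 \<le> 2 * \<eta> * (real Q - 1)" "T\<^sup>2 \<le> \<eta>\<^sup>2 * v * (real Q - 1)"
proof -
  define v where "v = ((c + t) / 2)\<^sup>2"
  define \<eta> where "\<eta> = (t - c) / (8 * (t + c))"
  have v: "0 < v" "v < t\<^sup>2" "sqrt v = (c + t) / 2"
    using assms by (auto simp: v_def intro!: power_strict_mono)
  have \<eta>: "0 < \<eta>" "8 * \<eta> \<le> 1" "1 - 8 * \<eta> = 2 * c / (c + t)"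
    using assms by (auto simp: \<eta>_def field_simps)
  obtain Q :: nat where Q: "max 2 (max (1 / (2 * \<eta>) + 1) (T\<^sup>2 / (\<eta>\<^sup>2 * v) + 1)) \<le> real Q"
    using real_arch_simple by blast
  have "1 / (2 * \<eta>) \<le> real Q - 1" "T\<^sup>2 / (\<eta>\<^sup>2 * v) \<le> real Q - 1" using Q by auto
  hence q: "1 \<le> 2 * \<eta> * (real Q - 1)" "T\<^sup>2 \<le> \<eta>\<^sup>2 * v * (real Q - 1)"
    using \<eta> v by (auto simp: divide_le_eq mult.commute)
  have q2: "2 \<le> Q" using Q by simp
  have c: "c \<le> (1 - 8 * \<eta>) * sqrt v" unfolding v(3) \<eta>(3) using assms by (simp add: field_simps)
  have "\<eta> < 1 / 2" using \<eta>(1,2) by linarith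
  from that[OF v(1,2) \<eta>(1,2) this c q2 q] show ?thesis .
qed

lemma lower_paths:
  fixes S :: "nat \<Rightarrow> real"
  assumes v: "0 < v" and \<eta>: "0 < \<eta>" "8 * \<eta> \<le> 1" "c \<le> (1 - 8 * \<eta>) * sqrt v" and Q: "2 \<le> Q"
    "1 \<le> 2 * \<eta> * (real Q - 1)" "T\<^sup>2 \<le> \<eta>\<^sup>2 * v * (real Q - 1)" and T: "0 \<le> T"
    and ev: "eventually (\<lambda>n. \<bar>S n\<bar> \<le> T * nrm n) sequentially"
    and io: "\<And>K. \<exists>k\<ge>K. \<exists>m\<le>Q ^ Suc k - Q ^ k. line Q v \<eta> k m - 1 \<le> S (Q ^ k + m) - S (Q ^ k)"
  shows "\<exists>n\<ge>N. c * nrm n \<le> S n"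
proof -
  have Qk: "k \<le> Q ^ k" for k using Q less_exp[of k] power_mono[of 2 Q k] by (meson le_trans less_imp_le zero_le)
  obtain N1 where N1: "\<And>n. N1 \<le> n \<Longrightarrow> \<bar>S n\<bar> \<le> T * nrm n" using ev by (auto simp: eventually_sequentially)
  obtain K :: nat where K: "(1 / (\<eta> * sqrt v))\<^sup>2 \<le> real K" using real_arch_simple by blast
  obtain k m where k: "max N (max N1 K) \<le> k" "m \<le> Q ^ Suc k - Q ^ k"
    "line Q v \<eta> k m - 1 \<le> S (Q ^ k + m) - S (Q ^ k)" using io by blast
  have "max N (max N1 K) \<le> Q ^ k" using k(1) Qk[of k] by linarith
  hence kk: "N \<le> Q ^ k" "N1 \<le> Q ^ k" "K \<le> Q ^ k" by auto
  have "(1 / (\<eta> * sqrt v))\<^sup>2 \<le> real (Q ^ k)" using K kk(3) by (meson le_trans of_nat_le_iff order_trans)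
  hence "1 / (\<eta> * sqrt v) \<le> sqrt (real (Q ^ k))" by (rule real_le_rsqrt)
  hence big: "1 \<le> \<eta> * sqrt v * sqrt (real (Q ^ k))" using \<eta> v by (simp add: divide_le_eq mult.commute mult.left_commute)
  have "- (T * nrm (Q ^ k)) \<le> S (Q ^ k)" using N1[OF kk(2)] by linarith
  from line_crossing_large[OF v \<eta>(1,2) Q T big k(2,3) this]
  have "(1 - 8 * \<eta>) * sqrt v * nrm (Q ^ k + m) \<le> S (Q ^ k + m)" by simp
  moreover have "c * nrm (Q ^ k + m) \<le> (1 - 8 * \<eta>) * sqrt v * nrm (Q ^ k + m)"
    using \<eta> by (intro mult_right_mono) auto
  ultimately show ?thesis using kk by (intro exI[of _ "Q ^ k + m"]) auto
qed

context mds begin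

lemma uminus: "mds P F (\<lambda>i \<omega>. - X i \<omega>) u w"
proof
  fix n y and g :: "'a \<Rightarrow> real" and B assume g: "g \<in> borel_measurable (F n)" "\<And>\<omega>. 0 \<le> g \<omega> \<and> g \<omega> \<le> B"
  show "(\<integral>\<omega>. g \<omega> * - X n \<omega> \<partial>P) = 0" using cond_mean[OF g] by simp
  show "(\<integral>\<omega>. g \<omega> * (- X n \<omega>)\<^sup>2 \<partial>P) \<le> u n * (\<integral>\<omega>. g \<omega> \<partial>P)" using cond_var[OF g] by simp
  show "(\<integral>\<omega>. g \<omega> * min (\<bar>- X n \<omega>\<bar> / y) 1 ^ 4 \<partial>P) \<le> w y * (\<integral>\<omega>. g \<omega> \<partial>P)" if "0 < y"
    using cond_tail[OF g that] by simp
qed (use subalg F_mono adapted square_integrable in auto)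

lemma lowvar_uminus: "mds.lowvar P F (\<lambda>i \<omega>. - X i \<omega>) i c s = lowvar i c s"
proof -
  interpret m: mds P F "\<lambda>i \<omega>. - X i \<omega>" u w by (rule uminus)
  show ?thesis unfolding lowvar_def m.lowvar_def by simp
qed

lemma lowvar_mono:
  assumes "lowvar i c s" "c \<le> c'" "s' \<le> s" "0 \<le> c"
  shows "lowvar i c' s'"
  unfolding lowvar_def
proof (intro allI impI)
  fix g :: "'a \<Rightarrow> real" and B assume g: "g \<in> borel_measurable (F i)" "\<forall>\<omega>. 0 \<le> g \<omega> \<and> g \<omega> \<le> B"
  have gB: "\<bar>g \<omega>\<bar> \<le> B" for \<omega> using g(2)[rule_format, of \<omega>] by auto
  have gP: "g \<in> borel_measurable P" by (rule measurable_F_P[OF g(1)])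
  have int: "integrable P (\<lambda>\<omega>. g \<omega> * min ((X i \<omega>)\<^sup>2) c)" if "0 \<le> c" for c
    by (rule integrable_times[OF _ gP gB], rule integrable_bdd[of _ c]) (use that in auto)
  have "s' * (\<integral>\<omega>. g \<omega> \<partial>P) \<le> s * (\<integral>\<omega>. g \<omega> \<partial>P)"
    using assms by (intro mult_right_mono integral_F_nonneg) (use g in auto)
  also have "\<dots> \<le> (\<integral>\<omega>. g \<omega> * min ((X i \<omega>)\<^sup>2) c \<partial>P)" using assms g unfolding lowvar_def by blast
  also have "\<dots> \<le> (\<integral>\<omega>. g \<omega> * min ((X i \<omega>)\<^sup>2) c' \<partial>P)"
    using assms g by (intro integral_mono int) (auto intro!: mult_left_mono)
  finally show "s' * (\<integral>\<omega>. g \<omega> \<partial>P) \<le> (\<integral>\<omega>. g \<omega> * min ((X i \<omega>)\<^sup>2) c' \<partial>P)" .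
qed

text \<open>
  The second Borel--Cantelli lemma in conditional form: not having met the earlier lines is an
  event known at time \<open>Q ^ k\<close>, so its indicator is an admissible weight, and each block multiplies
  the probability by at most \<open>1 - q k \<le> exp (- q k)\<close>.
\<close>

lemma no_hit_probability:
  assumes Q: "1 \<le> Q"
    and hit: "\<And>k g B. K \<le> k \<Longrightarrow> g \<in> borel_measurable (F (Q ^ k)) \<Longrightarrow> (\<And>\<omega>. 0 \<le> g \<omega> \<and> g \<omega> \<le> B) \<Longrightarrow>
      q k * (\<integral>\<omega>. g \<omega> \<partial>P) \<le>
      (\<integral>\<omega>. g \<omega> * indicator {\<omega>. \<exists>m\<le>Q ^ Suc k - Q ^ k. line Q v \<eta> k m \<le> (\<Sum>i=Q^k..<Q^k+m. X i \<omega>)} \<omega> \<partial>P)"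
    and L: "K \<le> L"
  shows "prob {\<omega>\<in>space P. \<forall>k\<in>{K..<L}. \<not> (\<exists>m\<le>Q ^ Suc k - Q ^ k. line Q v \<eta> k m \<le> (\<Sum>i=Q^k..<Q^k+m. X i \<omega>))}
     \<le> exp (- (\<Sum>k=K..<L. q k))"
  using L
proof (induction L rule: dec_induct)
  case base
  show ?case using prob_space by simp
next
  case (step L)
  define Hit where "Hit = (\<lambda>k \<omega>. \<exists>m\<le>Q ^ Suc k - Q ^ k. line Q v \<eta> k m \<le> (\<Sum>i=Q^k..<Q^k+m. X i \<omega>))"
  have hitF: "Measurable.pred (F (Q ^ j)) (Hit k)" if "k < j" for k j
  proof -
    have Qj: "Q ^ Suc k \<le> Q ^ j" using that Q by (intro power_increasing) auto
    have "Measurable.pred (F (Q ^ j)) (\<lambda>\<omega>. \<exists>m\<in>{..Q ^ Suc k - Q ^ k}. line Q v \<eta> k m \<le> (\<Sum>i=Q^k..<Q^k+m. X i \<omega>))"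
    proof (rule pred_intros_finite(4))
      fix m assume m: "m \<in> {..Q ^ Suc k - Q ^ k}"
      have "Q ^ k \<le> Q ^ Suc k" using Q by (intro power_increasing) auto
      hence "Q ^ k + m \<le> Q ^ j" using m Qj unfolding atMost_iff by linarith
      hence [measurable]: "(\<lambda>\<omega>. \<Sum>i=Q^k..<Q^k+m. X i \<omega>) \<in> borel_measurable (F (Q ^ j))"
        by (intro borel_measurable_sum X_F) auto
      show "Measurable.pred (F (Q ^ j)) (\<lambda>\<omega>. line Q v \<eta> k m \<le> (\<Sum>i=Q^k..<Q^k+m. X i \<omega>))" by measurable
    qed simp
    moreover have "(\<lambda>\<omega>. \<exists>m\<in>{..Q ^ Suc k - Q ^ k}. line Q v \<eta> k m \<le> (\<Sum>i=Q^k..<Q^k+m. X i \<omega>)) = Hit k"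
      by (auto simp: Hit_def)
    ultimately show ?thesis by argo
  qed
  define A where "A = (\<lambda>L. {\<omega>\<in>space P. \<forall>k\<in>{K..<L}. \<not> Hit k \<omega>})"
  have A: "A j \<in> sets (F (Q ^ j))" for j
  proof -
    have "A j = {\<omega>\<in>space (F (Q ^ j)). \<forall>k\<in>{K..<j}. \<not> Hit k \<omega>}" by (simp add: A_def)
    also have "\<dots> \<in> sets (F (Q ^ j))"
      by (rule predE, rule pred_intros_finite(3), simp, rule pred_intros_logic(2)[OF hitF]) auto
    finally show ?thesis .
  qed
  have AP[measurable]: "A j \<in> sets P" for j using A sets_F by blast
  have hP: "{\<omega>. Hit L \<omega>} \<inter> space P \<in> sets P"
  proof -
    have "{\<omega>. Hit L \<omega>} \<inter> space P = {\<omega> \<in> space (F (Q ^ Suc L)). Hit L \<omega>}" by auto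
    also have "\<dots> \<in> sets (F (Q ^ Suc L))" using hitF[of L "Suc L"] by (intro predE) auto
    finally show ?thesis using sets_F by blast
  qed
  have "q L * (\<integral>\<omega>. indicator (A L) \<omega> \<partial>P) \<le> (\<integral>\<omega>. indicator (A L) \<omega> * indicator {\<omega>. Hit L \<omega>} \<omega> \<partial>P)"
    unfolding Hit_def by (rule hit[of L "indicator (A L)" 1]) (use step A in \<open>auto simp: indicator_def[abs_def] intro: borel_measurable_indicator\<close>)
  also have "(\<integral>\<omega>. indicator (A L) \<omega> * indicator {\<omega>. Hit L \<omega>} \<omega> \<partial>P) = (LINT \<omega>|P. (indicator (A L \<inter> ({\<omega>. Hit L \<omega>} \<inter> space P)) \<omega> :: real))"
    by (rule Bochner_Integration.integral_cong) (auto simp: indicator_def)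
  also have "\<dots> = prob (A L \<inter> ({\<omega>. Hit L \<omega>} \<inter> space P))" using hP by simp
  finally have 1: "q L * prob (A L) \<le> prob (A L \<inter> ({\<omega>. Hit L \<omega>} \<inter> space P))" by simp
  have "A (Suc L) = A L - (A L \<inter> ({\<omega>. Hit L \<omega>} \<inter> space P))"
    using step by (auto simp: A_def less_Suc_eq)
  hence "prob (A (Suc L)) = prob (A L) - prob (A L \<inter> ({\<omega>. Hit L \<omega>} \<inter> space P))"
    using hP by (simp add: finite_measure_Diff)
  also have "\<dots> \<le> (1 - q L) * prob (A L)" using 1 by (simp add: algebra_simps)
  also have "\<dots> \<le> exp (- q L) * prob (A L)" using exp_ge_add_one_self[of "- q L"] by (intro mult_right_mono) auto
  also have "\<dots> \<le> exp (- q L) * exp (- (\<Sum>k=K..<L. q k))"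
    using step.IH unfolding A_def Hit_def by (intro mult_left_mono) auto
  also have "\<dots> = exp (- (\<Sum>k=K..<Suc L. q k))" using step by (simp add: exp_add[symmetric])
  finally show ?case unfolding A_def Hit_def .
qed

end

lemma exp_minus_partial_sums_to_0:
  fixes q :: "nat \<Rightarrow> real"
  assumes "\<And>k. 0 \<le> q k" "\<not> summable q"
  shows "(\<lambda>L. exp (- (\<Sum>k=K..<L. q k))) \<longlonglongrightarrow> 0"
proof -
  have ns: "\<not> summable (\<lambda>k. q (k + K))" using assms by (simp add: summable_iff_shift)
  have "filterlim (\<lambda>L. \<Sum>k<L. q (k + K)) at_top sequentially"
  proof (rule ccontr)
    assume a: "\<not> filterlim (\<lambda>L. \<Sum>k<L. q (k + K)) at_top sequentially"
    have "\<exists>C. \<forall>L. (\<Sum>k<L. q (k + K)) \<le> C"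
    proof (rule ccontr)
      assume b: "\<not> (\<exists>C. \<forall>L. (\<Sum>k<L. q (k + K)) \<le> C)"
      have "filterlim (\<lambda>L. \<Sum>k<L. q (k + K)) at_top sequentially"
        unfolding filterlim_at_top
      proof
        fix C
        obtain L0 where L0: "C < (\<Sum>k<L0. q (k + K))" using b by (meson not_le)
        show "\<forall>\<^sub>F L in sequentially. C \<le> (\<Sum>k<L. q (k + K))"
          using eventually_ge_at_top[of L0]
        proof eventually_elim
          case (elim L)
          have "(\<Sum>k<L0. q (k + K)) \<le> (\<Sum>k<L. q (k + K))" using elim assms by (intro sum_mono2) auto
          thus ?case using L0 by linarith
        qed
      qed
      thus False using a by simp
    qed
    then obtain C where "\<And>L. (\<Sum>k<L. q (k + K)) \<le> C" by auto
    hence "(\<Sum>k\<le>n. q (k + K)) \<le> C" for n by (simp only: lessThan_Suc_atMost[symmetric])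
    hence "summable (\<lambda>k. q (k + K))" using assms by (intro bounded_imp_summable[of _ C]) auto
    thus False using ns by simp
  qed
  hence "(\<lambda>L. exp (- (\<Sum>k<L. q (k + K)))) \<longlonglongrightarrow> 0"
    by (intro filterlim_compose[OF exp_at_bot] filterlim_uminus_at_bot_at_top[THEN filterlim_compose])
  hence "(\<lambda>L. exp (- (\<Sum>k=K..<L+K. q k))) \<longlonglongrightarrow> 0"
    by (simp add: sum.shift_bounds_nat_ivl[of q 0 K, simplified] atLeast0LessThan[symmetric])
  thus ?thesis by (rule LIMSEQ_offset)
qed


section \<open>The law of the iterated logarithm for martingale differences\<close>

context mds begin

lemma AE_upper:
  assumes w: "tail_summable w" and t: "0 < t" and \<epsilon>: "0 < \<epsilon>"
    and u: "\<And>\<delta>. 0 < \<delta> \<Longrightarrow> eventually (\<lambda>n. (\<Sum>i<n. u i) \<le> real n * (t\<^sup>2 + \<delta>)) sequentially"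
  shows "AE \<omega> in P. eventually (\<lambda>n. (\<Sum>i<n. X i \<omega>) \<le> (1 + \<epsilon>) * t * nrm n) sequentially"
proof -
  have mds: "mds P F X u w" ..
  obtain \<theta> \<delta> bd where \<theta>: "1 < \<theta>" and \<delta>: "0 < \<delta>" and bd: "summable bd"
    and bound: "\<And>k. (\<Sum>i<blk \<theta> (Suc k). u i) \<le> real (blk \<theta> (Suc k)) * (t\<^sup>2 * (1 + \<delta>)) \<Longrightarrow>
       prob {\<omega> \<in> space P. \<exists>m\<le>blk \<theta> (Suc k). (1 + \<epsilon>) * t * nrm (blk \<theta> k) \<le> (\<Sum>i<m. X i \<omega>)} \<le> bd k"
    using upper_block_bound[OF w w_nonneg t \<epsilon>, where 'a = 'a] mds by blast
  define A where "A = (\<lambda>k. {\<omega> \<in> space P. \<exists>m\<le>blk \<theta> (Suc k). (1 + \<epsilon>) * t * nrm (blk \<theta> k) \<le> (\<Sum>i<m. X i \<omega>)})"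
  have A: "A k \<in> sets P" for k unfolding A_def by measurable
  have "eventually (\<lambda>n. (\<Sum>i<n. u i) \<le> real n * (t\<^sup>2 + t\<^sup>2 * \<delta>)) sequentially" using t \<delta> by (intro u) simp
  moreover have "filterlim (\<lambda>k. blk \<theta> (Suc k)) sequentially sequentially"
    by (rule filterlim_compose[OF blk_at_top[OF \<theta>] filterlim_Suc])
  ultimately have "eventually (\<lambda>k. (\<Sum>i<blk \<theta> (Suc k). u i) \<le> real (blk \<theta> (Suc k)) * (t\<^sup>2 + t\<^sup>2 * \<delta>)) sequentially"
    by (rule eventually_compose_filterlim)
  hence "eventually (\<lambda>k. norm (prob (A k)) \<le> bd k) sequentially"
    by eventually_elim (auto simp: A_def distrib_left intro!: bound)
  hence "summable (\<lambda>k. prob (A k))" by (rule summable_comparison_test_ev[OF _ bd])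
  hence "AE \<omega> in P. eventually (\<lambda>k. \<omega> \<in> space P - A k) sequentially"
    by (intro borel_cantelli_AE1 A) (auto simp: emeasure_eq_measure)
  thus ?thesis
  proof (rule AE_mp, intro AE_I2 impI)
    fix \<omega> assume "eventually (\<lambda>k. \<omega> \<in> space P - A k) sequentially"
    hence "eventually (\<lambda>k. \<not> (\<exists>m\<le>blk \<theta> (Suc k). (1 + \<epsilon>) * t * nrm (blk \<theta> k) \<le> (\<Sum>i<m. X i \<omega>))) sequentially"
      by eventually_elim (auto simp: A_def)
    thus "eventually (\<lambda>n. (\<Sum>i<n. X i \<omega>) \<le> (1 + \<epsilon>) * t * nrm n) sequentially"
      by (rule upper_paths[OF \<theta>, rotated]) (use t \<epsilon> in simp)
  qed
qed

lemma AE_increments: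
  assumes w: "tail_summable w"
  shows "AE \<omega> in P. (\<lambda>n. X n \<omega> / nrm n) \<longlonglongrightarrow> 0"
proof -
  have "AE \<omega> in P. eventually (\<lambda>n. \<bar>X n \<omega>\<bar> \<le> c * nrm n) sequentially" if c: "0 < c" for c
  proof -
    define A where "A = (\<lambda>k. {\<omega> \<in> space P. \<exists>i<blk 2 (Suc k). c * nrm (blk 2 k) < \<bar>X i \<omega>\<bar>})"
    have A: "A k \<in> sets P" for k unfolding A_def by measurable
    have "0 < c * nrm (blk 2 k)" for k using c nrm_pos[of "blk 2 k"] blk_bounds(3)[of 2 k] by simp
    hence "prob (A k) \<le> real (blk 2 (Suc k)) * w (c * nrm (blk 2 k))" for k
      unfolding A_def by (rule tail_prob_union)
    hence "summable (\<lambda>k. prob (A k))"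
      using w c unfolding tail_summable_def
      by (intro summable_comparison_test[of "\<lambda>k. prob (A k)" "\<lambda>k. real (blk 2 (Suc k)) * w (c * nrm (blk 2 k))"]) auto
    hence "AE \<omega> in P. eventually (\<lambda>k. \<omega> \<in> space P - A k) sequentially"
      by (intro borel_cantelli_AE1 A) (auto simp: emeasure_eq_measure)
    thus ?thesis
    proof (rule AE_mp, intro AE_I2 impI)
      fix \<omega> assume "\<omega> \<in> space P" "eventually (\<lambda>k. \<omega> \<in> space P - A k) sequentially"
      then obtain K where K': "\<And>k. K \<le> k \<Longrightarrow> \<omega> \<in> space P - A k"
        unfolding eventually_sequentially by blast
      have K: "\<bar>X i \<omega>\<bar> \<le> c * nrm (blk 2 k)" if "K \<le> k" "i < blk 2 (Suc k)" for k i
      proof -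
        have "\<not> (\<exists>i<blk 2 (Suc k). c * nrm (blk 2 k) < \<bar>X i \<omega>\<bar>)" using K'[OF that(1)] by (simp add: A_def)
        thus ?thesis using that(2) by (meson not_le)
      qed
      show "eventually (\<lambda>n. \<bar>X n \<omega>\<bar> \<le> c * nrm n) sequentially" unfolding eventually_sequentially
      proof (intro exI allI impI)
        fix n assume "blk 2 K \<le> n"
        then obtain k where k: "K \<le> k" "blk 2 k \<le> n" "n < blk 2 (Suc k)" by (rule blk_cover[of 2, rotated]) auto
        have "\<bar>X n \<omega>\<bar> \<le> c * nrm (blk 2 k)" by (rule K[OF k(1,3)])
        also have "\<dots> \<le> c * nrm n" using c nrm_mono[OF k(2)] by (intro mult_left_mono) auto
        finally show "\<bar>X n \<omega>\<bar> \<le> c * nrm n" .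
      qed
    qed
  qed
  hence "AE \<omega> in P. \<forall>j. eventually (\<lambda>n. \<bar>X n \<omega>\<bar> \<le> inverse (real (Suc j)) * nrm n) sequentially"
    unfolding AE_all_countable by simp
  thus ?thesis
  proof (rule AE_mp, intro AE_I2 impI)
    fix \<omega> assume a: "\<forall>j. eventually (\<lambda>n. \<bar>X n \<omega>\<bar> \<le> inverse (real (Suc j)) * nrm n) sequentially"
    show "(\<lambda>n. X n \<omega> / nrm n) \<longlonglongrightarrow> 0"
    proof (rule tendstoI)
      fix e :: real assume "0 < e"
      then obtain j where j: "inverse (real (Suc j)) < e" using reals_Archimedean by blast
      from a[rule_format, of j] eventually_gt_at_top[of 0]
      show "\<forall>\<^sub>F n in sequentially. dist (X n \<omega> / nrm n) 0 < e"
      proof eventually_elim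
        case (elim n)
        have "\<bar>X n \<omega>\<bar> / nrm n \<le> inverse (real (Suc j))" using elim nrm_pos[of n] by (simp add: divide_le_eq)
        thus ?case using j nrm_pos[of n] elim(2) by (simp add: dist_real_def abs_divide)
      qed
    qed
  qed
qed

text \<open>
  Every block gives a fresh chance \<open>\<kappa> * q0 k\<close>, conditionally on the past, to meet the line, and these
  chances are not summable. That \<open>\<bar>S\<bar>\<close> is at most \<open>T\<close> times the normalization keeps the start of the
  block from spoiling the crossing.
\<close>

lemma AE_lower:
  assumes t: "0 < t" and c: "0 < c" "c < t" and T: "0 \<le> T"
    and up: "AE \<omega> in P. eventually (\<lambda>n. \<bar>\<Sum>i<n. X i \<omega>\<bar> \<le> T * nrm n) sequentially"
    and low: "\<And>\<delta>. 0 < \<delta> \<Longrightarrow> eventually (\<lambda>i. lowvar i (sqrt (real i)) (t\<^sup>2 - \<delta>)) sequentially"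
    and ub: "\<And>i. u i \<le> ub"
  shows "AE \<omega> in P. \<forall>N. \<exists>n\<ge>N. c * nrm n \<le> (\<Sum>i<n. X i \<omega>)"
proof -
  have mds: "mds P F X u w" ..
  obtain v \<eta> Q where v: "0 < v" "v < t\<^sup>2" and \<eta>: "0 < \<eta>" "8 * \<eta> \<le> 1" "\<eta> < 1/2" and cv: "c \<le> (1 - 8 * \<eta>) * sqrt v"
    and Q: "2 \<le> Q" "1 \<le> 2 * \<eta> * (real Q - 1)" "T\<^sup>2 \<le> \<eta>\<^sup>2 * v * (real Q - 1)"
    using lower_constants[OF c T] by blast
  define s where "s = (v + t\<^sup>2) / 2"
  define q0 where "q0 = (\<lambda>k. exp (- ((1 - 2 * \<eta>) * LL (real (Q ^ Suc k)))))"
  define Hit where "Hit = (\<lambda>k \<omega>. \<exists>m\<le>Q ^ Suc k - Q ^ k. line Q v \<eta> k m \<le> (\<Sum>i=Q^k..<Q^k+m. X i \<omega>))"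
  have s: "v < s" "s < t\<^sup>2" using v by (auto simp: s_def)
  have m1: "0 < max 1 ub" by simp
  obtain \<kappa> k0 where \<kappa>: "0 < \<kappa>" and H: "\<forall>k\<ge>k0. \<forall>(P :: 'a measure) F X u w (g :: 'a \<Rightarrow> real) B. mds P F X u w \<longrightarrow>
     (\<forall>i. Q ^ k \<le> i \<longrightarrow> i < Q ^ Suc k \<longrightarrow> mds.lowvar P F X i (sqrt (real (Q ^ Suc k))) s \<and> u i \<le> max 1 ub) \<longrightarrow>
     g \<in> borel_measurable (F (Q ^ k)) \<longrightarrow> (\<forall>\<omega>. 0 \<le> g \<omega> \<and> g \<omega> \<le> B) \<longrightarrow>
     \<kappa> * exp (- ((1 - 2 * \<eta>) * LL (real (Q ^ Suc k)))) * (\<integral>\<omega>. g \<omega> \<partial>P) \<le>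
     (\<integral>\<omega>. g \<omega> * indicator {\<omega>. \<exists>m\<le>Q ^ Suc k - Q ^ k. line Q v \<eta> k m \<le> (\<Sum>i=Q^k..<Q^k+m. X i \<omega>)} \<omega> \<partial>P)"
    using lower_block_bound[OF v(1) s(1) m1 \<eta>(1,3) Q(1), where 'a = 'a] by (elim exE conjE) (rule that)
  have hit: "\<kappa> * q0 k * (\<integral>\<omega>. g \<omega> \<partial>P) \<le> (\<integral>\<omega>. g \<omega> * indicator {\<omega>. Hit k \<omega>} \<omega> \<partial>P)"
    if "k0 \<le> k" "\<And>i. Q ^ k \<le> i \<Longrightarrow> i < Q ^ Suc k \<Longrightarrow> lowvar i (sqrt (real (Q ^ Suc k))) s \<and> u i \<le> max 1 ub"
      "g \<in> borel_measurable (F (Q ^ k))" "\<And>\<omega>. 0 \<le> g \<omega> \<and> g \<omega> \<le> B" for k g B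
    using H[rule_format, OF that(1) mds that(2-4)] unfolding q0_def Hit_def by blast
  obtain i0 where i0: "\<And>i. i0 \<le> i \<Longrightarrow> lowvar i (sqrt (real i)) s"
    using low[of "t\<^sup>2 - s"] s by (auto simp: eventually_sequentially)
  have Qk: "k \<le> Q ^ k" for k using Q(1) less_exp[of k] power_mono[of 2 Q k] by (meson le_trans less_imp_le zero_le)
  have hit': "\<kappa> * q0 k * (\<integral>\<omega>. g \<omega> \<partial>P) \<le> (\<integral>\<omega>. g \<omega> * indicator {\<omega>. Hit k \<omega>} \<omega> \<partial>P)"
    if k: "max k0 i0 \<le> k" and g: "g \<in> borel_measurable (F (Q ^ k))" "\<And>\<omega>. 0 \<le> g \<omega> \<and> g \<omega> \<le> B" for k g B
  proof (rule hit[OF _ _ g])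
    show "k0 \<le> k" using k by simp
    fix i assume i: "Q ^ k \<le> i" "i < Q ^ Suc k"
    have "i0 \<le> i" using k Qk[of k] i(1) by linarith
    from i0[OF this] have "lowvar i (sqrt (real (Q ^ Suc k))) s"
    proof (rule lowvar_mono)
      show "sqrt (real i) \<le> sqrt (real (Q ^ Suc k))"
        using i(2) by (simp only: real_sqrt_le_iff of_nat_le_iff less_imp_le)
    qed auto
    thus "lowvar i (sqrt (real (Q ^ Suc k))) s \<and> u i \<le> max 1 ub" using ub[of i] by auto
  qed
  have ns: "\<not> summable (\<lambda>k. \<kappa> * q0 k)"
    using block_probabilities_diverge[OF \<eta>(1,3) Q(1)] \<kappa> unfolding q0_def by (subst summable_cmult_iff) auto
  have Hm[measurable]: "Measurable.pred P (Hit k)" for k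
  proof -
    have "Measurable.pred P (\<lambda>\<omega>. \<exists>m\<in>{..Q ^ Suc k - Q ^ k}. line Q v \<eta> k m \<le> (\<Sum>i=Q^k..<Q^k+m. X i \<omega>))" by measurable
    moreover have "(\<lambda>\<omega>. \<exists>m\<in>{..Q ^ Suc k - Q ^ k}. line Q v \<eta> k m \<le> (\<Sum>i=Q^k..<Q^k+m. X i \<omega>)) = Hit k" by (auto simp: Hit_def)
    ultimately show ?thesis by argo
  qed
  have null: "AE \<omega> in P. \<exists>k\<ge>K. Hit k \<omega>" if K: "max k0 i0 \<le> K" for K
  proof -
    define A where "A = {\<omega>\<in>space P. \<forall>k\<ge>K. \<not> Hit k \<omega>}"
    have A: "A \<in> sets P" unfolding A_def by measurable
    have "prob A \<le> exp (- (\<Sum>k=K..<L. \<kappa> * q0 k))" if "K \<le> L" for L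
    proof -
      have "prob A \<le> prob {\<omega>\<in>space P. \<forall>k\<in>{K..<L}. \<not> Hit k \<omega>}"
        unfolding A_def by (rule finite_measure_mono) auto
      also have "\<dots> \<le> exp (- (\<Sum>k=K..<L. \<kappa> * q0 k))" unfolding Hit_def
      proof (rule no_hit_probability[OF _ _ that])
        fix k g B assume "K \<le> k" and g: "g \<in> borel_measurable (F (Q ^ k))" "\<And>\<omega>. 0 \<le> g \<omega> \<and> g \<omega> \<le> (B::real)"
        thus "\<kappa> * q0 k * (\<integral>\<omega>. g \<omega> \<partial>P) \<le> (\<integral>\<omega>. g \<omega> * indicator {\<omega>. \<exists>m\<le>Q ^ Suc k - Q ^ k. line Q v \<eta> k m \<le> (\<Sum>i=Q^k..<Q^k+m. X i \<omega>)} \<omega> \<partial>P)"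
          using hit'[of k g B, OF _ g] K unfolding Hit_def by auto
      qed (use Q in simp)
      finally show ?thesis .
    qed
    hence "eventually (\<lambda>L. prob A \<le> exp (- (\<Sum>k=K..<L. \<kappa> * q0 k))) sequentially"
      unfolding eventually_sequentially by blast
    moreover have "(\<lambda>L. exp (- (\<Sum>k=K..<L. \<kappa> * q0 k))) \<longlonglongrightarrow> 0"
      by (rule exp_minus_partial_sums_to_0[OF _ ns]) (use \<kappa> in \<open>simp add: q0_def\<close>)
    ultimately have "prob A \<le> 0" by (intro tendsto_lowerbound) auto
    hence "prob A = 0" by (simp add: measure_le_0_iff)
    hence "AE \<omega> in P. \<omega> \<notin> A" using A by (simp add: AE_iff_measurable emeasure_eq_measure prob_eq_0)
    thus ?thesis by (rule AE_mp) (auto simp: A_def intro!: AE_I2)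
  qed
  have "AE \<omega> in P. \<forall>K. \<exists>k\<ge>max K (max k0 i0). Hit k \<omega>"
    by (subst AE_all_countable, rule allI, rule null) simp
  with up show ?thesis
  proof eventually_elim
    case (elim \<omega>)
    show ?case
    proof
      fix N
      show "\<exists>n\<ge>N. c * nrm n \<le> (\<Sum>i<n. X i \<omega>)"
      proof (rule lower_paths[OF v(1) \<eta>(1,2) cv Q T elim(1)])
        fix K
        obtain k m where k: "max K (max k0 i0) \<le> k" "m \<le> Q ^ Suc k - Q ^ k" "line Q v \<eta> k m \<le> (\<Sum>i=Q^k..<Q^k+m. X i \<omega>)"
          using elim(2) unfolding Hit_def by blast
        have "(\<Sum>i=Q^k..<Q^k+m. X i \<omega>) = (\<Sum>i<Q ^ k + m. X i \<omega>) - (\<Sum>i<Q ^ k. X i \<omega>)"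
          by (simp add: sum_diff_nat_ivl[of 0 "Q^k" "Q^k+m" "\<lambda>i. X i \<omega>", symmetric] atLeast0LessThan)
        thus "\<exists>k\<ge>K. \<exists>m\<le>Q ^ Suc k - Q ^ k. line Q v \<eta> k m - 1 \<le> (\<Sum>i<Q ^ k + m. X i \<omega>) - (\<Sum>i<Q ^ k. X i \<omega>)"
          using k by (intro exI[of _ k] conjI exI[of _ m]) auto
      qed
    qed
  qed
qed

lemma iterated_logarithm:
  assumes w: "tail_summable w" and t: "0 < t"
    and u: "\<And>\<delta>. 0 < \<delta> \<Longrightarrow> eventually (\<lambda>n. (\<Sum>i<n. u i) \<le> real n * (t\<^sup>2 + \<delta>)) sequentially"
    and low: "\<And>\<delta>. 0 < \<delta> \<Longrightarrow> eventually (\<lambda>i. lowvar i (sqrt (real i)) (t\<^sup>2 - \<delta>)) sequentially"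
    and ub: "\<And>i. u i \<le> ub"
  shows "AE \<omega> in P. cluster_set (\<lambda>n. (\<Sum>i<n. X i \<omega>) / nrm n) = {-t..t}"
proof -
  interpret neg: mds P F "\<lambda>i \<omega>. - X i \<omega>" u w by (rule uminus)
  have low': "\<And>\<delta>. 0 < \<delta> \<Longrightarrow> eventually (\<lambda>i. neg.lowvar i (sqrt (real i)) (t\<^sup>2 - \<delta>)) sequentially"
    using low unfolding lowvar_uminus .
  have up: "AE \<omega> in P. eventually (\<lambda>n. \<bar>\<Sum>i<n. X i \<omega>\<bar> \<le> (1 + \<epsilon>) * t * nrm n) sequentially" if "0 < \<epsilon>" for \<epsilon>
  proof -
    have "AE \<omega> in P. eventually (\<lambda>n. (\<Sum>i<n. X i \<omega>) \<le> (1 + \<epsilon>) * t * nrm n) sequentially"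
      by (rule AE_upper[OF w t that u])
    moreover have "AE \<omega> in P. eventually (\<lambda>n. (\<Sum>i<n. - X i \<omega>) \<le> (1 + \<epsilon>) * t * nrm n) sequentially"
      by (rule neg.AE_upper[OF w t that u])
    ultimately show ?thesis
    proof eventually_elim
      case (elim \<omega>)
      from elim show ?case by eventually_elim (auto simp: sum_negf)
    qed
  qed
  have up2: "AE \<omega> in P. eventually (\<lambda>n. \<bar>\<Sum>i<n. X i \<omega>\<bar> \<le> 2 * t * nrm n) sequentially" using up[of 1] by simp
  hence up2': "AE \<omega> in P. eventually (\<lambda>n. \<bar>\<Sum>i<n. - X i \<omega>\<bar> \<le> 2 * t * nrm n) sequentially"
    by (simp add: sum_negf)
  define c where "c = (\<lambda>j::nat. t * (1 - inverse (real (Suc (Suc j)))))"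
  have cj: "0 < c j" "c j < t" for j
  proof -
    have "inverse (real (Suc (Suc j))) < 1" by (simp add: inverse_less_1_iff)
    thus "0 < c j" "c j < t" using t by (auto simp: c_def mult_less_cancel_left1)
  qed
  have t2: "0 \<le> 2 * t" using t by simp
  have "AE \<omega> in P. \<forall>j. eventually (\<lambda>n. \<bar>\<Sum>i<n. X i \<omega>\<bar> \<le> (1 + inverse (real (Suc j))) * t * nrm n) sequentially"
    unfolding AE_all_countable by (auto intro!: up)
  moreover have "AE \<omega> in P. \<forall>j. \<forall>N. \<exists>n\<ge>N. c j * nrm n \<le> (\<Sum>i<n. X i \<omega>)"
    by (subst AE_all_countable, rule allI, rule AE_lower[OF t cj t2 up2 low ub])
  moreover have "AE \<omega> in P. \<forall>j. \<forall>N. \<exists>n\<ge>N. c j * nrm n \<le> (\<Sum>i<n. - X i \<omega>)"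
    by (subst AE_all_countable, rule allI, rule neg.AE_lower[OF t cj t2 up2' low' ub])
  moreover note AE_increments[OF w]
  ultimately show ?thesis
  proof eventually_elim
    case (elim \<omega>)
    have "eventually (\<lambda>n. \<bar>\<Sum>i<n. X i \<omega>\<bar> \<le> ((1 + inverse (real (Suc 0))) * t) * nrm n) sequentially"
      using elim(1) by blast
    note inc = normalized_increments[OF elim(4) this]
    define x where "x = (\<lambda>n. (\<Sum>i<n. X i \<omega>) / nrm n)"
    have small: "\<exists>j. t * inverse (real (Suc j)) \<le> e" if "0 < e" for e
    proof -
      have "0 < e / t" using that t by simp
      from reals_Archimedean[OF this] obtain j where "inverse (real (Suc j)) < e / t" ..
      thus ?thesis using t by (intro exI[of _ j]) (simp add: field_simps)
    qed
    have small': "\<exists>j. t - e \<le> c j" if e: "0 < e" for e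
    proof -
      obtain j where "t * inverse (real (Suc j)) \<le> e" using small[OF e] by blast
      moreover have "t * inverse (real (Suc (Suc j))) \<le> t * inverse (real (Suc j))"
        using t by (intro mult_left_mono) (auto simp: field_simps)
      ultimately show ?thesis by (intro exI[of _ j]) (simp add: c_def algebra_simps)
    qed
    have "cluster_set x = {-t..t}"
    proof (rule cluster_set_eq_interval[OF t])
      fix e :: real assume e: "0 < e"
      obtain j where j: "t * inverse (real (Suc j)) \<le> e" using small[OF e] by blast
      from elim(1)[rule_format, of j] eventually_gt_at_top[of 0]
      show "eventually (\<lambda>n. \<bar>x n\<bar> \<le> t + e) sequentially"
      proof eventually_elim
        case (elim n)
        have "\<bar>x n\<bar> \<le> (1 + inverse (real (Suc j))) * t"
          using elim nrm_pos[of n] by (simp add: x_def abs_divide divide_le_eq)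
        thus ?case using j by (simp add: algebra_simps)
      qed
    next
      fix e :: real and N assume "0 < e"
      then obtain j where j: "t - e \<le> c j" using small' by blast
      obtain n where n: "max N 1 \<le> n" "c j * nrm n \<le> (\<Sum>i<n. X i \<omega>)" using elim(2) by blast
      hence "c j \<le> x n" using nrm_pos[of n] by (simp add: x_def le_divide_eq)
      thus "\<exists>n\<ge>N. t - e \<le> x n" using j n by (intro exI[of _ n]) auto
      obtain n where n: "max N 1 \<le> n" "c j * nrm n \<le> (\<Sum>i<n. - X i \<omega>)" using elim(3) by blast
      hence "x n \<le> - c j" using nrm_pos[of n] by (simp add: x_def divide_le_eq sum_negf)
      thus "\<exists>n\<ge>N. x n \<le> - t + e" using j n by (intro exI[of _ n]) auto
    next
      show "(\<lambda>n. x (Suc n) - x n) \<longlonglongrightarrow> 0" unfolding x_def by (rule inc)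
    qed
    thus ?case unfolding x_def .
  qed
qed

end


section \<open>Lipschitz functions of finitely many coordinates\<close>

definition lipf :: "nat \<Rightarrow> ((nat \<Rightarrow> real) \<Rightarrow> real) set" where
  "lipf n = {h. \<exists>C\<ge>0. \<forall>x y. \<bar>h x - h y\<bar> \<le> C * L2_set (\<lambda>i. x i - y i) {..<n}}"

lemma C_bLip_iff: "\<phi> \<in> C_bLip n \<longleftrightarrow> \<phi> \<in> lipf n \<and> (\<exists>b. \<forall>x. \<bar>\<phi> x\<bar> \<le> b)"
proof -
  have "(\<exists>C. \<forall>x y. \<bar>\<phi> x - \<phi> y\<bar> \<le> C * L2_set (\<lambda>i. x i - y i) {..<n}) \<longleftrightarrow>
    (\<exists>C\<ge>0. \<forall>x y. \<bar>\<phi> x - \<phi> y\<bar> \<le> C * L2_set (\<lambda>i. x i - y i) {..<n})"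
  proof (intro iffI)
    assume "\<exists>C. \<forall>x y. \<bar>\<phi> x - \<phi> y\<bar> \<le> C * L2_set (\<lambda>i. x i - y i) {..<n}"
    then obtain C where C: "\<And>x y. \<bar>\<phi> x - \<phi> y\<bar> \<le> C * L2_set (\<lambda>i. x i - y i) {..<n}" by blast
    have "\<bar>\<phi> x - \<phi> y\<bar> \<le> max C 0 * L2_set (\<lambda>i. x i - y i) {..<n}" for x y
      by (rule order_trans[OF C mult_right_mono]) (auto simp: L2_set_nonneg)
    thus "\<exists>C\<ge>0. \<forall>x y. \<bar>\<phi> x - \<phi> y\<bar> \<le> C * L2_set (\<lambda>i. x i - y i) {..<n}"
      by (intro exI[of _ "max C 0"]) auto
  qed blast
  thus ?thesis unfolding C_bLip_def lipf_def bounded_iff by auto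
qed

lemma lipfE:
  assumes "h \<in> lipf n"
  obtains C where "0 \<le> C" "\<And>x y. \<bar>h x - h y\<bar> \<le> C * L2_set (\<lambda>i. x i - y i) {..<n}"
  using assms unfolding lipf_def by blast

lemma lipfI: "0 \<le> C \<Longrightarrow> (\<And>x y. \<bar>h x - h y\<bar> \<le> C * L2_set (\<lambda>i. x i - y i) {..<n}) \<Longrightarrow> h \<in> lipf n"
  unfolding lipf_def by blast

lemma abs_le_L2_set: "(i::nat) < n \<Longrightarrow> \<bar>x i\<bar> \<le> L2_set x {..<n}"
  unfolding L2_set_def by (rule real_le_rsqrt, subst power2_abs) (rule member_le_sum, auto)

lemma lipf_const: "(\<lambda>x. c) \<in> lipf n"
  by (rule lipfI[of 0]) auto

lemma lipf_coord: "i < n \<Longrightarrow> (\<lambda>x. x i) \<in> lipf n"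
  by (rule lipfI[of 1]) (use abs_le_L2_set[of i n "\<lambda>i. _ i - _ i"] in auto)

lemma lipf_add: "f \<in> lipf n \<Longrightarrow> g \<in> lipf n \<Longrightarrow> (\<lambda>x. f x + g x) \<in> lipf n"
proof (elim lipfE)
  fix C D assume C: "0 \<le> C" "\<And>x y. \<bar>f x - f y\<bar> \<le> C * L2_set (\<lambda>i. x i - y i) {..<n}"
    and D: "0 \<le> D" "\<And>x y. \<bar>g x - g y\<bar> \<le> D * L2_set (\<lambda>i. x i - y i) {..<n}"
  have "\<bar>f x + g x - (f y + g y)\<bar> \<le> (C + D) * L2_set (\<lambda>i. x i - y i) {..<n}" for x y
    using C(2)[of x y] D(2)[of x y] unfolding distrib_right by linarith
  thus ?thesis using C D by (intro lipfI[of "C + D"]) auto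
qed

lemma lipf_compose:
  assumes f: "f \<in> lipf n" and k: "\<And>a b. \<bar>k a - k b\<bar> \<le> K * \<bar>a - b\<bar>" "0 \<le> K"
  shows "(\<lambda>x. k (f x) :: real) \<in> lipf n"
proof -
  obtain C where C: "0 \<le> C" "\<And>x y. \<bar>f x - f y\<bar> \<le> C * L2_set (\<lambda>i. x i - y i) {..<n}" using lipfE[OF f] by blast
  have "\<bar>k (f x) - k (f y)\<bar> \<le> (K * C) * L2_set (\<lambda>i. x i - y i) {..<n}" for x y
    using order_trans[OF k(1) mult_left_mono[OF C(2)[of x y] k(2)]] by (simp add: mult.assoc)
  thus ?thesis using C k by (intro lipfI[of "K * C"]) auto
qed

lemma lipf_scale: "f \<in> lipf n \<Longrightarrow> (\<lambda>x. c * f x) \<in> lipf n"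
  by (rule lipf_compose[where K = "\<bar>c\<bar>"]) (auto simp: abs_mult[symmetric] right_diff_distrib)

lemma lipf_minus: "f \<in> lipf n \<Longrightarrow> (\<lambda>x. - f x) \<in> lipf n"
  using lipf_scale[of f n "-1"] by simp

lemma lipf_diff: "f \<in> lipf n \<Longrightarrow> g \<in> lipf n \<Longrightarrow> (\<lambda>x. f x - g x) \<in> lipf n"
  using lipf_add[OF _ lipf_minus, of f n g] by simp

lemma lipf_max: "f \<in> lipf n \<Longrightarrow> g \<in> lipf n \<Longrightarrow> (\<lambda>x. max (f x) (g x)) \<in> lipf n"
proof (elim lipfE)
  fix C D assume C: "0 \<le> C" "\<And>x y. \<bar>f x - f y\<bar> \<le> C * L2_set (\<lambda>i. x i - y i) {..<n}"
    and D: "0 \<le> D" "\<And>x y. \<bar>g x - g y\<bar> \<le> D * L2_set (\<lambda>i. x i - y i) {..<n}"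
  have "\<bar>max (f x) (g x) - max (f y) (g y)\<bar> \<le> (C + D) * L2_set (\<lambda>i. x i - y i) {..<n}" for x y
  proof -
    have "\<bar>max (f x) (g x) - max (f y) (g y)\<bar> \<le> \<bar>f x - f y\<bar> + \<bar>g x - g y\<bar>" by linarith
    thus ?thesis using C(2)[of x y] D(2)[of x y] unfolding distrib_right by linarith
  qed
  thus ?thesis using C D by (intro lipfI[of "C + D"]) auto
qed

lemma lipf_min: "f \<in> lipf n \<Longrightarrow> g \<in> lipf n \<Longrightarrow> (\<lambda>x. min (f x) (g x)) \<in> lipf n"
proof -
  assume "f \<in> lipf n" "g \<in> lipf n"
  hence "(\<lambda>x. - max (- f x) (- g x)) \<in> lipf n" by (intro lipf_minus lipf_max)
  moreover have "(\<lambda>x. - max (- f x) (- g x)) = (\<lambda>x. min (f x) (g x))" by (auto simp: max_def min_def)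
  ultimately show ?thesis by simp
qed

lemma lipf_sum: "finite I \<Longrightarrow> (\<And>i. i \<in> I \<Longrightarrow> h i \<in> lipf n) \<Longrightarrow> (\<lambda>x. \<Sum>i\<in>I. h i x) \<in> lipf n"
  by (induction I rule: finite_induct) (auto intro: lipf_const lipf_add)

lemma lipf_Min:
  "finite I \<Longrightarrow> I \<noteq> {} \<Longrightarrow> (\<And>i. i \<in> I \<Longrightarrow> h i \<in> lipf n) \<Longrightarrow> (\<lambda>x. Min ((\<lambda>i. h i x) ` I)) \<in> lipf n"
  by (induction I rule: finite_ne_induct) (auto intro: lipf_min)

lemma lipf_Max:
  "finite I \<Longrightarrow> I \<noteq> {} \<Longrightarrow> (\<And>i. i \<in> I \<Longrightarrow> h i \<in> lipf n) \<Longrightarrow> (\<lambda>x. Max ((\<lambda>i. h i x) ` I)) \<in> lipf n"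
  by (induction I rule: finite_ne_induct) (auto intro: lipf_max)

lemma lipf_mono: "f \<in> lipf n \<Longrightarrow> n \<le> m \<Longrightarrow> f \<in> lipf m"
proof (elim lipfE)
  fix C assume C: "0 \<le> C" "\<And>x y. \<bar>f x - f y\<bar> \<le> C * L2_set (\<lambda>i. x i - y i) {..<n}" and nm: "n \<le> m"
  have "L2_set x {..<n} \<le> L2_set x {..<m}" for x
    unfolding L2_set_def using nm by (intro real_sqrt_le_mono sum_mono2) auto
  thus ?thesis using C by (intro lipfI[of C]) (auto intro: order_trans[OF C(2) mult_left_mono])
qed

lemma lipf_cong_coords: "f \<in> lipf n \<Longrightarrow> (\<And>i. i < n \<Longrightarrow> x i = y i) \<Longrightarrow> f x = f y"
proof (elim lipfE)
  fix C assume C: "0 \<le> C" "\<And>x y. \<bar>f x - f y\<bar> \<le> C * L2_set (\<lambda>i. x i - y i) {..<n}" and e: "\<And>i. i < n \<Longrightarrow> x i = y i"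
  have "L2_set (\<lambda>i. x i - y i) {..<n} = 0" using e by (simp add: L2_set_def)
  thus ?thesis using C(2)[of x y] by simp
qed

definition clamp01 :: "real \<Rightarrow> real" where "clamp01 a = max 0 (min 1 a)"

lemma clamp01: "0 \<le> clamp01 a" "clamp01 a \<le> 1" "clamp01 a \<le> \<bar>a\<bar>" by (auto simp: clamp01_def)

lemma clamp_C_bLip: "h \<in> lipf n \<Longrightarrow> (\<lambda>x. clamp01 (h x)) \<in> C_bLip n"
  unfolding C_bLip_iff clamp01_def
  by (intro conjI lipf_max lipf_min lipf_const exI[of _ 1]) auto

lemma C_bLip_cong_coords: "f \<in> C_bLip n \<Longrightarrow> (\<And>i. i < n \<Longrightarrow> x i = y i) \<Longrightarrow> f x = f y"
  unfolding C_bLip_iff using lipf_cong_coords by blast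

lemma C_bLip_mult:
  assumes "f \<in> C_bLip n" "g \<in> C_bLip n" shows "(\<lambda>x. f x * g x) \<in> C_bLip n"
proof -
  obtain a b where a: "\<And>x. \<bar>f x\<bar> \<le> a" and b: "\<And>x. \<bar>g x\<bar> \<le> b" using assms unfolding C_bLip_iff by blast
  obtain C where C: "0 \<le> C" "\<And>x y. \<bar>f x - f y\<bar> \<le> C * L2_set (\<lambda>i. x i - y i) {..<n}" using assms lipfE unfolding C_bLip_iff by blast
  obtain D where D: "0 \<le> D" "\<And>x y. \<bar>g x - g y\<bar> \<le> D * L2_set (\<lambda>i. x i - y i) {..<n}" using assms lipfE unfolding C_bLip_iff by blast
  have a0: "0 \<le> a" "0 \<le> b" using a[of undefined] b[of undefined] by auto
  have "\<bar>f x * g x - f y * g y\<bar> \<le> (a * D + b * C) * L2_set (\<lambda>i. x i - y i) {..<n}" for x y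
  proof -
    have "f x * g x - f y * g y = f x * (g x - g y) + g y * (f x - f y)" by (simp add: algebra_simps)
    hence "\<bar>f x * g x - f y * g y\<bar> \<le> \<bar>f x\<bar> * \<bar>g x - g y\<bar> + \<bar>g y\<bar> * \<bar>f x - f y\<bar>"
      by (metis abs_mult abs_triangle_ineq)
    also have "\<dots> \<le> a * (D * L2_set (\<lambda>i. x i - y i) {..<n}) + b * (C * L2_set (\<lambda>i. x i - y i) {..<n})"
      using a b a0 C D by (intro add_mono mult_mono) auto
    finally show ?thesis by (simp add: algebra_simps)
  qed
  hence "(\<lambda>x. f x * g x) \<in> lipf n" using a0 C D by (intro lipfI[of "a * D + b * C"]) auto
  moreover have "\<bar>f x * g x\<bar> \<le> a * b" for x unfolding abs_mult using a b a0 by (intro mult_mono) auto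
  ultimately show ?thesis unfolding C_bLip_iff by blast
qed

definition blip :: "(real \<Rightarrow> real) \<Rightarrow> bool" where
  "blip \<phi> \<longleftrightarrow> (\<exists>b. \<forall>y. \<bar>\<phi> y\<bar> \<le> b) \<and> (\<exists>C\<ge>0. \<forall>y z. \<bar>\<phi> y - \<phi> z\<bar> \<le> C * \<bar>y - z\<bar>)"

lemma blip_coord: "blip \<phi> \<Longrightarrow> i < n \<Longrightarrow> (\<lambda>x. \<phi> (x i)) \<in> C_bLip n"
  unfolding C_bLip_iff blip_def using lipf_compose[OF lipf_coord] by blast

lemma blip_continuous: "blip \<phi> \<Longrightarrow> continuous_on UNIV \<phi>"
proof -
  assume "blip \<phi>"
  then obtain C where C: "0 \<le> C" "\<And>y z. \<bar>\<phi> y - \<phi> z\<bar> \<le> C * \<bar>y - z\<bar>" unfolding blip_def by blast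
  have "C-lipschitz_on UNIV \<phi>" using C by (intro lipschitz_onI) (auto simp: dist_real_def)
  thus ?thesis by (rule lipschitz_on_continuous_on)
qed

lemma blip_borel [measurable_dest]: "blip \<phi> \<Longrightarrow> \<phi> \<in> borel_measurable borel"
  by (rule borel_measurable_continuous_onI[OF blip_continuous])

lemma C_bLip_borel:
  assumes f: "f \<in> C_bLip n" and Z: "\<And>i. i < n \<Longrightarrow> Z i \<in> borel_measurable P"
  shows "(\<lambda>\<omega>. f (\<lambda>i. Z i \<omega>)) \<in> borel_measurable P"
proof -
  obtain C where C: "0 \<le> C" "\<And>x y. \<bar>f x - f y\<bar> \<le> C * L2_set (\<lambda>i. x i - y i) {..<n}"
    using f lipfE unfolding C_bLip_iff by blast
  define r where "r = (\<lambda>x i. if i < n then x i else 0 :: real)"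
  have fr: "f (r x) = f x" for x by (rule C_bLip_cong_coords[OF f]) (simp add: r_def)
  have "continuous_on UNIV f"
  proof (rule continuous_on_sequentiallyI)
    fix u :: "nat \<Rightarrow> nat \<Rightarrow> real" and a assume u: "u \<longlonglongrightarrow> a"
    have c: "(\<lambda>k. u k i) \<longlonglongrightarrow> a i" for i
    proof -
      have "continuous_on UNIV (\<lambda>x :: nat \<Rightarrow> real. x i)" by (rule continuous_on_product_coordinates)
      from continuous_on_tendsto_compose[OF this u] show ?thesis by simp
    qed
    have "(\<lambda>k. C * L2_set (\<lambda>i. u k i - a i) {..<n}) \<longlonglongrightarrow> C * L2_set (\<lambda>i. a i - a i) {..<n}"
      unfolding L2_set_def by (intro tendsto_intros c)
    hence "(\<lambda>k. C * L2_set (\<lambda>i. u k i - a i) {..<n}) \<longlonglongrightarrow> 0" by (simp add: L2_set_def)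
    hence "(\<lambda>k. f (u k) - f a) \<longlonglongrightarrow> 0"
      by (rule Lim_null_comparison[rotated]) (use C in auto)
    thus "(\<lambda>k. f (u k)) \<longlonglongrightarrow> f a" by (simp add: LIM_zero_iff)
  qed
  hence fm: "f \<in> borel_measurable borel" by (rule borel_measurable_continuous_onI)
  have "(\<lambda>\<omega>. r (\<lambda>i. Z i \<omega>)) \<in> borel_measurable P"
  proof (rule measurable_coordinatewise_then_product)
    fix i show "(\<lambda>\<omega>. r (\<lambda>i. Z i \<omega>) i) \<in> borel_measurable P" using Z by (cases "i < n") (auto simp: r_def)
  qed
  from measurable_compose[OF this fm] show ?thesis by (simp add: fr)
qed

section \<open>Lipschitz weights determine conditional expectations\<close>

definition gen :: "'a measure \<Rightarrow> (nat \<Rightarrow> 'a \<Rightarrow> real) \<Rightarrow> nat \<Rightarrow> 'a measure" where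
  "gen P Z n = sigma (space P) {{\<omega> \<in> space P. Z i \<omega> \<le> a} | i a. i < n}"

lemma gen_simps: "space (gen P Z n) = space P"
  "sets (gen P Z n) = sigma_sets (space P) {{\<omega> \<in> space P. Z i \<omega> \<le> a} | i a. i < n}"
  unfolding gen_def by (auto intro!: space_measure_of sets_measure_of)

lemma gen_measurable: "i < n \<Longrightarrow> Z i \<in> borel_measurable (gen P Z n)"
  unfolding borel_measurable_iff_le gen_simps by (intro allI sigma_sets.Basic) blast

lemma gen_subalgebra:
  assumes [measurable]: "\<And>i. Z i \<in> borel_measurable P"
  shows "subalgebra P (gen P Z n)"
proof -
  have "{\<omega> \<in> space P. Z i \<omega> \<le> a} \<in> sets P" for i a by measurable
  hence "{{\<omega> \<in> space P. Z i \<omega> \<le> a} | i a. i < n} \<subseteq> sets P" by blast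
  thus ?thesis unfolding subalgebra_def gen_simps by (simp add: sets.sigma_sets_subset)
qed

lemma gen_mono: "m \<le> n \<Longrightarrow> sets (gen P Z m) \<subseteq> sets (gen P Z n)"
  unfolding gen_simps by (intro sigma_sets_mono') auto

lemma abs_diff_indicator_mono:
  "S \<subseteq> T \<Longrightarrow> \<bar>a - indicator T x\<bar> \<le> \<bar>a - indicator S x\<bar> + (indicator (T - S) x :: real)"
  by (cases "x \<in> S"; cases "x \<in> T") (auto simp: indicator_def)

text \<open>
  The sets that can be approximated in mean by Lipschitz functions form a sigma-algebra: steep ramps
  handle the generators \<open>{Z i \<le> a}\<close>, maxima handle finite unions, and continuity of the measure
  handles countable ones.
\<close>

lemma lip_approximates_generated_sets:
  assumes P: "prob_space P" and Z: "\<And>i. Z i \<in> borel_measurable P" and A: "A \<in> sets (gen P Z n)" and e: "0 < e"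
  shows "\<exists>g\<in>C_bLip n. (\<forall>x. 0 \<le> g x \<and> g x \<le> 1) \<and> (\<integral>\<omega>. \<bar>g (\<lambda>i. Z i \<omega>) - indicator A \<omega>\<bar> \<partial>P) < e"
proof -
  interpret prob_space P by fact
  define ok where "ok = (\<lambda>A e. \<exists>g\<in>C_bLip n. (\<forall>x. 0 \<le> g x \<and> g x \<le> 1) \<and> (\<integral>\<omega>. \<bar>g (\<lambda>i. Z i \<omega>) - indicator A \<omega>\<bar> \<partial>P) < e)"
  have gm: "(\<lambda>\<omega>. g (\<lambda>i. Z i \<omega>)) \<in> borel_measurable P" if "g \<in> C_bLip n" for g by (rule C_bLip_borel[OF that Z])
  have AP: "A \<in> sigma_sets (space P) {{\<omega> \<in> space P. Z i \<omega> \<le> a} | i a. i < n} \<Longrightarrow> A \<in> sets P" for A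
    using gen_subalgebra[where Z = Z and P = P and n = n, OF Z] unfolding subalgebra_def gen_simps by auto
  have int: "integrable P (\<lambda>\<omega>. \<bar>g (\<lambda>i. Z i \<omega>) - indicator A \<omega>\<bar>)"
    if "g \<in> C_bLip n" "\<forall>x. 0 \<le> g x \<and> g x \<le> 1" "A \<in> sets P" for g A
  proof (rule integrable_const_bound[of _ 1])
    show "AE \<omega> in P. norm \<bar>g (\<lambda>i. Z i \<omega>) - indicator A \<omega>\<bar> \<le> 1"
    proof (rule AE_I2)
      fix \<omega> show "norm \<bar>g (\<lambda>i. Z i \<omega>) - indicator A \<omega>\<bar> \<le> 1"
        using that(2)[rule_format, of "\<lambda>i. Z i \<omega>"] by (auto simp: indicator_def abs_if)
    qed
  qed (use gm[OF that(1)] that(3) in measurable)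
  have "A \<in> sigma_sets (space P) {{\<omega> \<in> space P. Z i \<omega> \<le> a} | i a. i < n} \<Longrightarrow> 0 < e \<Longrightarrow> ok A e"
  proof (induction arbitrary: e rule: sigma_sets.induct)
    case (Basic A)
    then obtain i a where ia: "i < n" "A = {\<omega> \<in> space P. Z i \<omega> \<le> a}" by auto
    define g where "g = (\<lambda>k x. clamp01 (1 - real k * (x i - a)))"
    have gC: "g k \<in> C_bLip n" for k unfolding g_def
      by (intro clamp_C_bLip lipf_diff lipf_const lipf_scale lipf_coord ia)
    have A: "A \<in> sets P" using Basic AP by (auto intro: sigma_sets.Basic)
    have "(\<lambda>k. \<integral>\<omega>. \<bar>g k (\<lambda>i. Z i \<omega>) - indicator A \<omega>\<bar> \<partial>P) \<longlonglongrightarrow> (\<integral>\<omega>. 0 \<partial>P)"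
    proof (rule integral_dominated_convergence[where w = "\<lambda>_. 1"])
      show "AE \<omega> in P. (\<lambda>k. \<bar>g k (\<lambda>i. Z i \<omega>) - indicator A \<omega>\<bar>) \<longlonglongrightarrow> 0"
      proof (rule AE_I2)
        fix \<omega> assume \<omega>: "\<omega> \<in> space P"
        have "eventually (\<lambda>k. \<bar>g k (\<lambda>i. Z i \<omega>) - indicator A \<omega>\<bar> = 0) sequentially"
        proof (cases "Z i \<omega> \<le> a")
          case True
          hence "real k * (Z i \<omega> - a) \<le> 0" for k by (simp add: mult_nonneg_nonpos)
          hence "1 \<le> 1 - real k * (Z i \<omega> - a)" for k by (metis add_le_same_cancel1 diff_add_cancel le_diff_eq add.commute le_iff_diff_le_0 diff_ge_0_iff_ge diff_le_eq)
          hence "g k (\<lambda>i. Z i \<omega>) = 1" for k by (simp add: g_def clamp01_def)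
          thus ?thesis using True \<omega> by (simp add: ia indicator_def)
        next
          case False
          obtain K :: nat where K: "1 / (Z i \<omega> - a) \<le> real K" using real_arch_simple by blast
          show ?thesis using eventually_ge_at_top[of K]
          proof eventually_elim
            case (elim k)
            have "1 / (Z i \<omega> - a) \<le> real k" using K elim by (meson of_nat_le_iff order_trans)
            hence "1 \<le> real k * (Z i \<omega> - a)" using False by (simp add: divide_le_eq)
            thus ?case using False by (simp add: g_def clamp01_def ia indicator_def)
          qed
        qed
        thus "(\<lambda>k. \<bar>g k (\<lambda>i. Z i \<omega>) - indicator A \<omega>\<bar>) \<longlonglongrightarrow> 0" by (rule tendsto_eventually)
      qed
      show "AE \<omega> in P. norm \<bar>g k (\<lambda>i. Z i \<omega>) - indicator A \<omega>\<bar> \<le> 1" for k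
      proof (rule AE_I2)
        fix \<omega> show "norm \<bar>g k (\<lambda>i. Z i \<omega>) - indicator A \<omega>\<bar> \<le> 1"
          using clamp01[of "1 - real k * (Z i \<omega> - a)"] by (auto simp: g_def indicator_def abs_if)
      qed
    qed (use gm[OF gC] A in measurable)
    hence "eventually (\<lambda>k. (\<integral>\<omega>. \<bar>g k (\<lambda>i. Z i \<omega>) - indicator A \<omega>\<bar> \<partial>P) < e) sequentially"
      using Basic by (intro order_tendstoD(2)) auto
    then obtain k where "(\<integral>\<omega>. \<bar>g k (\<lambda>i. Z i \<omega>) - indicator A \<omega>\<bar> \<partial>P) < e" by (auto simp: eventually_sequentially)
    thus ?case unfolding ok_def using gC[of k] clamp01 by (intro bexI[of _ "g k"]) (auto simp: g_def)
  next
    case Empty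
    have "(\<lambda>x. clamp01 0) \<in> C_bLip n" by (intro clamp_C_bLip lipf_const)
    thus ?case unfolding ok_def using Empty by (intro bexI[of _ "\<lambda>x. clamp01 0"]) (auto simp: clamp01_def)
  next
    case (Compl A)
    then obtain g where g: "g \<in> C_bLip n" "\<forall>x. 0 \<le> g x \<and> g x \<le> 1" "(\<integral>\<omega>. \<bar>g (\<lambda>i. Z i \<omega>) - indicator A \<omega>\<bar> \<partial>P) < e"
      unfolding ok_def by blast
    have "(\<lambda>x. 1 - g x) \<in> C_bLip n" using g unfolding C_bLip_iff
      by (intro conjI lipf_diff lipf_const exI[of _ 1]) (auto simp: abs_le_iff intro: order_trans[of _ 0])
    moreover have "(\<integral>\<omega>. \<bar>1 - g (\<lambda>i. Z i \<omega>) - indicator (space P - A) \<omega>\<bar> \<partial>P) = (\<integral>\<omega>. \<bar>g (\<lambda>i. Z i \<omega>) - indicator A \<omega>\<bar> \<partial>P)"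
      by (rule Bochner_Integration.integral_cong) (auto simp: indicator_def)
    ultimately show ?case unfolding ok_def using g by (intro bexI[of _ "\<lambda>x. 1 - g x"]) auto
  next
    case (Union A)
    have AiP: "A i \<in> sets P" for i using Union AP by auto
    have fin: "0 < e \<Longrightarrow> ok (\<Union>i<N. A i) e" for N e
    proof (induction N arbitrary: e)
      case 0
      have "(\<lambda>x. clamp01 0) \<in> C_bLip n" by (intro clamp_C_bLip lipf_const)
      thus ?case unfolding ok_def using 0 by (intro bexI[of _ "\<lambda>x. clamp01 0"]) (auto simp: clamp01_def)
    next
      case (Suc N)
      have "ok (\<Union>i<N. A i) (e/2)" "ok (A N) (e/2)" using Suc Union.IH by auto
      then obtain g h where g: "g \<in> C_bLip n" "\<forall>x. 0 \<le> g x \<and> g x \<le> 1" "(\<integral>\<omega>. \<bar>g (\<lambda>i. Z i \<omega>) - indicator (\<Union>i<N. A i) \<omega>\<bar> \<partial>P) < e/2"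
        and h: "h \<in> C_bLip n" "\<forall>x. 0 \<le> h x \<and> h x \<le> 1" "(\<integral>\<omega>. \<bar>h (\<lambda>i. Z i \<omega>) - indicator (A N) \<omega>\<bar> \<partial>P) < e/2"
        unfolding ok_def by blast
      have k1: "\<forall>x. 0 \<le> max (g x) (h x) \<and> max (g x) (h x) \<le> 1" using g h by (auto simp: le_max_iff_disj)
      hence "\<forall>x. \<bar>max (g x) (h x)\<bar> \<le> 1" by (metis abs_of_nonneg)
      hence k: "(\<lambda>x. max (g x) (h x)) \<in> C_bLip n" using g h unfolding C_bLip_iff
        by (intro conjI lipf_max) auto
      have UP: "(\<Union>i<N. A i) \<in> sets P" "(\<Union>i<Suc N. A i) \<in> sets P" using AiP by auto
      have "(\<integral>\<omega>. \<bar>max (g (\<lambda>i. Z i \<omega>)) (h (\<lambda>i. Z i \<omega>)) - indicator (\<Union>i<Suc N. A i) \<omega>\<bar> \<partial>P)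
        \<le> (\<integral>\<omega>. \<bar>g (\<lambda>i. Z i \<omega>) - indicator (\<Union>i<N. A i) \<omega>\<bar> + \<bar>h (\<lambda>i. Z i \<omega>) - indicator (A N) \<omega>\<bar> \<partial>P)"
      proof (rule integral_mono)
        fix \<omega>
        have "indicator (\<Union>i<Suc N. A i) \<omega> = max (indicator (\<Union>i<N. A i) \<omega>) (indicator (A N) \<omega> :: real)"
          by (auto simp: indicator_def less_Suc_eq)
        thus "\<bar>max (g (\<lambda>i. Z i \<omega>)) (h (\<lambda>i. Z i \<omega>)) - indicator (\<Union>i<Suc N. A i) \<omega>\<bar>
          \<le> \<bar>g (\<lambda>i. Z i \<omega>) - indicator (\<Union>i<N. A i) \<omega>\<bar> + \<bar>h (\<lambda>i. Z i \<omega>) - indicator (A N) \<omega>\<bar>" by linarith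
      qed (use int[OF k k1 UP(2)] int[OF g(1,2) UP(1)] int[OF h(1,2) AiP] in auto)
      also have "\<dots> < e"
        unfolding Bochner_Integration.integral_add[OF int[OF g(1,2) UP(1)] int[OF h(1,2) AiP]]
        using add_strict_mono[OF g(3) h(3)] by (simp only: field_sum_of_halves)
      finally show ?case unfolding ok_def by (intro bexI[OF _ k] conjI k1)
    qed
    have "(\<lambda>N. prob (\<Union>i<N. A i)) \<longlonglongrightarrow> prob (\<Union>N. \<Union>i<N. A i)"
      using AiP by (intro finite_Lim_measure_incseq incseq_SucI) (auto simp: less_Suc_eq)
    also have "(\<Union>N. \<Union>i<N. A i) = (\<Union>i. A i)" by auto
    finally have "eventually (\<lambda>N. prob (\<Union>i. A i) - e/2 < prob (\<Union>i<N. A i)) sequentially"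
      using Union.prems by (intro order_tendstoD(1)) auto
    then obtain N where N: "prob (\<Union>i. A i) - e/2 < prob (\<Union>i<N. A i)" by (auto simp: eventually_sequentially)
    have UP: "(\<Union>i<N. A i) \<in> sets P" "(\<Union>i. A i) \<in> sets P" using AiP by auto
    obtain g where g: "g \<in> C_bLip n" "\<forall>x. 0 \<le> g x \<and> g x \<le> 1" "(\<integral>\<omega>. \<bar>g (\<lambda>i. Z i \<omega>) - indicator (\<Union>i<N. A i) \<omega>\<bar> \<partial>P) < e/2"
      using fin[of "e/2" N] Union.prems unfolding ok_def by auto
    have i2: "integrable P (indicator ((\<Union>i. A i) - (\<Union>i<N. A i)) :: _ \<Rightarrow> real)"
      using UP by (intro integrable_real_indicator) (auto simp: emeasure_eq_measure)
    have "(\<integral>\<omega>. \<bar>g (\<lambda>i. Z i \<omega>) - indicator (\<Union>i. A i) \<omega>\<bar> \<partial>P)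
      \<le> (\<integral>\<omega>. \<bar>g (\<lambda>i. Z i \<omega>) - indicator (\<Union>i<N. A i) \<omega>\<bar> + indicator ((\<Union>i. A i) - (\<Union>i<N. A i)) \<omega> \<partial>P)"
    proof (rule integral_mono)
      fix \<omega> show "\<bar>g (\<lambda>i. Z i \<omega>) - indicator (\<Union>i. A i) \<omega>\<bar>
        \<le> \<bar>g (\<lambda>i. Z i \<omega>) - indicator (\<Union>i<N. A i) \<omega>\<bar> + indicator ((\<Union>i. A i) - (\<Union>i<N. A i)) \<omega>"
        by (rule abs_diff_indicator_mono) auto
    qed (use int[OF g(1,2) UP(1)] int[OF g(1,2) UP(2)] i2 in auto)
    also have "\<dots> = (\<integral>\<omega>. \<bar>g (\<lambda>i. Z i \<omega>) - indicator (\<Union>i<N. A i) \<omega>\<bar> \<partial>P) + prob ((\<Union>i. A i) - (\<Union>i<N. A i))"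
      unfolding Bochner_Integration.integral_add[OF int[OF g(1,2) UP(1)] i2] using UP by simp
    also have "prob ((\<Union>i. A i) - (\<Union>i<N. A i)) = prob (\<Union>i. A i) - prob (\<Union>i<N. A i)"
      using UP by (intro finite_measure_Diff) auto
    finally have "(\<integral>\<omega>. \<bar>g (\<lambda>i. Z i \<omega>) - indicator (\<Union>i. A i) \<omega>\<bar> \<partial>P)
      \<le> (\<integral>\<omega>. \<bar>g (\<lambda>i. Z i \<omega>) - indicator (\<Union>i<N. A i) \<omega>\<bar> \<partial>P) + (prob (\<Union>i. A i) - prob (\<Union>i<N. A i))" .
    also have "\<dots> < e / 2 + e / 2" using N by (intro add_strict_mono g(3)) linarith
    finally have "(\<integral>\<omega>. \<bar>g (\<lambda>i. Z i \<omega>) - indicator (\<Union>i. A i) \<omega>\<bar> \<partial>P) < e" by (simp only: field_sum_of_halves)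
    thus ?case unfolding ok_def using g(1,2) by blast
  qed
  thus ?thesis using A e unfolding ok_def gen_simps by blast
qed

text \<open>
  Independence is formulated with Lipschitz functions of the past. Approximation in mean transfers
  an inequality to indicators of past events, and linearity with monotone limits to all bounded
  weights.
\<close>

lemma lip_weights_extend:
  assumes P: "prob_space P" and Z: "\<And>i. Z i \<in> borel_measurable P"
    and psi: "\<psi> \<in> borel_measurable P" "\<And>\<omega>. \<bar>\<psi> \<omega>\<bar> \<le> b"
    and lip: "\<And>g. g \<in> C_bLip n \<Longrightarrow> (\<And>x. 0 \<le> g x \<and> g x \<le> 1) \<Longrightarrow> (\<integral>\<omega>. g (\<lambda>i. Z i \<omega>) * \<psi> \<omega> \<partial>P) \<le> c * (\<integral>\<omega>. g (\<lambda>i. Z i \<omega>) \<partial>P)"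
    and h: "h \<in> borel_measurable (gen P Z n)" "\<And>\<omega>. 0 \<le> h \<omega> \<and> h \<omega> \<le> B"
  shows "(\<integral>\<omega>. h \<omega> * \<psi> \<omega> \<partial>P) \<le> c * (\<integral>\<omega>. h \<omega> \<partial>P)"
proof -
  interpret prob_space P by fact
  define ps where "ps = (\<lambda>\<omega>. \<psi> \<omega> - c)"
  define b' where "b' = b + \<bar>c\<bar>"
  have [measurable]: "\<psi> \<in> borel_measurable P" by fact
  have ps[measurable]: "ps \<in> borel_measurable P" unfolding ps_def by measurable
  have psb: "\<bar>ps \<omega>\<bar> \<le> b'" for \<omega> using psi(2)[of \<omega>] unfolding ps_def b'_def by linarith
  have b'0: "0 \<le> b'" using psb[of undefined] by linarith
  have sub: "k \<in> borel_measurable (gen P Z n) \<Longrightarrow> k \<in> borel_measurable P" for k :: "'a \<Rightarrow> real"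
    by (rule measurable_from_subalg[OF gen_subalgebra[where Z = Z and P = P, OF Z]])
  have int1: "integrable P k" if "k \<in> borel_measurable P" "\<And>\<omega>. 0 \<le> k \<omega> \<and> k \<omega> \<le> B" for k :: "'a \<Rightarrow> real" and B
    by (rule integrable_const_bound[of _ B]) (use that in auto)
  have int: "integrable P (\<lambda>\<omega>. k \<omega> * ps \<omega>)" if [measurable]: "k \<in> borel_measurable P" and kb: "\<And>\<omega>. 0 \<le> k \<omega> \<and> k \<omega> \<le> B" for k B
  proof (rule integrable_const_bound[of _ "B * b'"])
    show "AE \<omega> in P. norm (k \<omega> * ps \<omega>) \<le> B * b'"
    proof (rule AE_I2)
      fix \<omega> have "0 \<le> B" using kb[of \<omega>] by linarith
      thus "norm (k \<omega> * ps \<omega>) \<le> B * b'"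
        unfolding real_norm_def abs_mult using kb[of \<omega>] psb[of \<omega>] by (intro mult_mono) auto
    qed
  qed measurable
  have set_le: "(\<integral>\<omega>. indicator A \<omega> * ps \<omega> \<partial>P) \<le> 0" if A: "A \<in> sets (gen P Z n)" for A
  proof (rule field_le_epsilon)
    fix e :: real assume e: "0 < e"
    have AP[measurable]: "A \<in> sets P" using A gen_subalgebra[where Z = Z and P = P and n = n, OF Z] by (auto simp: subalgebra_def)
    have "0 < e / (b' + 1)" using e b'0 by simp
    from lip_approximates_generated_sets[where Z = Z, OF P Z A this] obtain g where g: "g \<in> C_bLip n" "\<And>x. 0 \<le> g x \<and> g x \<le> 1"
      and ge: "(\<integral>\<omega>. \<bar>g (\<lambda>i. Z i \<omega>) - indicator A \<omega>\<bar> \<partial>P) < e / (b' + 1)" by blast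
    have gm[measurable]: "(\<lambda>\<omega>. g (\<lambda>i. Z i \<omega>)) \<in> borel_measurable P" by (rule C_bLip_borel[OF g(1) Z])
    have i1: "integrable P (\<lambda>\<omega>. g (\<lambda>i. Z i \<omega>) * ps \<omega>)" by (rule int[OF gm, of 1]) (use g in auto)
    have i2: "integrable P (\<lambda>\<omega>. \<bar>g (\<lambda>i. Z i \<omega>) - indicator A \<omega>\<bar>)"
    proof (rule int1[of _ 1])
      fix \<omega> show "0 \<le> \<bar>g (\<lambda>i. Z i \<omega>) - indicator A \<omega>\<bar> \<and> \<bar>g (\<lambda>i. Z i \<omega>) - indicator A \<omega>\<bar> \<le> 1"
        using g(2)[of "\<lambda>i. Z i \<omega>"] by (auto simp: indicator_def abs_if)
    qed measurable
    have "(\<integral>\<omega>. indicator A \<omega> * ps \<omega> \<partial>P) \<le> (\<integral>\<omega>. g (\<lambda>i. Z i \<omega>) * ps \<omega> + b' * \<bar>g (\<lambda>i. Z i \<omega>) - indicator A \<omega>\<bar> \<partial>P)"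
    proof (rule integral_mono)
      fix \<omega>
      have "(indicator A \<omega> - g (\<lambda>i. Z i \<omega>)) * ps \<omega> \<le> \<bar>indicator A \<omega> - g (\<lambda>i. Z i \<omega>)\<bar> * \<bar>ps \<omega>\<bar>"
        by (metis abs_ge_self abs_mult)
      also have "\<dots> \<le> \<bar>indicator A \<omega> - g (\<lambda>i. Z i \<omega>)\<bar> * b'" using psb by (intro mult_left_mono) auto
      finally show "indicator A \<omega> * ps \<omega> \<le> g (\<lambda>i. Z i \<omega>) * ps \<omega> + b' * \<bar>g (\<lambda>i. Z i \<omega>) - indicator A \<omega>\<bar>"
        by (simp add: algebra_simps abs_minus_commute)
    next
      show "integrable P (\<lambda>\<omega>. indicator A \<omega> * ps \<omega>)" by (rule int[of _ 1]) (auto simp: indicator_def)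
      show "integrable P (\<lambda>\<omega>. g (\<lambda>i. Z i \<omega>) * ps \<omega> + b' * \<bar>g (\<lambda>i. Z i \<omega>) - indicator A \<omega>\<bar>)"
        using i1 i2 by (intro Bochner_Integration.integrable_add integrable_mult_right)
    qed
    also have "\<dots> = (\<integral>\<omega>. g (\<lambda>i. Z i \<omega>) * ps \<omega> \<partial>P) + b' * (\<integral>\<omega>. \<bar>g (\<lambda>i. Z i \<omega>) - indicator A \<omega>\<bar> \<partial>P)" using i1 i2 by simp
    also have "(\<integral>\<omega>. g (\<lambda>i. Z i \<omega>) * ps \<omega> \<partial>P) \<le> 0"
    proof -
      have ig: "integrable P (\<lambda>\<omega>. g (\<lambda>i. Z i \<omega>))" by (rule int1[OF gm, of 1]) (use g in auto)
      have "(\<lambda>\<omega>. g (\<lambda>i. Z i \<omega>) * \<psi> \<omega>) = (\<lambda>\<omega>. g (\<lambda>i. Z i \<omega>) * ps \<omega> + c * g (\<lambda>i. Z i \<omega>))"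
        by (auto simp: ps_def algebra_simps)
      hence "(\<integral>\<omega>. g (\<lambda>i. Z i \<omega>) * \<psi> \<omega> \<partial>P) = (\<integral>\<omega>. g (\<lambda>i. Z i \<omega>) * ps \<omega> \<partial>P) + c * (\<integral>\<omega>. g (\<lambda>i. Z i \<omega>) \<partial>P)"
        using i1 ig by simp
      thus ?thesis using lip[OF g] by simp
    qed
    also have "b' * (\<integral>\<omega>. \<bar>g (\<lambda>i. Z i \<omega>) - indicator A \<omega>\<bar> \<partial>P) \<le> b' * (e / (b' + 1))" using ge b'0 by (intro mult_left_mono) auto
    also have "\<dots> \<le> e" using b'0 e by (simp add: field_simps)
    finally show "(\<integral>\<omega>. indicator A \<omega> * ps \<omega> \<partial>P) \<le> 0 + e" by simp
  qed
  have h0: "\<And>\<omega>. 0 \<le> h \<omega>" using h by auto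
  have "\<forall>B. (\<forall>\<omega>\<in>space P. h \<omega> \<le> B) \<longrightarrow> (\<integral>\<omega>. h \<omega> * ps \<omega> \<partial>P) \<le> 0"
    using h(1) h0
  proof (induction rule: borel_measurable_induct_real)
    case (set A) thus ?case using set_le by blast
  next
    case (mult k d)
    show ?case
    proof (cases "d = 0")
      case False
      have "(\<forall>\<omega>\<in>space P. d * k \<omega> \<le> B) \<longrightarrow> (\<integral>\<omega>. d * k \<omega> * ps \<omega> \<partial>P) \<le> 0" for B
      proof
        assume "\<forall>\<omega>\<in>space P. d * k \<omega> \<le> B"
        hence "\<forall>\<omega>\<in>space P. k \<omega> \<le> B / d" using mult False by (simp add: field_simps)
        hence "(\<integral>\<omega>. k \<omega> * ps \<omega> \<partial>P) \<le> 0" using mult by blast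
        thus "(\<integral>\<omega>. d * k \<omega> * ps \<omega> \<partial>P) \<le> 0" using mult by (simp add: mult.assoc mult_nonneg_nonpos)
      qed
      thus ?thesis by blast
    qed simp
  next
    case (add k k')
    show ?case
    proof (intro allI impI)
      fix B assume B: "\<forall>\<omega>\<in>space P. k' \<omega> + k \<omega> \<le> B"
      have kB: "\<forall>\<omega>\<in>space P. k \<omega> \<le> B" "\<forall>\<omega>\<in>space P. k' \<omega> \<le> B"
      proof (safe)
        fix \<omega> assume "\<omega> \<in> space P"
        hence "k' \<omega> + k \<omega> \<le> B" using B by blast
        thus "k \<omega> \<le> B" "k' \<omega> \<le> B" using add.hyps(2)[of \<omega>] add.hyps(4)[of \<omega>] by linarith+
      qed
      have I: "integrable P (\<lambda>\<omega>. k \<omega> * ps \<omega>)" if "k \<in> borel_measurable (gen P Z n)" "\<And>\<omega>. 0 \<le> k \<omega>" "\<forall>\<omega>\<in>space P. k \<omega> \<le> B" for k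
      proof (rule integrable_const_bound[of _ "B * b'"])
        show "(\<lambda>\<omega>. k \<omega> * ps \<omega>) \<in> borel_measurable P" using sub[OF that(1)] by measurable
        show "AE \<omega> in P. norm (k \<omega> * ps \<omega>) \<le> B * b'"
        proof (rule AE_I2)
          fix \<omega> assume "\<omega> \<in> space P"
          hence "k \<omega> \<le> B" "0 \<le> B" using that(2)[of \<omega>] that(3) by (auto intro: order_trans)
          thus "norm (k \<omega> * ps \<omega>) \<le> B * b'" unfolding real_norm_def abs_mult using that(2)[of \<omega>] psb[of \<omega>] by (intro mult_mono) auto
        qed
      qed
      have "(\<integral>\<omega>. k \<omega> * ps \<omega> \<partial>P) \<le> 0" "(\<integral>\<omega>. k' \<omega> * ps \<omega> \<partial>P) \<le> 0" using add kB by blast+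
      thus "(\<integral>\<omega>. (k' \<omega> + k \<omega>) * ps \<omega> \<partial>P) \<le> 0"
        using I[OF add.hyps(1,2) kB(1)] I[OF add.hyps(3,4) kB(2)] by (simp add: distrib_right)
    qed
  next
    case (seq U)
    show ?case
    proof (intro allI impI)
      fix B assume B: "\<forall>\<omega>\<in>space P. h \<omega> \<le> B"
      have Ule: "U i \<omega> \<le> h \<omega>" if "\<omega> \<in> space P" for i \<omega>
        using seq.hyps(3) seq.hyps(4)[of \<omega>] that by (intro incseq_le) (auto simp: incseq_def le_fun_def gen_simps)
      have "(\<lambda>i. \<integral>\<omega>. U i \<omega> * ps \<omega> \<partial>P) \<longlonglongrightarrow> (\<integral>\<omega>. h \<omega> * ps \<omega> \<partial>P)"
      proof (rule integral_dominated_convergence[where w = "\<lambda>_. B * b'"])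
        show "AE \<omega> in P. (\<lambda>i. U i \<omega> * ps \<omega>) \<longlonglongrightarrow> h \<omega> * ps \<omega>"
          using seq.hyps(4) by (intro AE_I2 tendsto_mult tendsto_const) (auto simp: gen_simps)
        show "AE \<omega> in P. norm (U i \<omega> * ps \<omega>) \<le> B * b'" for i
        proof (rule AE_I2)
          fix \<omega> assume w: "\<omega> \<in> space P"
          have "U i \<omega> \<le> B" "0 \<le> B" using Ule[OF w, of i] B w seq.hyps(2)[of i \<omega>] by (auto intro: order_trans)
          thus "norm (U i \<omega> * ps \<omega>) \<le> B * b'" unfolding real_norm_def abs_mult using seq.hyps(2)[of i \<omega>] psb[of \<omega>] by (intro mult_mono) auto
        qed
        show "(\<lambda>\<omega>. h \<omega> * ps \<omega>) \<in> borel_measurable P" using sub[OF h(1)] by measurable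
        show "(\<lambda>\<omega>. U i \<omega> * ps \<omega>) \<in> borel_measurable P" for i using sub[OF seq.hyps(1)[of i]] by measurable
      qed auto
      moreover have "(\<integral>\<omega>. U i \<omega> * ps \<omega> \<partial>P) \<le> 0" for i
      proof -
        have "\<forall>\<omega>\<in>space P. U i \<omega> \<le> B" using Ule B by (meson order_trans)
        thus ?thesis using seq.IH[of i] by blast
      qed
      ultimately show "(\<integral>\<omega>. h \<omega> * ps \<omega> \<partial>P) \<le> 0" by (intro LIMSEQ_le_const2[of _ _ 0]) auto
    qed
  qed
  hence "(\<integral>\<omega>. h \<omega> * ps \<omega> \<partial>P) \<le> 0" using h(2) by blast
  moreover have "(\<integral>\<omega>. h \<omega> * \<psi> \<omega> \<partial>P) = (\<integral>\<omega>. h \<omega> * ps \<omega> \<partial>P) + c * (\<integral>\<omega>. h \<omega> \<partial>P)"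
  proof -
    have "(\<lambda>\<omega>. h \<omega> * \<psi> \<omega>) = (\<lambda>\<omega>. h \<omega> * ps \<omega> + c * h \<omega>)" by (auto simp: ps_def algebra_simps)
    thus ?thesis using int[OF sub[OF h(1)] h(2)] int1[OF sub[OF h(1)] h(2)] by simp
  qed
  ultimately show ?thesis by simp
qed


section \<open>Processes controlled by Lipschitz weights\<close>

lemma trunc_bounds: "0 \<le> c \<Longrightarrow> \<bar>trunc c y\<bar> \<le> c" "0 \<le> c \<Longrightarrow> \<bar>trunc c y\<bar> \<le> \<bar>y\<bar>"
  unfolding trunc_def by auto

lemma trunc_tendsto: "(\<lambda>k. trunc (real k) y) \<longlonglongrightarrow> y"
proof (rule tendsto_eventually)
  obtain K :: nat where K: "\<bar>y\<bar> \<le> real K" using real_arch_simple by blast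
  show "eventually (\<lambda>k. trunc (real k) y = y) sequentially"
    using eventually_ge_at_top[of K]
  proof eventually_elim
    case (elim k)
    have "\<bar>y\<bar> \<le> real k" using K elim by (meson of_nat_le_iff order_trans)
    thus ?case by (auto simp: trunc_def)
  qed
qed

lemma min_square_tendsto: "(\<lambda>k. min (y\<^sup>2) (real k)) \<longlonglongrightarrow> (y::real)\<^sup>2"
proof (rule tendsto_eventually)
  obtain K :: nat where K: "y\<^sup>2 \<le> real K" using real_arch_simple by blast
  show "eventually (\<lambda>k. min (y\<^sup>2) (real k) = y\<^sup>2) sequentially"
    using eventually_ge_at_top[of K]
  proof eventually_elim
    case (elim k)
    have "y\<^sup>2 \<le> real k" using K elim by (meson of_nat_le_iff order_trans)
    thus ?case by simp
  qed
qed

lemma integrable_of_truncated_bound: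
  assumes P: "prob_space P" and Z[measurable]: "Z \<in> borel_measurable P"
    and b: "\<And>k::nat. (\<integral>\<omega>. min ((Z \<omega>)\<^sup>2) (real k) \<partial>P) \<le> u"
  shows "integrable P (\<lambda>\<omega>. (Z \<omega> :: real)\<^sup>2)" "(\<integral>\<omega>. (Z \<omega>)\<^sup>2 \<partial>P) \<le> u"
proof -
  interpret prob_space P by fact
  have int: "integrable P (\<lambda>\<omega>. min ((Z \<omega>)\<^sup>2) (real k))" for k
    by (rule integrable_const_bound[of _ "real k"]) auto
  have mono: "mono (\<lambda>k. min ((Z \<omega>)\<^sup>2) (real k))" for \<omega> by (auto simp: mono_def)
  define I where "I = (\<lambda>k. \<integral>\<omega>. min ((Z \<omega>)\<^sup>2) (real k) \<partial>P)"
  have "incseq I" unfolding I_def incseq_def using int by (auto intro!: integral_mono)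
  moreover have "bdd_above (range I)" using b unfolding I_def by (auto intro!: bdd_aboveI)
  ultimately have I: "I \<longlonglongrightarrow> (SUP k. I k)" by (rule LIMSEQ_incseq_SUP[rotated])
  have "(SUP k. I k) \<le> u" using b unfolding I_def by (intro cSUP_least) auto
  moreover have "has_bochner_integral P (\<lambda>\<omega>. (Z \<omega>)\<^sup>2) (SUP k. I k)"
    using integrable_monotone_convergence[of P "\<lambda>k \<omega>. min ((Z \<omega>)\<^sup>2) (real k)" "\<lambda>\<omega>. (Z \<omega>)\<^sup>2" "SUP k. I k"]
      integral_monotone_convergence[of P "\<lambda>k \<omega>. min ((Z \<omega>)\<^sup>2) (real k)" "\<lambda>\<omega>. (Z \<omega>)\<^sup>2" "SUP k. I k"]
      int mono I min_square_tendsto unfolding I_def by (simp add: has_bochner_integral_iff)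
  ultimately show "integrable P (\<lambda>\<omega>. (Z \<omega> :: real)\<^sup>2)" "(\<integral>\<omega>. (Z \<omega>)\<^sup>2 \<partial>P) \<le> u"
    by (auto simp: has_bochner_integral_iff)
qed

text \<open>
  What independence gives directly: bounds for truncated functions of \<open>Z n\<close> against Lipschitz
  weights of the past. Here \<open>a c\<close> bounds the drift left by truncation at \<open>c\<close>, for both signs.
\<close>

locale lip_process =
  fixes P :: "'a measure" and Z :: "nat \<Rightarrow> 'a \<Rightarrow> real" and u :: "nat \<Rightarrow> real" and w a :: "real \<Rightarrow> real"
  assumes prob: "prob_space P" and Z: "\<And>i. Z i \<in> borel_measurable P"
    and mean1: "\<And>n g c. g \<in> C_bLip n \<Longrightarrow> (\<And>x. 0 \<le> g x \<and> g x \<le> 1) \<Longrightarrow> 0 < c \<Longrightarrow>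
      (\<integral>\<omega>. g (\<lambda>i. Z i \<omega>) * trunc c (Z n \<omega>) \<partial>P) \<le> a c * (\<integral>\<omega>. g (\<lambda>i. Z i \<omega>) \<partial>P)"
    and mean2: "\<And>n g c. g \<in> C_bLip n \<Longrightarrow> (\<And>x. 0 \<le> g x \<and> g x \<le> 1) \<Longrightarrow> 0 < c \<Longrightarrow>
      (\<integral>\<omega>. g (\<lambda>i. Z i \<omega>) * trunc c (- Z n \<omega>) \<partial>P) \<le> a c * (\<integral>\<omega>. g (\<lambda>i. Z i \<omega>) \<partial>P)"
    and a: "(a \<longlongrightarrow> 0) at_top"
    and var: "\<And>n g c. g \<in> C_bLip n \<Longrightarrow> (\<And>x. 0 \<le> g x \<and> g x \<le> 1) \<Longrightarrow> 0 < c \<Longrightarrow>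
      (\<integral>\<omega>. g (\<lambda>i. Z i \<omega>) * min ((Z n \<omega>)\<^sup>2) c \<partial>P) \<le> u n * (\<integral>\<omega>. g (\<lambda>i. Z i \<omega>) \<partial>P)"
    and tail: "\<And>n g y. g \<in> C_bLip n \<Longrightarrow> (\<And>x. 0 \<le> g x \<and> g x \<le> 1) \<Longrightarrow> 0 < y \<Longrightarrow>
      (\<integral>\<omega>. g (\<lambda>i. Z i \<omega>) * min (\<bar>Z n \<omega>\<bar> / y) 1 ^ 4 \<partial>P) \<le> w y * (\<integral>\<omega>. g (\<lambda>i. Z i \<omega>) \<partial>P)"
begin

lemma min_bound: "0 < c \<Longrightarrow> \<bar>min ((y::real)\<^sup>2) c\<bar> \<le> c" by auto

lemma mds: "mds P (gen P Z) Z u w"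
proof -
  interpret prob_space P by (rule prob)
  note [measurable] = Z
  have sub: "k \<in> borel_measurable (gen P Z n) \<Longrightarrow> k \<in> borel_measurable P" for k :: "'a \<Rightarrow> real" and n
    by (rule measurable_from_subalg[OF gen_subalgebra[OF Z]])
  have tm: "(\<lambda>\<omega>. trunc c (Z n \<omega>)) \<in> borel_measurable P" "(\<lambda>\<omega>. trunc c (- Z n \<omega>)) \<in> borel_measurable P" for c n
    unfolding trunc_def by measurable
  have var': "(\<integral>\<omega>. h \<omega> * min ((Z n \<omega>)\<^sup>2) c \<partial>P) \<le> u n * (\<integral>\<omega>. h \<omega> \<partial>P)"
    if "h \<in> borel_measurable (gen P Z n)" "\<And>\<omega>. 0 \<le> h \<omega> \<and> h \<omega> \<le> B" "0 < c" for h B c n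
    by (rule lip_weights_extend[where b = c, OF prob Z _ min_bound var that(1,2)]) (use that in measurable)
  have var1: "(\<integral>\<omega>. min ((Z n \<omega>)\<^sup>2) (real k) \<partial>P) \<le> max 0 (u n)" for n k
  proof (cases "k = 0")
    case False
    thus ?thesis using var'[of "\<lambda>_. 1" n 1 "real k"] prob_space by simp
  qed (simp add: min_absorb2)
  show ?thesis
  proof
    show "subalgebra P (gen P Z n)" for n by (rule gen_subalgebra[OF Z])
    show "m \<le> n \<Longrightarrow> sets (gen P Z m) \<subseteq> sets (gen P Z n)" for m n by (rule gen_mono)
    show "Z n \<in> borel_measurable (gen P Z (Suc n))" for n by (rule gen_measurable) simp
    show sq: "integrable P (\<lambda>\<omega>. (Z n \<omega>)\<^sup>2)" for n
      by (rule integrable_of_truncated_bound(1)[OF prob Z var1])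
    have iZ: "integrable P (Z n)" for n by (rule square_integrable_imp_integrable[OF Z sq])
    fix n and h :: "'a \<Rightarrow> real" and B assume h: "h \<in> borel_measurable (gen P Z n)" "\<And>\<omega>. 0 \<le> h \<omega> \<and> h \<omega> \<le> B"
    have hP[measurable]: "h \<in> borel_measurable P" by (rule sub[OF h(1)])
    have B: "0 \<le> B" using h(2)[of undefined] by linarith
    have dom: "norm (h \<omega> * x) \<le> B * y" if "\<bar>x\<bar> \<le> y" for x y \<omega>
      unfolding real_norm_def abs_mult using h(2)[of \<omega>] that B by (intro mult_mono) auto
    have ev: "eventually (\<lambda>k::nat. 0 < real k) sequentially" using eventually_gt_at_top[of 0] by eventually_elim simp
    have a': "(\<lambda>k. a (real k) * (\<integral>\<omega>. h \<omega> \<partial>P)) \<longlonglongrightarrow> 0 * (\<integral>\<omega>. h \<omega> \<partial>P)"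
      by (intro tendsto_mult tendsto_const filterlim_compose[OF a filterlim_real_sequentially])
    have "(\<lambda>k. \<integral>\<omega>. h \<omega> * trunc (real k) (Z n \<omega>) \<partial>P) \<longlonglongrightarrow> (\<integral>\<omega>. h \<omega> * Z n \<omega> \<partial>P)"
    proof (rule integral_dominated_convergence[where w = "\<lambda>\<omega>. B * \<bar>Z n \<omega>\<bar>"])
      show "AE \<omega> in P. norm (h \<omega> * trunc (real k) (Z n \<omega>)) \<le> B * \<bar>Z n \<omega>\<bar>" for k
        by (intro AE_I2 dom trunc_bounds) simp
      show "AE \<omega> in P. (\<lambda>k. h \<omega> * trunc (real k) (Z n \<omega>)) \<longlonglongrightarrow> h \<omega> * Z n \<omega>"
        by (intro AE_I2 tendsto_mult tendsto_const trunc_tendsto)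
      show "integrable P (\<lambda>\<omega>. B * \<bar>Z n \<omega>\<bar>)" using iZ by simp
      show "(\<lambda>\<omega>. h \<omega> * trunc (real k) (Z n \<omega>)) \<in> borel_measurable P" for k using tm by measurable
    qed measurable
    moreover have "eventually (\<lambda>k. (\<integral>\<omega>. h \<omega> * trunc (real k) (Z n \<omega>) \<partial>P) \<le> a (real k) * (\<integral>\<omega>. h \<omega> \<partial>P)) sequentially"
      using ev
    proof eventually_elim
      case (elim k)
      show ?case
        by (rule lip_weights_extend[where b = "real k", OF prob Z tm(1) _ mean1 h]) (use elim trunc_bounds in auto)
    qed
    ultimately have 1: "(\<integral>\<omega>. h \<omega> * Z n \<omega> \<partial>P) \<le> 0 * (\<integral>\<omega>. h \<omega> \<partial>P)" by (intro tendsto_le[OF _ a']) auto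
    have "(\<lambda>k. \<integral>\<omega>. h \<omega> * trunc (real k) (- Z n \<omega>) \<partial>P) \<longlonglongrightarrow> (\<integral>\<omega>. h \<omega> * - Z n \<omega> \<partial>P)"
    proof (rule integral_dominated_convergence[where w = "\<lambda>\<omega>. B * \<bar>- Z n \<omega>\<bar>"])
      show "AE \<omega> in P. norm (h \<omega> * trunc (real k) (- Z n \<omega>)) \<le> B * \<bar>- Z n \<omega>\<bar>" for k
        by (intro AE_I2 dom trunc_bounds) simp
      show "AE \<omega> in P. (\<lambda>k. h \<omega> * trunc (real k) (- Z n \<omega>)) \<longlonglongrightarrow> h \<omega> * - Z n \<omega>"
        by (intro AE_I2 tendsto_mult tendsto_const trunc_tendsto)
      show "integrable P (\<lambda>\<omega>. B * \<bar>- Z n \<omega>\<bar>)" using iZ by simp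
      show "(\<lambda>\<omega>. h \<omega> * trunc (real k) (- Z n \<omega>)) \<in> borel_measurable P" for k using tm by measurable
    qed measurable
    moreover have "eventually (\<lambda>k. (\<integral>\<omega>. h \<omega> * trunc (real k) (- Z n \<omega>) \<partial>P) \<le> a (real k) * (\<integral>\<omega>. h \<omega> \<partial>P)) sequentially"
      using ev
    proof eventually_elim
      case (elim k)
      show ?case
        by (rule lip_weights_extend[where b = "real k", OF prob Z tm(2) _ mean2 h]) (use elim trunc_bounds in auto)
    qed
    ultimately have 2: "(\<integral>\<omega>. h \<omega> * - Z n \<omega> \<partial>P) \<le> 0 * (\<integral>\<omega>. h \<omega> \<partial>P)" by (intro tendsto_le[OF _ a']) auto
    show "(\<integral>\<omega>. h \<omega> * Z n \<omega> \<partial>P) = 0" using 1 2 by simp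
    have "(\<lambda>k. \<integral>\<omega>. h \<omega> * min ((Z n \<omega>)\<^sup>2) (real k) \<partial>P) \<longlonglongrightarrow> (\<integral>\<omega>. h \<omega> * (Z n \<omega>)\<^sup>2 \<partial>P)"
    proof (rule integral_dominated_convergence[where w = "\<lambda>\<omega>. B * (Z n \<omega>)\<^sup>2"])
      show "AE \<omega> in P. norm (h \<omega> * min ((Z n \<omega>)\<^sup>2) (real k)) \<le> B * (Z n \<omega>)\<^sup>2" for k
        by (intro AE_I2 dom) auto
      show "AE \<omega> in P. (\<lambda>k. h \<omega> * min ((Z n \<omega>)\<^sup>2) (real k)) \<longlonglongrightarrow> h \<omega> * (Z n \<omega>)\<^sup>2"
        by (intro AE_I2 tendsto_mult tendsto_const min_square_tendsto)
      show "integrable P (\<lambda>\<omega>. B * (Z n \<omega>)\<^sup>2)" using sq by simp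
    qed measurable
    moreover have "eventually (\<lambda>k. (\<integral>\<omega>. h \<omega> * min ((Z n \<omega>)\<^sup>2) (real k) \<partial>P) \<le> u n * (\<integral>\<omega>. h \<omega> \<partial>P)) sequentially"
      using ev by eventually_elim (rule var'[OF h])
    ultimately show "(\<integral>\<omega>. h \<omega> * (Z n \<omega>)\<^sup>2 \<partial>P) \<le> u n * (\<integral>\<omega>. h \<omega> \<partial>P)"
      by (intro tendsto_upperbound) auto
    fix y :: real assume y: "0 < y"
    show "(\<integral>\<omega>. h \<omega> * min (\<bar>Z n \<omega>\<bar> / y) 1 ^ 4 \<partial>P) \<le> w y * (\<integral>\<omega>. h \<omega> \<partial>P)"
    proof (rule lip_weights_extend[where b = 1, OF prob Z _ _ tail h])
      fix \<omega>
      have "0 \<le> min (\<bar>Z n \<omega>\<bar> / y) 1" "min (\<bar>Z n \<omega>\<bar> / y) 1 \<le> 1" using y by auto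
      thus "\<bar>min (\<bar>Z n \<omega>\<bar> / y) 1 ^ 4\<bar> \<le> 1" by (simp add: power_le_one del: min_less_iff_conj)
    qed (use y in auto)
  qed
qed

lemma lowvar:
  assumes c: "0 < c" and low: "\<And>g. g \<in> C_bLip n \<Longrightarrow> (\<And>x. 0 \<le> g x \<and> g x \<le> 1) \<Longrightarrow>
      s * (\<integral>\<omega>. g (\<lambda>i. Z i \<omega>) \<partial>P) \<le> (\<integral>\<omega>. g (\<lambda>i. Z i \<omega>) * min ((Z n \<omega>)\<^sup>2) c \<partial>P)"
  shows "mds.lowvar P (gen P Z) Z n c s"
proof -
  interpret m: mds P "gen P Z" Z u w by (rule mds)
  note [measurable] = Z
  show ?thesis unfolding m.lowvar_def
  proof (intro allI impI)
    fix h :: "'a \<Rightarrow> real" and B assume h: "h \<in> borel_measurable (gen P Z n)" "\<forall>\<omega>. 0 \<le> h \<omega> \<and> h \<omega> \<le> B"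
    have "(\<integral>\<omega>. h \<omega> * - min ((Z n \<omega>)\<^sup>2) c \<partial>P) \<le> - s * (\<integral>\<omega>. h \<omega> \<partial>P)"
    proof (rule lip_weights_extend[where b = c, OF prob Z _ _ _ h(1)])
      fix g assume "g \<in> C_bLip n" "\<And>x. 0 \<le> g x \<and> g x \<le> 1"
      from low[OF this] show "(\<integral>\<omega>. g (\<lambda>i. Z i \<omega>) * - min ((Z n \<omega>)\<^sup>2) c \<partial>P) \<le> - s * (\<integral>\<omega>. g (\<lambda>i. Z i \<omega>) \<partial>P)" by simp
    qed (use h c in auto)
    thus "s * (\<integral>\<omega>. h \<omega> \<partial>P) \<le> (\<integral>\<omega>. h \<omega> * min ((Z n \<omega>)\<^sup>2) c \<partial>P)" by simp
  qed
qed

end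


section \<open>Independent sequences under a sublinear expectation\<close>

lemma C_bLip_lLip: "\<phi> \<in> C_bLip n \<Longrightarrow> \<phi> \<in> C_lLip n"
proof -
  assume "\<phi> \<in> C_bLip n"
  then obtain C where C: "0 \<le> C" "\<And>x y. \<bar>\<phi> x - \<phi> y\<bar> \<le> C * L2_set (\<lambda>i. x i - y i) {..<n}"
    using lipfE unfolding C_bLip_iff by blast
  have "\<bar>\<phi> x - \<phi> y\<bar> \<le> (C + 1) * (1 + L2_set x {..<n} ^ 0 + L2_set y {..<n} ^ 0) * L2_set (\<lambda>i. x i - y i) {..<n}" for x y
    using C by (intro order_trans[OF C(2)] mult_right_mono L2_set_nonneg) auto
  thus ?thesis unfolding C_lLip_def using C by (intro CollectI exI[of _ "C + 1"] conjI exI[of _ 0]) auto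
qed

text \<open>
  On bounded random variables \<open>E\<close> is finite; \<open>Er\<close> is its real value. The sequence shifted to start at
  index \<open>0\<close> is \<open>Yv\<close>, a point of the sequence space, and \<open>law\<close> is the common sublinear
  distribution of the \<open>Y i\<close>.
\<close>

locale sublinear_iid = sublinear_expectation_space M H E
  for M :: "'a measure" and H :: "('a \<Rightarrow> real) set" and E :: "('a \<Rightarrow> real) \<Rightarrow> ereal" +
  fixes \<P> :: "'a measure set" and Y :: "nat \<Rightarrow> 'a \<Rightarrow> real"
  assumes \<P>_prob: "\<And>P. P \<in> \<P> \<Longrightarrow> prob_space P \<and> sets P = sets (sigma_gen_by M H)"
    and E_eq_SUP: "\<And>X. X \<in> bounded_part M H \<Longrightarrow> E X = (SUP P\<in>\<P>. ereal (\<integral>\<omega>. X \<omega> \<partial>P))"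
    and Y_H: "\<And>n. n \<ge> 1 \<Longrightarrow> Y n \<in> H"
    and indep: "independent_seq E Y"
    and ident: "identically_distributed_seq E Y"
begin

definition Er :: "('a \<Rightarrow> real) \<Rightarrow> real" where "Er X = real_of_ereal (E X)"

definition Yv :: "'a \<Rightarrow> nat \<Rightarrow> real" where "Yv \<omega> = (\<lambda>i. Y (Suc i) \<omega>)"

definition law :: "(real \<Rightarrow> real) \<Rightarrow> real" where "law \<phi> = Er (\<lambda>\<omega>. \<phi> (Y 1 \<omega>))"

lemma sigma_gen: "space (sigma_gen_by M H) = space M"
  "sets (sigma_gen_by M H) = sigma_sets (space M) {X -` B \<inter> space M | X B. X \<in> H \<and> B \<in> sets borel}"
  unfolding sigma_gen_by_def by (auto intro!: space_measure_of sets_measure_of)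

lemma space_\<P>: "P \<in> \<P> \<Longrightarrow> space P = space M"
  using \<P>_prob sets_eq_imp_space_eq sigma_gen(1) by metis

lemma H_measurable_\<P>: "P \<in> \<P> \<Longrightarrow> X \<in> H \<Longrightarrow> X \<in> borel_measurable P"
proof (rule measurableI)
  assume a: "P \<in> \<P>" "X \<in> H"
  fix B :: "real set" assume "B \<in> sets borel"
  thus "X -` B \<inter> space P \<in> sets P" using \<P>_prob[OF a(1)] a unfolding space_\<P>[OF a(1)]
    by (auto simp: sigma_gen(2) intro!: sigma_sets.Basic)
qed simp

lemma const_H: "(\<lambda>\<omega>. c) \<in> H"
proof -
  have "(\<lambda>x. c) \<in> C_lLip 0" by (rule C_bLip_lLip) (auto simp: C_bLip_iff intro: lipf_const)
  from H_comp[OF this] show ?thesis by simp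
qed

lemma const_bounded: "(\<lambda>\<omega>. c) \<in> bounded_part M H"
  unfolding bounded_part_def using const_H by (auto simp: bounded_iff)

lemma bounded_partI: "X \<in> H \<Longrightarrow> (\<And>\<omega>. \<omega> \<in> space M \<Longrightarrow> \<bar>X \<omega>\<bar> \<le> b) \<Longrightarrow> X \<in> bounded_part M H"
  unfolding bounded_part_def by (auto simp: bounded_iff)

lemma bounded_part_H: "X \<in> bounded_part M H \<Longrightarrow> X \<in> H"
  unfolding bounded_part_def by simp

lemma bounded_partE:
  assumes "X \<in> bounded_part M H" obtains b where "\<And>\<omega>. \<omega> \<in> space M \<Longrightarrow> \<bar>X \<omega>\<bar> \<le> b"
  using assms unfolding bounded_part_def bounded_iff by auto

lemma E_Er: "X \<in> bounded_part M H \<Longrightarrow> E X = ereal (Er X)"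
proof -
  assume X: "X \<in> bounded_part M H"
  obtain b where b: "\<And>\<omega>. \<omega> \<in> space M \<Longrightarrow> \<bar>X \<omega>\<bar> \<le> b" using bounded_partE[OF X] by blast
  have "E (\<lambda>\<omega>. - b) \<le> E X" by (rule E_mono[OF bounded_part_H[OF X] const_H]) (use b in fastforce)
  moreover have "E X \<le> E (\<lambda>\<omega>. b)" by (rule E_mono[OF const_H bounded_part_H[OF X]]) (use b in fastforce)
  ultimately have "\<bar>E X\<bar> \<noteq> \<infinity>" unfolding E_const by auto
  thus ?thesis unfolding Er_def by (simp add: ereal_real)
qed

lemma integrable_\<P>: "P \<in> \<P> \<Longrightarrow> X \<in> bounded_part M H \<Longrightarrow> integrable P X"
proof -
  assume P: "P \<in> \<P>" and X: "X \<in> bounded_part M H"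
  interpret prob_space P using \<P>_prob[OF P] by simp
  obtain b where b: "\<And>\<omega>. \<omega> \<in> space M \<Longrightarrow> \<bar>X \<omega>\<bar> \<le> b" using bounded_partE[OF X] by blast
  show ?thesis by (rule integrable_const_bound[of _ b])
    (use b space_\<P>[OF P] H_measurable_\<P>[OF P bounded_part_H[OF X]] in auto)
qed

lemma integral_le_Er: "P \<in> \<P> \<Longrightarrow> X \<in> bounded_part M H \<Longrightarrow> (\<integral>\<omega>. X \<omega> \<partial>P) \<le> Er X"
proof -
  assume P: "P \<in> \<P>" and X: "X \<in> bounded_part M H"
  have "ereal (\<integral>\<omega>. X \<omega> \<partial>P) \<le> E X" unfolding E_eq_SUP[OF X] by (rule SUP_upper[OF P])
  thus ?thesis unfolding E_Er[OF X] by simp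
qed

lemma integral_near_Er: "X \<in> bounded_part M H \<Longrightarrow> r < Er X \<Longrightarrow> \<exists>P\<in>\<P>. r < (\<integral>\<omega>. X \<omega> \<partial>P)"
proof -
  assume X: "X \<in> bounded_part M H" and e: "r < Er X"
  have "ereal r < (SUP P\<in>\<P>. ereal (\<integral>\<omega>. X \<omega> \<partial>P))" unfolding E_eq_SUP[OF X, symmetric] E_Er[OF X] using e by simp
  thus ?thesis unfolding less_SUP_iff by auto
qed

lemma Er_le: "X \<in> bounded_part M H \<Longrightarrow> (\<And>P. P \<in> \<P> \<Longrightarrow> (\<integral>\<omega>. X \<omega> \<partial>P) \<le> r) \<Longrightarrow> Er X \<le> r"
  using integral_near_Er[of X r] by (meson not_le)

lemma Er_const: "Er (\<lambda>\<omega>. c) = c"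
  unfolding Er_def E_const by simp

lemma \<P>_nonempty: "\<P> \<noteq> {}"
  using integral_near_Er[OF const_bounded, of "-1" 0] by (auto simp: Er_const)

lemma Er_mono:
  assumes "X \<in> bounded_part M H" "X' \<in> bounded_part M H" "\<And>\<omega>. \<omega> \<in> space M \<Longrightarrow> X \<omega> \<le> X' \<omega>"
  shows "Er X \<le> Er X'"
  using E_mono[OF bounded_part_H[OF assms(2)] bounded_part_H[OF assms(1)] assms(3)] unfolding E_Er[OF assms(1)] E_Er[OF assms(2)] by simp

lemma add_const_bounded:
  assumes X: "X \<in> bounded_part M H" shows "(\<lambda>\<omega>. X \<omega> + c) \<in> bounded_part M H"
proof -
  obtain b where b: "\<And>\<omega>. \<omega> \<in> space M \<Longrightarrow> \<bar>X \<omega>\<bar> \<le> b" using bounded_partE[OF X] by blast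
  show ?thesis by (rule bounded_partI[OF H_add[OF bounded_part_H[OF X] const_H], where b = "b + \<bar>c\<bar>"])
     (use b in \<open>auto intro: order_trans[OF abs_triangle_ineq]\<close>)
qed

lemma Er_add_const:
  assumes X: "X \<in> bounded_part M H"
  shows "Er (\<lambda>\<omega>. X \<omega> + c) = Er X + c"
proof -
  have le: "Er (\<lambda>\<omega>. X \<omega> + c) \<le> Er X + c" if X: "X \<in> bounded_part M H" for X c
  proof -
    have "E (\<lambda>\<omega>. X \<omega> + c) \<le> E X + E (\<lambda>\<omega>. c)"
      by (rule E_subadd[OF bounded_part_H[OF X] const_H]) (auto simp: E_const)
    thus ?thesis unfolding E_const E_Er[OF X] E_Er[OF add_const_bounded[OF X]] by simp
  qed
  show ?thesis using le[OF X, of c] le[OF add_const_bounded[OF X, of c], of "- c"] by simp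
qed

lemma Er_scale: "X \<in> bounded_part M H \<Longrightarrow> 0 \<le> c \<Longrightarrow> Er (\<lambda>\<omega>. c * X \<omega>) = c * Er X"
  unfolding Er_def using E_pos_hom[OF bounded_part_H, of X c] by simp

lemma Yv_eq: "Yv \<omega> i = Y (Suc i) \<omega>" by (simp add: Yv_def)

lemma cyl_bounded: "\<phi> \<in> C_bLip n \<Longrightarrow> (\<lambda>\<omega>. \<phi> (Yv \<omega>)) \<in> bounded_part M H"
proof -
  assume p: "\<phi> \<in> C_bLip n"
  then obtain b where "\<And>x. \<bar>\<phi> x\<bar> \<le> b" unfolding C_bLip_iff by blast
  moreover have "(\<lambda>\<omega>. \<phi> (Yv \<omega>)) \<in> H"
    unfolding Yv_def by (rule H_comp[OF C_bLip_lLip[OF p]]) (rule Y_H, simp)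
  ultimately show ?thesis by (intro bounded_partI) auto
qed

lemma one_bounded:
  assumes p: "blip \<phi>" and k: "1 \<le> k" shows "(\<lambda>\<omega>. \<phi> (Y k \<omega>)) \<in> bounded_part M H"
proof -
  have "k - 1 < k" using k by simp
  from cyl_bounded[OF blip_coord[OF p this]] show ?thesis using k by (simp add: Yv_eq)
qed

lemma law_eq: "blip \<phi> \<Longrightarrow> 1 \<le> k \<Longrightarrow> E (\<lambda>\<omega>. \<phi> (Y k \<omega>)) = ereal (law \<phi>)"
proof -
  assume p: "blip \<phi>" and k: "1 \<le> k"
  have "E (\<lambda>\<omega>. \<phi> (Y k \<omega>)) = E (\<lambda>\<omega>. \<phi> (Y 1 \<omega>))"
    using ident[unfolded identically_distributed_seq_def, rule_format, OF k, unfolded same_distribution_def, rule_format, OF blip_coord[OF p, of 0 1]]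
    by simp
  thus ?thesis unfolding law_def using E_Er[OF one_bounded[OF p, of 1]] by simp
qed

lemma law_const: "law (\<lambda>y. c) = c" unfolding law_def by (rule Er_const)

lemma law_scale: "blip \<phi> \<Longrightarrow> 0 \<le> c \<Longrightarrow> law (\<lambda>y. c * \<phi> y) = c * law \<phi>"
  unfolding law_def by (rule Er_scale[OF one_bounded]) auto

lemma law_add_const: "blip \<phi> \<Longrightarrow> law (\<lambda>y. \<phi> y + c) = law \<phi> + c"
  unfolding law_def by (rule Er_add_const[OF one_bounded]) auto

lemma integral_le_law: "P \<in> \<P> \<Longrightarrow> blip \<phi> \<Longrightarrow> (\<integral>\<omega>. \<phi> (Y 1 \<omega>) \<partial>P) \<le> law \<phi>"
  unfolding law_def by (rule integral_le_Er[OF _ one_bounded]) auto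

lemma law_mono: "blip \<phi> \<Longrightarrow> blip \<psi> \<Longrightarrow> (\<And>y. \<phi> y \<le> \<psi> y) \<Longrightarrow> law \<phi> \<le> law \<psi>"
  unfolding law_def by (rule Er_mono[OF one_bounded one_bounded]) auto

lemma blip_section: "f \<in> C_bLip (Suc n) \<Longrightarrow> blip (\<lambda>y. f (x(n := y)))"
proof -
  assume f: "f \<in> C_bLip (Suc n)"
  then obtain b where f': "f \<in> lipf (Suc n)" and b: "\<And>x. \<bar>f x\<bar> \<le> b" unfolding C_bLip_iff by blast
  obtain C where C: "0 \<le> C" "\<And>x y. \<bar>f x - f y\<bar> \<le> C * L2_set (\<lambda>i. x i - y i) {..<Suc n}"
    using lipfE[OF f'] by blast
  have "L2_set (\<lambda>i. (x(n := y)) i - (x(n := z)) i) {..<Suc n} = \<bar>y - z\<bar>" for y z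
    unfolding L2_set_def by (simp add: lessThan_Suc)
  hence "\<bar>f (x(n := y)) - f (x(n := z))\<bar> \<le> C * \<bar>y - z\<bar>" for y z using C(2)[of "x(n := y)" "x(n := z)"] by simp
  thus ?thesis unfolding blip_def using b C(1) by blast
qed

text \<open>
  Independence in the form of a recursion on the number of variables. For \<open>n = 0\<close>, where nothing
  precedes, it is the definition of \<open>law\<close>.
\<close>

lemma E_nested:
  assumes f: "f \<in> C_bLip (Suc n)"
  shows "E (\<lambda>\<omega>. f (Yv \<omega>)) = E (\<lambda>\<omega>. law (\<lambda>y. f ((Yv \<omega>)(n := y))))"
proof (cases "n = 0")
  case True
  have e: "f x = f ((\<lambda>_. 0)(n := x 0))" for x by (rule C_bLip_cong_coords[OF f]) (simp add: True)
  have "(\<lambda>\<omega>. f (Yv \<omega>)) = (\<lambda>\<omega>. f ((\<lambda>_. 0)(n := Y 1 \<omega>)))"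
  proof
    fix \<omega> show "f (Yv \<omega>) = f ((\<lambda>_. 0)(n := Y 1 \<omega>))" using e[of "Yv \<omega>"] unfolding Yv_eq One_nat_def .
  qed
  hence "E (\<lambda>\<omega>. f (Yv \<omega>)) = E (\<lambda>\<omega>. f ((\<lambda>_. 0)(n := Y 1 \<omega>)))" by (rule arg_cong)
  also have "\<dots> = ereal (law (\<lambda>y. f ((\<lambda>_. 0)(n := y))))" by (rule law_eq[OF blip_section[OF f]]) simp
  also have "\<dots> = E (\<lambda>\<omega>. law (\<lambda>y. f ((\<lambda>_. 0)(n := y))))" by (simp add: E_const)
  also have "(\<lambda>\<omega>. law (\<lambda>y. f ((\<lambda>_. 0)(n := y)))) = (\<lambda>\<omega>. law (\<lambda>y. f ((Yv \<omega>)(n := y))))"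
  proof
    fix \<omega>
    have "f ((\<lambda>_. 0)(n := y)) = f ((Yv \<omega>)(n := y))" for y using e[of "(Yv \<omega>)(n := y)"] True by simp
    thus "law (\<lambda>y. f ((\<lambda>_. 0)(n := y))) = law (\<lambda>y. f ((Yv \<omega>)(n := y)))" by simp
  qed
  finally show ?thesis .
next
  case False
  have v: "f (vec_append n (\<lambda>i. Y (i + 1) \<omega>) (\<lambda>j. y)) = f ((Yv \<omega>)(n := y))" for \<omega> y
    by (rule C_bLip_cong_coords[OF f]) (auto simp: vec_append_def Yv_eq less_Suc_eq)
  have "independent_to E 1 (\<lambda>_. Y (n + 1)) n (\<lambda>j. Y (j + 1))"
    using indep False unfolding independent_seq_def by simp
  hence "E (\<lambda>\<omega>. f (vec_append n (\<lambda>i. Y (i + 1) \<omega>) (\<lambda>j. Y (n + 1) \<omega>)))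
     = E (\<lambda>\<omega>. real_of_ereal (E (\<lambda>\<omega>'. f (vec_append n (\<lambda>i. Y (i + 1) \<omega>) (\<lambda>j. Y (n + 1) \<omega>')))))"
    unfolding independent_to_def using f by simp
  also have "(\<lambda>\<omega>. f (vec_append n (\<lambda>i. Y (i + 1) \<omega>) (\<lambda>j. Y (n + 1) \<omega>))) = (\<lambda>\<omega>. f (Yv \<omega>))"
    unfolding v by (rule ext) (simp add: fun_upd_idem Yv_eq)
  also have "(\<lambda>\<omega>. real_of_ereal (E (\<lambda>\<omega>'. f (vec_append n (\<lambda>i. Y (i + 1) \<omega>) (\<lambda>j. Y (n + 1) \<omega>')))))
     = (\<lambda>\<omega>. law (\<lambda>y. f ((Yv \<omega>)(n := y))))"
    unfolding v using law_eq[OF blip_section[OF f], of "n + 1"] by simp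
  finally show ?thesis .
qed

text \<open>
  With \<open>\<psi> = \<phi> - law \<phi>\<close>, positive homogeneity gives \<open>law (g(x) * \<psi>) = g(x) * law \<psi> = 0\<close>, so the nested
  expectation of \<open>g * \<psi>\<close> vanishes, and \<open>P\<close> is dominated by \<open>E\<close>. It says that under each \<open>P\<close> the
  conditional distribution of \<open>Y (n + 1)\<close> is dominated by \<open>law\<close>.
\<close>

lemma weighted_law_bound:
  assumes P: "P \<in> \<P>" and g: "g \<in> C_bLip n" "\<And>x. 0 \<le> g x" and p: "blip \<phi>"
  shows "(\<integral>\<omega>. g (Yv \<omega>) * \<phi> (Y (Suc n) \<omega>) \<partial>P) \<le> law \<phi> * (\<integral>\<omega>. g (Yv \<omega>) \<partial>P)"
proof -
  define \<psi> where "\<psi> = (\<lambda>y. \<phi> y + - law \<phi>)"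
  obtain b C where b: "\<And>y. \<bar>\<phi> y\<bar> \<le> b" and C: "0 \<le> C" "\<And>y z. \<bar>\<phi> y - \<phi> z\<bar> \<le> C * \<bar>y - z\<bar>"
    using p unfolding blip_def by blast
  have \<psi>: "blip \<psi>" unfolding blip_def \<psi>_def
    using C by (intro conjI exI[of _ "b + \<bar>law \<phi>\<bar>"] allI exI[of _ C]) (auto intro!: order_trans[OF abs_triangle_ineq4] add_right_mono b)
  have \<psi>0: "law \<psi> = 0" unfolding \<psi>_def by (simp only: law_add_const[OF p])
  define f where "f = (\<lambda>x. g x * \<psi> (x n))"
  have g': "g \<in> C_bLip (Suc n)" using g(1) unfolding C_bLip_iff by (auto intro: lipf_mono)
  have f: "f \<in> C_bLip (Suc n)" unfolding f_def by (intro C_bLip_mult g' blip_coord \<psi>) simp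
  have "law (\<lambda>y. f (x(n := y))) = 0" for x
  proof -
    have "g (x(n := y)) = g x" for y by (rule C_bLip_cong_coords[OF g(1)]) simp
    hence "(\<lambda>y. f (x(n := y))) = (\<lambda>y. g x * \<psi> y)" by (simp add: f_def)
    thus ?thesis using law_scale[OF \<psi> g(2)] \<psi>0 by simp
  qed
  hence "E (\<lambda>\<omega>. f (Yv \<omega>)) = 0" unfolding E_nested[OF f] by (simp add: E_const zero_ereal_def)
  hence "Er (\<lambda>\<omega>. f (Yv \<omega>)) = 0" by (simp add: Er_def)
  hence "(\<integral>\<omega>. f (Yv \<omega>) \<partial>P) \<le> 0" using integral_le_Er[OF P cyl_bounded[OF f]] by simp
  moreover have "(\<integral>\<omega>. f (Yv \<omega>) \<partial>P) = (\<integral>\<omega>. g (Yv \<omega>) * \<phi> (Y (Suc n) \<omega>) \<partial>P) - law \<phi> * (\<integral>\<omega>. g (Yv \<omega>) \<partial>P)"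
  proof -
    have i1: "integrable P (\<lambda>\<omega>. g (Yv \<omega>) * \<phi> (Y (Suc n) \<omega>))"
      using integrable_\<P>[OF P cyl_bounded[OF C_bLip_mult[OF g' blip_coord[OF p, of n]]]] by (simp add: Yv_eq)
    have i2: "integrable P (\<lambda>\<omega>. g (Yv \<omega>))" by (rule integrable_\<P>[OF P cyl_bounded[OF g(1)]])
    have "(\<lambda>\<omega>. f (Yv \<omega>)) = (\<lambda>\<omega>. g (Yv \<omega>) * \<phi> (Y (Suc n) \<omega>) - law \<phi> * g (Yv \<omega>))"
      by (auto simp: f_def \<psi>_def Yv_eq algebra_simps)
    thus ?thesis using i1 i2 by simp
  qed
  ultimately show ?thesis by simp
qed

text \<open>
  The clamped function lies between the indicators of \<open>h \<ge> 1\<close> and of \<open>h > 0\<close>: the first makes it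
  admissible in \<open>V_hat\<close>, the second bounds its expectation through the measures of \<open>\<P>\<close>.
\<close>

lemma V_hat_le:
  assumes h: "h \<in> lipf n" and r: "\<And>P. P \<in> \<P> \<Longrightarrow> measure P {\<omega> \<in> space M. 0 < h (Yv \<omega>)} \<le> r"
  shows "V_hat M H E {\<omega> \<in> space M. 1 \<le> h (Yv \<omega>)} \<le> ereal r"
proof -
  define f where "f = (\<lambda>x. clamp01 (h x))"
  have f: "f \<in> C_bLip n" unfolding f_def by (rule clamp_C_bLip[OF h])
  have fb: "(\<lambda>\<omega>. f (Yv \<omega>)) \<in> bounded_part M H" by (rule cyl_bounded[OF f])
  have "Er (\<lambda>\<omega>. f (Yv \<omega>)) \<le> r"
  proof (rule Er_le[OF fb])
    fix P assume P: "P \<in> \<P>"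
    interpret prob_space P using \<P>_prob[OF P] by simp
    have "{\<omega> \<in> space M. 0 < h (Yv \<omega>)} = {\<omega> \<in> space P. 0 < f (Yv \<omega>)}"
      using space_\<P>[OF P] by (auto simp: f_def clamp01_def)
    moreover have [measurable]: "(\<lambda>\<omega>. f (Yv \<omega>)) \<in> borel_measurable P" by (rule H_measurable_\<P>[OF P bounded_part_H[OF fb]])
    ultimately have m: "{\<omega> \<in> space M. 0 < h (Yv \<omega>)} \<in> sets P" by simp
    have "(\<integral>\<omega>. f (Yv \<omega>) \<partial>P) \<le> (\<integral>\<omega>. indicator {\<omega> \<in> space M. 0 < h (Yv \<omega>)} \<omega> \<partial>P)"
    proof (rule integral_mono[OF integrable_\<P>[OF P fb]])
      show "integrable P (indicator {\<omega> \<in> space M. 0 < h (Yv \<omega>)} :: _ \<Rightarrow> real)" using m by (simp add: emeasure_eq_measure)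
      fix \<omega> assume "\<omega> \<in> space P"
      thus "f (Yv \<omega>) \<le> indicator {\<omega> \<in> space M. 0 < h (Yv \<omega>)} \<omega>"
        using space_\<P>[OF P] by (auto simp: f_def clamp01_def indicator_def)
    qed
    also have "\<dots> = measure P {\<omega> \<in> space M. 0 < h (Yv \<omega>)}" using m by simp
    finally show "(\<integral>\<omega>. f (Yv \<omega>) \<partial>P) \<le> r" using r[OF P] by linarith
  qed
  moreover have "V_hat M H E {\<omega> \<in> space M. 1 \<le> h (Yv \<omega>)} \<le> E (\<lambda>\<omega>. f (Yv \<omega>))"
    unfolding V_hat_def
  proof (rule Inf_lower, rule CollectI, intro exI conjI)
    show "\<forall>\<omega>\<in>space M. indicator {\<omega> \<in> space M. 1 \<le> h (Yv \<omega>)} \<omega> \<le> f (Yv \<omega>)"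
      by (auto simp: f_def clamp01_def indicator_def)
  qed (use bounded_part_H[OF fb] in auto)
  ultimately show ?thesis unfolding E_Er[OF fb] by (meson ereal_less_eq(3) order_trans)
qed

lemma cyl_sets: "h \<in> lipf n \<Longrightarrow> {\<omega> \<in> space M. 1 \<le> h (Yv \<omega>)} \<in> sets M"
proof -
  assume h: "h \<in> lipf n"
  have "(\<lambda>\<omega>. clamp01 (h (Yv \<omega>))) \<in> borel_measurable M"
    using bounded_part_H[OF cyl_bounded[OF clamp_C_bLip[OF h]]] H_measurable by auto
  moreover have "{\<omega> \<in> space M. 1 \<le> h (Yv \<omega>)} = {\<omega> \<in> space M. 1 \<le> clamp01 (h (Yv \<omega>))}" by (auto simp: clamp01_def)
  ultimately show ?thesis by simp
qed

end


section \<open>Comparison of the capacities and null sets\<close>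

context sublinear_iid begin

lemma V_hat_nonneg: "0 \<le> V_hat M H E A"
  unfolding V_hat_def
proof (rule Inf_greatest, clarify)
  fix \<xi> assume \<xi>: "\<xi> \<in> H" "\<forall>\<omega>\<in>space M. indicator A \<omega> \<le> \<xi> \<omega>"
  have "E (\<lambda>\<omega>. 0) \<le> E \<xi>"
    by (rule E_mono[OF \<xi>(1) const_H]) (use \<xi>(2) in \<open>auto intro: order_trans[OF indicator_pos_le]\<close>)
  thus "0 \<le> E \<xi>" by (simp add: E_const zero_ereal_def)
qed

lemma V_hat_le_E: "\<xi> \<in> H \<Longrightarrow> (\<And>\<omega>. \<omega> \<in> space M \<Longrightarrow> indicator A \<omega> \<le> \<xi> \<omega>) \<Longrightarrow> V_hat M H E A \<le> E \<xi>"
  unfolding V_hat_def by (rule Inf_lower) blast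

lemma V_hat_empty: "V_hat M H E {} = 0"
  using V_hat_le_E[OF const_H[of 0], of "{}"] V_hat_nonneg[of "{}"] by (simp add: E_const zero_ereal_def)

lemma V_hat_le_1: "V_hat M H E A \<le> 1"
  using V_hat_le_E[OF const_H[of 1], of A] by (simp add: E_const indicator_le_1 one_ereal_def)

lemma V_hat_star_le_1: "A \<subseteq> space M \<Longrightarrow> V_hat_star M H E A \<le> 1"
proof -
  assume A: "A \<subseteq> space M"
  define B where "B = (\<lambda>n::nat. if n = 0 then space M else {})"
  have "V_hat_star M H E A \<le> (\<Sum>n. V_hat M H E (B n))"
    unfolding V_hat_star_def by (rule Inf_lower) (use A in \<open>auto simp: B_def intro!: exI[of _ B]\<close>)
  also have "\<dots> = (\<Sum>n\<in>{0}. V_hat M H E (B n))" by (rule suminf_finite) (auto simp: B_def V_hat_empty)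
  also have "\<dots> \<le> 1" using V_hat_le_1 by simp
  finally show ?thesis .
qed

text \<open>
  Null sets of \<open>V_hat_star\<close>. The bounds \<open>r n\<close> for the members of the cover are of type
  \<^typ>\<open>ennreal\<close>, where sums can be rearranged freely.
\<close>

definition small :: "'a set \<Rightarrow> bool" where
  "small A \<longleftrightarrow> (\<forall>e>0. \<exists>B r. (\<forall>n::nat. B n \<in> sets M \<and> V_hat M H E (B n) \<le> enn2ereal (r n)) \<and>
     (\<Sum>n. r n) \<le> ennreal e \<and> A \<subseteq> (\<Union>n. B n))"

lemma small_V_hat_star: assumes "small A" shows "V_hat_star M H E A \<le> 0"
proof (rule ereal_le_epsilon2)
  fix e :: real assume "0 < e"
  with assms obtain B r where B: "\<And>n::nat. B n \<in> sets M" "\<And>n. V_hat M H E (B n) \<le> enn2ereal (r n)"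
     and r: "(\<Sum>n. r n) \<le> ennreal e" and A: "A \<subseteq> (\<Union>n. B n)" unfolding small_def by metis
  have "V_hat_star M H E A \<le> (\<Sum>n. V_hat M H E (B n))"
    unfolding V_hat_star_def by (rule Inf_lower) (use A B in blast)
  also have "\<dots> \<le> (\<Sum>n. enn2ereal (r n))" by (intro suminf_le_pos B V_hat_nonneg)
  also have "\<dots> = enn2ereal (\<Sum>n. r n)" by simp
  also have "\<dots> \<le> enn2ereal (ennreal e)" using r by (simp add: less_eq_ennreal.rep_eq)
  also have "\<dots> = ereal e" using \<open>0 < e\<close> by simp
  finally show "V_hat_star M H E A \<le> 0 + ereal e" by simp
qed

lemma small_subset: "small B \<Longrightarrow> A \<subseteq> B \<Longrightarrow> small A"
  unfolding small_def by (meson order_trans)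

lemma small_UN: assumes "\<And>j::nat. small (A j)" shows "small (\<Union>j. A j)"
  unfolding small_def
proof (intro allI impI)
  fix e :: real assume e: "0 < e"
  have "\<forall>j. \<exists>B r. (\<forall>n::nat. B n \<in> sets M \<and> V_hat M H E (B n) \<le> enn2ereal (r n)) \<and>
     (\<Sum>n. r n) \<le> ennreal (e * (1/2) ^ Suc j) \<and> A j \<subseteq> (\<Union>n. B n)"
    using assms e unfolding small_def by simp
  then obtain B r where B: "\<And>j n::nat. B j n \<in> sets M" "\<And>j n. V_hat M H E (B j n) \<le> enn2ereal (r j n)"
     and r: "\<And>j. (\<Sum>n. r j n) \<le> ennreal (e * (1/2) ^ Suc j)" and A: "\<And>j. A j \<subseteq> (\<Union>n. B j n)" by metis
  define B' where "B' = (\<lambda>i. case prod_decode i of (j, n) \<Rightarrow> B j n)"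
  define r' where "r' = (\<lambda>i. case prod_decode i of (j, n) \<Rightarrow> r j n)"
  have "(\<Sum>i. r' i) = (\<Sum>j. \<Sum>n. r j n)"
    unfolding r'_def by (rule suminf_ennreal_2dimen[of _ "\<lambda>(j, n). r j n"]) simp
  also have "\<dots> \<le> (\<Sum>j. ennreal (e * (1/2) ^ Suc j))" by (intro suminf_le r) auto
  also have "\<dots> = ennreal e"
  proof (rule suminf_ennreal_eq)
    show "(\<lambda>j. e * (1/2) ^ Suc j) sums e" using sums_mult[OF power_half_series, of e] by simp
  qed (use e in simp)
  finally have 1: "(\<Sum>i. r' i) \<le> ennreal e" .
  have 2: "(\<Union>j. A j) \<subseteq> (\<Union>i. B' i)"
  proof
    fix x assume "x \<in> (\<Union>j. A j)"
    then obtain j n where "x \<in> B j n" using A by blast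
    hence "x \<in> B' (prod_encode (j, n))" by (simp add: B'_def)
    thus "x \<in> (\<Union>i. B' i)" by blast
  qed
  have 3: "\<forall>i. B' i \<in> sets M \<and> V_hat M H E (B' i) \<le> enn2ereal (r' i)"
    using B by (auto simp: B'_def r'_def split: prod.split)
  show "\<exists>B r. (\<forall>n::nat. B n \<in> sets M \<and> V_hat M H E (B n) \<le> enn2ereal (r n)) \<and>
     (\<Sum>n. r n) \<le> ennreal e \<and> (\<Union>j. A j) \<subseteq> (\<Union>n. B n)"
    using 1 2 3 by blast
qed

lemma small_Un: "small A \<Longrightarrow> small B \<Longrightarrow> small (A \<union> B)"
proof -
  assume "small A" "small B"
  hence "small (\<Union>j::nat. if j = 0 then A else B)" by (intro small_UN) auto
  thus ?thesis by (rule small_subset) (auto split: if_splits)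
qed

lemma small_limsup:
  assumes U: "\<And>k. U k \<in> sets M" "\<And>k::nat. V_hat M H E (U k) \<le> ereal (b k)" and b: "summable b" "\<And>k. 0 \<le> b k"
  shows "small {\<omega>. \<forall>K. \<exists>k\<ge>K. \<omega> \<in> U k}"
  unfolding small_def
proof (intro allI impI)
  fix e :: real assume e: "0 < e"
  have "eventually (\<lambda>K. norm (\<Sum>k. b (k + K)) < e) sequentially"
    using suminf_exist_split[OF e b(1)] by (auto simp: eventually_sequentially)
  then obtain K where K: "norm (\<Sum>k. b (k + K)) < e" by (auto simp: eventually_sequentially)
  have "(\<Sum>k. ennreal (b (k + K))) = ennreal (\<Sum>k. b (k + K))"
    using b by (intro suminf_ennreal2 summable_ignore_initial_segment) auto
  also have "\<dots> \<le> ennreal e" using K by (intro ennreal_leI) auto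
  finally have 1: "(\<Sum>k. ennreal (b (k + K))) \<le> ennreal e" .
  have 2: "{\<omega>. \<forall>K. \<exists>k\<ge>K. \<omega> \<in> U k} \<subseteq> (\<Union>k. U (k + K))"
  proof
    fix \<omega> assume "\<omega> \<in> {\<omega>. \<forall>K. \<exists>k\<ge>K. \<omega> \<in> U k}"
    then obtain k where "K \<le> k" "\<omega> \<in> U k" by blast
    hence "\<omega> \<in> U ((k - K) + K)" by simp
    thus "\<omega> \<in> (\<Union>k. U (k + K))" by blast
  qed
  have 3: "\<forall>k. U (k + K) \<in> sets M \<and> V_hat M H E (U (k + K)) \<le> enn2ereal (ennreal (b (k + K)))"
    using U b by simp
  show "\<exists>B r. (\<forall>n::nat. B n \<in> sets M \<and> V_hat M H E (B n) \<le> enn2ereal (r n)) \<and>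
     (\<Sum>n. r n) \<le> ennreal e \<and> {\<omega>. \<forall>K. \<exists>k\<ge>K. \<omega> \<in> U k} \<subseteq> (\<Union>n. B n)"
    by (rule exI[of _ "\<lambda>k. U (k + K)"], rule exI[of _ "\<lambda>k. ennreal (b (k + K))"]) (use 1 2 3 in blast)
qed

lemma small_shrinking:
  assumes D: "\<And>L::nat. D L \<in> sets M" "\<And>L. A \<subseteq> D L" "\<And>L. V_hat M H E (D L) \<le> ereal (b L)" and b: "b \<longlonglongrightarrow> 0"
  shows "small A"
  unfolding small_def
proof (intro allI impI)
  fix e :: real assume e: "0 < e"
  have "eventually (\<lambda>L. b L < e) sequentially" by (rule order_tendstoD(2)[OF b e])
  then obtain L where L: "b L < e" by (auto simp: eventually_sequentially)
  define B where "B = (\<lambda>n::nat. if n = 0 then D L else {})"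
  define r where "r = (\<lambda>n::nat. if n = 0 then ennreal e else 0)"
  have "V_hat M H E (D L) \<le> ereal e" using D(3)[of L] L by (meson ereal_less_eq(3) less_imp_le order_trans)
  hence "\<forall>n. B n \<in> sets M \<and> V_hat M H E (B n) \<le> enn2ereal (r n)"
    using D(1) e by (auto simp: B_def r_def V_hat_empty zero_ennreal.rep_eq)
  moreover have "(\<Sum>n. r n) = (\<Sum>n\<in>{0}. r n)" by (rule suminf_finite) (auto simp: r_def)
  hence "(\<Sum>n. r n) \<le> ennreal e" by (simp add: r_def)
  moreover have "A \<subseteq> (\<Union>n. B n)" using D(2)[of L] by (auto simp: B_def)
  ultimately show "\<exists>B r. (\<forall>n::nat. B n \<in> sets M \<and> V_hat M H E (B n) \<le> enn2ereal (r n)) \<and>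
     (\<Sum>n. r n) \<le> ennreal e \<and> A \<subseteq> (\<Union>n. B n)" by blast
qed

lemma sum_H: "(\<And>i. i < n \<Longrightarrow> g i \<in> H) \<Longrightarrow> (\<lambda>\<omega>. \<Sum>i<n. g i \<omega>) \<in> H" for n :: nat
proof (induction n)
  case 0 show ?case using H_zero by simp
next
  case (Suc n)
  thus ?case using H_add[of "\<lambda>\<omega>. \<Sum>i<n. g i \<omega>" "g n"] by simp
qed

lemma E_sum_le:
  fixes n :: nat
  assumes g: "\<And>i. g i \<in> H" "\<And>i \<omega>. \<omega> \<in> space M \<Longrightarrow> 0 \<le> g i \<omega>"
  shows "E (\<lambda>\<omega>. \<Sum>i<n. g i \<omega>) \<le> (\<Sum>i<n. E (g i))"
proof (induction n)
  case 0 show ?case by (simp add: E_const zero_ereal_def)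
next
  case (Suc n)
  have nn: "0 \<le> E X" if "X \<in> H" "\<And>\<omega>. \<omega> \<in> space M \<Longrightarrow> 0 \<le> X \<omega>" for X
    using E_mono[OF that(1) const_H[of 0] that(2)] by (simp add: E_const zero_ereal_def)
  have "0 \<le> E (\<lambda>\<omega>. \<Sum>i<n. g i \<omega>)" "0 \<le> E (g n)"
    by (auto intro!: nn sum_H g sum_nonneg)
  hence "E (\<lambda>\<omega>. (\<Sum>i<n. g i \<omega>) + g n \<omega>) \<le> E (\<lambda>\<omega>. \<Sum>i<n. g i \<omega>) + E (g n)"
    by (intro E_subadd sum_H g) auto
  also have "\<dots> \<le> (\<Sum>i<n. E (g i)) + E (g n)" using Suc by (rule add_right_mono)
  finally show ?case by simp
qed

lemma C_star_le_V_hat_star: "C_star M H E A \<le> V_hat_star M H E A"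
  unfolding V_hat_star_def
proof (rule Inf_greatest, clarify)
  fix B :: "nat \<Rightarrow> 'a set" assume B: "\<forall>n. B n \<in> sets M" "A \<subseteq> (\<Union>n. B n)"
  show "C_star M H E A \<le> (\<Sum>n. V_hat M H E (B n))"
  proof (rule ereal_le_epsilon2)
    fix e :: real assume e: "0 < e"
    have ex: "\<exists>\<xi>\<in>H. (\<forall>\<omega>\<in>space M. indicator (B n) \<omega> \<le> \<xi> \<omega>) \<and> E \<xi> \<le> V_hat M H E (B n) + ereal (e * (1/2) ^ Suc n)" for n
    proof -
      have "\<bar>V_hat M H E (B n)\<bar> \<noteq> \<infinity>" using V_hat_nonneg[of "B n"] V_hat_le_1[of "B n"] by auto
      moreover have "0 < ereal (e * (1/2) ^ Suc n)" using e by simp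
      ultimately have "V_hat M H E (B n) < V_hat M H E (B n) + ereal (e * (1/2) ^ Suc n)"
        by (cases "V_hat M H E (B n)") auto
      hence "\<exists>a\<in>{E \<xi> | \<xi>. \<xi> \<in> H \<and> (\<forall>\<omega>\<in>space M. indicator (B n) \<omega> \<le> \<xi> \<omega>)}. a < V_hat M H E (B n) + ereal (e * (1/2) ^ Suc n)"
        unfolding V_hat_def Inf_less_iff by simp
      thus ?thesis by (auto intro: less_imp_le)
    qed
    then obtain g where g: "\<And>n. g n \<in> H" "\<And>n \<omega>. \<omega> \<in> space M \<Longrightarrow> indicator (B n) \<omega> \<le> g n \<omega>"
      "\<And>n. E (g n) \<le> V_hat M H E (B n) + ereal (e * (1/2) ^ Suc n)" by metis
    have g0: "0 \<le> g n \<omega>" if "\<omega> \<in> space M" for n \<omega>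
      using g(2)[OF that, of n] by (auto intro: order_trans[OF indicator_pos_le])
    define L where "L = (SUP n. E (\<lambda>\<omega>. \<Sum>i<n. g i \<omega>))"
    have "incseq (\<lambda>n. E (\<lambda>\<omega>. \<Sum>i<n. g i \<omega>))"
      unfolding incseq_def by (intro allI impI E_mono sum_H g sum_mono2) (auto intro: g0)
    hence L: "(\<lambda>n. E (\<lambda>\<omega>. \<Sum>i<n. g i \<omega>)) \<longlonglongrightarrow> L" unfolding L_def by (rule LIMSEQ_SUP)
    have "C_star M H E A \<le> L"
      unfolding C_star_def
    proof (rule Inf_lower, rule CollectI, rule exI[of _ g], intro conjI allI ballI L)
      fix \<omega> assume w: "\<omega> \<in> space M"
      show "indicator A \<omega> \<le> (\<Sum>n. ereal (g n \<omega>))"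
      proof (cases "\<omega> \<in> A")
        case True
        then obtain n where n: "\<omega> \<in> B n" using B by blast
        have "indicator A \<omega> \<le> ereal (g n \<omega>)" using g(2)[OF w, of n] n True by (simp add: one_ereal_def)
        also have "\<dots> \<le> (\<Sum>i<Suc n. ereal (g i \<omega>))"
          unfolding sum.lessThan_Suc by (rule add_increasing[OF sum_nonneg]) (use g0[OF w] in auto)
        also have "\<dots> \<le> (\<Sum>n. ereal (g n \<omega>))" by (rule suminf_upper) (use g0[OF w] in auto)
        finally show ?thesis .
      next
        case False
        thus ?thesis using suminf_0_le[of "\<lambda>n. ereal (g n \<omega>)"] g0[OF w] by simp
      qed
    qed (use g g0 in auto)
    also have "L \<le> (\<Sum>n. V_hat M H E (B n)) + ereal e"
      unfolding L_def
    proof (rule SUP_least)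
      fix n
      have "E (\<lambda>\<omega>. \<Sum>i<n. g i \<omega>) \<le> (\<Sum>i<n. E (g i))" by (rule E_sum_le[OF g(1) g0])
      also have "\<dots> \<le> (\<Sum>i<n. V_hat M H E (B i) + ereal (e * (1/2) ^ Suc i))" by (intro sum_mono g)
      also have "\<dots> = (\<Sum>i<n. V_hat M H E (B i)) + (\<Sum>i<n. ereal (e * (1/2) ^ Suc i))" by (rule sum.distrib)
      also have "\<dots> \<le> (\<Sum>n. V_hat M H E (B n)) + ereal e"
      proof (rule add_mono)
        show "(\<Sum>i<n. V_hat M H E (B i)) \<le> (\<Sum>n. V_hat M H E (B n))" by (rule suminf_upper[OF V_hat_nonneg])
        have s: "(\<lambda>j. e * (1/2) ^ Suc j) sums e" using sums_mult[OF power_half_series, of e] by simp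
        have "(\<Sum>i<n. e * (1/2) ^ Suc i) \<le> (\<Sum>i. e * (1/2) ^ Suc i)"
          by (rule sum_le_suminf) (use s e in \<open>auto simp: sums_iff\<close>)
        also have "\<dots> = e" using s by (simp add: sums_iff)
        finally show "(\<Sum>i<n. ereal (e * (1/2) ^ Suc i)) \<le> ereal e" by (simp only: sum_ereal ereal_less_eq)
      qed
      finally show "E (\<lambda>\<omega>. \<Sum>i<n. g i \<omega>) \<le> (\<Sum>n. V_hat M H E (B n)) + ereal e" .
    qed
    finally show "C_star M H E A \<le> (\<Sum>n. V_hat M H E (B n)) + ereal e" .
  qed
qed

text \<open>
  If \<open>I_A \<le> g 0 + g 1 + ...\<close>, the partial sums clamped to \<open>[0, 1]\<close> increase to at least \<open>1\<close> on \<open>A\<close>.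
  Clamping makes them bounded, so \<open>E\<close> dominates their \<open>P\<close>-integrals. Should \<open>A\<close> not be measurable for
  \<open>P\<close>, then \<open>measure P A\<close> is \<open>0\<close>.
\<close>

lemma V_sup_le_C_star: "V_sup \<P> A \<le> C_star M H E A"
  unfolding V_sup_def C_star_def
proof (rule SUP_least, rule Inf_greatest, clarify)
  fix P L and g :: "nat \<Rightarrow> 'a \<Rightarrow> real"
  assume P: "P \<in> \<P>" and g: "\<forall>n. g n \<in> H \<and> (\<forall>\<omega>\<in>space M. 0 \<le> g n \<omega>)"
    and A: "\<forall>\<omega>\<in>space M. indicator A \<omega> \<le> (\<Sum>n. ereal (g n \<omega>))" and L: "(\<lambda>n. E (\<lambda>\<omega>. \<Sum>i<n. g i \<omega>)) \<longlonglongrightarrow> L"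
  interpret prob_space P using \<P>_prob[OF P] by simp
  define S where "S = (\<lambda>n \<omega>. \<Sum>i<n. g i \<omega>)"
  define f where "f = (\<lambda>n \<omega>. clamp01 (S n \<omega>))"
  have SH: "S n \<in> H" for n unfolding S_def by (rule sum_H) (use g in auto)
  have S0: "0 \<le> S n \<omega>" if "\<omega> \<in> space M" for n \<omega> unfolding S_def using g that by (auto intro: sum_nonneg)
  have fH: "f n \<in> H" for n
  proof -
    have "(\<lambda>x. clamp01 (x 0)) \<in> C_bLip 1" by (intro clamp_C_bLip lipf_coord) simp
    from H_comp[OF C_bLip_lLip[OF this], of "\<lambda>_. S n"] SH show ?thesis by (simp add: f_def)
  qed
  have f01: "0 \<le> f n \<omega>" "f n \<omega> \<le> 1" for n \<omega> unfolding f_def by (rule clamp01)+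
  have fB: "f n \<in> bounded_part M H" for n by (rule bounded_partI[OF fH, of _ 1]) (use f01 in auto)
  have fE: "ereal (\<integral>\<omega>. f n \<omega> \<partial>P) \<le> E (S n)" for n
  proof -
    have "ereal (\<integral>\<omega>. f n \<omega> \<partial>P) \<le> E (f n)" unfolding E_Er[OF fB] using integral_le_Er[OF P fB] by simp
    also have "\<dots> \<le> E (S n)" by (rule E_mono[OF SH fH]) (use S0 in \<open>auto simp: f_def clamp01_def\<close>)
    finally show ?thesis .
  qed
  show "ereal (measure P A) \<le> L"
  proof (cases "A \<in> sets P")
    case False
    hence "measure P A = 0" by (simp add: measure_notin_sets)
    moreover have "0 \<le> E (S n)" for n
    proof -
      have "0 \<le> ereal (\<integral>\<omega>. f n \<omega> \<partial>P)" using f01 by (simp add: integral_nonneg_AE)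
      thus ?thesis using fE order_trans by blast
    qed
    hence "0 \<le> L" using L unfolding S_def by (intro LIMSEQ_le_const) auto
    ultimately show ?thesis by (simp add: zero_ereal_def)
  next
    case True
    define c where "c = (\<lambda>\<omega>. if \<omega> \<in> space P then SUP n. f n \<omega> else 0)"
    have fm: "f n \<in> borel_measurable P" for n by (rule H_measurable_\<P>[OF P fH])
    have lim: "(\<lambda>n. f n \<omega>) \<longlonglongrightarrow> c \<omega>" if w: "\<omega> \<in> space P" for \<omega>
    proof -
      have "incseq (\<lambda>n. f n \<omega>)" unfolding incseq_def f_def S_def clamp01_def using g w space_\<P>[OF P]
        by (intro allI impI max.mono min.mono order_refl sum_mono2) auto
      moreover have "bdd_above (range (\<lambda>n. f n \<omega>))" using f01 by (auto intro!: bdd_aboveI)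
      ultimately show ?thesis unfolding c_def using w by (simp add: LIMSEQ_incseq_SUP)
    qed
    have cm: "c \<in> borel_measurable P" by (rule borel_measurable_LIMSEQ_real[OF lim fm])
    have conv: "(\<lambda>n. \<integral>\<omega>. f n \<omega> \<partial>P) \<longlonglongrightarrow> (\<integral>\<omega>. c \<omega> \<partial>P)"
      by (rule integral_dominated_convergence[where w = "\<lambda>_. 1"]) (use fm cm lim f01 in auto)
    have c0: "0 \<le> c \<omega> \<and> c \<omega> \<le> 1" if "\<omega> \<in> space P" for \<omega>
      using LIMSEQ_le_const[OF lim[OF that], of 0] LIMSEQ_le_const2[OF lim[OF that], of 1] f01 by auto
    have c1: "1 \<le> c \<omega>" if "\<omega> \<in> A" "\<omega> \<in> space P" for \<omega>
    proof (rule ccontr)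
      assume nc: "\<not> 1 \<le> c \<omega>"
      have "incseq (\<lambda>n. f n \<omega>)" unfolding incseq_def f_def S_def clamp01_def using g that space_\<P>[OF P]
        by (intro allI impI max.mono min.mono order_refl sum_mono2) auto
      hence fc: "f n \<omega> \<le> c \<omega>" for n by (rule incseq_le[OF _ lim[OF that(2)]])
      hence "S n \<omega> \<le> c \<omega>" for n using fc[of n] nc unfolding f_def clamp01_def by linarith
      hence "\<forall>n. (\<Sum>i<n. ereal (g i \<omega>)) \<le> ereal (c \<omega>)" by (simp add: S_def)
      hence "(\<Sum>n. ereal (g n \<omega>)) \<le> ereal (c \<omega>)"
        by (rule suminf_bound) (use g that space_\<P>[OF P] in auto)
      moreover have "indicator A \<omega> \<le> (\<Sum>n. ereal (g n \<omega>))" using A that space_\<P>[OF P] by blast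
      ultimately have "indicator A \<omega> \<le> ereal (c \<omega>)" by (rule order_trans[rotated])
      thus False using that nc by (simp add: one_ereal_def)
    qed
    have ic: "integrable P c" by (rule integrable_const_bound[of _ 1]) (use c0 cm in auto)
    have "measure P A = (\<integral>\<omega>. indicator A \<omega> \<partial>P)" using True by simp
    also have "\<dots> \<le> (\<integral>\<omega>. c \<omega> \<partial>P)"
    proof (rule integral_mono[OF _ ic])
      show "integrable P (indicator A :: _ \<Rightarrow> real)" using True by (simp add: emeasure_eq_measure)
    qed (use c0 c1 in \<open>auto simp: indicator_def\<close>)
    finally have "ereal (measure P A) \<le> ereal (\<integral>\<omega>. c \<omega> \<partial>P)" by simp
    also have "\<dots> \<le> L"
    proof (rule LIMSEQ_le)
      show "(\<lambda>n. ereal (\<integral>\<omega>. f n \<omega> \<partial>P)) \<longlonglongrightarrow> ereal (\<integral>\<omega>. c \<omega> \<partial>P)" using conv by simp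
      show "(\<lambda>n. E (S n)) \<longlonglongrightarrow> L" using L by (simp add: S_def)
    qed (use fE in auto)
    finally show ?thesis .
  qed
qed

lemma V_sup_nonneg: "0 \<le> V_sup \<P> A"
proof -
  obtain P where "P \<in> \<P>" using \<P>_nonempty by blast
  thus ?thesis unfolding V_sup_def by (intro SUP_upper2[of P]) auto
qed

end


section \<open>The moment condition\<close>

lemma blipI: "(\<And>y. \<bar>\<phi> y\<bar> \<le> b) \<Longrightarrow> 0 \<le> C \<Longrightarrow> (\<And>y z. \<bar>\<phi> y - \<phi> z\<bar> \<le> C * \<bar>y - z\<bar>) \<Longrightarrow> blip \<phi>"
  unfolding blip_def by blast

lemma blip_minus: "blip \<phi> \<Longrightarrow> blip (\<lambda>y. - \<phi> y)"
  unfolding blip_def by (auto simp: abs_minus_commute)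

lemma blip_trunc: "0 \<le> c \<Longrightarrow> blip (trunc c)"
  by (rule blipI[of _ c 1]) (auto simp: trunc_def)

lemma blip_trunc_minus: "0 \<le> c \<Longrightarrow> blip (\<lambda>y. trunc c (- y))"
  by (rule blipI[of _ c 1]) (auto simp: trunc_def)

lemma blip_min_square: assumes "0 \<le> c" shows "blip (\<lambda>y. min (y\<^sup>2) c)"
proof (rule blipI[of _ c "2 * sqrt c"])
  fix y z :: real
  define s t where "s = min \<bar>y\<bar> (sqrt c)" and "t = min \<bar>z\<bar> (sqrt c)"
  have sq: "min (y\<^sup>2) c = (min \<bar>y\<bar> (sqrt c))\<^sup>2" for y :: real
  proof (cases "\<bar>y\<bar> \<le> sqrt c")
    case True
    hence "\<bar>y\<bar>\<^sup>2 \<le> (sqrt c)\<^sup>2" by (intro power_mono) auto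
    thus ?thesis using True assms by simp
  next
    case False
    hence "(sqrt c)\<^sup>2 \<le> \<bar>y\<bar>\<^sup>2" using assms by (intro power_mono) auto
    thus ?thesis using False assms by simp
  qed
  have st: "0 \<le> s" "s \<le> sqrt c" "0 \<le> t" "t \<le> sqrt c" "\<bar>s - t\<bar> \<le> \<bar>y - z\<bar>"
    using assms by (auto simp: s_def t_def)
  have "\<bar>min (y\<^sup>2) c - min (z\<^sup>2) c\<bar> = \<bar>(s + t) * (s - t)\<bar>"
    unfolding sq s_def[symmetric] t_def[symmetric] by (simp add: power2_eq_square algebra_simps)
  also have "\<dots> = (s + t) * \<bar>s - t\<bar>" using st by (simp add: abs_mult)
  also have "\<dots> \<le> 2 * sqrt c * \<bar>y - z\<bar>" using st assms by (intro mult_mono) auto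
  finally show "\<bar>min (y\<^sup>2) c - min (z\<^sup>2) c\<bar> \<le> 2 * sqrt c * \<bar>y - z\<bar>" .
qed (use assms in auto)

lemma blip_tail: assumes "0 < y" shows "blip (\<lambda>x. min (\<bar>x\<bar> / y) 1 ^ 4)"
proof (rule blipI[of _ 1 "4 / y"])
  fix x z :: real
  define s t where "s = min (\<bar>x\<bar> / y) 1" and "t = min (\<bar>z\<bar> / y) 1"
  have st: "0 \<le> s" "s \<le> 1" "0 \<le> t" "t \<le> 1" using assms by (auto simp: s_def t_def)
  show "\<bar>min (\<bar>x\<bar> / y) 1 ^ 4\<bar> \<le> 1"
    unfolding s_def[symmetric] using st by (simp add: power_le_one)
  have "\<bar>s - t\<bar> \<le> \<bar>\<bar>x\<bar> / y - \<bar>z\<bar> / y\<bar>" unfolding s_def t_def by linarith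
  also have "\<dots> = \<bar>\<bar>x\<bar> - \<bar>z\<bar>\<bar> / y" using assms by (simp add: diff_divide_distrib[symmetric] abs_divide)
  also have "\<dots> \<le> \<bar>x - z\<bar> / y" using assms by (intro divide_right_mono) auto
  finally have d: "\<bar>s - t\<bar> \<le> \<bar>x - z\<bar> / y" .
  have "s ^ 4 - t ^ 4 = (s^3 + s^2 * t + s * t^2 + t^3) * (s - t)" by algebra
  hence "\<bar>s ^ 4 - t ^ 4\<bar> = (s^3 + s^2 * t + s * t^2 + t^3) * \<bar>s - t\<bar>"
    using st by (simp add: abs_mult)
  also have "\<dots> \<le> 4 * (\<bar>x - z\<bar> / y)"
  proof (rule mult_mono)
    have "s^3 \<le> 1" "s^2 * t \<le> 1" "s * t^2 \<le> 1" "t^3 \<le> 1"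
      using st by (auto intro!: power_le_one mult_le_one)
    thus "s^3 + s^2 * t + s * t^2 + t^3 \<le> 4" by linarith
  qed (use d st in auto)
  finally show "\<bar>min (\<bar>x\<bar> / y) 1 ^ 4 - min (\<bar>z\<bar> / y) 1 ^ 4\<bar> \<le> 4 / y * \<bar>x - z\<bar>"
    unfolding s_def t_def by simp
qed (use assms in auto)

lemma blip_ramp: assumes "0 < b" shows "blip (\<lambda>x. clamp01 (\<bar>x\<bar> / b - 1))"
proof (rule blipI[of _ 1 "1 / b"])
  fix x z :: real
  have "\<bar>clamp01 (\<bar>x\<bar> / b - 1) - clamp01 (\<bar>z\<bar> / b - 1)\<bar> \<le> \<bar>\<bar>x\<bar> / b - \<bar>z\<bar> / b\<bar>"
    unfolding clamp01_def by linarith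
  also have "\<dots> = \<bar>\<bar>x\<bar> - \<bar>z\<bar>\<bar> / b" using assms by (simp add: diff_divide_distrib[symmetric] abs_divide)
  also have "\<dots> \<le> \<bar>x - z\<bar> / b" using assms by (intro divide_right_mono) auto
  finally show "\<bar>clamp01 (\<bar>x\<bar> / b - 1) - clamp01 (\<bar>z\<bar> / b - 1)\<bar> \<le> 1 / b * \<bar>x - z\<bar>" by simp
  show "\<bar>clamp01 (\<bar>x\<bar> / b - 1)\<bar> \<le> 1" using clamp01 by (simp add: abs_of_nonneg)
qed (use assms in auto)

text \<open>
  The logarithm grows more slowly than linearly, which lets changes of scale pass through \<open>LL\<close> at the
  price of the same factor.
\<close>

lemma lg_scale: assumes "1 \<le> \<rho>" "0 < x" shows "lg (\<rho> * x) \<le> \<rho> * lg x"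
proof -
  have "max (exp 1) (\<rho> * x) \<le> \<rho> * max (exp 1) x"
  proof (rule max.boundedI)
    have "1 * exp 1 \<le> \<rho> * max (exp 1) x" using assms by (intro mult_mono) auto
    thus "exp 1 \<le> \<rho> * max (exp 1) x" by simp
    show "\<rho> * x \<le> \<rho> * max (exp 1) x" using assms by (intro mult_left_mono) auto
  qed
  hence "lg (\<rho> * x) \<le> ln (\<rho> * max (exp 1) x)"
    unfolding lg_def by (subst ln_le_cancel_iff) (use assms in \<open>auto simp: less_max_iff_disj\<close>)
  also have "\<dots> = ln \<rho> + lg x" unfolding lg_def using assms by (subst ln_mult) (auto simp: less_max_iff_disj)
  also have "\<dots> \<le> (\<rho> - 1) * lg x + lg x"
  proof -
    have "ln \<rho> \<le> \<rho> - 1" using assms by (intro ln_le_minus_one) auto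
    also have "\<dots> \<le> (\<rho> - 1) * lg x" using lg_ge_1[of x] assms mult_left_mono[OF lg_ge_1, of "\<rho> - 1" x] by simp
    finally show ?thesis by simp
  qed
  finally show ?thesis by (simp add: algebra_simps)
qed

lemma LL_scale: assumes "1 \<le> \<rho>" "0 < x" shows "LL (\<rho> * x) \<le> \<rho> * LL x"
proof -
  have "LL (\<rho> * x) \<le> lg (\<rho> * lg x)" by (intro lg_mono lg_scale assms)
  also have "\<dots> \<le> \<rho> * LL x" using lg_ge_1[of x] by (intro lg_scale assms) auto
  finally show ?thesis .
qed

lemma LL_le: "1 \<le> x \<Longrightarrow> LL x \<le> x"
proof -
  assume x: "1 \<le> x"
  have "lg 1 = 1" unfolding lg_def by (simp add: max_def)
  hence l: "lg y \<le> y" if "1 \<le> y" for y using lg_scale[of y 1] that by simp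
  show ?thesis using l[OF x] l[OF lg_ge_1[of x]] by simp
qed

lemma square_over_LL_mono:
  assumes "0 \<le> u" "u \<le> v" shows "u\<^sup>2 / LL u \<le> v\<^sup>2 / LL v"
proof (cases "u = 0")
  case True thus ?thesis using lg_ge_1[of "lg v"] by simp
next
  case False
  have p: "0 < LL u" "0 < LL v" using lg_ge_1[of "lg u"] lg_ge_1[of "lg v"] by auto
  have "LL v \<le> v / u * LL u" using LL_scale[of "v / u" u] False assms by simp
  also have "\<dots> \<le> (v / u)\<^sup>2 * LL u"
  proof (rule mult_right_mono)
    have "1 \<le> v / u" using assms False by simp
    from power_increasing[OF _ this, of 1 2] show "v / u \<le> (v / u)\<^sup>2" by simp
  qed (use p in simp)
  finally have "u\<^sup>2 * LL v \<le> v\<^sup>2 * LL u" using False by (simp add: power_divide field_simps)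
  thus ?thesis using p by (simp add: field_simps)
qed

lemma mono_tendsto_SUP_at_top:
  fixes f :: "real \<Rightarrow> ereal"
  assumes "mono f" shows "(f \<longlongrightarrow> (SUP c. f c)) at_top"
proof (rule increasing_tendsto)
  show "eventually (\<lambda>c. f c \<le> (SUP c. f c)) at_top" by (intro always_eventually allI SUP_upper) simp
  fix x assume "x < (SUP c. f c)"
  then obtain c where c: "x < f c" unfolding less_SUP_iff by auto
  show "eventually (\<lambda>c. x < f c) at_top"
    using eventually_ge_at_top[of c] by eventually_elim (use c assms in \<open>auto simp: mono_def intro: less_le_trans\<close>)
qed

locale lil_setting = sublinear_iid M H E \<P> Y
  for M :: "'a measure" and H :: "('a \<Rightarrow> real) set" and E :: "('a \<Rightarrow> real) \<Rightarrow> ereal"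
    and \<P> :: "'a measure set" and Y :: "nat \<Rightarrow> 'a \<Rightarrow> real" +
  fixes V :: "'a set \<Rightarrow> real" and \<sigma>\<^sub>l \<sigma>\<^sub>u :: real
  assumes V: "associated_capacity M H E V"
    and wc: "countably_dim_weakly_compact M H \<P>"
    and choq: "choquet M V (\<lambda>\<omega>. (Y 1 \<omega>)\<^sup>2 / lg (lg \<bar>Y 1 \<omega>\<bar>)) < \<infinity>"
    and centered: "((\<lambda>c::real. E (\<lambda>\<omega>. trunc c (Y 1 \<omega>))) \<longlongrightarrow> 0) at_top"
      "((\<lambda>c::real. E (\<lambda>\<omega>. trunc c (- Y 1 \<omega>))) \<longlongrightarrow> 0) at_top"
    and low_pos: "lower_variance E (Y 1) > 0"
    and up_fin: "upper_variance E (Y 1) < \<infinity>"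
    and \<sigma>l: "\<sigma>\<^sub>l = sqrt (real_of_ereal (lower_variance E (Y 1)))"
    and \<sigma>u: "\<sigma>\<^sub>u = sqrt (real_of_ereal (upper_variance E (Y 1)))"
begin

text \<open>
  Real-valued forms of the truncated upper and lower variance, the tail function and the drift left
  by truncation. They play the roles of the bounds in \<^locale>\<open>lip_process\<close>.
\<close>

definition up2 :: "real \<Rightarrow> real" where "up2 c = law (\<lambda>y. min (y\<^sup>2) c)"
definition low2 :: "real \<Rightarrow> real" where "low2 c = - law (\<lambda>y. - min (y\<^sup>2) c)"
definition tailw :: "real \<Rightarrow> real" where "tailw y = law (\<lambda>x. min (\<bar>x\<bar> / y) 1 ^ 4)"
definition drift :: "real \<Rightarrow> real" where "drift c = max (law (trunc c)) (law (\<lambda>y. trunc c (- y)))"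

lemma Y1_bounded: "blip \<phi> \<Longrightarrow> (\<lambda>\<omega>. \<phi> (Y 1 \<omega>)) \<in> bounded_part M H"
  by (rule one_bounded) simp_all

lemma E_law: "blip \<phi> \<Longrightarrow> E (\<lambda>\<omega>. \<phi> (Y 1 \<omega>)) = ereal (law \<phi>)"
  by (rule law_eq) simp_all

lemma H_min_square: "(\<lambda>\<omega>. min ((Y 1 \<omega>)\<^sup>2) c) \<in> H"
proof (cases "0 \<le> c")
  case True
  thus ?thesis by (rule bounded_part_H[OF Y1_bounded[OF blip_min_square]])
next
  case False
  hence "(\<lambda>\<omega>. min ((Y 1 \<omega>)\<^sup>2) c) = (\<lambda>\<omega>. c)"
    by (intro ext min_absorb2) (meson le_cases order_trans zero_le_power2)
  thus ?thesis using const_H by simp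
qed

lemma upper_variance_SUP: "upper_variance E (Y 1) = (SUP c. E (\<lambda>\<omega>. min ((Y 1 \<omega>)\<^sup>2) c))"
proof -
  have "mono (\<lambda>c. E (\<lambda>\<omega>. min ((Y 1 \<omega>)\<^sup>2) c))"
    by (intro monoI E_mono H_min_square) auto
  from mono_tendsto_SUP_at_top[OF this] show ?thesis
    unfolding upper_variance_def by (intro tendsto_Lim) auto
qed

lemma lower_variance_SUP: "lower_variance E (Y 1) = (SUP c. conj_expectation E (\<lambda>\<omega>. min ((Y 1 \<omega>)\<^sup>2) c))"
proof -
  have "(\<lambda>\<omega>. - min ((Y 1 \<omega>)\<^sup>2) c) \<in> H" for c using H_scale[OF H_min_square, of "-1" c] by simp
  hence "mono (\<lambda>c. conj_expectation E (\<lambda>\<omega>. min ((Y 1 \<omega>)\<^sup>2) c))"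
    unfolding conj_expectation_def by (intro monoI, subst ereal_minus_le_minus, intro E_mono) auto
  from mono_tendsto_SUP_at_top[OF this] show ?thesis
    unfolding lower_variance_def by (intro tendsto_Lim) auto
qed

lemma E_up2: "0 \<le> c \<Longrightarrow> E (\<lambda>\<omega>. min ((Y 1 \<omega>)\<^sup>2) c) = ereal (up2 c)"
  unfolding up2_def by (rule E_law[OF blip_min_square])

lemma conj_low2: "0 \<le> c \<Longrightarrow> conj_expectation E (\<lambda>\<omega>. min ((Y 1 \<omega>)\<^sup>2) c) = ereal (low2 c)"
  unfolding low2_def conj_expectation_def using E_law[OF blip_minus[OF blip_min_square]] by simp

lemma upper_variance_eq: "upper_variance E (Y 1) = ereal (\<sigma>\<^sub>u\<^sup>2)"
proof -
  have "E (\<lambda>\<omega>. min ((Y 1 \<omega>)\<^sup>2) 0) \<le> upper_variance E (Y 1)" unfolding upper_variance_SUP by (rule SUP_upper) simp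
  moreover have "(\<lambda>\<omega>. min ((Y 1 \<omega>)\<^sup>2) 0) = (\<lambda>\<omega>. 0)" by (auto simp: min_absorb2)
  ultimately have "0 \<le> upper_variance E (Y 1)" by (simp add: E_const zero_ereal_def)
  thus ?thesis using up_fin \<sigma>u by (cases "upper_variance E (Y 1)") auto
qed

lemma up2_le: "0 \<le> c \<Longrightarrow> up2 c \<le> \<sigma>\<^sub>u\<^sup>2"
proof -
  assume c: "0 \<le> c"
  have "E (\<lambda>\<omega>. min ((Y 1 \<omega>)\<^sup>2) c) \<le> upper_variance E (Y 1)" unfolding upper_variance_SUP by (rule SUP_upper) simp
  thus ?thesis unfolding E_up2[OF c] upper_variance_eq by simp
qed

lemma up2_approx: assumes "0 < \<delta>" obtains c where "0 < c" "\<sigma>\<^sub>u\<^sup>2 - \<delta> < up2 c"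
proof -
  have "ereal (\<sigma>\<^sub>u\<^sup>2 - \<delta>) < (SUP c. E (\<lambda>\<omega>. min ((Y 1 \<omega>)\<^sup>2) c))"
    unfolding upper_variance_SUP[symmetric] upper_variance_eq using assms by simp
  then obtain c where c: "ereal (\<sigma>\<^sub>u\<^sup>2 - \<delta>) < E (\<lambda>\<omega>. min ((Y 1 \<omega>)\<^sup>2) c)" unfolding less_SUP_iff by auto
  have "E (\<lambda>\<omega>. min ((Y 1 \<omega>)\<^sup>2) c) \<le> E (\<lambda>\<omega>. min ((Y 1 \<omega>)\<^sup>2) (max c 1))" by (intro E_mono H_min_square) auto
  also have "\<dots> = ereal (up2 (max c 1))" by (rule E_up2) simp
  finally have "ereal (\<sigma>\<^sub>u\<^sup>2 - \<delta>) < ereal (up2 (max c 1))" using c by (rule less_le_trans[rotated])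
  thus ?thesis by (intro that[of "max c 1"]) auto
qed

lemma low2_le_up2: "0 \<le> c \<Longrightarrow> low2 c \<le> up2 c"
proof -
  assume c: "0 \<le> c"
  obtain P where P: "P \<in> \<P>" using \<P>_nonempty by blast
  have "- (\<integral>\<omega>. min ((Y 1 \<omega>)\<^sup>2) c \<partial>P) \<le> - low2 c"
    using integral_le_law[OF P blip_minus[OF blip_min_square[OF c]]] by (simp add: low2_def)
  moreover have "(\<integral>\<omega>. min ((Y 1 \<omega>)\<^sup>2) c \<partial>P) \<le> up2 c"
    using integral_le_law[OF P blip_min_square[OF c]] by (simp add: up2_def)
  ultimately show ?thesis by linarith
qed

lemma lower_variance_eq: "lower_variance E (Y 1) = ereal (\<sigma>\<^sub>l\<^sup>2)"
proof -
  have "lower_variance E (Y 1) \<le> ereal (\<sigma>\<^sub>u\<^sup>2)"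
    unfolding lower_variance_SUP
  proof (rule SUP_least)
    fix c
    have "(\<lambda>\<omega>. - min ((Y 1 \<omega>)\<^sup>2) c) \<in> H" for c using H_scale[OF H_min_square, of "-1" c] by simp
    hence "conj_expectation E (\<lambda>\<omega>. min ((Y 1 \<omega>)\<^sup>2) c) \<le> conj_expectation E (\<lambda>\<omega>. min ((Y 1 \<omega>)\<^sup>2) (max c 0))"
      unfolding conj_expectation_def by (subst ereal_minus_le_minus, intro E_mono) auto
    also have "\<dots> \<le> ereal (\<sigma>\<^sub>u\<^sup>2)" using low2_le_up2[of "max c 0"] up2_le[of "max c 0"] by (subst conj_low2) auto
    finally show "conj_expectation E (\<lambda>\<omega>. min ((Y 1 \<omega>)\<^sup>2) c) \<le> ereal (\<sigma>\<^sub>u\<^sup>2)" .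
  qed
  thus ?thesis using low_pos \<sigma>l by (cases "lower_variance E (Y 1)") auto
qed

lemma \<sigma>l_pos: "0 < \<sigma>\<^sub>l"
  using low_pos lower_variance_eq \<sigma>l by (cases "lower_variance E (Y 1)") auto

lemma low2_approx: assumes "0 < \<delta>" obtains c where "0 < c" "\<sigma>\<^sub>l\<^sup>2 - \<delta> < low2 c"
proof -
  have "ereal (\<sigma>\<^sub>l\<^sup>2 - \<delta>) < (SUP c. conj_expectation E (\<lambda>\<omega>. min ((Y 1 \<omega>)\<^sup>2) c))"
    unfolding lower_variance_SUP[symmetric] lower_variance_eq using assms by simp
  then obtain c where c: "ereal (\<sigma>\<^sub>l\<^sup>2 - \<delta>) < conj_expectation E (\<lambda>\<omega>. min ((Y 1 \<omega>)\<^sup>2) c)" unfolding less_SUP_iff by auto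
  have "(\<lambda>\<omega>. - min ((Y 1 \<omega>)\<^sup>2) c) \<in> H" for c using H_scale[OF H_min_square, of "-1" c] by simp
  hence "conj_expectation E (\<lambda>\<omega>. min ((Y 1 \<omega>)\<^sup>2) c) \<le> conj_expectation E (\<lambda>\<omega>. min ((Y 1 \<omega>)\<^sup>2) (max c 1))"
    unfolding conj_expectation_def by (subst ereal_minus_le_minus, intro E_mono) auto
  also have "\<dots> = ereal (low2 (max c 1))" by (rule conj_low2) simp
  finally have "ereal (\<sigma>\<^sub>l\<^sup>2 - \<delta>) < ereal (low2 (max c 1))" using c by (rule less_le_trans[rotated])
  thus ?thesis by (intro that[of "max c 1"]) auto
qed

lemma low2_le: "0 \<le> c \<Longrightarrow> low2 c \<le> \<sigma>\<^sub>l\<^sup>2"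
proof -
  assume c: "0 \<le> c"
  have "conj_expectation E (\<lambda>\<omega>. min ((Y 1 \<omega>)\<^sup>2) c) \<le> lower_variance E (Y 1)" unfolding lower_variance_SUP by (rule SUP_upper) simp
  thus ?thesis unfolding conj_low2[OF c] lower_variance_eq by simp
qed

lemma drift_tendsto: "(drift \<longlongrightarrow> 0) at_top"
proof -
  have ev: "eventually (\<lambda>c::real. 0 \<le> c) at_top" by (rule eventually_ge_at_top)
  have "((\<lambda>c. ereal (law (trunc c))) \<longlongrightarrow> ereal 0) at_top"
    using centered(1) unfolding zero_ereal_def[symmetric]
    by (rule Lim_transform_eventually) (use ev in \<open>eventually_elim, simp add: E_law[OF blip_trunc, unfolded One_nat_def]\<close>)
  moreover have "((\<lambda>c. ereal (law (\<lambda>y. trunc c (- y)))) \<longlongrightarrow> ereal 0) at_top"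
    using centered(2) unfolding zero_ereal_def[symmetric]
    by (rule Lim_transform_eventually) (use ev in \<open>eventually_elim, simp add: E_law[OF blip_trunc_minus, unfolded One_nat_def]\<close>)
  ultimately have "((\<lambda>c. max (law (trunc c)) (law (\<lambda>y. trunc c (- y)))) \<longlongrightarrow> max 0 0) at_top"
    by (intro tendsto_max) auto
  thus ?thesis unfolding drift_def[abs_def] by simp
qed

abbreviation Z :: "nat \<Rightarrow> 'a \<Rightarrow> real" where "Z \<equiv> \<lambda>i. Y (Suc i)"

lemma lip_process_\<P>:
  assumes P: "P \<in> \<P>"
  shows "lip_process P Z (\<lambda>_. \<sigma>\<^sub>u\<^sup>2) tailw drift"
proof (rule lip_process.intro)
  show "prob_space P" using \<P>_prob[OF P] by simp
  show "Z i \<in> borel_measurable P" for i by (rule H_measurable_\<P>[OF P Y_H]) simp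
  show "(drift \<longlongrightarrow> 0) at_top" by (rule drift_tendsto)
  fix n g and c :: real assume g: "g \<in> C_bLip n" "\<And>x. 0 \<le> g x \<and> g x \<le> 1" and c: "0 < c"
  have Yv: "g (\<lambda>i. Y (Suc i) \<omega>) = g (Yv \<omega>)" for \<omega> by (simp add: Yv_def)
  have g0: "0 \<le> (\<integral>\<omega>. g (Yv \<omega>) \<partial>P)" using g by (simp add: integral_nonneg_AE)
  note bound = weighted_law_bound[OF P g(1) conjunct1[OF g(2)]]
  have le: "(\<integral>\<omega>. g (Yv \<omega>) * \<phi> (Y (Suc n) \<omega>) \<partial>P) \<le> r * (\<integral>\<omega>. g (Yv \<omega>) \<partial>P)" if "blip \<phi>" "law \<phi> \<le> r" for \<phi> r
    using bound[OF that(1)] mult_right_mono[OF that(2) g0] by linarith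
  show "(\<integral>\<omega>. g (\<lambda>i. Y (Suc i) \<omega>) * trunc c (Y (Suc n) \<omega>) \<partial>P) \<le> drift c * (\<integral>\<omega>. g (\<lambda>i. Y (Suc i) \<omega>) \<partial>P)"
    unfolding Yv using c by (intro le blip_trunc) (auto simp: drift_def)
  show "(\<integral>\<omega>. g (\<lambda>i. Y (Suc i) \<omega>) * trunc c (- Y (Suc n) \<omega>) \<partial>P) \<le> drift c * (\<integral>\<omega>. g (\<lambda>i. Y (Suc i) \<omega>) \<partial>P)"
    unfolding Yv using c by (intro le[of "\<lambda>y. trunc c (- y)"] blip_trunc_minus) (auto simp: drift_def)
  show "(\<integral>\<omega>. g (\<lambda>i. Y (Suc i) \<omega>) * min ((Y (Suc n) \<omega>)\<^sup>2) c \<partial>P) \<le> \<sigma>\<^sub>u\<^sup>2 * (\<integral>\<omega>. g (\<lambda>i. Y (Suc i) \<omega>) \<partial>P)"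
    unfolding Yv using c up2_le[of c] by (intro le[of "\<lambda>y. min (y\<^sup>2) c"] blip_min_square) (auto simp: up2_def)
  show "(\<integral>\<omega>. g (\<lambda>i. Y (Suc i) \<omega>) * min (\<bar>Y (Suc n) \<omega>\<bar> / c) 1 ^ 4 \<partial>P) \<le> tailw c * (\<integral>\<omega>. g (\<lambda>i. Y (Suc i) \<omega>) \<partial>P)"
    unfolding Yv using c by (intro le[of "\<lambda>y. min (\<bar>y\<bar> / c) 1 ^ 4"] blip_tail) (auto simp: tailw_def)
qed

lemma mds_\<P>: "P \<in> \<P> \<Longrightarrow> mds P (gen P Z) Z (\<lambda>_. \<sigma>\<^sub>u\<^sup>2) tailw"
  by (rule lip_process.mds[OF lip_process_\<P>])

lemma lowvar_\<P>:
  assumes P: "P \<in> \<P>" and c: "0 < c"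
  shows "mds.lowvar P (gen P Z) Z n c (low2 c)"
proof (rule lip_process.lowvar[OF lip_process_\<P>[OF P] c])
  fix g assume g: "g \<in> C_bLip n" "\<And>x. 0 \<le> g x \<and> g x \<le> 1"
  have Yv: "g (\<lambda>i. Y (Suc i) \<omega>) = g (Yv \<omega>)" for \<omega> by (simp add: Yv_def)
  have "blip (\<lambda>y. - min (y\<^sup>2) c)" using c by (intro blip_minus blip_min_square) simp
  from weighted_law_bound[OF P g(1) conjunct1[OF g(2)] this]
  show "low2 c * (\<integral>\<omega>. g (\<lambda>i. Y (Suc i) \<omega>) \<partial>P) \<le> (\<integral>\<omega>. g (\<lambda>i. Y (Suc i) \<omega>) * min ((Y (Suc n) \<omega>)\<^sup>2) c \<partial>P)"
    unfolding Yv low2_def by simp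
qed

text \<open>
  A Lipschitz substitute for the probability that \<open>\<bar>Y 1\<bar>\<close> exceeds a level between \<open>b\<close> and \<open>2 b\<close>.
\<close>

definition T :: "real \<Rightarrow> real" where "T b = law (\<lambda>x. clamp01 (\<bar>x\<bar> / b - 1))"

lemma T_nonneg: "0 < b \<Longrightarrow> 0 \<le> T b"
proof -
  assume b: "0 < b"
  have "blip (\<lambda>x. 0 :: real)" by (rule blipI[of _ 0 0]) auto
  from law_mono[OF this blip_ramp[OF b]] clamp01 show ?thesis unfolding T_def by (simp add: law_const)
qed

text \<open>
  The ramp vanishes unless \<open>\<bar>Y 1\<bar> > b\<close>, where \<open>(Y 1)\<^sup>2 / LL \<bar>Y 1\<bar> \<ge> b\<^sup>2 / LL b \<ge> s\<close>; so it lies below an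
  indicator and the capacity \<open>V\<close> dominates its expectation.
\<close>

lemma T_le_V:
  assumes b: "0 < b" and s: "s \<le> b\<^sup>2 / LL b"
  shows "T b \<le> V {\<omega>\<in>space M. s \<le> (Y 1 \<omega>)\<^sup>2 / LL \<bar>Y 1 \<omega>\<bar>}"
proof -
  define A where "A = {\<omega>\<in>space M. s \<le> (Y 1 \<omega>)\<^sup>2 / LL \<bar>Y 1 \<omega>\<bar>}"
  have [measurable]: "Y 1 \<in> borel_measurable M" using H_measurable Y_H[of 1] by auto
  have A: "A \<in> sets M" unfolding A_def lg_def by measurable
  have ind: "\<forall>\<omega>\<in>space M. clamp01 (\<bar>Y 1 \<omega>\<bar> / b - 1) \<le> indicator A \<omega>"
  proof
    fix \<omega> assume w: "\<omega> \<in> space M"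
    show "clamp01 (\<bar>Y 1 \<omega>\<bar> / b - 1) \<le> indicator A \<omega>"
    proof (cases "b \<le> \<bar>Y 1 \<omega>\<bar>")
      case True
      have "s \<le> \<bar>Y 1 \<omega>\<bar>\<^sup>2 / LL \<bar>Y 1 \<omega>\<bar>" using s square_over_LL_mono[of b "\<bar>Y 1 \<omega>\<bar>"] True b by linarith
      hence "\<omega> \<in> A" using w by (simp add: A_def)
      thus ?thesis using clamp01 by simp
    next
      case False
      hence "\<bar>Y 1 \<omega>\<bar> / b \<le> 1" using b by simp
      hence "clamp01 (\<bar>Y 1 \<omega>\<bar> / b - 1) = 0" by (simp add: clamp01_def)
      thus ?thesis by simp
    qed
  qed
  have "E (\<lambda>\<omega>. clamp01 (\<bar>Y 1 \<omega>\<bar> / b - 1)) \<le> ereal (V A)"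
    by (rule V[unfolded associated_capacity_def, THEN conjunct2, THEN conjunct1, THEN bspec, OF A, THEN bspec,
          OF bounded_part_H[OF Y1_bounded[OF blip_ramp[OF b]]], THEN mp, OF ind])
  thus ?thesis unfolding A_def T_def E_law[OF blip_ramp[OF b]] by simp
qed

lemma choquet_integral_finite:
  "(\<integral>\<^sup>+t\<in>{0..}. ennreal (V {\<omega>\<in>space M. t \<le> (Y 1 \<omega>)\<^sup>2 / LL \<bar>Y 1 \<omega>\<bar>}) \<partial>lborel) < \<infinity>"
proof -
  let ?A = "\<lambda>t. {\<omega>\<in>space M. t \<le> (Y 1 \<omega>)\<^sup>2 / LL \<bar>Y 1 \<omega>\<bar>}"
  have V1: "V (space M) = 1"
  proof -
    have "E (\<lambda>\<omega>. 1) \<le> ereal (V (space M))"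
      using V const_H[of 1] unfolding associated_capacity_def by (auto dest!: bspec[of _ _ "space M"])
    moreover have "V (space M) \<le> 1" using V unfolding associated_capacity_def by auto
    ultimately show ?thesis by (simp add: E_const)
  qed
  have "(\<integral>\<^sup>+t\<in>{..0}. ennreal (1 - V (?A t)) \<partial>lborel) = (\<integral>\<^sup>+t. 0 \<partial>(lborel :: real measure))"
  proof (rule nn_integral_cong)
    fix t :: real
    show "ennreal (1 - V (?A t)) * indicator {..0} t = 0"
    proof (cases "t \<le> 0")
      case True
      have "?A t = space M"
      proof (safe)
        fix \<omega>
        have "0 \<le> (Y 1 \<omega>)\<^sup>2 / LL \<bar>Y 1 \<omega>\<bar>" using lg_ge_1[of "lg \<bar>Y 1 \<omega>\<bar>"] by simp
        thus "t \<le> (Y 1 \<omega>)\<^sup>2 / LL \<bar>Y 1 \<omega>\<bar>" using True by linarith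
      qed
      thus ?thesis using V1 by simp
    qed simp
  qed
  hence "choquet M V (\<lambda>\<omega>. (Y 1 \<omega>)\<^sup>2 / LL \<bar>Y 1 \<omega>\<bar>) = enn2ereal (\<integral>\<^sup>+t\<in>{0..}. ennreal (V (?A t)) \<partial>lborel)"
    unfolding choquet_def by (simp add: zero_ennreal.rep_eq)
  thus ?thesis using choq by (simp add: less_ennreal.rep_eq top_ennreal.rep_eq top_ereal_def infinity_ennreal_def)
qed

text \<open>
  On the disjoint intervals \<open>I j\<close>, of length proportional to \<open>\<theta> ^ j\<close>, the integrand of the Choquet
  integral is at least \<open>T (b j)\<close>.
\<close>

lemma summable_T:
  assumes \<theta>: "1 < \<theta>" and d: "0 < d" and b: "\<And>j::nat. 0 < b j" and q: "\<And>j. d * \<theta> ^ j \<le> (b j)\<^sup>2 / LL (b j)"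
  shows "summable (\<lambda>j. \<theta> ^ j * T (b j))"
proof -
  define I where "I = (\<lambda>j::nat. {d * \<theta> ^ j / \<theta> <.. d * \<theta> ^ j})"
  have disj: "i = j" if "s \<in> I i" "s \<in> I j" for s i j
  proof -
    have no: False if "i < j" "s \<in> I i" "s \<in> I j" for i j
    proof -
      have "\<theta> ^ Suc i \<le> \<theta> ^ j" using that \<theta> by (intro power_increasing) auto
      hence "\<theta> ^ i \<le> \<theta> ^ j / \<theta>" using \<theta> by (simp add: field_simps)
      hence "d * \<theta> ^ i \<le> d * \<theta> ^ j / \<theta>" using d by (simp add: mult_left_mono flip: times_divide_eq_right)
      thus False using that by (auto simp: I_def)
    qed
    show ?thesis using no[of i j] no[of j i] that by (cases i j rule: linorder_cases) auto
  qed
  have "(\<Sum>j. ennreal (T (b j)) * ennreal (d * \<theta> ^ j - d * \<theta> ^ j / \<theta>)) = (\<Sum>j. \<integral>\<^sup>+s. ennreal (T (b j)) * indicator (I j) s \<partial>lborel)"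
  proof (rule suminf_cong)
    fix j
    have "d * \<theta> ^ j / \<theta> \<le> d * \<theta> ^ j" using \<theta> d by (simp add: field_simps)
    hence "emeasure lborel (I j) = ennreal (d * \<theta> ^ j - d * \<theta> ^ j / \<theta>)" unfolding I_def by simp
    thus "ennreal (T (b j)) * ennreal (d * \<theta> ^ j - d * \<theta> ^ j / \<theta>) = (\<integral>\<^sup>+s. ennreal (T (b j)) * indicator (I j) s \<partial>lborel)"
      by (subst nn_integral_cmult_indicator) (auto simp: I_def)
  qed
  also have "\<dots> = (\<integral>\<^sup>+s. (\<Sum>j. ennreal (T (b j)) * indicator (I j) s) \<partial>lborel)"
    by (rule nn_integral_suminf[symmetric]) (simp add: I_def)
  also have "\<dots> \<le> (\<integral>\<^sup>+s\<in>{0..}. ennreal (V {\<omega>\<in>space M. s \<le> (Y 1 \<omega>)\<^sup>2 / LL \<bar>Y 1 \<omega>\<bar>}) \<partial>lborel)"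
  proof (rule nn_integral_mono)
    fix s
    show "(\<Sum>j. ennreal (T (b j)) * indicator (I j) s) \<le> ennreal (V {\<omega>\<in>space M. s \<le> (Y 1 \<omega>)\<^sup>2 / LL \<bar>Y 1 \<omega>\<bar>}) * indicator {0..} s"
    proof (cases "\<exists>j. s \<in> I j")
      case True
      then obtain j where j: "s \<in> I j" by blast
      have "(\<Sum>j. ennreal (T (b j)) * indicator (I j) s) = (\<Sum>j\<in>{j}. ennreal (T (b j)) * indicator (I j) s)"
        by (rule suminf_finite) (use disj j in \<open>auto simp: indicator_def\<close>)
      also have "\<dots> = ennreal (T (b j))" using j by simp
      also have "\<dots> \<le> ennreal (V {\<omega>\<in>space M. s \<le> (Y 1 \<omega>)\<^sup>2 / LL \<bar>Y 1 \<omega>\<bar>})"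
        by (intro ennreal_leI T_le_V b) (use j q[of j] in \<open>auto simp: I_def\<close>)
      also have "\<dots> = ennreal (V {\<omega>\<in>space M. s \<le> (Y 1 \<omega>)\<^sup>2 / LL \<bar>Y 1 \<omega>\<bar>}) * indicator {0..} s"
      proof -
        have "0 \<le> d * \<theta> ^ j / \<theta>" using d \<theta> by simp
        hence "0 \<le> s" using j by (auto simp: I_def)
        thus ?thesis by simp
      qed
      finally show ?thesis .
    next
      case False
      hence "(\<Sum>j. ennreal (T (b j)) * indicator (I j) s) = 0" by (simp add: indicator_def)
      thus ?thesis by simp
    qed
  qed
  also have "\<dots> < \<infinity>" by (rule choquet_integral_finite)
  finally have fin: "(\<Sum>j. ennreal (T (b j)) * ennreal (d * \<theta> ^ j - d * \<theta> ^ j / \<theta>)) < \<infinity>" .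
  have len: "0 \<le> d * \<theta> ^ j - d * \<theta> ^ j / \<theta>" for j using d \<theta> by (simp add: field_simps)
  have "(\<Sum>j. ennreal (T (b j) * (d * \<theta> ^ j - d * \<theta> ^ j / \<theta>))) < \<infinity>"
    using fin by (simp only: ennreal_mult[OF T_nonneg[OF b] len])
  hence "summable (\<lambda>j. T (b j) * (d * \<theta> ^ j - d * \<theta> ^ j / \<theta>))"
    using T_nonneg[OF b] len by (intro summable_suminf_not_top mult_nonneg_nonneg) auto
  moreover have "T (b j) * (d * \<theta> ^ j - d * \<theta> ^ j / \<theta>) = d * (1 - 1 / \<theta>) * (\<theta> ^ j * T (b j))" for j
    using \<theta> by (simp add: field_simps)
  ultimately have "summable (\<lambda>j. d * (1 - 1 / \<theta>) * (\<theta> ^ j * T (b j)))" by simp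
  thus ?thesis using d \<theta> by (subst (asm) summable_cmult_iff) auto
qed

text \<open>
  Cutting the range of \<open>\<bar>x\<bar>\<close> at the levels \<open>y j\<close> and replacing the indicator of \<open>\<bar>x\<bar> \<ge> y j\<close> by the ramp
  that rises from \<open>y j / 2\<close> to \<open>y j\<close>; only finitely many layers below \<open>y k\<close> are involved, because the
  cut-off at \<open>1\<close> merges everything above.
\<close>

lemma tailw_layers:
  assumes y: "\<And>j. 0 < y j" "\<And>i j. i \<le> j \<Longrightarrow> y i \<le> y j"
  shows "tailw (y k) \<le> (y 0 / y k) ^ 4 + (\<Sum>j\<le>k. (y (Suc j) / y k) ^ 4 * T (y j / 2))"
proof -
  define r where "r = (\<lambda>j x. clamp01 (\<bar>x\<bar> / (y j / 2) - 1))"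
  have pw: "min (\<bar>x\<bar> / y k) 1 ^ 4 \<le> (y 0 / y k) ^ 4 + (\<Sum>j\<le>k. (y (Suc j) / y k) ^ 4 * r j x)" for x
  proof (cases "\<bar>x\<bar> < y 0")
    case True
    have "min (\<bar>x\<bar> / y k) 1 ^ 4 \<le> (y 0 / y k) ^ 4"
      using True y(1)[of k] by (intro power_mono) (auto simp: min_le_iff_disj intro: divide_right_mono)
    moreover have "0 \<le> (\<Sum>j\<le>k. (y (Suc j) / y k) ^ 4 * r j x)" unfolding r_def by (intro sum_nonneg mult_nonneg_nonneg clamp01) auto
    ultimately show ?thesis by linarith
  next
    case False
    define j where "j = (GREATEST j. j \<le> k \<and> y j \<le> \<bar>x\<bar>)"
    have "j \<le> k \<and> y j \<le> \<bar>x\<bar>" unfolding j_def by (rule GreatestI_nat[of _ 0 k]) (use False in auto)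
    hence j: "j \<le> k" "y j \<le> \<bar>x\<bar>" by auto
    have "min (\<bar>x\<bar> / y k) 1 \<le> y (Suc j) / y k"
    proof (cases "j = k")
      case True
      have "1 \<le> y (Suc j) / y k" using y(1)[of k] y(2)[of k "Suc k"] True by simp
      thus ?thesis by linarith
    next
      case nk: False
      have "\<not> (Suc j \<le> k \<and> y (Suc j) \<le> \<bar>x\<bar>)"
      proof
        assume "Suc j \<le> k \<and> y (Suc j) \<le> \<bar>x\<bar>"
        hence "Suc j \<le> j" unfolding j_def by (intro Greatest_le_nat[of _ _ k]) auto
        thus False by simp
      qed
      hence "\<bar>x\<bar> \<le> y (Suc j)" using j nk by auto
      hence "\<bar>x\<bar> / y k \<le> y (Suc j) / y k" using y(1)[of k] by (intro divide_right_mono) auto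
      thus ?thesis by linarith
    qed
    hence "min (\<bar>x\<bar> / y k) 1 ^ 4 \<le> (y (Suc j) / y k) ^ 4" using y(1)[of k] by (intro power_mono) auto
    also have "\<dots> = (y (Suc j) / y k) ^ 4 * r j x"
    proof -
      have "2 \<le> \<bar>x\<bar> / (y j / 2)" using j y(1)[of j] by (simp add: field_simps)
      thus ?thesis by (simp add: r_def clamp01_def)
    qed
    also have "\<dots> \<le> (\<Sum>j\<le>k. (y (Suc j) / y k) ^ 4 * r j x)"
      unfolding r_def by (rule member_le_sum[of j "{..k}"]) (use j in \<open>auto intro!: mult_nonneg_nonneg clamp01\<close>)
    also have "\<dots> \<le> (y 0 / y k) ^ 4 + \<dots>" by simp
    finally show ?thesis .
  qed
  have y2: "0 < y j / 2" for j using y(1)[of j] by simp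
  show ?thesis unfolding tailw_def law_def
  proof (rule Er_le[OF Y1_bounded[OF blip_tail[OF y(1)]]])
    fix P assume P: "P \<in> \<P>"
    interpret prob_space P using \<P>_prob[OF P] by simp
    have ir: "integrable P (\<lambda>\<omega>. r j (Y 1 \<omega>))" for j
      unfolding r_def by (rule integrable_\<P>[OF P Y1_bounded[OF blip_ramp[OF y2]]])
    have "(\<integral>\<omega>. min (\<bar>Y 1 \<omega>\<bar> / y k) 1 ^ 4 \<partial>P) \<le> (\<integral>\<omega>. (y 0 / y k) ^ 4 + (\<Sum>j\<le>k. (y (Suc j) / y k) ^ 4 * r j (Y 1 \<omega>)) \<partial>P)"
      by (rule integral_mono[OF integrable_\<P>[OF P Y1_bounded[OF blip_tail[OF y(1)]]] _ pw]) (use ir in auto)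
    also have "\<dots> = (y 0 / y k) ^ 4 + (\<Sum>j\<le>k. (y (Suc j) / y k) ^ 4 * (\<integral>\<omega>. r j (Y 1 \<omega>) \<partial>P))"
      using ir prob_space by simp
    also have "\<dots> \<le> (y 0 / y k) ^ 4 + (\<Sum>j\<le>k. (y (Suc j) / y k) ^ 4 * T (y j / 2))"
      unfolding T_def r_def
      by (intro add_left_mono sum_mono mult_left_mono integral_le_law[OF P blip_ramp[OF y2]]) auto
    finally show "(\<integral>\<omega>. min (\<bar>Y 1 \<omega>\<bar> / y k) 1 ^ 4 \<partial>P) \<le> (y 0 / y k) ^ 4 + (\<Sum>j\<le>k. (y (Suc j) / y k) ^ 4 * T (y j / 2))" .
  qed
qed

text \<open>
  Here \<open>(y j)\<^sup>4\<close> is of order \<open>\<theta> ^ (2 j)\<close> up to the slowly increasing factor \<open>l\<close>, so the layers of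
  \<open>tailw_layers\<close> times the block length \<open>\<theta> ^ k\<close> are at most a constant times
  \<open>\<theta> ^ j T (y j / 2) * \<theta> ^ (j - k)\<close>. Their sum is a Cauchy product of a series that converges by
  \<open>summable_T\<close> and a geometric series.
\<close>

lemma tail_summable_tailw: "tail_summable tailw"
  unfolding tail_summable_def
proof (intro allI impI)
  fix \<theta> c :: real assume \<theta>: "1 < \<theta>" and c: "0 < c"
  define n where "n = (\<lambda>k. real (blk \<theta> k))"
  define y where "y = (\<lambda>k. c * nrm (blk \<theta> k))"
  define l where "l = (\<lambda>k. LL (n k))"
  have n1: "1 \<le> n k" for k using blk_bounds(3)[OF \<theta>, of k] by (simp add: n_def)
  have nl: "\<theta> ^ k \<le> n k" for k using blk_bounds(1)[OF \<theta>] by (simp add: n_def)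
  have th1: "1 \<le> \<theta> ^ k" for k using \<theta> by (simp add: one_le_power)
  have nu: "n k \<le> 2 * \<theta> ^ k" for k using blk_bounds(2)[OF \<theta>, of k] th1[of k] unfolding n_def by linarith
  have y0: "0 < y k" for k unfolding y_def using c nrm_pos[of "blk \<theta> k"] blk_bounds(3)[OF \<theta>, of k] by simp
  have ym: "i \<le> j \<Longrightarrow> y i \<le> y j" for i j unfolding y_def using c by (intro mult_left_mono nrm_mono blk_mono \<theta>) auto
  have l1: "1 \<le> l k" for k unfolding l_def by (rule lg_ge_1)
  have lm: "i \<le> j \<Longrightarrow> l i \<le> l j" for i j unfolding l_def n_def by (intro LL_mono) (simp add: blk_mono[OF \<theta>])
  have y4: "(y k) ^ 4 = c ^ 4 * 4 * (n k)\<^sup>2 * (l k)\<^sup>2" for k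
  proof -
    have "(y k)\<^sup>2 = c\<^sup>2 * (2 * n k * l k)" unfolding y_def power_mult_distrib nrm_sq n_def l_def by simp
    hence "((y k)\<^sup>2)\<^sup>2 = (c\<^sup>2 * (2 * n k * l k))\<^sup>2" by simp
    thus ?thesis by (simp add: power_mult_distrib flip: power_mult)
  qed
  have lS: "l (Suc k) \<le> 2 * \<theta> * l k" for k
  proof -
    have "2 * \<theta> ^ Suc k = 2 * \<theta> * \<theta> ^ k" by simp
    hence "n (Suc k) \<le> 2 * \<theta> * n k" using nu[of "Suc k"] mult_left_mono[OF nl[of k], of "2 * \<theta>"] \<theta> by linarith
    hence "l (Suc k) \<le> LL (2 * \<theta> * n k)" unfolding l_def by (rule LL_mono)
    also have "\<dots> \<le> 2 * \<theta> * l k" unfolding l_def using \<theta> n1[of k] by (intro LL_scale) auto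
    finally show ?thesis .
  qed
  \<comment> \<open>The factor \<open>max 1 c\<close> is the price for replacing \<open>LL (y k / 2)\<close> by \<open>LL (n k)\<close>.\<close>
  define d where "d = c\<^sup>2 / (2 * max 1 c)"
  have d: "0 < d" using c by (simp add: d_def)
  have q: "d * \<theta> ^ k \<le> (y k / 2)\<^sup>2 / LL (y k / 2)" for k
  proof -
    have "nrm (blk \<theta> k) \<le> 2 * n k"
    proof -
      have "2 * n k * l k \<le> 2 * n k * n k" using LL_le[OF n1[of k]] n1[of k] unfolding l_def by (intro mult_left_mono) auto
      also have "\<dots> \<le> (2 * n k)\<^sup>2" by (simp add: power2_eq_square)
      finally show ?thesis unfolding nrm_def l_def n_def by (intro real_le_lsqrt) auto
    qed
    hence "c / 2 * nrm (blk \<theta> k) \<le> c / 2 * (2 * n k)" using c by (intro mult_left_mono) auto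
    also have "\<dots> \<le> max 1 c * n k" using n1[of k] by (simp add: mult_right_mono)
    finally have "y k / 2 \<le> max 1 c * n k" unfolding y_def by simp
    hence "LL (y k / 2) \<le> LL (max 1 c * n k)" by (rule LL_mono)
    also have "\<dots> \<le> max 1 c * l k" unfolding l_def using n1[of k] by (intro LL_scale) auto
    finally have L: "LL (y k / 2) \<le> max 1 c * l k" .
    have "d * \<theta> ^ k \<le> d * n k" using d nl[of k] by (intro mult_left_mono) auto
    also have "d * n k = (c\<^sup>2 * n k * l k / 2) / (max 1 c * l k)" using l1[of k] c by (simp add: d_def field_simps)
    also have "c\<^sup>2 * n k * l k / 2 = (y k / 2)\<^sup>2"
      unfolding y_def power_divide power_mult_distrib nrm_sq n_def l_def by simp
    also have "(y k / 2)\<^sup>2 / (max 1 c * l k) \<le> (y k / 2)\<^sup>2 / LL (y k / 2)"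
      using L lg_ge_1[of "lg (y k / 2)"] l1[of k] by (intro divide_left_mono) (auto intro!: mult_pos_pos)
    finally show ?thesis .
  qed
  have "summable (\<lambda>j. \<theta> ^ j * T (y j / 2))" by (rule summable_T[OF \<theta> d _ q]) (use y0 in simp)
  moreover have Tn: "0 \<le> T (y j / 2)" for j using T_nonneg[of "y j / 2"] y0[of j] by simp
  ultimately have s1: "summable (\<lambda>j. norm (\<theta> ^ j * T (y j / 2)))" using \<theta> by simp
  have s2: "summable (\<lambda>j. norm ((1 / \<theta>) ^ j))" using \<theta> by (simp add: summable_geometric_iff)
  define K where "K = 32 * \<theta> ^ 5"
  define K0 where "K0 = 8 * \<theta> * (l 0)\<^sup>2"
  have "summable (\<lambda>k. K0 * (1 / \<theta>) ^ k + K * (\<Sum>j\<le>k. (\<theta> ^ j * T (y j / 2)) * (1 / \<theta>) ^ (k - j)))"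
    using \<theta> by (intro summable_add summable_mult summable_Cauchy_product[OF s1 s2] summable_geometric) auto
  thus "summable (\<lambda>k. real (blk \<theta> (Suc k)) * tailw (c * nrm (blk \<theta> k)))"
  proof (rule summable_comparison_test[rotated], intro exI allI impI)
    fix k
    have y4k: "0 < (y k) ^ 4" using y0[of k] by simp
    have A: "n (Suc k) * (y 0 / y k) ^ 4 \<le> K0 * (1 / \<theta>) ^ k"
    proof -
      have "(y 0 / y k) ^ 4 = ((n 0)\<^sup>2 * (l 0)\<^sup>2) / ((n k)\<^sup>2 * (l k)\<^sup>2)"
        unfolding power_divide y4 using c by simp
      also have "\<dots> \<le> (2\<^sup>2 * (l 0)\<^sup>2) / ((\<theta> ^ k)\<^sup>2 * 1\<^sup>2)"
        using nl[of k] l1[of k] l1[of 0] nu[of 0] n1[of 0] \<theta>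
        by (intro frac_le mult_mono power_mono mult_pos_pos) auto
      finally have "n (Suc k) * (y 0 / y k) ^ 4 \<le> (2 * \<theta> ^ Suc k) * ((2\<^sup>2 * (l 0)\<^sup>2) / ((\<theta> ^ k)\<^sup>2 * 1\<^sup>2))"
        using nu[of "Suc k"] n1[of "Suc k"] \<theta> by (intro mult_mono) auto
      also have "\<dots> = K0 * (1 / \<theta>) ^ k"
        unfolding K0_def using \<theta> by (simp add: power2_eq_square power_one_over field_simps)
      finally show ?thesis .
    qed
    have C: "n (Suc k) * (y (Suc j) / y k) ^ 4 \<le> K * (\<theta> ^ j * (1 / \<theta>) ^ (k - j))" if "j \<le> k" for j
    proof -
      have "l (Suc j) \<le> 2 * \<theta> * l k"
        using lS[of j] mult_left_mono[OF lm[OF that], of "2 * \<theta>"] \<theta> by linarith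
      note lj = this
      have yj: "(y (Suc j) / y k) ^ 4 = ((n (Suc j))\<^sup>2 * (l (Suc j))\<^sup>2) / ((n k)\<^sup>2 * (l k)\<^sup>2)"
        unfolding power_divide y4 using c by simp
      have "(y (Suc j) / y k) ^ 4 \<le> ((2 * \<theta> ^ Suc j)\<^sup>2 * (2 * \<theta> * l k)\<^sup>2) / ((\<theta> ^ k)\<^sup>2 * (l k)\<^sup>2)"
        unfolding yj
      proof (intro frac_le mult_mono power_mono mult_pos_pos)
        show "l (Suc j) \<le> 2 * \<theta> * l k" by (rule lj)
        show "n (Suc j) \<le> 2 * \<theta> ^ Suc j" by (rule nu)
      qed (use nl[of k] l1[of k] l1[of "Suc j"] n1[of "Suc j"] n1[of k] \<theta> in auto)
      also have "\<dots> = (2 * \<theta> ^ Suc j)\<^sup>2 * (4 * \<theta>\<^sup>2) / (\<theta> ^ k)\<^sup>2"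
        using l1[of k] by (simp add: power_mult_distrib)
      finally have "n (Suc k) * (y (Suc j) / y k) ^ 4 \<le> (2 * \<theta> ^ Suc k) * ((2 * \<theta> ^ Suc j)\<^sup>2 * (4 * \<theta>\<^sup>2) / (\<theta> ^ k)\<^sup>2)"
        using nu[of "Suc k"] n1[of "Suc k"] \<theta> by (intro mult_mono) auto
      also have "\<dots> = 8 * \<theta> ^ 3 * (\<theta> ^ j * (\<theta> ^ j / \<theta> ^ k)) * (4 * \<theta>\<^sup>2)"
        using \<theta> by (simp add: power2_eq_square power3_eq_cube field_simps)
      also have "\<theta> ^ j / \<theta> ^ k = (1 / \<theta>) ^ (k - j)"
        using that \<theta> by (simp add: power_diff power_one_over field_simps)
      also have "8 * \<theta> ^ 3 * (\<theta> ^ j * (1 / \<theta>) ^ (k - j)) * (4 * \<theta>\<^sup>2) = K * (\<theta> ^ j * (1 / \<theta>) ^ (k - j))"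
        unfolding K_def by (simp add: eval_nat_numeral)
      finally show ?thesis .
    qed
    have t0: "0 \<le> tailw (y k)"
    proof -
      have "blip (\<lambda>x. 0 :: real)" by (rule blipI[of _ 0 0]) auto
      from law_mono[OF this blip_tail[OF y0[of k]]] show ?thesis unfolding tailw_def using y0[of k] by (simp add: law_const)
    qed
    have "n (Suc k) * tailw (y k) \<le> n (Suc k) * ((y 0 / y k) ^ 4 + (\<Sum>j\<le>k. (y (Suc j) / y k) ^ 4 * T (y j / 2)))"
      using n1[of "Suc k"] by (intro mult_left_mono tailw_layers y0 ym) auto
    also have "\<dots> = n (Suc k) * (y 0 / y k) ^ 4 + (\<Sum>j\<le>k. n (Suc k) * (y (Suc j) / y k) ^ 4 * T (y j / 2))"
      by (simp add: distrib_left sum_distrib_left mult.assoc)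
    also have "\<dots> \<le> K0 * (1 / \<theta>) ^ k + (\<Sum>j\<le>k. K * (\<theta> ^ j * (1 / \<theta>) ^ (k - j)) * T (y j / 2))"
      by (intro add_mono A sum_mono mult_right_mono C Tn) auto
    also have "\<dots> = K0 * (1 / \<theta>) ^ k + K * (\<Sum>j\<le>k. (\<theta> ^ j * T (y j / 2)) * (1 / \<theta>) ^ (k - j))"
      by (simp add: sum_distrib_left mult_ac)
    finally show "norm (real (blk \<theta> (Suc k)) * tailw (c * nrm (blk \<theta> k))) \<le> K0 * (1 / \<theta>) ^ k + K * (\<Sum>j\<le>k. (\<theta> ^ j * T (y j / 2)) * (1 / \<theta>) ^ (k - j))"
      using t0 n1[of "Suc k"] unfolding n_def y_def by simp
  qed
qed

end


section \<open>Outside the interval of standard deviations\<close>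

context lil_setting begin

lemma \<sigma>l_le_\<sigma>u: "\<sigma>\<^sub>l \<le> \<sigma>\<^sub>u"
proof -
  have "\<sigma>\<^sub>l\<^sup>2 \<le> \<sigma>\<^sub>u\<^sup>2"
  proof (rule field_le_epsilon)
    fix e :: real assume "0 < e"
    then obtain c where "0 < c" "\<sigma>\<^sub>l\<^sup>2 - e < low2 c" by (rule low2_approx)
    thus "\<sigma>\<^sub>l\<^sup>2 \<le> \<sigma>\<^sub>u\<^sup>2 + e" using low2_le_up2[of c] up2_le[of c] by linarith
  qed
  moreover have "0 \<le> \<sigma>\<^sub>u"
  proof -
    have "real_of_ereal (upper_variance E (Y 1)) = \<sigma>\<^sub>u\<^sup>2" unfolding upper_variance_eq by simp
    hence "0 \<le> real_of_ereal (upper_variance E (Y 1))" by (simp only: zero_le_power2)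
    thus ?thesis unfolding \<sigma>u by (rule real_sqrt_ge_zero)
  qed
  ultimately show ?thesis by (rule power2_le_imp_le)
qed

lemma \<sigma>u_pos: "0 < \<sigma>\<^sub>u"
  using \<sigma>l_pos \<sigma>l_le_\<sigma>u by simp

lemma tailw_nonneg: "0 < y \<Longrightarrow> 0 \<le> tailw y"
proof -
  assume y: "0 < y"
  obtain P where "P \<in> \<P>" using \<P>_nonempty by blast
  then interpret mds P "gen P Z" Z "\<lambda>_. \<sigma>\<^sub>u\<^sup>2" tailw by (rule mds_\<P>)
  show ?thesis by (rule w_nonneg[OF y])
qed

lemma mds_sign: "P \<in> \<P> \<Longrightarrow> s = 1 \<or> s = -1 \<Longrightarrow> mds P (gen P Z) (\<lambda>i \<omega>. s * Z i \<omega>) (\<lambda>_. \<sigma>\<^sub>u\<^sup>2) tailw"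
  using mds_\<P> mds.uminus[OF mds_\<P>] by auto

text \<open>
  The first Borel--Cantelli lemma, for \<open>V_hat\<close>: the event that a block maximum exceeds
  \<open>(1 + \<epsilon>) \<sigma>\<^sub>u\<close> times the normalization is \<open>h \<ge> 1\<close> for a Lipschitz function \<open>h\<close>, while \<open>h > 0\<close>
  means exceeding \<open>(1 + \<epsilon> / 2) \<sigma>\<^sub>u\<close>, which has summable probability under every \<open>P\<close>. The factor \<open>s\<close>
  is a sign, to cover both tails.
\<close>

lemma upper_small:
  assumes s: "s = 1 \<or> s = (-1 :: real)" and \<epsilon>: "0 < \<epsilon>"
  shows "small {\<omega> \<in> space M. \<not> eventually (\<lambda>n. (\<Sum>i<n. s * Z i \<omega>) \<le> (1 + \<epsilon>) * \<sigma>\<^sub>u * nrm n) sequentially}"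
proof -
  have \<epsilon>2: "0 < \<epsilon> / 2" using \<epsilon> by simp
  obtain \<theta> \<delta> bd where \<theta>: "1 < \<theta>" and \<delta>: "0 < \<delta>" and bd: "summable bd"
    and H: "\<forall>k (P :: 'a measure) F X u. mds P F X u tailw \<longrightarrow>
       (\<Sum>i<blk \<theta> (Suc k). u i) \<le> real (blk \<theta> (Suc k)) * (\<sigma>\<^sub>u\<^sup>2 * (1 + \<delta>)) \<longrightarrow>
       measure P {\<omega> \<in> space P. \<exists>m\<le>blk \<theta> (Suc k). (1 + \<epsilon> / 2) * \<sigma>\<^sub>u * nrm (blk \<theta> k) \<le> (\<Sum>i<m. X i \<omega>)} \<le> bd k"
    by atomize_elim (rule upper_block_bound[OF tail_summable_tailw tailw_nonneg \<sigma>u_pos \<epsilon>2])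
  have sd: "\<sigma>\<^sub>u\<^sup>2 \<le> \<sigma>\<^sub>u\<^sup>2 * (1 + \<delta>)" using \<delta> by (simp add: mult_le_cancel_left1)
  have bound: "measure P {\<omega> \<in> space P. \<exists>m\<le>blk \<theta> (Suc k). (1 + \<epsilon> / 2) * \<sigma>\<^sub>u * nrm (blk \<theta> k) \<le> (\<Sum>i<m. s * Z i \<omega>)} \<le> bd k"
    if "P \<in> \<P>" for P k
    by (rule H[rule_format, OF mds_sign[OF that s]]) (use mult_left_mono[OF sd] in simp)
  define d where "d = (\<lambda>k. \<epsilon> / 2 * \<sigma>\<^sub>u * nrm (blk \<theta> k))"
  have d: "0 < d k" for k unfolding d_def using \<epsilon> \<sigma>u_pos nrm_pos[of "blk \<theta> k"] blk_bounds(3)[OF \<theta>, of k] by simp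
  define h where "h = (\<lambda>k x. 1 + 1 / d k * (Max ((\<lambda>m. \<Sum>i<m. s * x i) ` {..blk \<theta> (Suc k)}) - (1 + \<epsilon>) * \<sigma>\<^sub>u * nrm (blk \<theta> k)))"
  have h: "h k \<in> lipf (blk \<theta> (Suc k))" for k
    unfolding h_def
    by (intro lipf_add lipf_const lipf_scale lipf_diff lipf_Max lipf_sum lipf_coord) auto
  define U where "U = (\<lambda>k. {\<omega> \<in> space M. 1 \<le> h k (Yv \<omega>)})"
  have Max_le: "a \<le> Max ((\<lambda>m. \<Sum>i<m. s * x i) ` {..N}) \<longleftrightarrow> (\<exists>m\<le>N. a \<le> (\<Sum>i<m. s * x i))" for a N and x :: "nat \<Rightarrow> real"
    by (subst Max_ge_iff) auto
  have Ub: "V_hat M H E (U k) \<le> ereal (bd k)" for k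
    unfolding U_def
  proof (rule V_hat_le[OF h])
    fix P assume P: "P \<in> \<P>"
    interpret m: mds P "gen P Z" "\<lambda>i \<omega>. s * Z i \<omega>" "\<lambda>_. \<sigma>\<^sub>u\<^sup>2" tailw by (rule mds_sign[OF P s])
    have "{\<omega> \<in> space P. \<exists>m\<le>blk \<theta> (Suc k). (1 + \<epsilon> / 2) * \<sigma>\<^sub>u * nrm (blk \<theta> k) \<le> (\<Sum>i<m. s * Z i \<omega>)} \<in> sets P"
      using m.X_P by measurable
    moreover have "{\<omega> \<in> space M. 0 < h k (Yv \<omega>)} \<subseteq> {\<omega> \<in> space P. \<exists>m\<le>blk \<theta> (Suc k). (1 + \<epsilon> / 2) * \<sigma>\<^sub>u * nrm (blk \<theta> k) \<le> (\<Sum>i<m. s * Z i \<omega>)}"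
    proof safe
      fix \<omega> assume w: "\<omega> \<in> space M" "0 < h k (Yv \<omega>)"
      define Mx where "Mx = Max ((\<lambda>m. \<Sum>i<m. s * Yv \<omega> i) ` {..blk \<theta> (Suc k)})"
      have "0 < d k * h k (Yv \<omega>)" using w d by simp
      also have "d k * h k (Yv \<omega>) = d k + (Mx - (1 + \<epsilon>) * \<sigma>\<^sub>u * nrm (blk \<theta> k))"
        unfolding h_def Mx_def using d[of k] by (simp add: field_simps)
      finally have "(1 + \<epsilon> / 2) * \<sigma>\<^sub>u * nrm (blk \<theta> k) \<le> Mx" by (simp add: d_def algebra_simps)
      thus "\<exists>m\<le>blk \<theta> (Suc k). (1 + \<epsilon> / 2) * \<sigma>\<^sub>u * nrm (blk \<theta> k) \<le> (\<Sum>i<m. s * Z i \<omega>)"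
        unfolding Mx_def Max_le Yv_eq .
      show "\<omega> \<in> space P" using w space_\<P>[OF P] by simp
    qed
    ultimately have "measure P {\<omega> \<in> space M. 0 < h k (Yv \<omega>)}
      \<le> measure P {\<omega> \<in> space P. \<exists>m\<le>blk \<theta> (Suc k). (1 + \<epsilon> / 2) * \<sigma>\<^sub>u * nrm (blk \<theta> k) \<le> (\<Sum>i<m. s * Z i \<omega>)}"
      by (intro m.finite_measure_mono)
    thus "measure P {\<omega> \<in> space M. 0 < h k (Yv \<omega>)} \<le> bd k" using bound[OF P, of k] by linarith
  qed
  have bd0: "0 \<le> bd k" for k
  proof -
    obtain P where "P \<in> \<P>" using \<P>_nonempty by blast
    from bound[OF this, of k] show ?thesis using measure_nonneg order_trans by blast
  qed
  have "small {\<omega>. \<forall>K. \<exists>k\<ge>K. \<omega> \<in> U k}"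
    by (rule small_limsup[OF _ Ub bd bd0]) (use cyl_sets[OF h] in \<open>simp add: U_def\<close>)
  thus ?thesis
  proof (rule small_subset, intro subsetI CollectI allI)
    fix \<omega> K assume "\<omega> \<in> {\<omega> \<in> space M. \<not> eventually (\<lambda>n. (\<Sum>i<n. s * Z i \<omega>) \<le> (1 + \<epsilon>) * \<sigma>\<^sub>u * nrm n) sequentially}"
    hence w: "\<omega> \<in> space M" and ne: "\<not> eventually (\<lambda>n. (\<Sum>i<n. s * Z i \<omega>) \<le> (1 + \<epsilon>) * \<sigma>\<^sub>u * nrm n) sequentially" by auto
    show "\<exists>k\<ge>K. \<omega> \<in> U k"
    proof (rule ccontr)
      assume "\<not> (\<exists>k\<ge>K. \<omega> \<in> U k)"
      hence "eventually (\<lambda>k. \<omega> \<notin> U k) sequentially" by (auto simp: eventually_sequentially)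
      hence "eventually (\<lambda>k. \<not> (\<exists>m\<le>blk \<theta> (Suc k). ((1 + \<epsilon>) * \<sigma>\<^sub>u) * nrm (blk \<theta> k) \<le> (\<Sum>i<m. s * Z i \<omega>))) sequentially"
      proof eventually_elim
        case (elim k)
        have "h k (Yv \<omega>) < 1" using elim w by (simp add: U_def)
        define Mx where "Mx = Max ((\<lambda>m. \<Sum>i<m. s * Yv \<omega> i) ` {..blk \<theta> (Suc k)})"
        have "1 / d k * (Mx - (1 + \<epsilon>) * \<sigma>\<^sub>u * nrm (blk \<theta> k)) < 0"
          using \<open>h k (Yv \<omega>) < 1\<close> by (simp add: h_def Mx_def)
        hence "\<not> (1 + \<epsilon>) * \<sigma>\<^sub>u * nrm (blk \<theta> k) \<le> Mx"
          using d[of k] by (simp add: divide_less_0_iff)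
        thus ?case unfolding Mx_def Max_le Yv_eq .
      qed
      from upper_paths[OF \<theta> _ this] ne show False using \<epsilon> \<sigma>u_pos by simp
    qed
  qed
qed

text \<open>
  If the line is lowered by \<open>1\<close>, missing it in the blocks \<open>K, ..., K + L\<close> is \<open>h \<ge> 1\<close> for a minimum \<open>h\<close>
  of Lipschitz functions, while \<open>h > 0\<close> means missing the line itself. The latter has probability
  at most \<open>exp (- sum of the q k)\<close> under every \<open>P\<close>, which tends to \<open>0\<close> as \<open>L\<close> grows.
\<close>

lemma lower_small:
  assumes c: "0 < c" "c < \<sigma>\<^sub>l"
  shows "small {\<omega> \<in> space M. eventually (\<lambda>n. \<bar>\<Sum>i<n. Z i \<omega>\<bar> \<le> 2 * \<sigma>\<^sub>u * nrm n) sequentially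
     \<and> \<not> (\<forall>N. \<exists>n\<ge>N. c * nrm n \<le> (\<Sum>i<n. Z i \<omega>))}"
proof -
  have T0: "0 \<le> 2 * \<sigma>\<^sub>u" using \<sigma>u_pos by simp
  obtain v \<eta> Q where v: "0 < v" "v < \<sigma>\<^sub>l\<^sup>2" and \<eta>: "0 < \<eta>" "8 * \<eta> \<le> 1" "\<eta> < 1/2" and cv: "c \<le> (1 - 8 * \<eta>) * sqrt v"
    and Q: "2 \<le> Q" "1 \<le> 2 * \<eta> * (real Q - 1)" "(2 * \<sigma>\<^sub>u)\<^sup>2 \<le> \<eta>\<^sup>2 * v * (real Q - 1)"
    using lower_constants[OF c T0] by blast
  define s where "s = (v + \<sigma>\<^sub>l\<^sup>2) / 2"
  have s: "v < s" "s < \<sigma>\<^sub>l\<^sup>2" using v by (auto simp: s_def)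
  have u0: "0 < \<sigma>\<^sub>u\<^sup>2" using \<sigma>u_pos by simp
  obtain \<kappa> k0 where \<kappa>: "0 < \<kappa>" and H: "\<forall>k\<ge>k0. \<forall>(P :: 'a measure) F X u w (g :: 'a \<Rightarrow> real) B. mds P F X u w \<longrightarrow>
     (\<forall>i. Q ^ k \<le> i \<longrightarrow> i < Q ^ Suc k \<longrightarrow> mds.lowvar P F X i (sqrt (real (Q ^ Suc k))) s \<and> u i \<le> \<sigma>\<^sub>u\<^sup>2) \<longrightarrow>
     g \<in> borel_measurable (F (Q ^ k)) \<longrightarrow> (\<forall>\<omega>. 0 \<le> g \<omega> \<and> g \<omega> \<le> B) \<longrightarrow>
     \<kappa> * exp (- ((1 - 2 * \<eta>) * LL (real (Q ^ Suc k)))) * (\<integral>\<omega>. g \<omega> \<partial>P) \<le>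
     (\<integral>\<omega>. g \<omega> * indicator {\<omega>. \<exists>m\<le>Q ^ Suc k - Q ^ k. line Q v \<eta> k m \<le> (\<Sum>i=Q^k..<Q^k+m. X i \<omega>)} \<omega> \<partial>P)"
    using lower_block_bound[OF v(1) s(1) u0 \<eta>(1,3) Q(1), where 'a = 'a] by (elim exE conjE) (rule that)
  define q where "q = (\<lambda>k. \<kappa> * exp (- ((1 - 2 * \<eta>) * LL (real (Q ^ Suc k)))))"
  have q0: "0 \<le> q k" for k using \<kappa> by (simp add: q_def)
  have ns: "\<not> summable q"
    using block_probabilities_diverge[OF \<eta>(1,3) Q(1)] \<kappa> unfolding q_def by (subst summable_cmult_iff) auto
  obtain c0 where c0: "0 < c0" "\<sigma>\<^sub>l\<^sup>2 - (\<sigma>\<^sub>l\<^sup>2 - s) < low2 c0" using low2_approx[of "\<sigma>\<^sub>l\<^sup>2 - s"] s by auto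
  obtain k1 :: nat where k1: "c0\<^sup>2 \<le> real k1" using real_arch_simple by blast
  have Qk: "k \<le> Q ^ k" for k using Q(1) less_exp[of k] power_mono[of 2 Q k] by (meson le_trans less_imp_le zero_le)
  define D where "D = (\<lambda>K L. {(k, m). k \<in> {K..<K + Suc L} \<and> m \<le> Q ^ Suc k - Q ^ k})"
  have fin: "finite (D K L)" for K L
  proof -
    have "D K L = (SIGMA k:{K..<K + Suc L}. {..Q ^ Suc k - Q ^ k})" by (auto simp: D_def)
    thus ?thesis by simp
  qed
  have ne: "D K L \<noteq> {}" for K L
  proof -
    have "(K, 0) \<in> D K L" by (simp add: D_def)
    thus ?thesis by blast
  qed
  define h where "h = (\<lambda>K L x. Min ((\<lambda>(k, m). line Q v \<eta> k m - (\<Sum>i=Q^k..<Q^k+m. x i)) ` D K L))"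
  have h: "h K L \<in> lipf (Q ^ (K + Suc L))" for K L
  proof -
    have "(\<lambda>x. Min ((\<lambda>p. line Q v \<eta> (fst p) (snd p) - (\<Sum>i=Q^fst p..<Q^fst p+snd p. x i)) ` D K L)) \<in> lipf (Q ^ (K + Suc L))"
    proof (intro lipf_Min fin ne lipf_diff lipf_const lipf_sum lipf_coord)
      fix p i assume p: "p \<in> D K L" and i: "i \<in> {Q ^ fst p..<Q ^ fst p + snd p}"
      obtain k m where pk: "p = (k, m)" by (cases p)
      have "Q ^ k \<le> Q ^ Suc k" using Q by simp
      moreover have "m \<le> Q ^ Suc k - Q ^ k" "i < Q ^ k + m" using p i unfolding pk D_def by (simp_all del: power_Suc)
      ultimately have "i < Q ^ Suc k" by linarith
      also have "Q ^ Suc k \<le> Q ^ (K + Suc L)" using p Q unfolding pk D_def by (intro power_increasing) auto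
      finally show "i < Q ^ (K + Suc L)" .
    qed simp
    thus ?thesis unfolding h_def case_prod_unfold .
  qed
  have h1: "1 \<le> h K L x \<longleftrightarrow> (\<forall>k\<in>{K..<K + Suc L}. \<forall>m\<le>Q ^ Suc k - Q ^ k. (\<Sum>i=Q^k..<Q^k+m. x i) \<le> line Q v \<eta> k m - 1)" for K L x
    unfolding h_def using fin[of K L] ne[of K L]
    by (subst Min_ge_iff) (auto simp: D_def algebra_simps simp del: power_Suc)
  have h0: "0 < h K L x \<Longrightarrow> (\<forall>k\<in>{K..<K + Suc L}. \<not> (\<exists>m\<le>Q ^ Suc k - Q ^ k. line Q v \<eta> k m \<le> (\<Sum>i=Q^k..<Q^k+m. x i)))" for K L x
    unfolding h_def using fin[of K L] ne[of K L]
    by (subst (asm) Min_gr_iff) (force simp: D_def simp del: power_Suc)+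
  define A where "A = (\<lambda>K. {\<omega> \<in> space M. \<forall>k\<ge>K. \<forall>m\<le>Q ^ Suc k - Q ^ k. (\<Sum>i=Q^k..<Q^k+m. Z i \<omega>) \<le> line Q v \<eta> k m - 1})"
  have small_A: "small (A K)" if K: "max k0 k1 \<le> K" for K
  proof (rule small_shrinking)
    fix L
    show "{\<omega> \<in> space M. 1 \<le> h K L (Yv \<omega>)} \<in> sets M" by (rule cyl_sets[OF h])
    show "A K \<subseteq> {\<omega> \<in> space M. 1 \<le> h K L (Yv \<omega>)}" unfolding h1 A_def Yv_eq by auto
    show "V_hat M H E {\<omega> \<in> space M. 1 \<le> h K L (Yv \<omega>)} \<le> ereal (exp (- (\<Sum>k=K..<K + Suc L. q k)))"
    proof (rule V_hat_le[OF h])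
      fix P assume P: "P \<in> \<P>"
      interpret m: mds P "gen P Z" Z "\<lambda>_. \<sigma>\<^sub>u\<^sup>2" tailw by (rule mds_\<P>[OF P])
      have "m.prob {\<omega>\<in>space P. \<forall>k\<in>{K..<K + Suc L}. \<not> (\<exists>m\<le>Q ^ Suc k - Q ^ k. line Q v \<eta> k m \<le> (\<Sum>i=Q^k..<Q^k+m. Z i \<omega>))}
        \<le> exp (- (\<Sum>k=K..<K + Suc L. q k))"
      proof (rule m.no_hit_probability)
        fix k g B assume k: "K \<le> k" and g: "g \<in> borel_measurable (gen P Z (Q ^ k))" "\<And>\<omega>. 0 \<le> g \<omega> \<and> g \<omega> \<le> (B::real)"
        show "q k * (\<integral>\<omega>. g \<omega> \<partial>P) \<le>
          (\<integral>\<omega>. g \<omega> * indicator {\<omega>. \<exists>m\<le>Q ^ Suc k - Q ^ k. line Q v \<eta> k m \<le> (\<Sum>i=Q^k..<Q^k+m. Z i \<omega>)} \<omega> \<partial>P)"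
          unfolding q_def
        proof (rule H[rule_format, OF _ m.mds_axioms _ g])
          show "k0 \<le> k" using k K by simp
          fix i assume "Q ^ k \<le> i" "i < Q ^ Suc k"
          have "m.lowvar i (sqrt (real (Q ^ Suc k))) s"
          proof (rule m.lowvar_mono[OF lowvar_\<P>[OF P c0(1)]])
            have "k1 \<le> Q ^ Suc k" using K k Qk[of "Suc k"] by linarith
            hence "c0\<^sup>2 \<le> real (Q ^ Suc k)" using k1 of_nat_le_iff order_trans by blast
            thus "c0 \<le> sqrt (real (Q ^ Suc k))" by (rule real_le_rsqrt)
          qed (use c0 in auto)
          thus "m.lowvar i (sqrt (real (Q ^ Suc k))) s \<and> \<sigma>\<^sub>u\<^sup>2 \<le> \<sigma>\<^sub>u\<^sup>2" by simp
        qed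
      qed (use Q in auto)
      moreover have "{\<omega> \<in> space M. 0 < h K L (Yv \<omega>)} \<subseteq> {\<omega>\<in>space P. \<forall>k\<in>{K..<K + Suc L}. \<not> (\<exists>m\<le>Q ^ Suc k - Q ^ k. line Q v \<eta> k m \<le> (\<Sum>i=Q^k..<Q^k+m. Z i \<omega>))}"
        using h0[of K L "Yv _"] space_\<P>[OF P] unfolding Yv_eq by auto
      moreover have "{\<omega>\<in>space P. \<forall>k\<in>{K..<K + Suc L}. \<not> (\<exists>m\<in>{..Q ^ Suc k - Q ^ k}. line Q v \<eta> k m \<le> (\<Sum>i=Q^k..<Q^k+m. Z i \<omega>))} \<in> sets P"
        using m.X_P by measurable
      hence "{\<omega>\<in>space P. \<forall>k\<in>{K..<K + Suc L}. \<not> (\<exists>m\<le>Q ^ Suc k - Q ^ k. line Q v \<eta> k m \<le> (\<Sum>i=Q^k..<Q^k+m. Z i \<omega>))} \<in> sets P"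
        by (simp only: Bex_def atMost_iff)
      ultimately show "measure P {\<omega> \<in> space M. 0 < h K L (Yv \<omega>)} \<le> exp (- (\<Sum>k=K..<K + Suc L. q k))"
        using m.finite_measure_mono by (meson order_trans)
    qed
  next
    have "(\<lambda>L. exp (- (\<Sum>k=K..<L. q k))) \<longlonglongrightarrow> 0" by (rule exp_minus_partial_sums_to_0[OF q0 ns])
    from LIMSEQ_ignore_initial_segment[OF this, of "Suc K"]
    show "(\<lambda>L. exp (- (\<Sum>k=K..<K + Suc L. q k))) \<longlonglongrightarrow> 0" by (simp add: add.commute)
  qed
  have "small (\<Union>j. A (max k0 k1 + j))" by (intro small_UN small_A) simp
  thus ?thesis
  proof (rule small_subset, intro subsetI)
    fix \<omega> assume "\<omega> \<in> {\<omega> \<in> space M. eventually (\<lambda>n. \<bar>\<Sum>i<n. Z i \<omega>\<bar> \<le> 2 * \<sigma>\<^sub>u * nrm n) sequentially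
     \<and> \<not> (\<forall>N. \<exists>n\<ge>N. c * nrm n \<le> (\<Sum>i<n. Z i \<omega>))}"
    then obtain N where w: "\<omega> \<in> space M" and ev: "eventually (\<lambda>n. \<bar>\<Sum>i<n. Z i \<omega>\<bar> \<le> 2 * \<sigma>\<^sub>u * nrm n) sequentially"
      and no: "\<not> (\<exists>n\<ge>N. c * nrm n \<le> (\<Sum>i<n. Z i \<omega>))" by blast
    show "\<omega> \<in> (\<Union>j. A (max k0 k1 + j))"
    proof (rule ccontr)
      assume nA: "\<omega> \<notin> (\<Union>j. A (max k0 k1 + j))"
      have "\<exists>n\<ge>N. c * nrm n \<le> (\<Sum>i<n. Z i \<omega>)"
      proof (rule lower_paths[OF v(1) \<eta>(1,2) cv Q T0 ev])
        fix K
        have "\<omega> \<notin> A (max k0 k1 + K)" using nA by blast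
        then obtain k m where k: "max k0 k1 + K \<le> k" "m \<le> Q ^ Suc k - Q ^ k" "\<not> (\<Sum>i=Q^k..<Q^k+m. Z i \<omega>) \<le> line Q v \<eta> k m - 1"
          using w unfolding A_def by blast
        have "(\<Sum>i=Q^k..<Q^k+m. Z i \<omega>) = (\<Sum>i<Q ^ k + m. Z i \<omega>) - (\<Sum>i<Q ^ k. Z i \<omega>)"
          by (simp add: sum_diff_nat_ivl[of 0 "Q^k" "Q^k+m" "\<lambda>i. Z i \<omega>", symmetric] atLeast0LessThan)
        thus "\<exists>k\<ge>K. \<exists>m\<le>Q ^ Suc k - Q ^ k. line Q v \<eta> k m - 1 \<le> (\<Sum>i<Q ^ k + m. Z i \<omega>) - (\<Sum>i<Q ^ k. Z i \<omega>)"
          using k by (intro exI[of _ k] conjI exI[of _ m]) auto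
      qed
      thus False using no by simp
    qed
  qed
qed

lemma normalized_sum_eq:
  "(\<Sum>i=1..n. Y i \<omega>) / sqrt (2 * real n * lg (lg (real n))) = (\<Sum>i<n. Z i \<omega>) / nrm n"
  by (simp add: nrm_def sum.atLeast1_atMost_eq)

text \<open>
  Up to null sets: if \<open>\<sigma> > \<sigma>\<^sub>u\<close>, the end point \<open>\<sigma>\<close> is not a cluster point; if \<open>\<sigma> < \<sigma>\<^sub>l\<close>, there is
  a cluster point larger than \<open>\<sigma>\<close>: the normalized sums exceed some \<open>c > \<sigma>\<close> infinitely often and stay bounded. This
  includes negative \<open>\<sigma>\<close>, where the interval is empty.
\<close>

lemma V_hat_star_outside:
  assumes \<sigma>: "\<sigma> \<notin> {\<sigma>\<^sub>l..\<sigma>\<^sub>u}"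
  shows "V_hat_star M H E {\<omega> \<in> space M. cluster_set (\<lambda>n. (\<Sum>i<n. Z i \<omega>) / nrm n) = {-\<sigma>..\<sigma>}} \<le> 0"
proof (cases "\<sigma>\<^sub>u < \<sigma>")
  case True
  define \<epsilon> where "\<epsilon> = (\<sigma> / \<sigma>\<^sub>u - 1) / 2"
  have \<epsilon>: "0 < \<epsilon>" using True \<sigma>u_pos by (simp add: \<epsilon>_def)
  have lt: "(1 + \<epsilon>) * \<sigma>\<^sub>u < \<sigma>" using True \<sigma>u_pos by (simp add: \<epsilon>_def field_simps)
  have "small {\<omega> \<in> space M. \<not> eventually (\<lambda>n. (\<Sum>i<n. 1 * Z i \<omega>) \<le> (1 + \<epsilon>) * \<sigma>\<^sub>u * nrm n) sequentially}" (is "small ?A")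
    by (rule upper_small[OF _ \<epsilon>]) simp
  moreover have "{\<omega> \<in> space M. cluster_set (\<lambda>n. (\<Sum>i<n. Z i \<omega>) / nrm n) = {-\<sigma>..\<sigma>}} \<subseteq> ?A"
  proof (rule subsetI, rule ccontr)
    fix \<omega> assume "\<omega> \<in> {\<omega> \<in> space M. cluster_set (\<lambda>n. (\<Sum>i<n. Z i \<omega>) / nrm n) = {-\<sigma>..\<sigma>}}" and nA: "\<omega> \<notin> ?A"
    hence w: "\<omega> \<in> space M" and cl: "cluster_set (\<lambda>n. (\<Sum>i<n. Z i \<omega>) / nrm n) = {-\<sigma>..\<sigma>}" by auto
    have ev: "eventually (\<lambda>n. (\<Sum>i<n. 1 * Z i \<omega>) \<le> (1 + \<epsilon>) * \<sigma>\<^sub>u * nrm n) sequentially" using nA w by simp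
    have "\<sigma> \<in> cluster_set (\<lambda>n. (\<Sum>i<n. Z i \<omega>) / nrm n)" unfolding cl using True \<sigma>u_pos by simp
    moreover obtain N where N: "\<And>n. N \<le> n \<Longrightarrow> (\<Sum>i<n. Z i \<omega>) \<le> (1 + \<epsilon>) * \<sigma>\<^sub>u * nrm n"
      using ev by (auto simp: eventually_sequentially)
    ultimately obtain n where n: "max N 1 \<le> n" "\<bar>(\<Sum>i<n. Z i \<omega>) / nrm n - \<sigma>\<bar> < \<sigma> - (1 + \<epsilon>) * \<sigma>\<^sub>u"
      unfolding cluster_set_iff using lt by (meson diff_gt_0_iff_gt)
    have "(\<Sum>i<n. Z i \<omega>) / nrm n \<le> (1 + \<epsilon>) * \<sigma>\<^sub>u" using N[of n] n(1) nrm_pos[of n] by (simp add: divide_le_eq)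
    thus False using n(2) by linarith
  qed
  ultimately have "small {\<omega> \<in> space M. cluster_set (\<lambda>n. (\<Sum>i<n. Z i \<omega>) / nrm n) = {-\<sigma>..\<sigma>}}" by (rule small_subset)
  thus ?thesis by (rule small_V_hat_star)
next
  case False
  hence lt: "\<sigma> < \<sigma>\<^sub>l" using \<sigma> by auto
  define c where "c = (max 0 \<sigma> + \<sigma>\<^sub>l) / 2"
  have c: "0 < c" "\<sigma> < c" "c < \<sigma>\<^sub>l" using lt \<sigma>l_pos by (auto simp: c_def)
  define A1 where "A1 = {\<omega> \<in> space M. \<not> eventually (\<lambda>n. (\<Sum>i<n. 1 * Z i \<omega>) \<le> (1 + 1) * \<sigma>\<^sub>u * nrm n) sequentially}"
  define A2 where "A2 = {\<omega> \<in> space M. \<not> eventually (\<lambda>n. (\<Sum>i<n. (-1) * Z i \<omega>) \<le> (1 + 1) * \<sigma>\<^sub>u * nrm n) sequentially}"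
  define A3 where "A3 = {\<omega> \<in> space M. eventually (\<lambda>n. \<bar>\<Sum>i<n. Z i \<omega>\<bar> \<le> 2 * \<sigma>\<^sub>u * nrm n) sequentially
     \<and> \<not> (\<forall>N. \<exists>n\<ge>N. c * nrm n \<le> (\<Sum>i<n. Z i \<omega>))}"
  have "small A1" unfolding A1_def by (rule upper_small) auto
  moreover have "small A2" unfolding A2_def by (rule upper_small) auto
  moreover have "small A3" unfolding A3_def by (rule lower_small[OF c(1,3)])
  ultimately have "small (A1 \<union> A2 \<union> A3)" by (intro small_Un)
  moreover have "{\<omega> \<in> space M. cluster_set (\<lambda>n. (\<Sum>i<n. Z i \<omega>) / nrm n) = {-\<sigma>..\<sigma>}} \<subseteq> A1 \<union> A2 \<union> A3"
  proof (rule subsetI, rule ccontr)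
    fix \<omega> assume "\<omega> \<in> {\<omega> \<in> space M. cluster_set (\<lambda>n. (\<Sum>i<n. Z i \<omega>) / nrm n) = {-\<sigma>..\<sigma>}}" and nA: "\<omega> \<notin> A1 \<union> A2 \<union> A3"
    hence w: "\<omega> \<in> space M" and cl: "cluster_set (\<lambda>n. (\<Sum>i<n. Z i \<omega>) / nrm n) = {-\<sigma>..\<sigma>}" by auto
    have "eventually (\<lambda>n. (\<Sum>i<n. 1 * Z i \<omega>) \<le> (1 + 1) * \<sigma>\<^sub>u * nrm n) sequentially"
      "eventually (\<lambda>n. (\<Sum>i<n. (-1) * Z i \<omega>) \<le> (1 + 1) * \<sigma>\<^sub>u * nrm n) sequentially"
      using nA w unfolding A1_def A2_def by auto
    hence ev: "eventually (\<lambda>n. \<bar>\<Sum>i<n. Z i \<omega>\<bar> \<le> 2 * \<sigma>\<^sub>u * nrm n) sequentially"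
      by eventually_elim (auto simp: sum_negf)
    hence io: "\<And>N. \<exists>n\<ge>N. c * nrm n \<le> (\<Sum>i<n. Z i \<omega>)" using nA w unfolding A3_def by auto
    obtain N0 where N0: "\<And>n. N0 \<le> n \<Longrightarrow> \<bar>\<Sum>i<n. Z i \<omega>\<bar> \<le> 2 * \<sigma>\<^sub>u * nrm n" using ev by (auto simp: eventually_sequentially)
    have "\<exists>n\<ge>N. (\<Sum>i<n. Z i \<omega>) / nrm n \<in> {c..2 * \<sigma>\<^sub>u}" for N
    proof -
      obtain n where n: "max N (max N0 1) \<le> n" "c * nrm n \<le> (\<Sum>i<n. Z i \<omega>)" using io by blast
      have "(\<Sum>i<n. Z i \<omega>) \<le> 2 * \<sigma>\<^sub>u * nrm n" using N0[of n] n(1) by auto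
      thus ?thesis using n nrm_pos[of n] by (intro exI[of _ n]) (auto simp: divide_le_eq le_divide_eq)
    qed
    then obtain l where "l \<in> cluster_set (\<lambda>n. (\<Sum>i<n. Z i \<omega>) / nrm n)" "l \<in> {c..2 * \<sigma>\<^sub>u}"
      by (rule cluster_point_in_interval)
    thus False unfolding cl using c by auto
  qed
  ultimately have "small {\<omega> \<in> space M. cluster_set (\<lambda>n. (\<Sum>i<n. Z i \<omega>) / nrm n) = {-\<sigma>..\<sigma>}}" by (rule small_subset)
  thus ?thesis by (rule small_V_hat_star)
qed

end


section \<open>Product laws and mixtures\<close>

text \<open>
  Rational points and levels suffice: this leaves countably many conditions, so that the cluster event
  is measurable.
\<close>

lemma cluster_set_eq_interval_iff:
  fixes x :: "nat \<Rightarrow> real"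
  assumes s: "0 < s"
  shows "cluster_set x = {-s..s} \<longleftrightarrow>
    (\<forall>q::rat. - s \<le> of_rat q \<and> of_rat q \<le> s \<longrightarrow> (\<forall>j::nat. \<forall>N. \<exists>n\<ge>N. \<bar>x n - of_rat q\<bar> < inverse (real (Suc j)))) \<and>
    (\<forall>p q::rat. s < of_rat p \<or> of_rat q < - s \<longrightarrow> (\<exists>N. \<forall>n\<ge>N. \<not> (of_rat p \<le> x n \<and> x n \<le> of_rat q)))"
    (is "?L \<longleftrightarrow> ?R1 \<and> ?R2")
proof
  assume L: ?L
  have ?R1
  proof (intro allI impI)
    fix q :: rat and j N :: nat assume "- s \<le> of_rat q \<and> of_rat q \<le> s"
    hence "of_rat q \<in> cluster_set x" using L by simp
    thus "\<exists>n\<ge>N. \<bar>x n - of_rat q\<bar> < inverse (real (Suc j))" unfolding cluster_set_iff by simp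
  qed
  moreover have ?R2
  proof (intro allI impI, rule ccontr)
    fix p q :: rat assume pq: "s < of_rat p \<or> of_rat q < - s" and "\<not> (\<exists>N. \<forall>n\<ge>N. \<not> (of_rat p \<le> x n \<and> x n \<le> of_rat q))"
    hence "\<And>N. \<exists>n\<ge>N. x n \<in> {of_rat p..of_rat q}" by auto
    then obtain l where "l \<in> cluster_set x" "l \<in> {of_rat p..of_rat q}" by (rule cluster_point_in_interval)
    thus False using L pq by auto
  qed
  ultimately show "?R1 \<and> ?R2" ..
next
  assume R: "?R1 \<and> ?R2"
  show ?L
  proof (intro set_eqI iffI)
    fix l assume l: "l \<in> {-s..s}"
    show "l \<in> cluster_set x" unfolding cluster_set_iff
    proof (intro allI impI)
      fix e :: real and N assume e: "0 < e"
      have "max (- s) (l - e / 2) < min s (l + e / 2)" using l e s by auto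
      then obtain q where q: "max (- s) (l - e / 2) < of_rat q" "of_rat q < min s (l + e / 2)"
        using of_rat_dense by blast
      have "0 < e / 2" using e by simp
      from reals_Archimedean[OF this] obtain j where j: "inverse (real (Suc j)) < e / 2" ..
      have "- s \<le> of_rat q \<and> of_rat q \<le> s" using q by simp
      then obtain n where "N \<le> n" "\<bar>x n - of_rat q\<bar> < inverse (real (Suc j))" using conjunct1[OF R] by blast
      thus "\<exists>n\<ge>N. \<bar>x n - l\<bar> < e" using q j by (intro exI[of _ n]) auto
    qed
  next
    fix l assume l: "l \<in> cluster_set x"
    have out: False if pq: "p < l" "l < q" "s < p \<or> q < - s" for p q
    proof -
      obtain p' where p': "max p (if s < p then s else p) < of_rat p'" "of_rat p' < l"
        using of_rat_dense[of "max p (if s < p then s else p)" l] pq by auto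
      obtain q' where q': "l < of_rat q'" "of_rat q' < q" using of_rat_dense[OF pq(2)] by auto
      have "s < of_rat p' \<or> of_rat q' < - s" using p' q' pq by (auto split: if_splits)
      then obtain N where N: "\<And>n. N \<le> n \<Longrightarrow> \<not> (of_rat p' \<le> x n \<and> x n \<le> of_rat q')" using R by blast
      have "0 < min (l - of_rat p') (of_rat q' - l)" using p' q' by simp
      then obtain n where "N \<le> n" "\<bar>x n - l\<bar> < min (l - of_rat p') (of_rat q' - l)" using l unfolding cluster_set_iff by blast
      thus False using N[of n] by auto
    qed
    show "l \<in> {-s..s}"
    proof (rule ccontr)
      assume "l \<notin> {-s..s}"
      thus False using out[of "(s + l) / 2" "l + 1"] out[of "l - 1" "(l - s) / 2"] by (auto simp: field_simps)
    qed
  qed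
qed

lemma cluster_event_measurable:
  assumes [measurable]: "\<And>n. f n \<in> borel_measurable N" and s: "0 < s"
  shows "{\<omega> \<in> space N. cluster_set (\<lambda>n. f n \<omega>) = {-s..s}} \<in> sets N"
  unfolding cluster_set_eq_interval_iff[OF s] by measurable

lemma coordinate_borel: "(\<lambda>x :: nat \<Rightarrow> real. x i) \<in> borel_measurable borel"
  by (intro borel_measurable_continuous_onI continuous_on_product_coordinates)

lemma C_bLip_borel': "f \<in> C_bLip n \<Longrightarrow> f \<in> borel_measurable borel"
  using C_bLip_borel[of f n "\<lambda>i x. x i" borel] coordinate_borel by simp

lemma L2_upd: "L2_set (\<lambda>i. (x(n := y)) i - (z(n := y)) i) {..<Suc n} = L2_set (\<lambda>i. x i - z i :: real) {..<n}"
  unfolding L2_set_def by (simp add: lessThan_Suc)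

locale real_laws =
  fixes \<kappa> :: "nat \<Rightarrow> real measure"
  assumes prob_\<kappa>: "\<And>i. prob_space (\<kappa> i)" and sets_\<kappa>: "\<And>i. sets (\<kappa> i) = sets borel"
begin

definition Q :: "(nat \<Rightarrow> real) measure" where "Q = PiM UNIV \<kappa>"

lemma prob_Q: "prob_space Q"
  unfolding Q_def by (rule prob_space_PiM) (rule prob_\<kappa>)

lemma sets_Q: "sets Q = sets borel"
proof -
  have "sets Q = sets (PiM UNIV (\<lambda>i::nat. borel :: real measure))" unfolding Q_def by (rule sets_PiM_cong) (auto simp: sets_\<kappa>)
  thus ?thesis by (simp add: sets_PiM_equal_borel)
qed

lemma borel_Q: "f \<in> borel_measurable borel \<Longrightarrow> f \<in> borel_measurable Q"
  using measurable_cong_sets[OF sets_Q refl] by blast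

lemma borel_\<kappa>: "f \<in> borel_measurable borel \<Longrightarrow> f \<in> borel_measurable (\<kappa> i)"
  using measurable_cong_sets[OF sets_\<kappa> refl] by blast

text \<open>
  Replacing one coordinate of a point of the product by an independent copy preserves its law.
\<close>

lemma resample:
  assumes f: "f \<in> borel_measurable borel" "\<And>x. \<bar>f x\<bar> \<le> (b::real)"
  shows "(\<integral>x. f x \<partial>Q) = (\<integral>x. (\<integral>y. f (x(n := y)) \<partial>\<kappa> n) \<partial>Q)"
proof -
  interpret K: prob_space "\<kappa> n" by (rule prob_\<kappa>)
  interpret Q: prob_space Q by (rule prob_Q)
  interpret KQ: pair_prob_space "\<kappa> n" Q ..
  have e: "distr (\<kappa> n \<Otimes>\<^sub>M Q) Q (\<lambda>(y, x). x(n := y)) = Q"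
    using distr_pair_PiM_eq_PiM[of UNIV \<kappa> n] prob_\<kappa> unfolding Q_def by simp
  have m[measurable]: "(\<lambda>(y, x). x(n := y)) \<in> measurable (\<kappa> n \<Otimes>\<^sub>M Q) Q"
  proof -
    have "(\<lambda>p. (snd p)(n := fst p)) \<in> measurable (\<kappa> n \<Otimes>\<^sub>M PiM UNIV \<kappa>) (PiM UNIV \<kappa>)"
      by (rule measurable_fun_upd[where J = UNIV]) auto
    thus ?thesis by (simp add: Q_def case_prod_unfold)
  qed
  have fm[measurable]: "f \<in> borel_measurable Q" by (rule borel_Q[OF f(1)])
  have "(\<integral>x. f x \<partial>Q) = (\<integral>p. f ((\<lambda>(y, x). x(n := y)) p) \<partial>(\<kappa> n \<Otimes>\<^sub>M Q))"
    by (subst e[symmetric], rule integral_distr) measurable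
  also have "\<dots> = (\<integral>p. (\<lambda>y x. f (x(n := y))) (fst p) (snd p) \<partial>(\<kappa> n \<Otimes>\<^sub>M Q))"
    by (simp add: case_prod_unfold)
  also have "\<dots> = (\<integral>x. (\<integral>y. f (x(n := y)) \<partial>\<kappa> n) \<partial>Q)"
  proof -
    have "(\<lambda>p. f ((snd p)(n := fst p))) \<in> borel_measurable (\<kappa> n \<Otimes>\<^sub>M Q)"
      using measurable_compose[OF m fm] by (simp add: case_prod_unfold)
    hence "integrable (\<kappa> n \<Otimes>\<^sub>M Q) (\<lambda>(y, x). f (x(n := y)))"
      by (intro KQ.P.integrable_const_bound[of _ b]) (use f(2) in \<open>auto simp: case_prod_unfold\<close>)
    from KQ.integral_snd[OF this] show ?thesis by (simp add: case_prod_unfold)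
  qed
  finally show ?thesis .
qed

lemma weighted_integral_Q:
  assumes g: "g \<in> C_bLip n" and p: "\<phi> \<in> borel_measurable borel" "\<And>y. \<bar>\<phi> y\<bar> \<le> b"
  shows "(\<integral>x. g x * \<phi> (x n) \<partial>Q) = (\<integral>y. \<phi> y \<partial>\<kappa> n) * (\<integral>x. g x \<partial>Q)"
proof -
  obtain a where a: "\<And>x. \<bar>g x\<bar> \<le> a" using g unfolding C_bLip_iff by blast
  have "(\<integral>x. g x * \<phi> (x n) \<partial>Q) = (\<integral>x. (\<integral>y. g (x(n := y)) * \<phi> ((x(n := y)) n) \<partial>\<kappa> n) \<partial>Q)"
  proof (rule resample[where b = "a * b"])
    show "(\<lambda>x. g x * \<phi> (x n)) \<in> borel_measurable borel"
      using C_bLip_borel'[OF g] measurable_compose[OF coordinate_borel p(1)] by measurable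
    fix x show "\<bar>g x * \<phi> (x n)\<bar> \<le> a * b" unfolding abs_mult using a[of x] p(2)[of "x n"]
      by (intro mult_mono) auto
  qed
  also have "\<dots> = (\<integral>x. (\<integral>y. \<phi> y \<partial>\<kappa> n) * g x \<partial>Q)"
  proof (rule Bochner_Integration.integral_cong[OF refl])
    fix x
    have "g (x(n := y)) = g x" for y by (rule C_bLip_cong_coords[OF g]) simp
    thus "(\<integral>y. g (x(n := y)) * \<phi> ((x(n := y)) n) \<partial>\<kappa> n) = (\<integral>y. \<phi> y \<partial>\<kappa> n) * g x" by simp
  qed
  finally show ?thesis by simp
qed

text \<open>
  Integrating out the last coordinate keeps the bound and the Lipschitz constant, which makes
  inductions on the number of coordinates possible.
\<close>

lemma section_C_bLip:
  assumes f: "f \<in> C_bLip (Suc n)"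
  shows "(\<lambda>x. \<integral>y. f (x(n := y)) \<partial>\<kappa> n) \<in> C_bLip n"
proof -
  interpret K: prob_space "\<kappa> n" by (rule prob_\<kappa>)
  obtain b where f': "f \<in> lipf (Suc n)" and b: "\<And>x. \<bar>f x\<bar> \<le> b" using f unfolding C_bLip_iff by blast
  obtain C where C: "0 \<le> C" "\<And>x y. \<bar>f x - f y\<bar> \<le> C * L2_set (\<lambda>i. x i - y i) {..<Suc n}" using lipfE[OF f'] by blast
  have fm: "(\<lambda>y. f (x(n := y))) \<in> borel_measurable (\<kappa> n)" for x
  proof (rule borel_\<kappa>)
    have "(\<lambda>y. x(n := y)) \<in> borel_measurable borel"
    proof (rule measurable_coordinatewise_then_product)
      fix i show "(\<lambda>y. (x(n := y)) i) \<in> borel_measurable borel" by (cases "i = n") auto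
    qed
    from measurable_compose[OF this C_bLip_borel'[OF f]] show "(\<lambda>y. f (x(n := y))) \<in> borel_measurable borel" .
  qed
  have int: "integrable (\<kappa> n) (\<lambda>y. f (x(n := y)))" for x
    by (rule K.integrable_const_bound[of _ b]) (use b fm in auto)
  have bd: "\<bar>\<integral>y. k y \<partial>\<kappa> n\<bar> \<le> r" if "integrable (\<kappa> n) k" "\<And>y. \<bar>k y\<bar> \<le> r" for k :: "real \<Rightarrow> real" and r
  proof -
    have "\<bar>\<integral>y. k y \<partial>\<kappa> n\<bar> \<le> (\<integral>y. \<bar>k y\<bar> \<partial>\<kappa> n)" by (rule integral_abs_bound)
    also have "\<dots> \<le> (\<integral>y. r \<partial>\<kappa> n)" by (rule integral_mono) (use that in auto)
    finally show ?thesis by (simp add: K.prob_space)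
  qed
  show ?thesis unfolding C_bLip_iff
  proof (intro conjI lipfI[OF C(1)] exI[of _ b] allI bd int b)
    fix x z
    have "\<bar>\<integral>y. f (x(n := y)) - f (z(n := y)) \<partial>\<kappa> n\<bar> \<le> C * L2_set (\<lambda>i. x i - z i) {..<n}"
    proof (rule bd)
      show "integrable (\<kappa> n) (\<lambda>y. f (x(n := y)) - f (z(n := y)))" by (intro Bochner_Integration.integrable_diff int)
      fix y show "\<bar>f (x(n := y)) - f (z(n := y))\<bar> \<le> C * L2_set (\<lambda>i. x i - z i) {..<n}"
        using C(2)[of "x(n := y)" "z(n := y)"] unfolding L2_upd .
    qed
    thus "\<bar>(\<integral>y. f (x(n := y)) \<partial>\<kappa> n) - (\<integral>y. f (z(n := y)) \<partial>\<kappa> n)\<bar> \<le> C * L2_set (\<lambda>i. x i - z i) {..<n}"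
      using int by simp
  qed
qed

end

definition mixture :: "real \<Rightarrow> real measure \<Rightarrow> real measure \<Rightarrow> real measure" where
  "mixture p A B = distr (measure_pmf (bernoulli_pmf p) \<Otimes>\<^sub>M (A \<Otimes>\<^sub>M B)) borel (\<lambda>(b, y, z). if b then y else z)"

lemma mixture:
  assumes p: "0 \<le> p" "p \<le> 1" and A: "prob_space A" "sets A = sets borel" and B: "prob_space B" "sets B = sets borel"
  shows "prob_space (mixture p A B)" "sets (mixture p A B) = sets borel"
    "\<phi> \<in> borel_measurable borel \<Longrightarrow> (\<And>y. \<bar>\<phi> y\<bar> \<le> b) \<Longrightarrow>
      (\<integral>y. \<phi> y \<partial>mixture p A B) = p * (\<integral>y. \<phi> y \<partial>A) + (1 - p) * (\<integral>y. \<phi> y \<partial>B)"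
proof -
  interpret A: prob_space A by fact
  interpret B: prob_space B by fact
  interpret AB: pair_prob_space A B ..
  interpret M: prob_space "measure_pmf (bernoulli_pmf p)" by (rule prob_space_measure_pmf)
  interpret N: pair_prob_space "measure_pmf (bernoulli_pmf p)" "A \<Otimes>\<^sub>M B" ..
  note [measurable_cong] = A(2) B(2)
  have m[measurable]: "(\<lambda>(b, y, z). if b then y else z) \<in> borel_measurable (measure_pmf (bernoulli_pmf p) \<Otimes>\<^sub>M (A \<Otimes>\<^sub>M B))"
    by measurable
  show "prob_space (mixture p A B)" unfolding mixture_def by (rule N.prob_space_distr[OF m])
  show "sets (mixture p A B) = sets borel" by (simp add: mixture_def)
  assume ph[measurable]: "\<phi> \<in> borel_measurable borel" and b: "\<And>y. \<bar>\<phi> y\<bar> \<le> b"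
  have "(\<integral>y. \<phi> y \<partial>mixture p A B) = (\<integral>q. \<phi> ((\<lambda>(b, y, z). if b then y else z) q) \<partial>(measure_pmf (bernoulli_pmf p) \<Otimes>\<^sub>M (A \<Otimes>\<^sub>M B)))"
    unfolding mixture_def by (rule integral_distr[OF m ph])
  also have "\<dots> = (\<integral>c. (\<integral>r. \<phi> ((\<lambda>(b, y, z). if b then y else z) (c, r)) \<partial>(A \<Otimes>\<^sub>M B)) \<partial>measure_pmf (bernoulli_pmf p))"
    by (rule N.integral_fst'[symmetric], rule N.integrable_const_bound[of _ b]) (use b in auto)
  also have "\<dots> = p * (\<integral>r. \<phi> (fst r) \<partial>(A \<Otimes>\<^sub>M B)) + (1 - p) * (\<integral>r. \<phi> (snd r) \<partial>(A \<Otimes>\<^sub>M B))"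
    using p by (simp add: case_prod_unfold)
  also have "(\<integral>r. \<phi> (fst r) \<partial>(A \<Otimes>\<^sub>M B)) = (\<integral>y. (\<integral>z. \<phi> (fst (y, z)) \<partial>B) \<partial>A)"
    by (rule AB.integral_fst'[symmetric], rule AB.P.integrable_const_bound[of _ b]) (use b in auto)
  also have "(\<integral>r. \<phi> (snd r) \<partial>(A \<Otimes>\<^sub>M B)) = (\<integral>y. (\<integral>z. \<phi> (snd (y, z)) \<partial>B) \<partial>A)"
    by (rule AB.integral_fst'[symmetric], rule AB.P.integrable_const_bound[of _ b]) (use b in auto)
  finally show "(\<integral>y. \<phi> y \<partial>mixture p A B) = p * (\<integral>y. \<phi> y \<partial>A) + (1 - p) * (\<integral>y. \<phi> y \<partial>B)"
    by (simp add: A.prob_space B.prob_space)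
qed


section \<open>Approximating closed sets of sequences\<close>

definition trunc_dist :: "nat \<Rightarrow> (nat \<Rightarrow> real) \<Rightarrow> (nat \<Rightarrow> real) set \<Rightarrow> real" where
  "trunc_dist j x K = (INF z\<in>K. L2_set (\<lambda>i. x i - z i) {..<j})"

definition bump :: "(nat \<Rightarrow> real) set \<Rightarrow> nat \<Rightarrow> (nat \<Rightarrow> real) \<Rightarrow> real" where
  "bump K j x = clamp01 (1 - real j * trunc_dist j x K)"

lemma bdd_below_L2: "bdd_below ((\<lambda>z. L2_set (\<lambda>i. x i - z i) {..<j}) ` K)"
  by (rule bdd_belowI[of _ 0]) (auto simp: L2_set_nonneg)

lemma trunc_dist_le: "z \<in> K \<Longrightarrow> trunc_dist j x K \<le> L2_set (\<lambda>i. x i - z i) {..<j}"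
  unfolding trunc_dist_def by (rule cINF_lower[OF bdd_below_L2])

lemma bump_C_bLip: assumes K: "K \<noteq> {}" shows "bump K j \<in> C_bLip j"
proof -
  have le: "trunc_dist j x K \<le> trunc_dist j y K + L2_set (\<lambda>i. x i - y i) {..<j}" for x y
  proof -
    have "trunc_dist j x K - L2_set (\<lambda>i. x i - y i) {..<j} \<le> L2_set (\<lambda>i. y i - z i) {..<j}" if "z \<in> K" for z
    proof -
      have "L2_set (\<lambda>i. x i - z i) {..<j} = L2_set (\<lambda>i. (x i - y i) + (y i - z i)) {..<j}" by simp
      also have "\<dots> \<le> L2_set (\<lambda>i. x i - y i) {..<j} + L2_set (\<lambda>i. y i - z i) {..<j}" by (rule L2_set_triangle_ineq)
      finally show ?thesis using trunc_dist_le[OF that, of j x] by linarith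
    qed
    hence "trunc_dist j x K - L2_set (\<lambda>i. x i - y i) {..<j} \<le> trunc_dist j y K"
      unfolding trunc_dist_def[of j y] using K by (intro cINF_greatest) auto
    thus ?thesis by linarith
  qed
  have sym: "L2_set (\<lambda>i. x i - y i) {..<j} = L2_set (\<lambda>i. y i - x i) {..<j}" for x y :: "nat \<Rightarrow> real"
    unfolding L2_set_def by (simp add: power2_commute)
  have "(\<lambda>x. trunc_dist j x K) \<in> lipf j"
  proof (rule lipfI[of 1])
    fix x y show "\<bar>trunc_dist j x K - trunc_dist j y K\<bar> \<le> 1 * L2_set (\<lambda>i. x i - y i) {..<j}"
      using le[of x y] le[of y x] sym[of x y] by linarith
  qed simp
  thus ?thesis unfolding bump_def[abs_def] by (intro clamp_C_bLip lipf_diff lipf_const lipf_scale)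
qed

lemma bump_on: "x \<in> K \<Longrightarrow> bump K j x = 1"
proof -
  assume x: "x \<in> K"
  have "trunc_dist j x K \<le> 0" using trunc_dist_le[OF x, of j x] by (simp add: L2_set_def)
  hence "real j * trunc_dist j x K \<le> 0" by (simp add: mult_nonneg_nonpos)
  thus ?thesis by (simp add: bump_def clamp01_def)
qed

lemma trunc_dist_nonneg: "K \<noteq> {} \<Longrightarrow> 0 \<le> trunc_dist j x K"
  unfolding trunc_dist_def by (intro cINF_greatest L2_set_nonneg)

lemma bump_antimono: assumes K: "K \<noteq> {}" and ij: "i \<le> j" shows "bump K j x \<le> bump K i x"
proof -
  have "trunc_dist i x K \<le> trunc_dist j x K"
    unfolding trunc_dist_def[of j]
  proof (rule cINF_greatest[OF K])
    fix z assume "z \<in> K"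
    hence "trunc_dist i x K \<le> L2_set (\<lambda>k. x k - z k) {..<i}" by (rule trunc_dist_le)
    also have "\<dots> \<le> L2_set (\<lambda>k. x k - z k) {..<j}"
      unfolding L2_set_def using ij by (intro real_sqrt_le_mono sum_mono2) auto
    finally show "trunc_dist i x K \<le> L2_set (\<lambda>k. x k - z k) {..<j}" .
  qed
  hence "real i * trunc_dist i x K \<le> real j * trunc_dist j x K"
    using ij trunc_dist_nonneg[OF K] by (intro mult_mono) auto
  thus ?thesis unfolding bump_def clamp01_def by linarith
qed

text \<open>
  If no \<open>bump K j x\<close> vanishes, there are points of \<open>K\<close> whose first \<open>j\<close> coordinates are within \<open>1 / j\<close>
  of those of \<open>x\<close>; they converge to \<open>x\<close> coordinatewise, and \<open>K\<close> is closed.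
\<close>

lemma bump_tendsto: assumes K: "closed K" "K \<noteq> {}" shows "(\<lambda>j. bump K j x) \<longlonglongrightarrow> indicator K x"
proof (cases "x \<in> K")
  case True thus ?thesis by (simp add: bump_on)
next
  case False
  have "\<exists>j. bump K j x = 0"
  proof (rule ccontr)
    assume nz: "\<not> (\<exists>j. bump K j x = 0)"
    have "\<exists>z\<in>K. L2_set (\<lambda>i. x i - z i) {..<Suc j} < inverse (real (Suc j))" for j
    proof -
      have "bump K (Suc j) x \<noteq> 0" using nz by blast
      hence "real (Suc j) * trunc_dist (Suc j) x K < 1" by (auto simp: bump_def clamp01_def)
      hence "trunc_dist (Suc j) x K < inverse (real (Suc j))" by (simp add: field_simps)
      thus ?thesis unfolding trunc_dist_def by (subst (asm) cINF_less_iff[OF K(2) bdd_below_L2]) auto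
    qed
    then obtain z where z: "\<And>j. z j \<in> K" "\<And>j. L2_set (\<lambda>i. x i - z j i) {..<Suc j} < inverse (real (Suc j))" by metis
    have "(\<lambda>j. z j i) \<longlonglongrightarrow> x i" for i
    proof -
      have "(\<lambda>j. x i - z j i) \<longlonglongrightarrow> 0"
      proof (rule Lim_null_comparison[OF _ LIMSEQ_inverse_real_of_nat])
        show "\<forall>\<^sub>F j in sequentially. norm (x i - z j i) \<le> inverse (real (Suc j))"
          using eventually_ge_at_top[of i]
        proof eventually_elim
          case (elim j)
          have "\<bar>x i - z j i\<bar> \<le> L2_set (\<lambda>i. x i - z j i) {..<Suc j}" using elim by (intro abs_le_L2_set) simp
          thus ?case using z(2)[of j] by simp
        qed
      qed
      from tendsto_diff[OF tendsto_const[of "x i"] this] show ?thesis by simp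
    qed
    hence "limitin (product_topology (\<lambda>_. euclidean) UNIV) z x sequentially"
      unfolding limitin_componentwise limitin_canonical_iff by (simp add: extensional_UNIV)
    hence "z \<longlonglongrightarrow> x" by (simp add: euclidean_product_topology limitin_canonical_iff)
    hence "x \<in> K" by (rule closed_sequentially[OF K(1), rotated]) (use z in auto)
    thus False using False by simp
  qed
  then obtain j0 where j0: "bump K j0 x = 0" by blast
  have "eventually (\<lambda>j. bump K j x = 0) sequentially"
    using eventually_ge_at_top[of j0]
  proof eventually_elim
    case (elim j)
    have "0 \<le> bump K j x" unfolding bump_def by (rule clamp01)
    thus ?case using bump_antimono[OF K(2) elim, of x] j0 by linarith
  qed
  thus ?thesis using False by (simp add: tendsto_eventually)
qed

section \<open>Laws of intermediate variance\<close>

context lil_setting begin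

definition admissible :: "real measure \<Rightarrow> bool" where
  "admissible \<kappa> \<longleftrightarrow> prob_space \<kappa> \<and> sets \<kappa> = sets borel \<and> (\<forall>\<phi>. blip \<phi> \<longrightarrow> (\<integral>y. \<phi> y \<partial>\<kappa>) \<le> law \<phi>)"

lemma weak_limit:
  fixes R :: "nat \<Rightarrow> 'a measure"
  assumes X: "\<And>j::nat. X j \<in> bounded_part M H" and R: "\<And>n. R n \<in> \<P>"
  obtains r P where "strict_mono r" "P \<in> \<P>" "\<And>j. (\<lambda>k. \<integral>\<omega>. X j \<omega> \<partial>(R (r k))) \<longlonglongrightarrow> (\<integral>\<omega>. X j \<omega> \<partial>P)"
proof -
  obtain r P where r: "strict_mono r" "P \<in> \<P>"
    and lim: "\<And>d \<phi>. 1 \<le> d \<Longrightarrow> \<phi> \<in> C_bLip d \<Longrightarrow>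
      (\<lambda>k. \<integral>\<omega>. \<phi> (\<lambda>i. X i \<omega>) \<partial>(R (r k))) \<longlonglongrightarrow> (\<integral>\<omega>. \<phi> (\<lambda>i. X i \<omega>) \<partial>P)"
    using wc[unfolded countably_dim_weakly_compact_def, rule_format, of X R] X R by blast
  have "(\<lambda>k. \<integral>\<omega>. X j \<omega> \<partial>(R (r k))) \<longlonglongrightarrow> (\<integral>\<omega>. X j \<omega> \<partial>P)" for j
  proof -
    obtain b where b: "\<And>\<omega>. \<omega> \<in> space M \<Longrightarrow> \<bar>X j \<omega>\<bar> \<le> b" using bounded_partE[OF X] by blast
    have b': "\<bar>X j \<omega>\<bar> \<le> max 0 b" if "\<omega> \<in> space M" for \<omega> using b[OF that] by simp
    have "(\<lambda>x. trunc (max 0 b) (x j)) \<in> C_bLip (Suc j)" by (rule blip_coord[OF blip_trunc]) auto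
    from lim[OF _ this]
    have "(\<lambda>k. \<integral>\<omega>. trunc (max 0 b) (X j \<omega>) \<partial>(R (r k))) \<longlonglongrightarrow> (\<integral>\<omega>. trunc (max 0 b) (X j \<omega>) \<partial>P)" by simp
    moreover have "(\<integral>\<omega>. trunc (max 0 b) (X j \<omega>) \<partial>P') = (\<integral>\<omega>. X j \<omega> \<partial>P')" if "P' \<in> \<P>" for P'
      by (rule Bochner_Integration.integral_cong[OF refl]) (use b' space_\<P>[OF that] in \<open>fastforce simp: trunc_def\<close>)
    ultimately show ?thesis using r R by simp
  qed
  thus ?thesis using that r by blast
qed

lemma law_of_Y1:
  fixes \<phi> :: "real \<Rightarrow> real"
  assumes P: "P \<in> \<P>"
  shows "admissible (distr P borel (Y 1))" "\<phi> \<in> borel_measurable borel \<Longrightarrow> (\<integral>y. \<phi> y \<partial>distr P borel (Y 1)) = (\<integral>\<omega>. \<phi> (Y 1 \<omega>) \<partial>P)"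
proof -
  interpret prob_space P using \<P>_prob[OF P] by simp
  have m: "Y 1 \<in> borel_measurable P" by (rule H_measurable_\<P>[OF P Y_H]) simp
  have e: "\<phi> \<in> borel_measurable borel \<Longrightarrow> (\<integral>y. \<phi> y \<partial>distr P borel (Y 1)) = (\<integral>\<omega>. \<phi> (Y 1 \<omega>) \<partial>P)" for \<phi> :: "real \<Rightarrow> real"
    by (rule integral_distr[OF m])
  show "\<phi> \<in> borel_measurable borel \<Longrightarrow> (\<integral>y. \<phi> y \<partial>distr P borel (Y 1)) = (\<integral>\<omega>. \<phi> (Y 1 \<omega>) \<partial>P)" by (rule e)
  show "admissible (distr P borel (Y 1))"
    unfolding admissible_def
  proof (intro conjI allI impI prob_space_distr[OF m] sets_distr)
    fix \<psi> assume b: "blip \<psi>"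
    show "(\<integral>y. \<psi> y \<partial>distr P borel (Y 1)) \<le> law \<psi>"
      unfolding e[OF blip_borel[OF b]] by (rule integral_le_law[OF P b])
  qed
qed

lemma min_square_borel: "(\<lambda>y::real. min (y\<^sup>2) c) \<in> borel_measurable borel"
  by measurable

text \<open>
  For each \<open>n\<close> some measure nearly attains the lower variance truncated at \<open>n\<close>. A weak limit \<open>P\<close> does it
  for all truncations: for fixed \<open>j\<close> the integrals at \<open>j\<close> are dominated by those at \<open>r k \<ge> j\<close>. Without
  the limit the variance of a measure could exceed \<open>\<sigma>\<^sub>l\<^sup>2\<close> through mass beyond the truncation.
\<close>

lemma ex_minimal_variance:
  obtains P where "P \<in> \<P>" "\<And>c. 0 \<le> c \<Longrightarrow> (\<integral>\<omega>. min ((Y 1 \<omega>)\<^sup>2) c \<partial>P) \<le> \<sigma>\<^sub>l\<^sup>2"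
proof -
  define X where "X = (\<lambda>j \<omega>. min ((Y 1 \<omega>)\<^sup>2) (real j))"
  have X: "X j \<in> bounded_part M H" for j unfolding X_def by (rule Y1_bounded[OF blip_min_square]) simp
  have "\<exists>P\<in>\<P>. (\<integral>\<omega>. X n \<omega> \<partial>P) < \<sigma>\<^sub>l\<^sup>2 + inverse (real (Suc n))" for n
  proof -
    have b: "(\<lambda>\<omega>. - X n \<omega>) \<in> bounded_part M H"
      unfolding X_def by (rule Y1_bounded[OF blip_minus[OF blip_min_square]]) simp
    have "Er (\<lambda>\<omega>. - X n \<omega>) = - low2 (real n)" by (simp add: low2_def law_def X_def)
    hence "- \<sigma>\<^sub>l\<^sup>2 - inverse (real (Suc n)) < Er (\<lambda>\<omega>. - X n \<omega>)"
      using low2_le[of "real n"] by (smt (verit) inverse_positive_iff_positive of_nat_0_less_iff of_nat_0_le_iff zero_less_Suc)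
    from integral_near_Er[OF b this] show ?thesis by force
  qed
  then obtain R where R: "\<And>n. R n \<in> \<P>" "\<And>n. (\<integral>\<omega>. X n \<omega> \<partial>(R n)) < \<sigma>\<^sub>l\<^sup>2 + inverse (real (Suc n))" by metis
  obtain r P where r: "strict_mono r" and P: "P \<in> \<P>"
    and lim: "\<And>j. (\<lambda>k. \<integral>\<omega>. X j \<omega> \<partial>(R (r k))) \<longlonglongrightarrow> (\<integral>\<omega>. X j \<omega> \<partial>P)"
    using weak_limit[where X = X and R = R] X R(1) by metis
  have Xle: "(\<integral>\<omega>. X j \<omega> \<partial>P) \<le> \<sigma>\<^sub>l\<^sup>2" for j
  proof (rule LIMSEQ_le[OF lim])
    have "(\<lambda>k. \<sigma>\<^sub>l\<^sup>2 + inverse (real (Suc (r k)))) \<longlonglongrightarrow> \<sigma>\<^sub>l\<^sup>2 + 0"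
      using LIMSEQ_subseq_LIMSEQ[OF LIMSEQ_inverse_real_of_nat r] by (intro tendsto_add tendsto_const) (simp add: o_def)
    thus "(\<lambda>k. \<sigma>\<^sub>l\<^sup>2 + inverse (real (Suc (r k)))) \<longlonglongrightarrow> \<sigma>\<^sub>l\<^sup>2" by simp
    show "\<exists>N. \<forall>k\<ge>N. (\<integral>\<omega>. X j \<omega> \<partial>(R (r k))) \<le> \<sigma>\<^sub>l\<^sup>2 + inverse (real (Suc (r k)))"
    proof (intro exI allI impI)
      fix k assume "j \<le> k"
      hence jk: "j \<le> r k" using seq_suble[OF r, of k] by linarith
      have "(\<integral>\<omega>. X j \<omega> \<partial>(R (r k))) \<le> (\<integral>\<omega>. X (r k) \<omega> \<partial>(R (r k)))"
        by (rule integral_mono[OF integrable_\<P>[OF R(1) X] integrable_\<P>[OF R(1) X]]) (use jk in \<open>auto simp: X_def\<close>)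
      thus "(\<integral>\<omega>. X j \<omega> \<partial>(R (r k))) \<le> \<sigma>\<^sub>l\<^sup>2 + inverse (real (Suc (r k)))" using R(2)[of "r k"] by linarith
    qed
  qed
  have "(\<integral>\<omega>. min ((Y 1 \<omega>)\<^sup>2) c \<partial>P) \<le> \<sigma>\<^sub>l\<^sup>2" if c: "0 \<le> c" for c
  proof -
    obtain j :: nat where j: "c \<le> real j" using real_arch_simple by blast
    have "(\<integral>\<omega>. min ((Y 1 \<omega>)\<^sup>2) c \<partial>P) \<le> (\<integral>\<omega>. X j \<omega> \<partial>P)"
      by (rule integral_mono[OF integrable_\<P>[OF P Y1_bounded[OF blip_min_square[OF c]]] integrable_\<P>[OF P X]]) (use j in \<open>auto simp: X_def\<close>)
    thus ?thesis using Xle[of j] by linarith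
  qed
  thus ?thesis using that P by blast
qed

text \<open>
  The proportion \<open>p\<close> interpolates \<open>\<sigma>\<^sup>2\<close> between the extreme variances. The component \<open>A\<close> has variance at
  most \<open>\<sigma>\<^sub>u\<^sup>2\<close>, as has every measure of \<open>\<P>\<close>, and \<open>B\<close> at most \<open>\<sigma>\<^sub>l\<^sup>2\<close>, so the mixture never exceeds \<open>\<sigma>\<^sup>2\<close>;
  domination by \<open>law\<close> is preserved by mixtures.
\<close>

lemma ex_admissible_variance:
  assumes \<sigma>: "\<sigma> \<in> {\<sigma>\<^sub>l..\<sigma>\<^sub>u}" and \<delta>: "0 < \<delta>"
  shows "\<exists>\<kappa> c. admissible \<kappa> \<and> (\<forall>c\<ge>0. (\<integral>y. min (y\<^sup>2) c \<partial>\<kappa>) \<le> \<sigma>\<^sup>2) \<and> 0 < c \<and> \<sigma>\<^sup>2 - \<delta> \<le> (\<integral>y. min (y\<^sup>2) c \<partial>\<kappa>)"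
proof -
  have sq: "\<sigma>\<^sub>l\<^sup>2 \<le> \<sigma>\<^sup>2" "\<sigma>\<^sup>2 \<le> \<sigma>\<^sub>u\<^sup>2" using \<sigma> \<sigma>l_pos by (auto intro: power_mono)
  define p where "p = (if \<sigma>\<^sub>l\<^sup>2 = \<sigma>\<^sub>u\<^sup>2 then 0 else (\<sigma>\<^sup>2 - \<sigma>\<^sub>l\<^sup>2) / (\<sigma>\<^sub>u\<^sup>2 - \<sigma>\<^sub>l\<^sup>2))"
  have p: "0 \<le> p" "p \<le> 1" "p * \<sigma>\<^sub>u\<^sup>2 + (1 - p) * \<sigma>\<^sub>l\<^sup>2 = \<sigma>\<^sup>2"
  proof -
    have "p * (\<sigma>\<^sub>u\<^sup>2 - \<sigma>\<^sub>l\<^sup>2) = \<sigma>\<^sup>2 - \<sigma>\<^sub>l\<^sup>2" unfolding p_def using sq by auto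
    thus "p * \<sigma>\<^sub>u\<^sup>2 + (1 - p) * \<sigma>\<^sub>l\<^sup>2 = \<sigma>\<^sup>2" by (simp add: algebra_simps)
  qed (use sq in \<open>auto simp: p_def divide_le_eq\<close>)
  obtain P1 where P1: "P1 \<in> \<P>" "\<And>c. 0 \<le> c \<Longrightarrow> (\<integral>\<omega>. min ((Y 1 \<omega>)\<^sup>2) c \<partial>P1) \<le> \<sigma>\<^sub>l\<^sup>2"
    by (rule ex_minimal_variance) blast
  obtain c1 where c1: "0 < c1" "\<sigma>\<^sub>l\<^sup>2 - \<delta> < low2 c1" using low2_approx[OF \<delta>] by blast
  obtain c2 where c2: "0 < c2" "\<sigma>\<^sub>u\<^sup>2 - \<delta> < up2 c2" using up2_approx[OF \<delta>] by blast
  define c where "c = max c1 c2"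
  have c: "0 < c" using c1 by (simp add: c_def)
  have "up2 c2 \<le> up2 c" unfolding up2_def by (rule law_mono[OF blip_min_square blip_min_square]) (use c1 c2 in \<open>auto simp: c_def\<close>)
  hence "\<sigma>\<^sub>u\<^sup>2 - \<delta> < Er (\<lambda>\<omega>. min ((Y 1 \<omega>)\<^sup>2) c)" using c2 by (simp add: up2_def law_def)
  then obtain P2 where P2: "P2 \<in> \<P>" "\<sigma>\<^sub>u\<^sup>2 - \<delta> < (\<integral>\<omega>. min ((Y 1 \<omega>)\<^sup>2) c \<partial>P2)"
    using integral_near_Er[OF Y1_bounded[OF blip_min_square]] c by (meson less_imp_le)
  have low1: "\<sigma>\<^sub>l\<^sup>2 - \<delta> \<le> (\<integral>\<omega>. min ((Y 1 \<omega>)\<^sup>2) c \<partial>P1)"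
  proof -
    have "low2 c1 \<le> (\<integral>\<omega>. min ((Y 1 \<omega>)\<^sup>2) c1 \<partial>P1)"
      using integral_le_law[OF P1(1) blip_minus[OF blip_min_square[of c1]]] c1 by (simp add: low2_def)
    also have "\<dots> \<le> (\<integral>\<omega>. min ((Y 1 \<omega>)\<^sup>2) c \<partial>P1)"
      by (rule integral_mono[OF integrable_\<P>[OF P1(1) Y1_bounded[OF blip_min_square]] integrable_\<P>[OF P1(1) Y1_bounded[OF blip_min_square]]])
         (use c1 c in \<open>auto simp: c_def\<close>)
    finally show ?thesis using c1 by linarith
  qed
  define A B where "A = distr P2 borel (Y 1)" and "B = distr P1 borel (Y 1)"
  have A: "prob_space A" "sets A = sets borel" "\<And>\<phi>. blip \<phi> \<Longrightarrow> (\<integral>y. \<phi> y \<partial>A) \<le> law \<phi>"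
    and B: "prob_space B" "sets B = sets borel" "\<And>\<phi>. blip \<phi> \<Longrightarrow> (\<integral>y. \<phi> y \<partial>B) \<le> law \<phi>"
    using law_of_Y1(1)[OF P2(1)] law_of_Y1(1)[OF P1(1)] unfolding A_def B_def admissible_def by auto
  note mix = mixture[OF p(1,2) A(1,2) B(1,2)]
  have adm: "admissible (mixture p A B)"
    unfolding admissible_def
  proof (intro conjI allI impI mix(1,2))
    fix \<phi> assume ph: "blip \<phi>"
    obtain b where b: "\<And>y. \<bar>\<phi> y\<bar> \<le> b" using ph unfolding blip_def by blast
    have "(\<integral>y. \<phi> y \<partial>mixture p A B) = p * (\<integral>y. \<phi> y \<partial>A) + (1 - p) * (\<integral>y. \<phi> y \<partial>B)"
      by (rule mix(3)[OF blip_borel[OF ph] b])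
    also have "\<dots> \<le> p * law \<phi> + (1 - p) * law \<phi>"
      using p A(3)[OF ph] B(3)[OF ph] by (intro add_mono mult_left_mono) auto
    finally show "(\<integral>y. \<phi> y \<partial>mixture p A B) \<le> law \<phi>" by (simp add: algebra_simps)
  qed
  have mint: "(\<integral>y. min (y\<^sup>2) d \<partial>mixture p A B) = p * (\<integral>y. min (y\<^sup>2) d \<partial>A) + (1 - p) * (\<integral>y. min (y\<^sup>2) d \<partial>B)"
    if "0 \<le> d" for d by (rule mix(3)[OF min_square_borel, of d d]) (use that in auto)
  have up: "(\<integral>y. min (y\<^sup>2) d \<partial>mixture p A B) \<le> \<sigma>\<^sup>2" if d: "0 \<le> d" for d
  proof -
    have "(\<integral>y. min (y\<^sup>2) d \<partial>A) \<le> \<sigma>\<^sub>u\<^sup>2" using A(3)[OF blip_min_square[OF d]] up2_le[OF d] by (simp add: up2_def)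
    moreover have "(\<integral>y. min (y\<^sup>2) d \<partial>B) \<le> \<sigma>\<^sub>l\<^sup>2"
      unfolding B_def law_of_Y1(2)[OF P1(1) min_square_borel] by (rule P1(2)[OF d])
    ultimately have "p * (\<integral>y. min (y\<^sup>2) d \<partial>A) + (1 - p) * (\<integral>y. min (y\<^sup>2) d \<partial>B) \<le> p * \<sigma>\<^sub>u\<^sup>2 + (1 - p) * \<sigma>\<^sub>l\<^sup>2"
      using p by (intro add_mono mult_left_mono) auto
    thus ?thesis unfolding mint[OF d] p(3) .
  qed
  have "\<sigma>\<^sup>2 - \<delta> \<le> (\<integral>y. min (y\<^sup>2) c \<partial>mixture p A B)"
  proof -
    have "p * (\<sigma>\<^sub>u\<^sup>2 - \<delta>) + (1 - p) * (\<sigma>\<^sub>l\<^sup>2 - \<delta>) \<le> p * (\<integral>y. min (y\<^sup>2) c \<partial>A) + (1 - p) * (\<integral>y. min (y\<^sup>2) c \<partial>B)"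
      using p P2(2) low1 unfolding A_def B_def law_of_Y1(2)[OF P1(1) min_square_borel] law_of_Y1(2)[OF P2(1) min_square_borel]
      by (intro add_mono mult_left_mono) auto
    moreover have "p * (\<sigma>\<^sub>u\<^sup>2 - \<delta>) + (1 - p) * (\<sigma>\<^sub>l\<^sup>2 - \<delta>) = \<sigma>\<^sup>2 - \<delta>" using p(3) by (simp add: algebra_simps)
    ultimately show ?thesis using mint[of c] c by simp
  qed
  thus ?thesis using adm up c by blast
qed

text \<open>
  The laws of \<open>ex_admissible_variance\<close> for \<open>\<delta> = 1 / (j + 1)\<close>, where \<open>j = J i\<close> grows so slowly that the
  truncation level \<open>c j\<close> stays below \<open>sqrt i\<close>, the level at which the law of the iterated logarithm
  measures conditional variances.
\<close>

lemma ex_admissible_sequence: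
  assumes \<sigma>: "\<sigma> \<in> {\<sigma>\<^sub>l..\<sigma>\<^sub>u}"
  obtains \<kappa> where "\<And>i::nat. admissible (\<kappa> i)" "\<And>i c. 0 \<le> c \<Longrightarrow> (\<integral>y. min (y\<^sup>2) c \<partial>\<kappa> i) \<le> \<sigma>\<^sup>2"
    "\<And>\<delta>. 0 < \<delta> \<Longrightarrow> eventually (\<lambda>i. \<sigma>\<^sup>2 - \<delta> \<le> (\<integral>y. min (y\<^sup>2) (sqrt (real i)) \<partial>\<kappa> i)) sequentially"
proof -
  have "\<forall>j::nat. \<exists>\<kappa> c. admissible \<kappa> \<and> (\<forall>c\<ge>0. (\<integral>y. min (y\<^sup>2) c \<partial>\<kappa>) \<le> \<sigma>\<^sup>2) \<and> 0 < c \<and>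
     \<sigma>\<^sup>2 - inverse (real (Suc j)) \<le> (\<integral>y. min (y\<^sup>2) c \<partial>\<kappa>)"
    by (intro allI ex_admissible_variance[OF \<sigma>]) simp
  then obtain k c where k: "\<And>j. admissible (k j)" "\<And>j c. 0 \<le> c \<Longrightarrow> (\<integral>y. min (y\<^sup>2) c \<partial>k j) \<le> \<sigma>\<^sup>2"
    and c: "\<And>j::nat. 0 < c j" "\<And>j. \<sigma>\<^sup>2 - inverse (real (Suc j)) \<le> (\<integral>y. min (y\<^sup>2) (c j) \<partial>k j)" by metis
  \<comment> \<open>The disjunct \<open>j = 0\<close> gives \<open>J i\<close> a value for the first few \<open>i\<close>, where no level fits.\<close>
  define J where "J = (\<lambda>i::nat. GREATEST j. j \<le> i \<and> (j = 0 \<or> c j \<le> sqrt (real i)))"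
  have J: "J i \<le> i \<and> (J i = 0 \<or> c (J i) \<le> sqrt (real i))" for i
    unfolding J_def by (rule GreatestI_nat[of _ 0 i]) auto
  have Jge: "j \<le> J i" if "j \<le> i" "c j \<le> sqrt (real i)" for i j
    unfolding J_def by (rule Greatest_le_nat[of _ j i]) (use that in auto)
  have "eventually (\<lambda>i. \<sigma>\<^sup>2 - \<delta> \<le> (\<integral>y. min (y\<^sup>2) (sqrt (real i)) \<partial>k (J i))) sequentially" if \<delta>: "0 < \<delta>" for \<delta>
  proof -
    from reals_Archimedean[OF \<delta>] obtain j where j: "inverse (real (Suc j)) < \<delta>" ..
    obtain i0 :: nat where i0: "(c (Suc j))\<^sup>2 \<le> real i0" using real_arch_simple by blast
    show ?thesis using eventually_ge_at_top[of "max (Suc j) i0"]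
    proof eventually_elim
      case (elim i)
      have "(c (Suc j))\<^sup>2 \<le> real i" using i0 elim by (meson max.boundedE of_nat_le_iff order_trans)
      hence "c (Suc j) \<le> sqrt (real i)" by (rule real_le_rsqrt)
      hence Ji: "Suc j \<le> J i" using elim by (intro Jge) auto
      hence cJ: "c (J i) \<le> sqrt (real i)" using J[of i] by auto
      have kp: "prob_space (k (J i))" "sets (k (J i)) = sets borel" using k(1) by (auto simp: admissible_def)
      interpret prob_space "k (J i)" by (rule kp)
      have int: "integrable (k (J i)) (\<lambda>y. min (y\<^sup>2) d)" if "0 \<le> d" for d
        by (rule integrable_const_bound[of _ d]) (use that kp(2) min_square_borel measurable_cong_sets[OF kp(2) refl] in auto)
      have "\<sigma>\<^sup>2 - \<delta> \<le> \<sigma>\<^sup>2 - inverse (real (Suc (J i)))"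
      proof -
        have "inverse (real (Suc (J i))) \<le> inverse (real (Suc j))" using Ji by (intro le_imp_inverse_le) auto
        thus ?thesis using j by linarith
      qed
      also have "\<dots> \<le> (\<integral>y. min (y\<^sup>2) (c (J i)) \<partial>k (J i))" by (rule c(2))
      also have "\<dots> \<le> (\<integral>y. min (y\<^sup>2) (sqrt (real i)) \<partial>k (J i))"
        by (rule integral_mono[OF int int]) (use cJ c(1)[of "J i"] in auto)
      finally show ?case .
    qed
  qed
  note ev = this
  show ?thesis by (rule that[of "\<lambda>i. k (J i)"]) (rule k(1), erule k(2), erule ev)
qed

end

section \<open>Inside the interval of standard deviations\<close>

context sublinear_iid begin

lemma law_section_C_bLip:
  assumes f: "f \<in> C_bLip (Suc n)"
  shows "(\<lambda>x. law (\<lambda>y. f (x(n := y)))) \<in> C_bLip n"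
proof -
  obtain b where f': "f \<in> lipf (Suc n)" and b: "\<And>x. \<bar>f x\<bar> \<le> b" using f unfolding C_bLip_iff by blast
  obtain C where C: "0 \<le> C" "\<And>x y. \<bar>f x - f y\<bar> \<le> C * L2_set (\<lambda>i. x i - y i) {..<Suc n}" using lipfE[OF f'] by blast
  have bs: "blip (\<lambda>y. f (x(n := y)))" for x by (rule blip_section[OF f])
  have bc: "blip (\<lambda>y. c)" for c :: real unfolding blip_def by (auto intro: exI[of _ "\<bar>c\<bar>"] exI[of _ 0])
  have ba: "blip (\<lambda>y. f (x(n := y)) + c)" for x c
  proof -
    obtain D where D: "0 \<le> D" "\<And>y z. \<bar>f (x(n := y)) - f (x(n := z))\<bar> \<le> D * \<bar>y - z\<bar>" using bs[of x] unfolding blip_def by blast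
    have "\<bar>f z + c\<bar> \<le> b + \<bar>c\<bar>" for z using b[of z] by linarith
    thus ?thesis unfolding blip_def using D by auto
  qed
  have le: "law (\<lambda>y. f (x(n := y))) \<le> law (\<lambda>y. f (z(n := y))) + C * L2_set (\<lambda>i. x i - z i) {..<n}" for x z
  proof -
    have "f (x(n := y)) \<le> f (z(n := y)) + C * L2_set (\<lambda>i. x i - z i) {..<n}" for y
      using C(2)[of "x(n := y)" "z(n := y)"] unfolding L2_upd by linarith
    from law_mono[OF bs ba this] show ?thesis unfolding law_add_const[OF bs] .
  qed
  have sym: "L2_set (\<lambda>i. x i - z i) {..<n} = L2_set (\<lambda>i. z i - x i) {..<n}" for x z :: "nat \<Rightarrow> real"
    unfolding L2_set_def by (simp add: power2_commute)
  show ?thesis unfolding C_bLip_iff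
  proof (intro conjI lipfI[OF C(1)] exI[of _ b] allI)
    fix x
    have bl: "f z \<le> b" "- b \<le> f z" for z using b[of z] by linarith+
    have "law (\<lambda>y. f (x(n := y))) \<le> law (\<lambda>y. b)" by (rule law_mono[OF bs bc]) (rule bl(1))
    moreover have "law (\<lambda>y. - b) \<le> law (\<lambda>y. f (x(n := y)))" by (rule law_mono[OF bc bs]) (rule bl(2))
    ultimately show "\<bar>law (\<lambda>y. f (x(n := y)))\<bar> \<le> b" unfolding law_const by linarith
  next
    fix x z
    show "\<bar>law (\<lambda>y. f (x(n := y))) - law (\<lambda>y. f (z(n := y)))\<bar> \<le> C * L2_set (\<lambda>i. x i - z i) {..<n}"
      using le[of x z] le[of z x] sym[of x z] by simp
  qed
qed

end

locale admissible_product = lil_setting M H E \<P> Y V \<sigma>\<^sub>l \<sigma>\<^sub>u + real_laws \<kappa>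
  for M :: "'a measure" and H :: "('a \<Rightarrow> real) set" and E :: "('a \<Rightarrow> real) \<Rightarrow> ereal"
    and \<P> :: "'a measure set" and Y :: "nat \<Rightarrow> 'a \<Rightarrow> real" and V \<sigma>\<^sub>l \<sigma>\<^sub>u and \<kappa> :: "nat \<Rightarrow> real measure" +
  assumes adm: "\<And>i. admissible (\<kappa> i)"
begin

lemma \<kappa>_le_law: "blip \<phi> \<Longrightarrow> (\<integral>y. \<phi> y \<partial>\<kappa> i) \<le> law \<phi>"
  using adm[of i] unfolding admissible_def by blast

text \<open>
  Integrating out the last coordinate under \<open>Q\<close> gives at most its sublinear counterpart, because \<open>\<kappa> n\<close>
  is dominated by \<open>law\<close>; independence is the same recursion for \<open>E\<close>.
\<close>

lemma integral_Q_le_Er: "f \<in> C_bLip n \<Longrightarrow> (\<integral>x. f x \<partial>Q) \<le> Er (\<lambda>\<omega>. f (Yv \<omega>))"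
proof (induction n arbitrary: f)
  case 0
  interpret prob_space Q by (rule prob_Q)
  have c: "f x = f (\<lambda>_. 0)" for x by (rule C_bLip_cong_coords[OF 0]) simp
  have "(\<integral>x. f x \<partial>Q) = (\<integral>x. f (\<lambda>_. 0) \<partial>Q)" by (rule Bochner_Integration.integral_cong[OF refl c])
  also have "\<dots> = f (\<lambda>_. 0)" by (simp add: prob_space)
  also have "\<dots> = Er (\<lambda>\<omega>. f (\<lambda>_. 0))" by (rule Er_const[symmetric])
  also have "\<dots> = Er (\<lambda>\<omega>. f (Yv \<omega>))" by (rule arg_cong[where f = Er], rule ext, rule c[symmetric])
  finally show ?case by simp
next
  case (Suc n)
  obtain b where b: "\<And>x. \<bar>f x\<bar> \<le> b" using Suc.prems unfolding C_bLip_iff by blast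
  define fb where "fb = (\<lambda>x. \<integral>y. f (x(n := y)) \<partial>\<kappa> n)"
  have fb: "fb \<in> C_bLip n" unfolding fb_def by (rule section_C_bLip[OF Suc.prems])
  have "(\<integral>x. f x \<partial>Q) = (\<integral>x. fb x \<partial>Q)" unfolding fb_def by (rule resample[OF C_bLip_borel'[OF Suc.prems] b])
  also have "\<dots> \<le> Er (\<lambda>\<omega>. fb (Yv \<omega>))" by (rule Suc.IH[OF fb])
  also have "\<dots> \<le> Er (\<lambda>\<omega>. f (Yv \<omega>))"
  proof -
    have "E (\<lambda>\<omega>. fb (Yv \<omega>)) \<le> E (\<lambda>\<omega>. law (\<lambda>y. f ((Yv \<omega>)(n := y))))"
    proof (rule E_mono)
      show "(\<lambda>\<omega>. fb (Yv \<omega>)) \<in> H" by (rule bounded_part_H[OF cyl_bounded[OF fb]])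
      show "fb (Yv \<omega>) \<le> law (\<lambda>y. f ((Yv \<omega>)(n := y)))" for \<omega>
        unfolding fb_def by (rule \<kappa>_le_law[OF blip_section[OF Suc.prems]])
      show "(\<lambda>\<omega>. law (\<lambda>y. f ((Yv \<omega>)(n := y)))) \<in> H"
        using bounded_part_H[OF cyl_bounded[OF law_section_C_bLip[OF Suc.prems]]] .
    qed
    thus ?thesis unfolding E_nested[OF Suc.prems, symmetric] E_Er[OF cyl_bounded[OF fb]] E_Er[OF cyl_bounded[OF Suc.prems]] by simp
  qed
  finally show ?case .
qed

lemma lip_process_Q:
  assumes u: "\<And>i c. 0 \<le> c \<Longrightarrow> (\<integral>y. min (y\<^sup>2) c \<partial>\<kappa> i) \<le> s"
  shows "lip_process Q (\<lambda>i x. x i) (\<lambda>_. s) tailw drift"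
proof (rule lip_process.intro)
  show "prob_space Q" by (rule prob_Q)
  show "(\<lambda>x. x i) \<in> borel_measurable Q" for i by (rule borel_Q[OF coordinate_borel])
  show "(drift \<longlongrightarrow> 0) at_top" by (rule drift_tendsto)
  fix n g and c :: real assume g: "g \<in> C_bLip n" "\<And>x. 0 \<le> g x \<and> g x \<le> 1" and c: "0 < c"
  have g0: "0 \<le> (\<integral>x. g x \<partial>Q)" using g by (simp add: integral_nonneg_AE)
  have le: "(\<integral>x. g x * \<phi> (x n) \<partial>Q) \<le> r * (\<integral>x. g x \<partial>Q)" if "blip \<phi>" "(\<integral>y. \<phi> y \<partial>\<kappa> n) \<le> r" for \<phi> r
  proof -
    obtain b where b: "\<And>y. \<bar>\<phi> y\<bar> \<le> b" using \<open>blip \<phi>\<close> unfolding blip_def by blast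
    show ?thesis unfolding weighted_integral_Q[OF g(1) blip_borel[OF that(1)] b] by (rule mult_right_mono[OF that(2) g0])
  qed
  have bl: "blip (trunc c)" "blip (\<lambda>y. trunc c (- y))" "blip (\<lambda>y. min (y\<^sup>2) c)" "blip (\<lambda>y. min (\<bar>y\<bar> / c) 1 ^ 4)"
    using c by (auto intro: blip_trunc blip_trunc_minus blip_min_square blip_tail)
  show "(\<integral>x. g (\<lambda>i. x i) * trunc c (x n) \<partial>Q) \<le> drift c * (\<integral>x. g (\<lambda>i. x i) \<partial>Q)"
    using le[OF bl(1), of "drift c"] \<kappa>_le_law[OF bl(1), of n] by (simp add: drift_def)
  show "(\<integral>x. g (\<lambda>i. x i) * trunc c (- x n) \<partial>Q) \<le> drift c * (\<integral>x. g (\<lambda>i. x i) \<partial>Q)"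
    using le[OF bl(2), of "drift c"] \<kappa>_le_law[OF bl(2), of n] by (simp add: drift_def)
  show "(\<integral>x. g (\<lambda>i. x i) * min ((x n)\<^sup>2) c \<partial>Q) \<le> s * (\<integral>x. g (\<lambda>i. x i) \<partial>Q)"
    using le[OF bl(3), of s] u[of c n] c by simp
  show "(\<integral>x. g (\<lambda>i. x i) * min (\<bar>x n\<bar> / c) 1 ^ 4 \<partial>Q) \<le> tailw c * (\<integral>x. g (\<lambda>i. x i) \<partial>Q)"
    using le[OF bl(4), of "tailw c"] \<kappa>_le_law[OF bl(4), of n] by (simp add: tailw_def)
qed

lemma AE_Q_cluster:
  assumes s: "0 < s" and u: "\<And>i c. 0 \<le> c \<Longrightarrow> (\<integral>y. min (y\<^sup>2) c \<partial>\<kappa> i) \<le> s\<^sup>2"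
    and low: "\<And>\<delta>. 0 < \<delta> \<Longrightarrow> eventually (\<lambda>i. s\<^sup>2 - \<delta> \<le> (\<integral>y. min (y\<^sup>2) (sqrt (real i)) \<partial>\<kappa> i)) sequentially"
  shows "AE x in Q. cluster_set (\<lambda>n. (\<Sum>i<n. x i) / nrm n) = {-s..s}"
proof -
  interpret L: lip_process Q "\<lambda>i x. x i" "\<lambda>_. s\<^sup>2" tailw drift by (rule lip_process_Q[OF u])
  interpret m: mds Q "gen Q (\<lambda>i x. x i)" "\<lambda>i x. x i" "\<lambda>_. s\<^sup>2" tailw by (rule L.mds)
  show ?thesis
  proof (rule m.iterated_logarithm[OF tail_summable_tailw s])
    show "eventually (\<lambda>n. (\<Sum>i<n. s\<^sup>2) \<le> real n * (s\<^sup>2 + \<delta>)) sequentially" if "0 < \<delta>" for \<delta>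
      using that by (simp add: mult_left_mono)
    fix \<delta> :: real assume "0 < \<delta>"
    from low[OF this] eventually_gt_at_top[of 0]
    show "eventually (\<lambda>i. m.lowvar i (sqrt (real i)) (s\<^sup>2 - \<delta>)) sequentially"
    proof eventually_elim
      case (elim i)
      show ?case
      proof (rule L.lowvar)
        show "0 < sqrt (real i)" using elim by simp
        fix g assume g: "g \<in> C_bLip i" "\<And>x. 0 \<le> g x \<and> g x \<le> 1"
        have "(\<integral>x. g x * min ((x i)\<^sup>2) (sqrt (real i)) \<partial>Q) = (\<integral>y. min (y\<^sup>2) (sqrt (real i)) \<partial>\<kappa> i) * (\<integral>x. g x \<partial>Q)"
          by (rule weighted_integral_Q[OF g(1) min_square_borel, of _ "sqrt (real i)"]) auto
        also have "\<dots> \<ge> (s\<^sup>2 - \<delta>) * (\<integral>x. g x \<partial>Q)"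
          by (rule mult_right_mono[OF elim(1)]) (use g in \<open>simp add: integral_nonneg_AE\<close>)
        finally show "(s\<^sup>2 - \<delta>) * (\<integral>x. g (\<lambda>i. x i) \<partial>Q) \<le> (\<integral>x. g (\<lambda>i. x i) * min ((x i)\<^sup>2) (sqrt (real i)) \<partial>Q)" by simp
      qed
    qed
  qed auto
qed

text \<open>
  The event depends on all coordinates and is neither open nor closed, so weak convergence says
  nothing about it directly. Inner regularity of \<open>Q\<close> on the Polish space of sequences provides a
  compact subset \<open>K\<close>; its approximations \<open>bump K j\<close> depend on finitely many coordinates, decrease in
  \<open>j\<close>, and have expectation above \<open>1 - e'\<close>. The decrease lets a weak limit of nearly optimal measures
  keep this bound for all \<open>j\<close> at once, hence for \<open>K\<close>.
\<close>

lemma V_sup_cluster_ge_1: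
  assumes s: "0 < s" and ae: "AE x in Q. cluster_set (\<lambda>n. (\<Sum>i<n. x i) / nrm n) = {-s..s}"
  shows "1 \<le> V_sup \<P> {\<omega> \<in> space M. cluster_set (\<lambda>n. (\<Sum>i<n. Z i \<omega>) / nrm n) = {-s..s}}"
proof (rule ereal_le_epsilon2)
  fix e :: real assume e: "0 < e"
  interpret Q: prob_space Q by (rule prob_Q)
  define C where "C = {x :: nat \<Rightarrow> real. cluster_set (\<lambda>n. (\<Sum>i<n. x i) / nrm n) = {-s..s}}"
  have "{x \<in> space borel. cluster_set (\<lambda>n. (\<Sum>i<n. x i) / nrm n) = {-s..s}} \<in> sets (borel :: (nat \<Rightarrow> real) measure)"
    by (rule cluster_event_measurable[OF _ s]) (use coordinate_borel in measurable)
  hence C: "C \<in> sets borel" by (simp add: C_def)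
  define e' where "e' = min e 1 / 2"
  have e': "0 < e'" "e' < 1" "2 * e' \<le> e" using e by (auto simp: e'_def)
  have QC: "emeasure Q C = 1"
    by (rule Q.emeasure_eq_1_AE) (use C sets_Q ae in \<open>auto simp: C_def\<close>)
  have "ennreal (1 - e') < 1" using e' by (simp add: ennreal_less_one_iff)
  also have "1 = (SUP K \<in> {K. K \<subseteq> C \<and> compact K}. emeasure Q K)"
    unfolding QC[symmetric] by (rule inner_regular[OF sets_Q _ C]) (simp add: Q.emeasure_space_1)
  finally obtain K where K: "K \<subseteq> C" "compact K" "ennreal (1 - e') < emeasure Q K"
    unfolding less_SUP_iff by auto
  have Kc: "closed K" by (rule compact_imp_closed[OF K(2)])
  have Kn: "K \<noteq> {}" using K(3) by auto
  have KQ: "K \<in> sets Q" unfolding sets_Q using Kc by simp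
  have QK: "1 - e' < measure Q K" using K(3) e' by (simp add: Q.emeasure_eq_measure ennreal_less_iff)
  define X where "X = (\<lambda>j \<omega>. bump K j (Yv \<omega>))"
  have b01: "0 \<le> bump K j x \<and> bump K j x \<le> 1" for j x unfolding bump_def by (intro conjI clamp01)
  have XB: "X j \<in> bounded_part M H" for j unfolding X_def by (rule cyl_bounded[OF bump_C_bLip[OF Kn]])
  have "1 - e' < Er (X j)" for j
  proof -
    have "measure Q K = (\<integral>x. indicator K x \<partial>Q)" using KQ by simp
    also have "\<dots> \<le> (\<integral>x. bump K j x \<partial>Q)"
    proof (rule integral_mono)
      show "integrable Q (indicator K :: _ \<Rightarrow> real)" using KQ by (simp add: Q.emeasure_eq_measure)
      show "integrable Q (bump K j)"
        by (rule Q.integrable_const_bound[of _ 1]) (use b01 borel_Q[OF C_bLip_borel'[OF bump_C_bLip[OF Kn]]] in auto)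
      fix x show "indicator K x \<le> bump K j x" using b01 bump_on[of x K j] by (auto simp: indicator_def)
    qed
    also have "\<dots> \<le> Er (X j)" unfolding X_def by (rule integral_Q_le_Er[OF bump_C_bLip[OF Kn]])
    finally show ?thesis using QK by linarith
  qed
  hence "\<exists>P\<in>\<P>. 1 - e' < (\<integral>\<omega>. X j \<omega> \<partial>P)" for j using integral_near_Er[OF XB] by blast
  then obtain R where R: "\<And>j. R j \<in> \<P>" "\<And>j. 1 - e' < (\<integral>\<omega>. X j \<omega> \<partial>(R j))" by metis
  obtain r P where r: "strict_mono r" and P: "P \<in> \<P>"
    and lim: "\<And>j. (\<lambda>k. \<integral>\<omega>. X j \<omega> \<partial>(R (r k))) \<longlonglongrightarrow> (\<integral>\<omega>. X j \<omega> \<partial>P)"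
    using weak_limit[where X = X and R = R] XB R(1) by metis
  interpret P: prob_space P using \<P>_prob[OF P] by simp
  have XP: "1 - e' \<le> (\<integral>\<omega>. X j \<omega> \<partial>P)" for j
  proof (rule LIMSEQ_le_const[OF lim], intro exI allI impI)
    fix k assume "j \<le> k"
    hence jk: "j \<le> r k" using seq_suble[OF r, of k] by linarith
    have "(\<integral>\<omega>. X (r k) \<omega> \<partial>(R (r k))) \<le> (\<integral>\<omega>. X j \<omega> \<partial>(R (r k)))"
      by (rule integral_mono[OF integrable_\<P>[OF R(1) XB] integrable_\<P>[OF R(1) XB]])
         (use bump_antimono[OF Kn jk] in \<open>auto simp: X_def\<close>)
    thus "1 - e' \<le> (\<integral>\<omega>. X j \<omega> \<partial>(R (r k)))" using R(2)[of "r k"] by linarith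
  qed
  have ZP: "Z i \<in> borel_measurable P" for i by (rule H_measurable_\<P>[OF P Y_H]) simp
  have YvP: "Yv \<in> measurable P borel"
    by (rule measurable_coordinatewise_then_product) (use ZP in \<open>simp add: Yv_eq\<close>)
  define B where "B = {\<omega> \<in> space P. Yv \<omega> \<in> K}"
  have BP: "B \<in> sets P" using measurable_sets[OF YvP, of K] Kc by (simp add: B_def vimage_def Int_def conj_commute)
  have "(\<lambda>j. \<integral>\<omega>. X j \<omega> \<partial>P) \<longlonglongrightarrow> (\<integral>\<omega>. indicator B \<omega> \<partial>P)"
  proof (rule integral_dominated_convergence[where w = "\<lambda>_. 1"])
    show "AE \<omega> in P. (\<lambda>j. X j \<omega>) \<longlonglongrightarrow> indicator B \<omega>"
    proof (rule AE_I2)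
      fix \<omega> assume "\<omega> \<in> space P"
      hence "indicator B \<omega> = (indicator K (Yv \<omega>) :: real)" by (simp add: B_def indicator_def)
      thus "(\<lambda>j. X j \<omega>) \<longlonglongrightarrow> indicator B \<omega>" unfolding X_def using bump_tendsto[OF Kc Kn, of "Yv \<omega>"] by simp
    qed
    show "X j \<in> borel_measurable P" for j by (rule H_measurable_\<P>[OF P bounded_part_H[OF XB]])
  qed (use BP b01 in \<open>auto simp: X_def\<close>)
  hence "1 - e' \<le> (\<integral>\<omega>. indicator B \<omega> \<partial>P)" by (rule LIMSEQ_le_const) (use XP in auto)
  hence PB: "1 - e' \<le> measure P B" using BP by simp
  define A where "A = {\<omega> \<in> space M. cluster_set (\<lambda>n. (\<Sum>i<n. Z i \<omega>) / nrm n) = {-s..s}}"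
  have "A = {\<omega> \<in> space P. cluster_set (\<lambda>n. (\<Sum>i<n. Z i \<omega>) / nrm n) = {-s..s}}" by (simp add: A_def space_\<P>[OF P])
  also have "\<dots> \<in> sets P" by (rule cluster_event_measurable[OF _ s]) (use ZP in measurable)
  finally have AP: "A \<in> sets P" .
  have "B \<subseteq> A" using K(1) by (auto simp: A_def B_def C_def Yv_eq space_\<P>[OF P])
  hence "measure P B \<le> measure P A" by (rule P.finite_measure_mono[OF _ AP])
  hence "1 \<le> measure P A + e" using PB e' by linarith
  hence "1 \<le> ereal (measure P A) + ereal e" by (simp add: one_ereal_def)
  also have "\<dots> \<le> V_sup \<P> A + ereal e"
    unfolding V_sup_def by (intro add_right_mono SUP_upper P)
  finally show "1 \<le> V_sup \<P> {\<omega> \<in> space M. cluster_set (\<lambda>n. (\<Sum>i<n. Z i \<omega>) / nrm n) = {-s..s}} + ereal e"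
    unfolding A_def .
qed

end

context lil_setting begin

lemma V_sup_inside:
  assumes \<sigma>: "\<sigma> \<in> {\<sigma>\<^sub>l..\<sigma>\<^sub>u}"
  shows "1 \<le> V_sup \<P> {\<omega> \<in> space M. cluster_set (\<lambda>n. (\<Sum>i<n. Z i \<omega>) / nrm n) = {-\<sigma>..\<sigma>}}"
proof -
  have s: "0 < \<sigma>" using \<sigma> \<sigma>l_pos by simp
  obtain \<kappa> where \<kappa>: "\<And>i::nat. admissible (\<kappa> i)" "\<And>i c. 0 \<le> c \<Longrightarrow> (\<integral>y. min (y\<^sup>2) c \<partial>\<kappa> i) \<le> \<sigma>\<^sup>2"
    "\<And>\<delta>. 0 < \<delta> \<Longrightarrow> eventually (\<lambda>i. \<sigma>\<^sup>2 - \<delta> \<le> (\<integral>y. min (y\<^sup>2) (sqrt (real i)) \<partial>\<kappa> i)) sequentially"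
    using ex_admissible_sequence[OF \<sigma>] by blast
  interpret admissible_product M H E \<P> Y V \<sigma>\<^sub>l \<sigma>\<^sub>u \<kappa>
    by (intro admissible_product.intro lil_setting_axioms real_laws.intro admissible_product_axioms.intro)
       (use \<kappa>(1) in \<open>auto simp: admissible_def\<close>)
  show ?thesis by (rule V_sup_cluster_ge_1[OF s AE_Q_cluster[OF s \<kappa>(2,3)]])
qed

end

theorem theorem2p2:
  fixes M :: "'a measure"
    and H :: "('a \<Rightarrow> real) set"
    and E :: "('a \<Rightarrow> real) \<Rightarrow> ereal"
    and V :: "'a set \<Rightarrow> real"
    and \<P> :: "'a measure set"
    and Y :: "nat \<Rightarrow> 'a \<Rightarrow> real"
    and \<sigma>\<^sub>l \<sigma>\<^sub>u :: real
  assumes "sublinear_expectation_space M H E"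
    and "associated_capacity M H E V"
    and "\<And>P. P \<in> \<P> \<Longrightarrow> prob_space P \<and> sets P = sets (sigma_gen_by M H)"
    and "\<And>X. X \<in> bounded_part M H \<Longrightarrow> E X = (SUP P\<in>\<P>. ereal (\<integral>\<omega>. X \<omega> \<partial>P))"
    and "countably_dim_weakly_compact M H \<P>"
    and "\<And>n. n \<ge> 1 \<Longrightarrow> Y n \<in> H"
    and "independent_seq E Y"
    and "identically_distributed_seq E Y"
    and "choquet M V (\<lambda>\<omega>. (Y 1 \<omega>)\<^sup>2 / lg (lg \<bar>Y 1 \<omega>\<bar>)) < \<infinity>"
    and "((\<lambda>c::real. E (\<lambda>\<omega>. trunc c (Y 1 \<omega>))) \<longlongrightarrow> 0) at_top"
    and "((\<lambda>c::real. E (\<lambda>\<omega>. trunc c (- Y 1 \<omega>))) \<longlongrightarrow> 0) at_top"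
    and "lower_variance E (Y 1) > 0"
    and "upper_variance E (Y 1) < \<infinity>"
    and "\<sigma>\<^sub>l = sqrt (real_of_ereal (lower_variance E (Y 1)))"
    and "\<sigma>\<^sub>u = sqrt (real_of_ereal (upper_variance E (Y 1)))"
  shows "\<forall>W \<in> {V_sup \<P>, C_star M H E, V_hat_star M H E}. \<forall>\<sigma>::real.
           W {\<omega> \<in> space M.
                cluster_set (\<lambda>n. (\<Sum>i=1..n. Y i \<omega>) / sqrt (2 * real n * lg (lg (real n))))
                  = {-\<sigma>..\<sigma>}}
           = (if \<sigma> \<in> {\<sigma>\<^sub>l..\<sigma>\<^sub>u} then 1 else 0)"
proof -
  interpret lil_setting M H E \<P> Y V \<sigma>\<^sub>l \<sigma>\<^sub>u
    by (intro lil_setting.intro sublinear_iid.intro sublinear_iid_axioms.intro lil_setting_axioms.intro assms)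
  have "W {\<omega> \<in> space M. cluster_set (\<lambda>n. (\<Sum>i<n. Z i \<omega>) / nrm n) = {-\<sigma>..\<sigma>}} = (if \<sigma> \<in> {\<sigma>\<^sub>l..\<sigma>\<^sub>u} then 1 else 0)"
    if W: "W \<in> {V_sup \<P>, C_star M H E, V_hat_star M H E}" for W \<sigma>
  proof -
    define A where "A = {\<omega> \<in> space M. cluster_set (\<lambda>n. (\<Sum>i<n. Z i \<omega>) / nrm n) = {-\<sigma>..\<sigma>}}"
    have le: "V_sup \<P> A \<le> W A" "W A \<le> V_hat_star M H E A"
      using W V_sup_le_C_star[of A] C_star_le_V_hat_star[of A] by (auto intro: order_trans)
    show ?thesis
    proof (cases "\<sigma> \<in> {\<sigma>\<^sub>l..\<sigma>\<^sub>u}")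
      case True
      have "1 \<le> W A" using V_sup_inside[OF True] le(1) unfolding A_def by (rule order_trans)
      moreover have "W A \<le> 1" by (rule order_trans[OF le(2) V_hat_star_le_1]) (simp add: A_def)
      ultimately show ?thesis using True unfolding A_def by simp
    next
      case False
      have "W A \<le> 0" using le(2) V_hat_star_outside[OF False] unfolding A_def by (rule order_trans)
      moreover have "0 \<le> W A" by (rule order_trans[OF V_sup_nonneg le(1)])
      ultimately show ?thesis using False unfolding A_def by simp
    qed
  qed
  thus ?thesis unfolding normalized_sum_eq by blast
qed

end
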